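(* Let $R$ be a commutative ring. The category of cocommutative $R$-bialgebras $A$ whose underlying $R$-module is projective is equivalent to the category of formal monoids $\operatorname{Spec}\mathcal A^*$ (with $A$ a projective $R$-module).
   Context: All functors are covariant functors on the category of commutative $R$-algebras. For an $R$-module $A$, $\mathcal A(S):=A\otimes_RS$, and $\mathcal A^*$ is the functor of $\mathcal R$-modules $\mathcal A^*(S)=\operatorname{Hom}_S(A\otimes_RS,S)=\operatorname{Hom}_R(A,S)$, where $\mathcal R(S)=S$. If $\mathcal A^*$ is a functor of commutative $\mathcal R$-algebras (e.g. when $A$ is a cocommutative coalgebra, with the convolution product), $\operatorname{Spec}\mathcal A^*$ is the functor of sets $(\operatorname{Spec}\mathcal A^* )(S):=\operatorname{Hom}_{\mathcal R\text{-alg}}(\mathcal A^*,\mathcal S)$, with $\mathcal S(S')=S\otimes_RS'$; it is called a formal scheme, and a formal monoid if it is endowed with a structure of functor of monoids. Morphisms of formal monoids are morphisms of functors of monoids. A bialgebra is an associative unital algebra and coassociative counital coalgebra with compatible structures (no antipode required). *)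

theory Defs
  imports "HOL-Algebra.Free_Abelian_Groups" "HOL-Algebra.Module"
begin

section \<open>Categories, functors, equivalence\<close>

text \<open>Composition takes the objects as arguments, \<open>Cmp C X Y Z g f\<close> being
  \<open>g\<close> after \<open>f\<close> for \<open>f : X \<rightarrow> Y\<close> and \<open>g : Y \<rightarrow> Z\<close>, so that morphisms can be plain
  functions, made extensional on the carrier of their domain.\<close>

record ('o, 'm) cat =
  Ob :: "'o set"
  Mor :: "'o \<Rightarrow> 'o \<Rightarrow> 'm set"
  Ident :: "'o \<Rightarrow> 'm"
  Cmp :: "'o \<Rightarrow> 'o \<Rightarrow> 'o \<Rightarrow> 'm \<Rightarrow> 'm \<Rightarrow> 'm"

definition is_category :: "('o, 'm) cat \<Rightarrow> bool" where
  "is_category C \<longleftrightarrow>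
     (\<forall>X\<in>Ob C. Ident C X \<in> Mor C X X) \<and>
     (\<forall>X\<in>Ob C. \<forall>Y\<in>Ob C. \<forall>Z\<in>Ob C. \<forall>f\<in>Mor C X Y. \<forall>g\<in>Mor C Y Z.
        Cmp C X Y Z g f \<in> Mor C X Z) \<and>
     (\<forall>X\<in>Ob C. \<forall>Y\<in>Ob C. \<forall>f\<in>Mor C X Y.
        Cmp C X X Y f (Ident C X) = f \<and> Cmp C X Y Y (Ident C Y) f = f) \<and>
     (\<forall>W\<in>Ob C. \<forall>X\<in>Ob C. \<forall>Y\<in>Ob C. \<forall>Z\<in>Ob C.
        \<forall>f\<in>Mor C W X. \<forall>g\<in>Mor C X Y. \<forall>h\<in>Mor C Y Z.
        Cmp C W Y Z h (Cmp C W X Y g f) = Cmp C W X Z (Cmp C X Y Z h g) f)"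

record ('o1, 'm1, 'o2, 'm2) ftor =
  on_ob :: "'o1 \<Rightarrow> 'o2"
  on_mor :: "'o1 \<Rightarrow> 'o1 \<Rightarrow> 'm1 \<Rightarrow> 'm2"

definition is_functor ::
  "('o1, 'm1) cat \<Rightarrow> ('o2, 'm2) cat \<Rightarrow> ('o1, 'm1, 'o2, 'm2) ftor \<Rightarrow> bool" where
  "is_functor C D F \<longleftrightarrow>
     (\<forall>X\<in>Ob C. on_ob F X \<in> Ob D) \<and>
     (\<forall>X\<in>Ob C. \<forall>Y\<in>Ob C. \<forall>f\<in>Mor C X Y. on_mor F X Y f \<in> Mor D (on_ob F X) (on_ob F Y)) \<and>
     (\<forall>X\<in>Ob C. on_mor F X X (Ident C X) = Ident D (on_ob F X)) \<and>
     (\<forall>X\<in>Ob C. \<forall>Y\<in>Ob C. \<forall>Z\<in>Ob C. \<forall>f\<in>Mor C X Y. \<forall>g\<in>Mor C Y Z.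
        on_mor F X Z (Cmp C X Y Z g f) =
        Cmp D (on_ob F X) (on_ob F Y) (on_ob F Z) (on_mor F Y Z g) (on_mor F X Y f))"

definition functors_agree ::
  "('o1, 'm1) cat \<Rightarrow> ('o1, 'm1, 'o2, 'm2) ftor \<Rightarrow> ('o1, 'm1, 'o2, 'm2) ftor \<Rightarrow> bool" where
  "functors_agree C F G \<longleftrightarrow>
     (\<forall>X\<in>Ob C. on_ob F X = on_ob G X) \<and>
     (\<forall>X\<in>Ob C. \<forall>Y\<in>Ob C. \<forall>f\<in>Mor C X Y. on_mor F X Y f = on_mor G X Y f)"

definition id_functor :: "('o, 'm, 'o, 'm) ftor" where
  "id_functor = \<lparr>on_ob = (\<lambda>X. X), on_mor = (\<lambda>X Y f. f)\<rparr>"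

definition comp_functor ::
  "('o2, 'm2, 'o3, 'm3) ftor \<Rightarrow> ('o1, 'm1, 'o2, 'm2) ftor \<Rightarrow> ('o1, 'm1, 'o3, 'm3) ftor" where
  "comp_functor G F =
     \<lparr>on_ob = (\<lambda>X. on_ob G (on_ob F X)),
      on_mor = (\<lambda>X Y f. on_mor G (on_ob F X) (on_ob F Y) (on_mor F X Y f))\<rparr>"

definition nat_trans ::
  "('o1, 'm1) cat \<Rightarrow> ('o2, 'm2) cat \<Rightarrow> ('o1, 'm1, 'o2, 'm2) ftor \<Rightarrow> ('o1, 'm1, 'o2, 'm2) ftor
     \<Rightarrow> ('o1 \<Rightarrow> 'm2) set" where
  "nat_trans C D F G =
     {\<tau> \<in> extensional (Ob C).
        (\<forall>X\<in>Ob C. \<tau> X \<in> Mor D (on_ob F X) (on_ob G X)) \<and>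
        (\<forall>X\<in>Ob C. \<forall>Y\<in>Ob C. \<forall>f\<in>Mor C X Y.
           Cmp D (on_ob F X) (on_ob F Y) (on_ob G Y) (\<tau> Y) (on_mor F X Y f) =
           Cmp D (on_ob F X) (on_ob G X) (on_ob G Y) (on_mor G X Y f) (\<tau> X))}"

definition is_iso :: "('o, 'm) cat \<Rightarrow> 'o \<Rightarrow> 'o \<Rightarrow> 'm \<Rightarrow> bool" where
  "is_iso C X Y f \<longleftrightarrow> f \<in> Mor C X Y \<and>
     (\<exists>g\<in>Mor C Y X. Cmp C X Y X g f = Ident C X \<and> Cmp C Y X Y f g = Ident C Y)"

definition naturally_isomorphic ::
  "('o1, 'm1) cat \<Rightarrow> ('o2, 'm2) cat \<Rightarrow> ('o1, 'm1, 'o2, 'm2) ftor \<Rightarrow> ('o1, 'm1, 'o2, 'm2) ftor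
     \<Rightarrow> bool" where
  "naturally_isomorphic C D F G \<longleftrightarrow>
     (\<exists>\<tau>\<in>nat_trans C D F G. \<forall>X\<in>Ob C. is_iso D (on_ob F X) (on_ob G X) (\<tau> X))"

definition equivalent_categories :: "('o1, 'm1) cat \<Rightarrow> ('o2, 'm2) cat \<Rightarrow> bool" where
  "equivalent_categories C D \<longleftrightarrow>
     is_category C \<and> is_category D \<and>
     (\<exists>F G. is_functor C D F \<and> is_functor D C G \<and>
        naturally_isomorphic C C (comp_functor G F) id_functor \<and>
        naturally_isomorphic D D (comp_functor F G) id_functor)"

definition functor_cat ::
  "('o1, 'm1) cat \<Rightarrow> ('o2, 'm2) cat \<Rightarrow> (('o1, 'm1, 'o2, 'm2) ftor, 'o1 \<Rightarrow> 'm2) cat" where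
  "functor_cat C D =
     \<lparr>Ob = {F. is_functor C D F},
      Mor = nat_trans C D,
      Ident = (\<lambda>F. \<lambda>X\<in>Ob C. Ident D (on_ob F X)),
      Cmp = (\<lambda>F G H \<sigma> \<tau>. \<lambda>X\<in>Ob C.
               Cmp D (on_ob F X) (on_ob G X) (on_ob H X) (\<sigma> X) (\<tau> X))\<rparr>"

definition full_subcat :: "('o, 'm) cat \<Rightarrow> ('o \<Rightarrow> bool) \<Rightarrow> ('o, 'm) cat" where
  "full_subcat C P = C\<lparr>Ob := {X \<in> Ob C. P X}\<rparr>"

definition set_cat :: "('x set, 'x \<Rightarrow> 'x) cat" where
  "set_cat =
     \<lparr>Ob = UNIV, Mor = (\<lambda>X Y. X \<rightarrow>\<^sub>E Y), Ident = (\<lambda>X. \<lambda>x\<in>X. x),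
      Cmp = (\<lambda>X Y Z g f. compose X g f)\<rparr>"

definition monoid_cat :: "('x monoid, 'x \<Rightarrow> 'x) cat" where
  "monoid_cat =
     \<lparr>Ob = {M. monoid M},
      Mor = (\<lambda>M N. {f \<in> hom M N \<inter> extensional (carrier M). f \<one>\<^bsub>M\<^esub> = \<one>\<^bsub>N\<^esub>}),
      Ident = (\<lambda>M. \<lambda>x\<in>carrier M. x),
      Cmp = (\<lambda>L M N g f. compose (carrier L) g f)\<rparr>"

definition carrier_functor ::
  "('o, 'm, ('x, 'z) partial_object_scheme, 'x \<Rightarrow> 'x) ftor \<Rightarrow> ('o, 'm, 'x set, 'x \<Rightarrow> 'x) ftor"
  where
  "carrier_functor F = \<lparr>on_ob = (\<lambda>X. carrier (on_ob F X)), on_mor = on_mor F\<rparr>"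


section \<open>Modules and tensor products\<close>

definition lin_hom ::
  "('r, 'y) ring_scheme \<Rightarrow> ('r, 'a, 'p) module_scheme \<Rightarrow> ('r, 'b, 'q) module_scheme
     \<Rightarrow> ('a \<Rightarrow> 'b) set" where
  "lin_hom R M N =
     {f \<in> carrier M \<rightarrow>\<^sub>E carrier N.
        (\<forall>x\<in>carrier M. \<forall>y\<in>carrier M. f (x \<oplus>\<^bsub>M\<^esub> y) = f x \<oplus>\<^bsub>N\<^esub> f y) \<and>
        (\<forall>r\<in>carrier R. \<forall>x\<in>carrier M. f (r \<odot>\<^bsub>M\<^esub> x) = r \<odot>\<^bsub>N\<^esub> f x)}"

text \<open>The lifting property is tested on modules with carrier in the same type \<open>'u\<close> as \<open>R\<close> and
  \<open>P\<close>. For infinite \<open>'u\<close> this is no restriction: \<open>P\<close> is projective as soon as a surjection onto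
  it from a free module on a generating set of \<open>P\<close> splits, and such a module fits into \<open>'u\<close>.\<close>

definition projective_module ::
  "('u, 'y) ring_scheme \<Rightarrow> ('u, 'u, 'p) module_scheme \<Rightarrow> bool" where
  "projective_module R P \<longleftrightarrow> module R P \<and>
     (\<forall>(M :: ('u, 'u) module) (N :: ('u, 'u) module) g f.
        module R M \<and> module R N \<and>
        g \<in> lin_hom R M N \<and> g ` carrier M = carrier N \<and> f \<in> lin_hom R P N \<longrightarrow>
        (\<exists>h\<in>lin_hom R P M. compose (carrier P) g h = f))"

definition ring_as_module :: "('r, 'y) ring_scheme \<Rightarrow> ('r, 'r) module" where
  "ring_as_module R =
     \<lparr>carrier = carrier R, mult = mult R, one = one R, zero = zero R, add = add R,
      smult = mult R\<rparr>"

text \<open>\<open>M \<otimes>\<^sub>R N\<close> is the free abelian group on the pairs modulo the usual relations; its elements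
  are cosets.\<close>

type_synonym ('a, 'b) tensor_elt = "(('a \<times> 'b) \<Rightarrow>\<^sub>0 int) set"

definition tensor_relators ::
  "('r, 'y) ring_scheme \<Rightarrow> ('r, 'a, 'p) module_scheme \<Rightarrow> ('r, 'b, 'q) module_scheme
     \<Rightarrow> (('a \<times> 'b) \<Rightarrow>\<^sub>0 int) set" where
  "tensor_relators R M N =
     {frag_of (x \<oplus>\<^bsub>M\<^esub> x', y) - frag_of (x, y) - frag_of (x', y) | x x' y.
        x \<in> carrier M \<and> x' \<in> carrier M \<and> y \<in> carrier N} \<union>
     {frag_of (x, y \<oplus>\<^bsub>N\<^esub> y') - frag_of (x, y) - frag_of (x, y') | x y y'.
        x \<in> carrier M \<and> y \<in> carrier N \<and> y' \<in> carrier N} \<union>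
     {frag_of (r \<odot>\<^bsub>M\<^esub> x, y) - frag_of (x, r \<odot>\<^bsub>N\<^esub> y) | r x y.
        r \<in> carrier R \<and> x \<in> carrier M \<and> y \<in> carrier N}"

definition tensor_kernel ::
  "('r, 'y) ring_scheme \<Rightarrow> ('r, 'a, 'p) module_scheme \<Rightarrow> ('r, 'b, 'q) module_scheme
     \<Rightarrow> (('a \<times> 'b) \<Rightarrow>\<^sub>0 int) set" where
  "tensor_kernel R M N =
     generate (free_Abelian_group (carrier M \<times> carrier N)) (tensor_relators R M N)"

definition tensor_group ::
  "('r, 'y) ring_scheme \<Rightarrow> ('r, 'a, 'p) module_scheme \<Rightarrow> ('r, 'b, 'q) module_scheme
     \<Rightarrow> ('a, 'b) tensor_elt monoid" where
  "tensor_group R M N = free_Abelian_group (carrier M \<times> carrier N) Mod tensor_kernel R M N"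

definition pure_tensor ::
  "('r, 'y) ring_scheme \<Rightarrow> ('r, 'a, 'p) module_scheme \<Rightarrow> ('r, 'b, 'q) module_scheme
     \<Rightarrow> 'a \<Rightarrow> 'b \<Rightarrow> ('a, 'b) tensor_elt" where
  "pure_tensor R M N x y =
     tensor_kernel R M N #>\<^bsub>free_Abelian_group (carrier M \<times> carrier N)\<^esub> frag_of (x, y)"

text \<open>For a balanced biadditive \<open>\<beta>\<close> with values in the (multiplicatively written) abelian group
  \<open>G\<close>, \<open>tensor_lift G \<beta>\<close> is the homomorphism sending \<open>x \<otimes> y\<close> to \<open>\<beta> x y\<close>; the chosen
  representative of the coset does not matter.\<close>

definition tensor_lift ::
  "('c, 'z) monoid_scheme \<Rightarrow> ('a \<Rightarrow> 'b \<Rightarrow> 'c) \<Rightarrow> ('a, 'b) tensor_elt \<Rightarrow> 'c" where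
  "tensor_lift G \<beta> X =
     (let c = (SOME c. c \<in> X)
      in finprod G (\<lambda>(x, y). \<beta> x y [^]\<^bsub>G\<^esub> Poly_Mapping.lookup c (x, y)) (Poly_Mapping.keys c))"

text \<open>\<open>mult\<close> and \<open>one\<close> are meaningful when \<open>M\<close> and \<open>N\<close> are \<open>R\<close>-algebras.\<close>

definition tensor ::
  "('r, 'y) ring_scheme \<Rightarrow> ('r, 'a, 'p) module_scheme \<Rightarrow> ('r, 'b, 'q) module_scheme
     \<Rightarrow> ('r, ('a, 'b) tensor_elt) module" where
  "tensor R M N =
     \<lparr>carrier = carrier (tensor_group R M N),
      mult = (\<lambda>X Y. tensor_lift (tensor_group R M N)
                 (\<lambda>x y. tensor_lift (tensor_group R M N)
                    (\<lambda>x' y'. pure_tensor R M N (x \<otimes>\<^bsub>M\<^esub> x') (y \<otimes>\<^bsub>N\<^esub> y')) Y) X),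
      one = pure_tensor R M N \<one>\<^bsub>M\<^esub> \<one>\<^bsub>N\<^esub>,
      zero = one (tensor_group R M N),
      add = mult (tensor_group R M N),
      smult = (\<lambda>r. tensor_lift (tensor_group R M N) (\<lambda>x y. pure_tensor R M N (r \<odot>\<^bsub>M\<^esub> x) y))\<rparr>"

definition tensor_map ::
  "('r, 'y) ring_scheme \<Rightarrow> ('r, 'a, 'p) module_scheme \<Rightarrow> ('r, 'b, 'q) module_scheme
     \<Rightarrow> ('r, 'c, 's) module_scheme \<Rightarrow> ('r, 'd, 't) module_scheme
     \<Rightarrow> ('a \<Rightarrow> 'c) \<Rightarrow> ('b \<Rightarrow> 'd) \<Rightarrow> ('a, 'b) tensor_elt \<Rightarrow> ('c, 'd) tensor_elt" where
  "tensor_map R M N M' N' f g =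
     (\<lambda>X\<in>carrier (tensor R M N).
        tensor_lift (tensor_group R M' N') (\<lambda>x y. pure_tensor R M' N' (f x) (g y)) X)"

definition tensor_swap ::
  "('r, 'y) ring_scheme \<Rightarrow> ('r, 'a, 'p) module_scheme \<Rightarrow> ('r, 'b, 'q) module_scheme
     \<Rightarrow> ('a, 'b) tensor_elt \<Rightarrow> ('b, 'a) tensor_elt" where
  "tensor_swap R M N = tensor_lift (tensor_group R N M) (\<lambda>x y. pure_tensor R N M y x)"

text \<open>The associator \<open>(M \<otimes> N) \<otimes> P \<rightarrow> M \<otimes> (N \<otimes> P)\<close>.\<close>

definition tensor_assoc ::
  "('r, 'y) ring_scheme \<Rightarrow> ('r, 'a, 'p) module_scheme \<Rightarrow> ('r, 'b, 'q) module_scheme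
     \<Rightarrow> ('r, 'c, 's) module_scheme
     \<Rightarrow> (('a, 'b) tensor_elt, 'c) tensor_elt \<Rightarrow> ('a, ('b, 'c) tensor_elt) tensor_elt" where
  "tensor_assoc R M N P =
     tensor_lift (tensor_group R M (tensor R N P))
       (\<lambda>X z. tensor_lift (tensor_group R M (tensor R N P))
          (\<lambda>x y. pure_tensor R M (tensor R N P) x (pure_tensor R N P y z)) X)"


section \<open>Bialgebras\<close>

record ('r, 'a) bialg = "('r, 'a) module" +
  comult :: "'a \<Rightarrow> ('a, 'a) tensor_elt"
  counit :: "'a \<Rightarrow> 'r"

text \<open>The library's locale \<open>algebra\<close> is for commutative algebras only.\<close>

definition assoc_algebra :: "('r, 'y) ring_scheme \<Rightarrow> ('r, 'a, 'p) module_scheme \<Rightarrow> bool" where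
  "assoc_algebra R A \<longleftrightarrow> module R A \<and> ring A \<and>
     (\<forall>r\<in>carrier R. \<forall>x\<in>carrier A. \<forall>y\<in>carrier A.
        (r \<odot>\<^bsub>A\<^esub> x) \<otimes>\<^bsub>A\<^esub> y = r \<odot>\<^bsub>A\<^esub> (x \<otimes>\<^bsub>A\<^esub> y) \<and> x \<otimes>\<^bsub>A\<^esub> (r \<odot>\<^bsub>A\<^esub> y) = r \<odot>\<^bsub>A\<^esub> (x \<otimes>\<^bsub>A\<^esub> y))"

definition coalgebra :: "('r, 'y) ring_scheme \<Rightarrow> ('r, 'a, 'p) bialg_scheme \<Rightarrow> bool" where
  "coalgebra R A \<longleftrightarrow> module R A \<and>
     comult A \<in> lin_hom R A (tensor R A A) \<and>
     counit A \<in> lin_hom R A (ring_as_module R) \<and>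
     (\<forall>x\<in>carrier A.
        tensor_assoc R A A A
          (tensor_map R A A (tensor R A A) A (comult A) (\<lambda>y. y) (comult A x)) =
        tensor_map R A A A (tensor R A A) (\<lambda>y. y) (comult A) (comult A x)) \<and>
     (\<forall>x\<in>carrier A.
        tensor_lift (add_monoid A) (\<lambda>y z. counit A y \<odot>\<^bsub>A\<^esub> z) (comult A x) = x \<and>
        tensor_lift (add_monoid A) (\<lambda>y z. counit A z \<odot>\<^bsub>A\<^esub> y) (comult A x) = x)"

definition cocommutative :: "('r, 'y) ring_scheme \<Rightarrow> ('r, 'a, 'p) bialg_scheme \<Rightarrow> bool" where
  "cocommutative R A \<longleftrightarrow> (\<forall>x\<in>carrier A. tensor_swap R A A (comult A x) = comult A x)"

definition bialgebra :: "('r, 'y) ring_scheme \<Rightarrow> ('r, 'a, 'p) bialg_scheme \<Rightarrow> bool" where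
  "bialgebra R A \<longleftrightarrow> assoc_algebra R A \<and> coalgebra R A \<and>
     comult A \<in> ring_hom A (tensor R A A) \<and> counit A \<in> ring_hom A R"

definition bialg_hom ::
  "('r, 'y) ring_scheme \<Rightarrow> ('r, 'a, 'p) bialg_scheme \<Rightarrow> ('r, 'b, 'q) bialg_scheme
     \<Rightarrow> ('a \<Rightarrow> 'b) set" where
  "bialg_hom R A B =
     {f \<in> lin_hom R A B \<inter> ring_hom A B. \<forall>x\<in>carrier A.
        comult B (f x) = tensor_map R A A B B f f (comult A x) \<and>
        counit B (f x) = counit A x}"

definition projective_cocomm_bialgebras ::
  "('u, 'y) ring_scheme \<Rightarrow> (('u, 'u) bialg, 'u \<Rightarrow> 'u) cat" where
  "projective_cocomm_bialgebras R =
     \<lparr>Ob = {A. bialgebra R A \<and> cocommutative R A \<and> projective_module R A},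
      Mor = bialg_hom R,
      Ident = (\<lambda>A. \<lambda>x\<in>carrier A. x),
      Cmp = (\<lambda>A B C g f. compose (carrier A) g f)\<rparr>"


section \<open>Functors on commutative algebras\<close>

definition alg_hom ::
  "('k, 'y) ring_scheme \<Rightarrow> ('k, 'a, 'p) module_scheme \<Rightarrow> ('k, 'b, 'q) module_scheme
     \<Rightarrow> ('a \<Rightarrow> 'b) set" where
  "alg_hom K M N = lin_hom K M N \<inter> ring_hom M N"

text \<open>The type \<open>'u\<close> plays the role of the universe: \<open>R\<close>, the commutative \<open>R\<close>-algebras on which
  functors are defined and the \<open>R\<close>-modules \<open>A\<close> all have their carriers in \<open>'u\<close>.\<close>

definition comm_algs :: "('u, 'y) ring_scheme \<Rightarrow> (('u, 'u) module, 'u \<Rightarrow> 'u) cat" where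
  "comm_algs R =
     \<lparr>Ob = {S. algebra R S},
      Mor = alg_hom R,
      Ident = (\<lambda>S. \<lambda>x\<in>carrier S. x),
      Cmp = (\<lambda>S T U g f. compose (carrier S) g f)\<rparr>"

text \<open>Data for a functor of \<open>\<R>\<close>-algebras \<open>F\<close>, \<open>\<R>(S) = S\<close>: the value \<open>F(S)\<close> is an algebra over
  the ring \<open>S\<close>, whose scalars are in \<open>'u\<close>.\<close>

type_synonym ('u, 'f) alg_ftor = "(('u, 'u) module, 'u \<Rightarrow> 'u, ('u, 'f) module, 'f \<Rightarrow> 'f) ftor"

definition comm_algebra_functor :: "('u, 'y) ring_scheme \<Rightarrow> ('u, 'f) alg_ftor \<Rightarrow> bool" where
  "comm_algebra_functor R F \<longleftrightarrow>
     is_functor (comm_algs R) set_cat (carrier_functor F) \<and>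
     (\<forall>S\<in>Ob (comm_algs R). algebra S (on_ob F S)) \<and>
     (\<forall>S\<in>Ob (comm_algs R). \<forall>T\<in>Ob (comm_algs R). \<forall>h\<in>Mor (comm_algs R) S T.
        on_mor F S T h \<in> ring_hom (on_ob F S) (on_ob F T) \<and>
        (\<forall>s\<in>carrier S. \<forall>x\<in>carrier (on_ob F S).
           on_mor F S T h (s \<odot>\<^bsub>on_ob F S\<^esub> x) = h s \<odot>\<^bsub>on_ob F T\<^esub> on_mor F S T h x))"

text \<open>The elements of source and target live in different types, so \<open>nat_trans\<close> with values in
  \<open>set_cat\<close> does not apply.\<close>

definition alg_functor_homs ::
  "('u, 'y) ring_scheme \<Rightarrow> ('u, 'f) alg_ftor \<Rightarrow> ('u, 'g) alg_ftor
     \<Rightarrow> (('u, 'u) module \<Rightarrow> 'f \<Rightarrow> 'g) set" where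
  "alg_functor_homs R F G =
     {\<phi> \<in> extensional (Ob (comm_algs R)).
        (\<forall>S\<in>Ob (comm_algs R). \<phi> S \<in> alg_hom S (on_ob F S) (on_ob G S)) \<and>
        (\<forall>S\<in>Ob (comm_algs R). \<forall>T\<in>Ob (comm_algs R). \<forall>h\<in>Mor (comm_algs R) S T.
           \<forall>x\<in>carrier (on_ob F S). \<phi> T (on_mor F S T h x) = on_mor G S T h (\<phi> S x))}"

text \<open>The functor \<open>S' \<mapsto> S \<otimes>\<^sub>R S'\<close> attached to an \<open>R\<close>-algebra \<open>S\<close>; \<open>S'\<close> acts on the right
  factor.\<close>

definition quasi_coherent ::
  "('u, 'y) ring_scheme \<Rightarrow> ('u, 'u) module \<Rightarrow> ('u, ('u, 'u) tensor_elt) alg_ftor" where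
  "quasi_coherent R S =
     \<lparr>on_ob = (\<lambda>S'. (tensor R S S')
        \<lparr>smult := (\<lambda>s'. tensor_lift (tensor_group R S S')
                     (\<lambda>s t. pure_tensor R S S' s (s' \<otimes>\<^bsub>S'\<^esub> t)))\<rparr>),
      on_mor = (\<lambda>S' T' h. tensor_map R S S' S T' (\<lambda>s. s) h)\<rparr>"

definition Spec ::
  "('u, 'y) ring_scheme \<Rightarrow> ('u, 'f) alg_ftor
     \<Rightarrow> (('u, 'u) module, 'u \<Rightarrow> 'u,
         (('u, 'u) module \<Rightarrow> 'f \<Rightarrow> ('u, 'u) tensor_elt) set,
         (('u, 'u) module \<Rightarrow> 'f \<Rightarrow> ('u, 'u) tensor_elt)
           \<Rightarrow> (('u, 'u) module \<Rightarrow> 'f \<Rightarrow> ('u, 'u) tensor_elt)) ftor" where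
  "Spec R F =
     \<lparr>on_ob = (\<lambda>S. alg_functor_homs R F (quasi_coherent R S)),
      on_mor = (\<lambda>S T h. \<lambda>\<phi>\<in>alg_functor_homs R F (quasi_coherent R S).
         \<lambda>S'\<in>Ob (comm_algs R).
           compose (carrier (on_ob F S')) (tensor_map R S S' T S' h (\<lambda>s'. s')) (\<phi> S'))\<rparr>"

text \<open>The functor of \<open>\<R>\<close>-modules \<open>A\<^sup>*(S) = Hom\<^sub>R(A, S)\<close> together with candidate
  multiplications \<open>m S\<close> and units \<open>e S\<close> on its values; everything else is forced by \<open>A\<close>. It is
  a functor of commutative \<open>\<R>\<close>-algebras iff \<open>comm_algebra_functor\<close> holds.\<close>

definition dual_functor ::
  "('u, 'y) ring_scheme \<Rightarrow> ('u, 'u) module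
     \<Rightarrow> (('u, 'u) module \<Rightarrow> ('u \<Rightarrow> 'u) \<Rightarrow> ('u \<Rightarrow> 'u) \<Rightarrow> ('u \<Rightarrow> 'u))
     \<Rightarrow> (('u, 'u) module \<Rightarrow> ('u \<Rightarrow> 'u)) \<Rightarrow> ('u, 'u \<Rightarrow> 'u) alg_ftor" where
  "dual_functor R A m e =
     \<lparr>on_ob = (\<lambda>S.
        \<lparr>carrier = lin_hom R A S,
         mult = m S,
         one = e S,
         zero = (\<lambda>a\<in>carrier A. \<zero>\<^bsub>S\<^esub>),
         add = (\<lambda>v w. \<lambda>a\<in>carrier A. v a \<oplus>\<^bsub>S\<^esub> w a),
         smult = (\<lambda>s w. \<lambda>a\<in>carrier A. s \<otimes>\<^bsub>S\<^esub> w a)\<rparr>),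
      on_mor = (\<lambda>S T h. \<lambda>w\<in>lin_hom R A S. compose (carrier A) h w)\<rparr>"

type_synonym 'u spec_point = "('u, 'u) module \<Rightarrow> ('u \<Rightarrow> 'u) \<Rightarrow> ('u, 'u) tensor_elt"

text \<open>A functor of sets is a formal scheme of the kind considered here if it is \<open>Spec A\<^sup>*\<close> for a
  projective \<open>R\<close>-module \<open>A\<close> and some structure of functor of commutative \<open>\<R>\<close>-algebras on \<open>A\<^sup>*\<close>.\<close>

definition projective_formal_scheme ::
  "('u, 'y) ring_scheme
     \<Rightarrow> (('u, 'u) module, 'u \<Rightarrow> 'u, 'u spec_point set, 'u spec_point \<Rightarrow> 'u spec_point) ftor
     \<Rightarrow> bool" where
  "projective_formal_scheme R X \<longleftrightarrow>
     (\<exists>(A :: ('u, 'u) module) m e.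
        projective_module R A \<and> comm_algebra_functor R (dual_functor R A m e) \<and>
        functors_agree (comm_algs R) X (Spec R (dual_functor R A m e)))"

definition projective_formal_monoids ::
  "('u, 'y) ring_scheme
     \<Rightarrow> ((('u, 'u) module, 'u \<Rightarrow> 'u, 'u spec_point monoid, 'u spec_point \<Rightarrow> 'u spec_point) ftor,
         ('u, 'u) module \<Rightarrow> 'u spec_point \<Rightarrow> 'u spec_point) cat" where
  "projective_formal_monoids R =
     full_subcat (functor_cat (comm_algs R) monoid_cat)
       (\<lambda>G. projective_formal_scheme R (carrier_functor G))"

end

theory Submission
  imports Defs "HOL-Algebra.QuotRing"
begin

text \<open>Write \<open>Gr(S)\<close> for the set of group-like elements of the \<open>S\<close>-coalgebra \<open>S \<otimes> A\<close>. A linear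
  natural transformation \<open>Hom(A, T) \<rightarrow> S \<otimes> T\<close> is given by an element of \<open>S \<otimes> A\<close> (evaluate it on
  the square zero extension \<open>R \<oplus> A\<close>), and it is multiplicative iff this element is group-like, so
  \<open>(Spec A\<^sup>*)(S) = Gr(S)\<close>. In the same way every structure of functor of algebras on \<open>A\<^sup>*\<close> comes
  from a comultiplication on \<open>A\<close>.

  The main point is a converse: every natural map \<open>Gr(T) \<rightarrow> T \<otimes> P\<close> extends uniquely to a natural
  \<open>T\<close>-linear map on \<open>T \<otimes> A\<close>, hence is induced by a linear map \<open>A \<rightarrow> P\<close>. Since \<open>A\<close> is projective,
  any finite subset is fixed by an endomorphism of finite rank; this gives, over small quotients of the
  algebra \<open>Hom(A, S)\<close>, group-like elements from which all group-like elements supported on that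
  subset are obtained by base change, and the linear map is read off there. Applied in one variable
  this yields full faithfulness; applied in two variables it turns the multiplication of a formal
  monoid into a bilinear multiplication on \<open>A\<close>, and uniqueness gives the bialgebra axioms.\<close>

text \<open>The obstacle is one of size and of finiteness. The natural home of a generic group-like
  element is Hom(A, S) with convolution, but this algebra consists of functions
  \<open>'u => 'u\<close>, so the functors at hand do not see it, and its tautological element would
  be an infinite sum over a dual basis. Both defects disappear after fixing a finite set M: a finite
  rank map that is the identity on M makes the sum finite, and modulo the ideal generated by the
  functions vanishing on M a function counts only through its values on M, so the quotient can be
  coded by finite lists; this is where the infinity of the type enters. The group-like elements do
  not form a module, so linearity must come from elsewhere: evaluation at an element a is linear on
  the quotient, although in general not multiplicative, provided M supports the second leg of the
  coproduct of a, and when a lies in M it sends the generic element to 1 \<otimes> a. Working over a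
  base algebra S instead of R alone is what allows two variables to be treated one after the other:
  the second group-like element is fixed over S and the first varies over S-algebras.\<close>

abbreviation elt (infix "<:" 50) where "x <: M \<equiv> x \<in> carrier M"

abbreviation one_sub ("\<one>\<^sub>_" [1000] 1000) where "\<one>\<^sub>M \<equiv> one M"

abbreviation zero_sub ("\<zero>\<^sub>_" [1000] 1000) where "\<zero>\<^sub>M \<equiv> zero M"

abbreviation mult_sub ("(_ \<otimes>\<^sub>_ _)" [70, 1000, 71] 70) where "x \<otimes>\<^sub>M y \<equiv> mult M x y"

abbreviation add_sub ("(_ \<oplus>\<^sub>_ _)" [65, 1000, 66] 65) where "x \<oplus>\<^sub>M y \<equiv> add M x y"

abbreviation minus_sub ("(_ \<ominus>\<^sub>_ _)" [65, 1000, 66] 65) where "x \<ominus>\<^sub>M y \<equiv> a_minus M x y"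

abbreviation inv_sub ("(\<ominus>\<^sub>_ _)" [1000, 81] 80) where "\<ominus>\<^sub>M x \<equiv> a_inv M x"

abbreviation smult_sub ("(_ \<odot>\<^sub>_ _)" [70, 1000, 71] 70) where "r \<odot>\<^sub>M x \<equiv> smult M r x"

abbreviation "tens \<equiv> pure_tensor"

abbreviation "tmap \<equiv> tensor_map"

abbreviation "rmap R M N P \<equiv> tensor_map R M N M P (\<lambda>x. x)"

type_synonym 'u md = "('u, 'u) module"

section \<open>Linear and bilinear maps\<close>

text \<open>Linearity without the extensionality built into \<open>lin_hom\<close>, so that plain
  lambda terms and their compositions qualify. \<open>lin_hom_iff\<close> and
  \<open>restrict_lin_hom\<close> lead back and forth.\<close>

definition lmap ::
 "('r, 'y) ring_scheme => ('r, 'a, 'p) module_scheme => ('r, 'b, 'q) module_scheme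
   => ('a => 'b) => bool" where
 "lmap R M N f \<longleftrightarrow>
   (\<forall>x\<in>carrier M. f x <: N) \<and>
   (\<forall>x\<in>carrier M. \<forall>y\<in>carrier M. f (x \<oplus>\<^sub>M y) = f x \<oplus>\<^sub>N f y) \<and>
   (\<forall>r\<in>carrier R. \<forall>x\<in>carrier M. f (r \<odot>\<^sub>M x) = r \<odot>\<^sub>N f x)"

definition bilin ::
 "('r, 'y) ring_scheme => ('r, 'a, 'p) module_scheme => ('r, 'b, 'q) module_scheme
   => ('r, 'c, 's) module_scheme => ('a => 'b => 'c) => bool" where
 "bilin R M N P \<beta> \<longleftrightarrow>
   (\<forall>x\<in>carrier M. lmap R N P (\<beta> x)) \<and> (\<forall>y\<in>carrier N. lmap R M P (\<lambda>x. \<beta> x y))"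

lemma lin_hom_iff: "f \<in> lin_hom R M N \<longleftrightarrow> lmap R M N f \<and> f \<in> extensional (carrier M)"
 unfolding lin_hom_def lmap_def by (auto simp: PiE_def Pi_def)

lemma lmapI:
 assumes "\<And>x. x <: M ==> f x <: N"
  and "\<And>x y. x <: M ==> y <: M ==> f (x \<oplus>\<^sub>M y) = f x \<oplus>\<^sub>N f y"
  and "\<And>r x. r <: R ==> x <: M ==> f (r \<odot>\<^sub>M x) = r \<odot>\<^sub>N f x"
 shows "lmap R M N f"
 using assms unfolding lmap_def by auto

lemma lin_closed: "lmap R M N f ==> x <: M ==> f x <: N"
 and lin_add: "lmap R M N f ==> x <: M ==> y <: M ==> f (x \<oplus>\<^sub>M y) = f x \<oplus>\<^sub>N f y"
 and lin_smult: "lmap R M N f ==> r <: R ==> x <: M ==> f (r \<odot>\<^sub>M x) = r \<odot>\<^sub>N f x"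
 unfolding lmap_def by auto

text \<open>The module hypothesis ensures that sums and multiples stay in the carrier, where the two
  functions agree.\<close>

lemma lin_cong:
 "module R M ==> (\<And>x. x <: M ==> f x = g x) ==> lmap R M N f \<longleftrightarrow> lmap R M N g"
proof -
 assume "module R M" and e: "\<And>x. x <: M ==> f x = g x"
 then interpret module R M by simp
 show ?thesis
  unfolding lmap_def using e by simp
qed

lemma lin_restrict: "module R M ==> lmap R M N f ==> lmap R M N (restrict f (carrier M))"
 by (subst lin_cong[where g = f]) auto

lemma restrict_lin_hom: "module R M ==> lmap R M N f ==> restrict f (carrier M) \<in> lin_hom R M N"
 by (simp add: lin_hom_iff lin_restrict)

lemma lin_zero:
 assumes "module R M" "module R N" "lmap R M N f"
 shows "f \<zero>\<^sub>M = \<zero>\<^sub>N"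
proof -
 interpret M: module R M by fact
 interpret N: module R N by fact
 have "f \<zero>\<^sub>M \<oplus>\<^sub>N f \<zero>\<^sub>M = f \<zero>\<^sub>M"
  using lin_add[OF assms(3), of "\<zero>\<^sub>M" "\<zero>\<^sub>M"] by simp
 then show ?thesis
  using lin_closed[OF assms(3), of "\<zero>\<^sub>M"] by (simp add: N.add.l_cancel_one')
qed

lemma lin_uminus:
 assumes "module R M" "module R N" "lmap R M N f" "x <: M"
 shows "f (\<ominus>\<^sub>M x) = \<ominus>\<^sub>N f x"
proof -
 interpret M: module R M by fact
 interpret N: module R N by fact
 have "f (\<ominus>\<^sub>M x) \<oplus>\<^sub>N f x = \<zero>\<^sub>N"
  using lin_add[OF assms(3), of "\<ominus>\<^sub>M x" x] assms lin_zero[OF assms(1-3)]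
  by (simp add: M.l_neg)
 then show ?thesis
  using lin_closed[OF assms(3)] assms(4) by (metis M.a_inv_closed N.minus_equality)
qed

lemma lin_minus:
 assumes "module R M" "module R N" "lmap R M N f" "x <: M" "y <: M"
 shows "f (x \<ominus>\<^sub>M y) = f x \<ominus>\<^sub>N f y"
proof -
 interpret M: module R M by fact
 interpret N: module R N by fact
 show ?thesis
  using assms lin_add[OF assms(3), of x "\<ominus>\<^sub>M y"] lin_uminus[OF assms(1-3,5)]
  by (simp add: a_minus_def)
qed

lemma lin_comp: "lmap R M N f ==> lmap R N P g ==> lmap R M P (\<lambda>x. g (f x))"
 unfolding lmap_def by auto

lemma lin_id: "lmap R M M (\<lambda>x. x)"
 unfolding lmap_def by auto

lemma lin_sum:
 assumes "module R N" "lmap R M N f" "lmap R M N g"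
 shows "lmap R M N (\<lambda>x. f x \<oplus>\<^sub>N g x)"
proof -
 interpret N: module R N by fact
 show ?thesis
  using assms(2,3) unfolding lmap_def by (simp add: N.smult_r_distr N.M.add.m_ac)
qed

lemma lin_smult_left:
 assumes "module R N" "lmap R M N f" "r <: R"
 shows "lmap R M N (\<lambda>x. r \<odot>\<^sub>N f x)"
proof -
 interpret N: module R N by fact
 show ?thesis
  using assms(2,3) unfolding lmap_def
  by (simp add: N.smult_r_distr N.smult_assoc1[symmetric] N.R.m_comm)
qed

lemma lin_const_zero:
 assumes "module R N"
 shows "lmap R M N (\<lambda>x. \<zero>\<^sub>N)"
proof -
 interpret N: module R N by fact
 show ?thesis unfolding lmap_def by simp
qed

lemma lin_smult_right:
 assumes "module R N" "lmap R M (ring_as_module R) f" "n <: N"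
 shows "lmap R M N (\<lambda>x. f x \<odot>\<^sub>N n)"
proof -
 interpret N: module R N by fact
 show ?thesis
  using assms(2,3) unfolding lmap_def ring_as_module_def
  by (simp add: N.smult_l_distr N.smult_assoc1)
qed

lemma bilinI:
 assumes "\<And>x. x <: M ==> lmap R N P (\<beta> x)" "\<And>y. y <: N ==> lmap R M P (\<lambda>x. \<beta> x y)"
 shows "bilin R M N P \<beta>"
 using assms unfolding bilin_def by auto

lemma bilin_left: "bilin R M N P \<beta> ==> y <: N ==> lmap R M P (\<lambda>x. \<beta> x y)"
 and bilin_right: "bilin R M N P \<beta> ==> x <: M ==> lmap R N P (\<beta> x)"
 unfolding bilin_def by auto

lemma bilin_closed: "bilin R M N P \<beta> ==> x <: M ==> y <: N ==> \<beta> x y <: P"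
 unfolding bilin_def lmap_def by auto

lemma bilin_comp:
 "bilin R M N P \<beta> ==> lmap R M' M f ==> lmap R N' N g ==> bilin R M' N' P (\<lambda>x y. \<beta> (f x) (g y))"
 unfolding bilin_def lmap_def by auto

lemma bilin_post: "bilin R M N P \<beta> ==> lmap R P Q h ==> bilin R M N Q (\<lambda>x y. h (\<beta> x y))"
 unfolding bilin_def lmap_def by auto

lemma bilin_flip: "bilin R M N P \<beta> ==> bilin R N M P (\<lambda>y x. \<beta> x y)"
 unfolding bilin_def by auto

lemma bilin_smult:
 assumes "module R P"
 shows "bilin R (ring_as_module R) P P (\<lambda>r p. r \<odot>\<^sub>P p)"
proof -
 interpret P: module R P by fact
 show ?thesis
  unfolding bilin_def lmap_def ring_as_module_def
  by (simp add: P.smult_l_distr P.smult_r_distr P.smult_assoc1[symmetric] P.R.m_comm)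
qed

lemma bilin_mult:
 assumes "algebra R P"
 shows "bilin R P P P (\<lambda>x y. x \<otimes>\<^sub>P y)"
proof -
 interpret P: algebra R P by fact
 show ?thesis
  unfolding bilin_def lmap_def
  apply (auto simp add: P.l_distr P.r_distr P.smult_assoc2)
  by (metis cring.cring_simprules(14) P.M_cring P.smult_assoc2 P.smult_closed)
qed

lemma module_ring_as_module: "cring R ==> module R (ring_as_module R)"
proof -
 assume "cring R"
 then interpret cring R .
 show ?thesis
  unfolding ring_as_module_def
  apply (rule moduleI)
     apply (rule \<open>cring R\<close>)
     apply (rule abelian_groupI)
  by (auto simp: l_distr r_distr a_ac m_ac intro: a_inv_closed l_neg)
qed

lemma algebra_ring_as_module: "cring R ==> algebra R (ring_as_module R)"
proof -
 assume "cring R"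
 then interpret cring R .
 show ?thesis
  unfolding ring_as_module_def
  apply (rule algebraI)
      apply (rule \<open>cring R\<close>)
     apply (rule cringI)
      apply (rule abelian_groupI)
         apply (auto simp: l_distr r_distr a_ac m_ac intro: a_inv_closed l_neg)
  apply unfold_locales
    apply (auto simp: m_ac)
  done
qed

section \<open>Tensor products\<close>

text \<open>\<open>tensor_lift\<close> evaluates a coset on a chosen representative. The same
  formula on the free abelian group is a homomorphism that kills all relators, hence is constant on
  cosets, and the choice becomes irrelevant.\<close>

lemma tensor_lift_rep:
 fixes G (structure) and M :: "('r, 'a, 'p) module_scheme" and N :: "('r, 'b, 'q) module_scheme"
 assumes "comm_group G"
  and M: "abelian_group M" and N: "abelian_group N"
  and rM: "\<And>r x. r <: R ==> x <: M ==> r \<odot>\<^sub>M x <: M"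
  and rN: "\<And>r x. r <: R ==> x <: N ==> r \<odot>\<^sub>N x <: N"
  and cl: "\<And>x y. x <: M ==> y <: N ==> \<beta> x y <: G"
  and al: "\<And>x x' y. x <: M ==> x' <: M ==> y <: N
       ==> \<beta> (x \<oplus>\<^sub>M x') y = \<beta> x y \<otimes> \<beta> x' y"
  and ar: "\<And>x y y'. x <: M ==> y <: N ==> y' <: N
       ==> \<beta> x (y \<oplus>\<^sub>N y') = \<beta> x y \<otimes> \<beta> x y'"
  and bal: "\<And>r x y. r <: R ==> x <: M ==> y <: N
       ==> \<beta> (r \<odot>\<^sub>M x) y = \<beta> x (r \<odot>\<^sub>N y)"
 shows "tensor_lift G \<beta> \<in> hom (tensor_group R M N) G"
  and "x <: M ==> y <: N ==> tensor_lift G \<beta> (tens R M N x y) = \<beta> x y"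
proof -
 interpret G: comm_group G by fact
 interpret M: abelian_group M by fact
 interpret N: abelian_group N by fact
 let ?S = "carrier M \<times> carrier N"
 let ?F = "free_Abelian_group ?S"
 interpret F: comm_group ?F by (rule abelian_free_Abelian_group)
 define g where "g c = (\<lambda>(x, y). \<beta> x y [^] (Poly_Mapping.lookup c (x, y) :: int))" for c
 define H where "H c = finprod G (g c) (Poly_Mapping.keys c)" for c
 have gcl: "g c \<in> K \<rightarrow> carrier G" if "K \<subseteq> ?S" for K c
  using that cl by (auto simp: g_def intro!: G.int_pow_closed)
 \<comment> \<open>Keys outside the support carry exponent 0 and contribute the unit. This allows
   the supports of two summands to be enlarged to a common one.\<close>
 have Hsup: "H c = finprod G (g c) K" if "finite K" "Poly_Mapping.keys c \<subseteq> K" "K \<subseteq> ?S" for c K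
  unfolding H_def
 proof (rule G.finprod_mono_neutral_cong_left)
  show "g c i = \<one>" if "i \<in> K - Poly_Mapping.keys c" for i
   using that by (auto simp: g_def in_keys_iff split: prod.split)
 qed (use that gcl in auto)
 have Hhom: "H \<in> hom ?F G"
 proof (rule homI)
  fix c assume "c <: ?F"
  then show "H c <: G" unfolding H_def using gcl by (auto intro!: G.finprod_closed)
 next
  fix c d assume cd: "c <: ?F" "d <: ?F"
  let ?K = "Poly_Mapping.keys c \<union> Poly_Mapping.keys d"
  have K: "finite ?K" "?K \<subseteq> ?S" using cd by auto
  have "H (c + d) = finprod G (g (c + d)) ?K"
   by (rule Hsup) (use K keys_add[of c d] in auto)
  also have "\<dots> = finprod G (\<lambda>k. g c k \<otimes> g d k) ?K"
  proof (rule G.finprod_cong')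
   show "(\<lambda>k. g c k \<otimes> g d k) \<in> ?K \<rightarrow> carrier G" using K gcl[of ?K] by auto
  next
   fix k assume "k \<in> ?K"
   then have "k \<in> ?S" using K by auto
   then show "g (c + d) k = g c k \<otimes> g d k"
    using cl by (auto simp: g_def Poly_Mapping.lookup_add G.int_pow_mult)
  qed auto
  also have "\<dots> = finprod G (g c) ?K \<otimes> finprod G (g d) ?K"
   by (rule G.finprod_multf) (use K gcl[of ?K] in auto)
  also have "\<dots> = H c \<otimes> H d"
   using Hsup[OF K(1) _ K(2), of c] Hsup[OF K(1) _ K(2), of d] by simp
  finally show "H (c \<otimes>\<^bsub>?F\<^esub> d) = H c \<otimes> H d" by simp
 qed
 then interpret H: group_hom ?F G H
  by (simp add: group_hom_def group_hom_axioms_def G.is_group)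
 have Hof: "H (frag_of (x, y)) = \<beta> x y" if "x <: M" "y <: N" for x y
  unfolding H_def g_def using that cl[OF that] by (simp add: G.finprod_singleton_swap G.finprod_insert)
 have Hdiff: "H (c - d) = H c \<otimes> inv (H d)" if "c <: ?F" "d <: ?F" for c d
 proof -
  have "H (c \<otimes>\<^bsub>?F\<^esub> inv\<^bsub>?F\<^esub> d) = H c \<otimes> inv (H d)"
   using that by (simp only: H.hom_mult H.hom_inv F.inv_closed)
  then show ?thesis using that by simp
 qed
 have dcl: "c - d <: ?F" if "c <: ?F" "d <: ?F" for c d
  using that keys_diff[of c d] by auto
 have relc: "tensor_relators R M N \<subseteq> carrier ?F"
  unfolding tensor_relators_def
  by (safe; intro dcl; simp add: rM rN)
 have ffc: "frag_of (x, y) <: ?F" if "x <: M" "y <: N" for x y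
  using that by simp
 have Hrel: "H c = \<one>" if "c \<in> tensor_relators R M N" for c
  using that unfolding tensor_relators_def
 proof (safe)
  fix x x' y assume a: "x <: M" "x' <: M" "y <: N"
  show "H (frag_of (x \<oplus>\<^sub>M x', y) - frag_of (x, y) - frag_of (x', y)) = \<one>"
   using a by (simp add: Hdiff dcl ffc Hof al cl G.m_assoc G.inv_mult_group[symmetric]
     del: carrier_free_Abelian_group_iff frag_of_in_free_Abelian_group)
    (metis G.m_assoc G.m_comm G.inv_closed G.r_inv G.r_one G.m_closed cl)
 next
  fix x y y' assume a: "x <: M" "y <: N" "y' <: N"
  show "H (frag_of (x, y \<oplus>\<^sub>N y') - frag_of (x, y) - frag_of (x, y')) = \<one>"
   using a by (simp add: Hdiff dcl ffc Hof ar cl G.m_assoc G.inv_mult_group[symmetric]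
     del: carrier_free_Abelian_group_iff frag_of_in_free_Abelian_group)
    (metis G.m_assoc G.m_comm G.inv_closed G.r_inv G.r_one G.m_closed cl)
 next
  fix r x y assume a: "r <: R" "x <: M" "y <: N"
  show "H (frag_of (r \<odot>\<^sub>M x, y) - frag_of (x, r \<odot>\<^sub>N y)) = \<one>"
   using a by (simp add: Hdiff dcl ffc Hof cl bal rM rN
     del: carrier_free_Abelian_group_iff frag_of_in_free_Abelian_group)
 qed
 let ?K = "tensor_kernel R M N"
 have Ksub: "subgroup ?K ?F"
  unfolding tensor_kernel_def by (rule F.generate_is_subgroup[OF relc])
 have Knorm: "?K \<lhd> ?F" by (rule F.normal_iff_subgroup[THEN iffD2, OF Ksub])
 \<comment> \<open>The relators generate the kernel subgroup, so it suffices that \<open>H\<close>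
   is trivial on them.\<close>
 have "?K \<subseteq> kernel ?F G H"
  unfolding tensor_kernel_def
  by (rule F.generate_subgroup_incl[OF _ H.subgroup_kernel])
   (use Hrel relc in \<open>auto simp: kernel_def simp del: carrier_free_Abelian_group_iff\<close>)
 then have HK: "H k = \<one>" if "k \<in> ?K" for k using that by (auto simp: kernel_def)
 have lift: "tensor_lift G \<beta> (?K #>\<^bsub>?F\<^esub> c) = H c" if c: "c <: ?F" for c
 proof -
  define d where "d = (SOME d. d \<in> ?K #>\<^bsub>?F\<^esub> c)"
  have "c \<in> ?K #>\<^bsub>?F\<^esub> c" by (rule F.rcos_self[OF c Ksub])
  then have "d \<in> ?K #>\<^bsub>?F\<^esub> c" unfolding d_def by (rule someI)
  then obtain k where k: "k \<in> ?K" "d = k \<otimes>\<^bsub>?F\<^esub> c"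
   unfolding r_coset_def by auto
  have kc: "k <: ?F" using k(1) subgroup.subset[OF Ksub] by blast
  have "tensor_lift G \<beta> (?K #>\<^bsub>?F\<^esub> c) = H d"
   unfolding tensor_lift_def d_def[symmetric] H_def g_def by simp
  also have "\<dots> = H k \<otimes> H c" unfolding k(2) by (rule H.hom_mult[OF kc c])
  also have "\<dots> = H c" using HK[OF k(1)] H.hom_closed[OF c] by simp
  finally show ?thesis .
 qed
 show "tensor_lift G \<beta> \<in> hom (tensor_group R M N) G"
 proof (rule homI)
  fix X assume "X <: tensor_group R M N"
  then obtain c where "c <: ?F" "X = ?K #>\<^bsub>?F\<^esub> c"
   unfolding tensor_group_def carrier_FactGroup by auto
  then show "tensor_lift G \<beta> X <: G" using lift H.hom_closed by auto
 next
  fix X Y assume "X <: tensor_group R M N" "Y <: tensor_group R M N"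
  then obtain c d where cd: "c <: ?F" "X = ?K #>\<^bsub>?F\<^esub> c" "d <: ?F" "Y = ?K #>\<^bsub>?F\<^esub> d"
   unfolding tensor_group_def carrier_FactGroup by auto
  have "X \<otimes>\<^bsub>tensor_group R M N\<^esub> Y = ?K #>\<^bsub>?F\<^esub> (c \<otimes>\<^bsub>?F\<^esub> d)"
   using normal.rcos_sum[OF Knorm cd(1,3)] by (simp add: tensor_group_def cd)
  then show "tensor_lift G \<beta> (X \<otimes>\<^bsub>tensor_group R M N\<^esub> Y) = tensor_lift G \<beta> X \<otimes> tensor_lift G \<beta> Y"
   using lift[of "c \<otimes>\<^bsub>?F\<^esub> d"] lift[OF cd(1)] lift[OF cd(3)] H.hom_mult[OF cd(1,3)] F.m_closed[OF cd(1,3)] cd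
   by metis
 qed
 show "tensor_lift G \<beta> (tens R M N x y) = \<beta> x y" if "x <: M" "y <: N"
  unfolding pure_tensor_def using lift[of "frag_of (x, y)"] Hof[OF that] that by simp
qed

lemma comm_group_tensor_group:
 assumes "module R M" "module R N"
 shows "comm_group (tensor_group R M N)"
  and "subgroup (tensor_kernel R M N) (free_Abelian_group (carrier M \<times> carrier N))"
proof -
 interpret M: module R M by fact
 interpret N: module R N by fact
 let ?F = "free_Abelian_group (carrier M \<times> carrier N)"
 interpret F: comm_group ?F by (rule abelian_free_Abelian_group)
 have dcl: "c - d <: ?F" if "c <: ?F" "d <: ?F" for c d
  using that keys_diff[of c d] by auto
 have relc: "tensor_relators R M N \<subseteq> carrier ?F"
  unfolding tensor_relators_def
  by (safe; intro dcl; simp)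
 show *: "subgroup (tensor_kernel R M N) ?F"
  unfolding tensor_kernel_def by (rule F.generate_is_subgroup[OF relc])
 show "comm_group (tensor_group R M N)"
  unfolding tensor_group_def by (rule F.abelian_FactGroup[OF *])
qed

lemma tensor_coset:
 assumes "module R M" "module R N"
 defines "F \<equiv> free_Abelian_group (carrier M \<times> carrier N)"
 assumes "c <: F" "d <: F"
 shows "(tensor_kernel R M N #>\<^bsub>F\<^esub> c) \<otimes>\<^bsub>tensor_group R M N\<^esub> (tensor_kernel R M N #>\<^bsub>F\<^esub> d)
      = tensor_kernel R M N #>\<^bsub>F\<^esub> (c + d)"
  and "c - d \<in> tensor_kernel R M N
      ==> tensor_kernel R M N #>\<^bsub>F\<^esub> c = tensor_kernel R M N #>\<^bsub>F\<^esub> d"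
proof -
 interpret F: comm_group F unfolding F_def by (rule abelian_free_Abelian_group)
 have K: "subgroup (tensor_kernel R M N) F"
  unfolding F_def by (rule comm_group_tensor_group[OF assms(1,2)])
 have Kn: "tensor_kernel R M N \<lhd> F" by (rule F.normal_iff_subgroup[THEN iffD2, OF K])
 show "(tensor_kernel R M N #>\<^bsub>F\<^esub> c) \<otimes>\<^bsub>tensor_group R M N\<^esub> (tensor_kernel R M N #>\<^bsub>F\<^esub> d)
      = tensor_kernel R M N #>\<^bsub>F\<^esub> (c + d)"
  using normal.rcos_sum[OF Kn assms(4,5)] unfolding tensor_group_def F_def by simp
 assume "c - d \<in> tensor_kernel R M N"
 moreover have "c \<otimes>\<^sub>F inv\<^bsub>F\<^esub> d = c - d"
  using assms(5) unfolding F_def by simp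
 ultimately have "c \<in> tensor_kernel R M N #>\<^bsub>F\<^esub> d"
  using subgroup.rcos_module_rev[OF K F.is_group assms(5,4)] by simp
 then show "tensor_kernel R M N #>\<^bsub>F\<^esub> c = tensor_kernel R M N #>\<^bsub>F\<^esub> d"
  using F.repr_independence[OF _ assms(5) K] by metis
qed

lemma tens_group:
 assumes "module R M" "module R N"
 shows "x <: M ==> y <: N ==> tens R M N x y <: tensor_group R M N"
  and "x <: M ==> x' <: M ==> y <: N ==> tens R M N (x \<oplus>\<^sub>M x') y
      = tens R M N x y \<otimes>\<^bsub>tensor_group R M N\<^esub> tens R M N x' y"
  and "x <: M ==> y <: N ==> y' <: N ==> tens R M N x (y \<oplus>\<^sub>N y')
      = tens R M N x y \<otimes>\<^bsub>tensor_group R M N\<^esub> tens R M N x y'"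
  and "r <: R ==> x <: M ==> y <: N
      ==> tens R M N (r \<odot>\<^sub>M x) y = tens R M N x (r \<odot>\<^sub>N y)"
proof -
 interpret M: module R M by fact
 interpret N: module R N by fact
 let ?F = "free_Abelian_group (carrier M \<times> carrier N)"
 let ?K = "tensor_kernel R M N"
 have rel: "c \<in> ?K" if "c \<in> tensor_relators R M N" for c
  unfolding tensor_kernel_def using that by (rule generate.incl)
 have pcl: "c + d <: ?F" if "c <: ?F" "d <: ?F" for c d
  using that keys_add[of c d] by auto
 note cos = tensor_coset[OF assms]
 show "x <: M ==> y <: N ==> tens R M N x y <: tensor_group R M N"
  unfolding pure_tensor_def tensor_group_def carrier_FactGroup by auto
 show "tens R M N (x \<oplus>\<^sub>M x') y
      = tens R M N x y \<otimes>\<^bsub>tensor_group R M N\<^esub> tens R M N x' y"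
  if a: "x <: M" "x' <: M" "y <: N" for x x' y
 proof -
  have "frag_of (x \<oplus>\<^sub>M x', y) - frag_of (x, y) - frag_of (x', y) \<in> ?K"
   by (rule rel) (use a in \<open>auto simp: tensor_relators_def\<close>)
  then have "frag_of (x \<oplus>\<^sub>M x', y) - (frag_of (x, y) + frag_of (x', y)) \<in> ?K"
   by (simp add: algebra_simps)
  then have "tens R M N (x \<oplus>\<^sub>M x') y = ?K #>\<^bsub>?F\<^esub> (frag_of (x, y) + frag_of (x', y))"
   unfolding pure_tensor_def by (intro cos(2) pcl) (use a in auto)
  then show ?thesis
   unfolding pure_tensor_def using cos(1)[of "frag_of (x, y)" "frag_of (x', y)"] a by simp
 qed
 show "tens R M N x (y \<oplus>\<^sub>N y')
      = tens R M N x y \<otimes>\<^bsub>tensor_group R M N\<^esub> tens R M N x y'"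
  if a: "x <: M" "y <: N" "y' <: N" for x y y'
 proof -
  have "frag_of (x, y \<oplus>\<^sub>N y') - frag_of (x, y) - frag_of (x, y') \<in> ?K"
   by (rule rel) (use a in \<open>auto simp: tensor_relators_def\<close>)
  then have "frag_of (x, y \<oplus>\<^sub>N y') - (frag_of (x, y) + frag_of (x, y')) \<in> ?K"
   by (simp add: algebra_simps)
  then have "tens R M N x (y \<oplus>\<^sub>N y') = ?K #>\<^bsub>?F\<^esub> (frag_of (x, y) + frag_of (x, y'))"
   unfolding pure_tensor_def by (intro cos(2) pcl) (use a in auto)
  then show ?thesis
   unfolding pure_tensor_def using cos(1)[of "frag_of (x, y)" "frag_of (x, y')"] a by simp
 qed
 show "tens R M N (r \<odot>\<^sub>M x) y = tens R M N x (r \<odot>\<^sub>N y)"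
  if a: "r <: R" "x <: M" "y <: N" for r x y
  unfolding pure_tensor_def
  by (intro cos(2) rel) (use a in \<open>auto simp: tensor_relators_def\<close>)
qed

text \<open>Powers and finite products see only these three fields. The lemma identifies lifts into
  \<open>tensor_group\<close> with lifts into the additive monoid of \<open>tensor\<close>, and
  later lifts into modules that differ in their ring structure.\<close>

lemma tensor_lift_monoid_cong:
 assumes "carrier G = carrier H" "mult G = mult H" "one G = one H"
 shows "tensor_lift G = tensor_lift H"
proof -
 have np: "x [^]\<^bsub>G\<^esub> n = x [^]\<^bsub>H\<^esub> n" for x and n :: nat
  unfolding nat_pow_def assms by simp
 have ip: "x [^]\<^bsub>G\<^esub> n = x [^]\<^bsub>H\<^esub> n" for x and n :: int
  unfolding int_pow_def np m_inv_def assms by simp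
 show ?thesis
  unfolding tensor_lift_def fun_eq_iff finprod_def ip assms by simp
qed

lemma add_monoid_tensor: "tensor_lift (add_monoid (tensor R M N)) = tensor_lift (tensor_group R M N)"
 by (rule tensor_lift_monoid_cong) (simp_all add: tensor_def)

lemma carrier_tensor: "carrier (tensor R M N) = carrier (tensor_group R M N)"
 unfolding tensor_def by simp

lemma add_tensor: "X \<oplus>\<^bsub>tensor R M N\<^esub> Y = X \<otimes>\<^bsub>tensor_group R M N\<^esub> Y"
 unfolding tensor_def by simp

text \<open>No cases for zero, negatives or scalars are required: 0 is 0 \<otimes> 0, and the
  negative of x \<otimes> y is (-x) \<otimes> y, so every tensor is a non-empty sum of pure
  tensors.\<close>

lemma tensor_induct [consumes 3, case_names pure add]:
 assumes "module R M" "module R N" and X: "X <: tensor R M N"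
  and pure: "\<And>x y. x <: M ==> y <: N ==> P (tens R M N x y)"
  and add: "\<And>X Y. X <: tensor R M N ==> Y <: tensor R M N ==> P X ==> P Y
        ==> P (X \<oplus>\<^bsub>tensor R M N\<^esub> Y)"
 shows "P X"
proof -
 interpret M: module R M by fact
 interpret N: module R N by fact
 let ?F = "free_Abelian_group (carrier M \<times> carrier N)"
 interpret F: comm_group ?F by (rule abelian_free_Abelian_group)
 interpret T: comm_group "tensor_group R M N" by (rule comm_group_tensor_group[OF assms(1,2)])
 let ?K = "tensor_kernel R M N"
 note cos = tensor_coset[OF assms(1,2)]
 obtain c where c: "c <: ?F" "X = ?K #>\<^bsub>?F\<^esub> c"
  using X unfolding carrier_tensor tensor_group_def carrier_FactGroup by auto
 have ccl: "?K #>\<^bsub>?F\<^esub> c <: tensor R M N" if "c <: ?F" for c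
  using that unfolding carrier_tensor tensor_group_def carrier_FactGroup by auto
 have zero: "tens R M N \<zero>\<^sub>M \<zero>\<^sub>N = ?K #>\<^bsub>?F\<^esub> 0"
 proof -
  have "tens R M N \<zero>\<^sub>M \<zero>\<^sub>N = tens R M N \<zero>\<^sub>M \<zero>\<^sub>N \<otimes>\<^bsub>tensor_group R M N\<^esub> tens R M N \<zero>\<^sub>M \<zero>\<^sub>N"
   using tens_group(2)[OF assms(1,2), of "\<zero>\<^sub>M" "\<zero>\<^sub>M" "\<zero>\<^sub>N"] by simp
  then have "tens R M N \<zero>\<^sub>M \<zero>\<^sub>N = \<one>\<^bsub>tensor_group R M N\<^esub>"
   using tens_group(1)[OF assms(1,2), of "\<zero>\<^sub>M" "\<zero>\<^sub>N"] by (metis M.zero_closed N.zero_closed T.l_cancel_one')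
  moreover have "?K #>\<^bsub>?F\<^esub> 0 = \<one>\<^bsub>tensor_group R M N\<^esub>"
   using F.coset_mult_one[OF subgroup.subset[OF comm_group_tensor_group(2)[OF assms(1,2)]]]
   by (simp add: tensor_group_def)
  ultimately show ?thesis by simp
 qed
 have neg: "tens R M N (\<ominus>\<^sub>M x) y = ?K #>\<^bsub>?F\<^esub> (- frag_of (x, y))"
  if a: "x <: M" "y <: N" for x y
 proof -
  let ?p = "tens R M N x y"
  let ?n = "?K #>\<^bsub>?F\<^esub> (- frag_of (x, y))"
  have one: "?K #>\<^bsub>?F\<^esub> 0 = \<one>\<^bsub>tensor_group R M N\<^esub>"
   using F.coset_mult_one[OF subgroup.subset[OF comm_group_tensor_group(2)[OF assms(1,2)]]]
   by (simp add: tensor_group_def)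
  have z: "tens R M N \<zero>\<^sub>M y = \<one>\<^bsub>tensor_group R M N\<^esub>"
   using tens_group(2)[OF assms(1,2), of "\<zero>\<^sub>M" "\<zero>\<^sub>M" y] a
    tens_group(1)[OF assms(1,2), of "\<zero>\<^sub>M" y]
   by (metis M.zero_closed M.l_zero T.l_cancel_one')
  have 1: "tens R M N (\<ominus>\<^sub>M x) y \<otimes>\<^bsub>tensor_group R M N\<^esub> ?p = \<one>\<^bsub>tensor_group R M N\<^esub>"
   using tens_group(2)[OF assms(1,2), of "\<ominus>\<^sub>M x" x y] a z by (simp add: M.l_neg)
  have 2: "?n \<otimes>\<^bsub>tensor_group R M N\<^esub> ?p = \<one>\<^bsub>tensor_group R M N\<^esub>"
   unfolding pure_tensor_def using cos(1)[of "- frag_of (x, y)" "frag_of (x, y)"] a one by simp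
  have c: "tens R M N (\<ominus>\<^sub>M x) y <: tensor_group R M N"
   "?p <: tensor_group R M N"
   by (intro tens_group[OF assms(1,2)]; use a in simp)+
  have c': "?n <: tensor_group R M N"
   using ccl[of "- frag_of (x, y)"] a unfolding carrier_tensor by simp
  show ?thesis using 1 2 c c' by (metis T.inv_equality)
 qed
 \<comment> \<open>Induction in the free abelian group proceeds by differences, so the claim is
   strengthened to a representative together with its negative.\<close>
 have "P (?K #>\<^bsub>?F\<^esub> c) \<and> P (?K #>\<^bsub>?F\<^esub> (- c))"
 proof (rule free_Abelian_group_induct[where x = c and S = "carrier M \<times> carrier N"])
  show "Poly_Mapping.keys c \<subseteq> carrier M \<times> carrier N" using c by simp
  show "P (?K #>\<^bsub>?F\<^esub> 0) \<and> P (?K #>\<^bsub>?F\<^esub> - 0)" using pure[of "\<zero>\<^sub>M" "\<zero>\<^sub>N"] zero by simp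
 next
  fix x y
  assume a: "Poly_Mapping.keys x \<subseteq> carrier M \<times> carrier N" "Poly_Mapping.keys y \<subseteq> carrier M \<times> carrier N"
   "P (?K #>\<^bsub>?F\<^esub> x) \<and> P (?K #>\<^bsub>?F\<^esub> - x)" "P (?K #>\<^bsub>?F\<^esub> y) \<and> P (?K #>\<^bsub>?F\<^esub> - y)"
  have "P (?K #>\<^bsub>?F\<^esub> (x + - y))"
   using add[OF ccl ccl, of x "- y"] cos(1)[of x "- y"] a by (simp add: add_tensor)
  moreover have "P (?K #>\<^bsub>?F\<^esub> (- x + y))"
   using add[OF ccl ccl, of "- x" "y"] cos(1)[of "- x" y] a by (simp add: add_tensor)
  ultimately show "P (?K #>\<^bsub>?F\<^esub> (x - y)) \<and> P (?K #>\<^bsub>?F\<^esub> - (x - y))" by simp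
 next
  fix a assume "a \<in> carrier M \<times> carrier N"
  then obtain x y where a: "a = (x, y)" "x <: M" "y <: N" by auto
  show "P (?K #>\<^bsub>?F\<^esub> frag_of a) \<and> P (?K #>\<^bsub>?F\<^esub> - frag_of a)"
   using pure[OF a(2,3)] pure[of "\<ominus>\<^sub>M x" y] neg[OF a(2,3)] a unfolding pure_tensor_def by simp
 qed
 then show ?thesis using c by simp
qed

lemma tensor_smult_pure:
 assumes "module R M" "module R N" "r <: R"
 shows "(\<lambda>X. r \<odot>\<^bsub>tensor R M N\<^esub> X) \<in> hom (tensor_group R M N) (tensor_group R M N)"
  and "x <: M ==> y <: N
   ==> r \<odot>\<^bsub>tensor R M N\<^esub> tens R M N x y = tens R M N (r \<odot>\<^sub>M x) y"
proof -
 interpret M: module R M by fact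
 interpret N: module R N by fact
 have sw: "s \<odot>\<^sub>M (t \<odot>\<^sub>M x) = t \<odot>\<^sub>M (s \<odot>\<^sub>M x)"
  if "s <: R" "t <: R" "x <: M" for s t x
  using that by (simp add: M.smult_assoc1[symmetric] M.R.m_comm)
 let ?b = "\<lambda>x y. tens R M N (r \<odot>\<^sub>M x) y"
 have e: "(\<lambda>X. r \<odot>\<^bsub>tensor R M N\<^esub> X) = tensor_lift (tensor_group R M N) ?b"
  unfolding tensor_def by simp
 note pt = tens_group[OF assms(1,2)]
 note l = tensor_lift_rep[OF comm_group_tensor_group(1)[OF assms(1,2)] M.abelian_group_axioms N.abelian_group_axioms,
   where \<beta> = ?b and R = R]
 show "(\<lambda>X. r \<odot>\<^bsub>tensor R M N\<^esub> X) \<in> hom (tensor_group R M N) (tensor_group R M N)"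
  unfolding e
  by (rule l(1)) (use assms(3) in \<open>simp_all add: pt(1-3) M.smult_r_distr sw pt(4)\<close>)
 show "r \<odot>\<^bsub>tensor R M N\<^esub> tens R M N x y = tens R M N (r \<odot>\<^sub>M x) y"
  if "x <: M" "y <: N"
  unfolding fun_cong[OF e]
  by (rule l(2)) (use assms(3) that in \<open>simp_all add: pt(1-3) M.smult_r_distr sw pt(4)\<close>)
qed

lemma module_tensor:
 assumes "module R M" "module R N"
 shows "module R (tensor R M N)"
proof -
 interpret M: module R M by fact
 interpret N: module R N by fact
 interpret T: comm_group "tensor_group R M N" by (rule comm_group_tensor_group[OF assms])
 have ab: "abelian_group (tensor R M N)"
 proof (rule abelian_groupI)
  show "\<exists>y\<in>carrier (tensor R M N). y \<oplus>\<^bsub>tensor R M N\<^esub> x = \<zero>\<^bsub>tensor R M N\<^esub>"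
   if "x <: tensor R M N" for x
   using that T.l_inv_ex by (simp add: tensor_def)
 qed (simp_all add: tensor_def T.m_ac)
 interpret ab: abelian_group "tensor R M N" by (rule ab)
 note pt = tens_group[OF assms]
 note sp = tensor_smult_pure(2)[OF assms]
 have sm_cl: "r \<odot>\<^bsub>tensor R M N\<^esub> X <: tensor R M N"
  if "r <: R" "X <: tensor R M N" for r X
  using tensor_smult_pure(1)[OF assms that(1)] that(2) unfolding carrier_tensor hom_def by auto
 have sm_add: "r \<odot>\<^bsub>tensor R M N\<^esub> (X \<oplus>\<^bsub>tensor R M N\<^esub> Y) = r \<odot>\<^bsub>tensor R M N\<^esub> X \<oplus>\<^bsub>tensor R M N\<^esub> r \<odot>\<^bsub>tensor R M N\<^esub> Y"
  if "r <: R" "X <: tensor R M N" "Y <: tensor R M N" for r X Y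
  using hom_mult[OF tensor_smult_pure(1)[OF assms that(1)]] that(2,3) unfolding carrier_tensor add_tensor by auto
 show ?thesis
 proof (rule moduleI[OF M.R.cring_axioms ab sm_cl _ sm_add])
  fix a b X assume a: "a <: R" "b <: R" and X: "X <: tensor R M N"
  show "(a \<oplus>\<^sub>R b) \<odot>\<^bsub>tensor R M N\<^esub> X = a \<odot>\<^bsub>tensor R M N\<^esub> X \<oplus>\<^bsub>tensor R M N\<^esub> b \<odot>\<^bsub>tensor R M N\<^esub> X"
   using assms X
  proof (induction rule: tensor_induct)
   case (pure x y)
   then show ?case using a by (simp add: sp M.smult_l_distr pt add_tensor)
  next
   case (add X Y)
   then show ?case using a by (simp add: sm_add sm_cl ab.add.m_ac)
  qed
  show "(a \<otimes>\<^sub>R b) \<odot>\<^bsub>tensor R M N\<^esub> X = a \<odot>\<^bsub>tensor R M N\<^esub> (b \<odot>\<^bsub>tensor R M N\<^esub> X)"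
   using assms X
  proof (induction rule: tensor_induct)
   case (pure x y)
   then show ?case using a by (simp add: sp M.smult_assoc1)
  next
   case (add X Y)
   then show ?case using a by (simp add: sm_add sm_cl)
  qed
 next
  fix X assume X: "X <: tensor R M N"
  show "\<one>\<^sub>R \<odot>\<^bsub>tensor R M N\<^esub> X = X"
   using assms X
  proof (induction rule: tensor_induct)
   case (pure x y)
   then show ?case by (simp add: sp)
  next
   case (add X Y)
   then show ?case by (simp add: sm_add)
  qed
 qed
qed

lemma bilin_pure_tensor:
 assumes "module R M" "module R N"
 shows "bilin R M N (tensor R M N) (tens R M N)"
proof -
 interpret M: module R M by fact
 interpret N: module R N by fact
 note pt = tens_group[OF assms]
 show ?thesis
  unfolding bilin_def lmap_def
  by (auto simp: carrier_tensor add_tensor pt(1-3) tensor_smult_pure(2)[OF assms] pt(4))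
qed

lemma tens_closed:
 "module R M ==> module R N ==> x <: M ==> y <: N
  ==> tens R M N x y <: tensor R M N"
 using bilin_closed[OF bilin_pure_tensor] .

abbreviation tlift :: "('r, 'c, 's) module_scheme => ('a => 'b => 'c) => ('a, 'b) tensor_elt => 'c" where
 "tlift P \<beta> \<equiv> tensor_lift (add_monoid P) \<beta>"

text \<open>The universal property of the tensor product. Balancedness of the bilinear map is
  automatic, because scalars can be pulled out of either argument.\<close>

lemma
 assumes "module R M" "module R N" "module R P" and \<beta>: "bilin R M N P \<beta>"
 shows lin_tlift: "lmap R (tensor R M N) P (tlift P \<beta>)"
  and tlift_pure: "x <: M ==> y <: N ==> tlift P \<beta> (tens R M N x y) = \<beta> x y"
proof -
 interpret M: module R M by fact
 interpret N: module R N by fact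
 interpret P: module R P by fact
 interpret T: module R "tensor R M N" by (rule module_tensor) fact+
 have g: "comm_group (add_monoid P)" by (rule P.a_comm_group)
 note bl = bilin_left[OF \<beta>] and br = bilin_right[OF \<beta>]
 have 1: "\<beta> (r \<odot>\<^sub>M x) y = \<beta> x (r \<odot>\<^sub>N y)" if "r <: R" "x <: M" "y <: N" for r x y
  using lin_smult[OF bl, of y r x] lin_smult[OF br, of x r y] that by simp
 note l = tensor_lift_rep[OF g M.abelian_group_axioms N.abelian_group_axioms, where \<beta> = \<beta> and R = R]
 have h: "tlift P \<beta> \<in> hom (tensor_group R M N) (add_monoid P)"
  by (rule l(1)) (use bilin_closed[OF \<beta>] lin_add[OF bl] lin_add[OF br] in \<open>simp_all add: 1\<close>)
 show p: "tlift P \<beta> (tens R M N x y) = \<beta> x y" if "x <: M" "y <: N" for x y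
  by (rule l(2)) (use that bilin_closed[OF \<beta>] lin_add[OF bl] lin_add[OF br] in \<open>simp_all add: 1\<close>)
 have cl: "tlift P \<beta> X <: P" if "X <: tensor R M N" for X
  using h that unfolding carrier_tensor hom_def by auto
 have add: "tlift P \<beta> (X \<oplus>\<^bsub>tensor R M N\<^esub> Y) = tlift P \<beta> X \<oplus>\<^sub>P tlift P \<beta> Y"
  if "X <: tensor R M N" "Y <: tensor R M N" for X Y
  using hom_mult[OF h] that unfolding carrier_tensor add_tensor by simp
 show "lmap R (tensor R M N) P (tlift P \<beta>)"
 proof (rule lmapI[OF cl add])
  fix r X assume r: "r <: R" and X: "X <: tensor R M N"
  show "tlift P \<beta> (r \<odot>\<^bsub>tensor R M N\<^esub> X) = r \<odot>\<^sub>P tlift P \<beta> X"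
   using assms(1,2) X
  proof (induction rule: tensor_induct)
   case (pure x y)
   then show ?case using r lin_smult[OF bl, of y r x] by (simp add: tensor_smult_pure[OF assms(1,2)] p)
  next
   case (add X Y)
   then show ?case using r by (simp add: T.smult_r_distr \<open>\<And>X Y. X <: tensor R M N ==> Y <: tensor R M N ==> tlift P \<beta> (X \<oplus>\<^bsub>tensor R M N\<^esub> Y) = tlift P \<beta> X \<oplus>\<^sub>P tlift P \<beta> Y\<close> cl P.smult_r_distr)
  qed
 qed
qed

text \<open>The main device for identities between linear maps out of a tensor product: both sides
  are shown to be linear and then compared on pure tensors only.\<close>

lemma tmap_ext:
 assumes "module R M" "module R N" "lmap R (tensor R M N) P f" "lmap R (tensor R M N) P g"
  and "\<And>x y. x <: M ==> y <: N ==> f (tens R M N x y) = g (tens R M N x y)"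
  and "X <: tensor R M N"
 shows "f X = g X"
 using assms(1,2,6)
 by (induction rule: tensor_induct) (simp_all add: assms(5) lin_add[OF assms(3)] lin_add[OF assms(4)])

text \<open>A lift depends linearly on a parameter as soon as the bilinear map does. It supplies the
  second linearity whenever a bilinear operation on tensors is built by nesting two lifts.\<close>

lemma lin_tlift_param:
 assumes "module R M" "module R N" "module R P" "module R Q"
  and \<beta>: "\<And>z. z <: Q ==> bilin R M N P (\<beta> z)"
  and l: "\<And>x y. x <: M ==> y <: N ==> lmap R Q P (\<lambda>z. \<beta> z x y)"
  and X: "X <: tensor R M N"
 shows "lmap R Q P (\<lambda>z. tlift P (\<beta> z) X)"
 using assms(1,2) X
proof (induction rule: tensor_induct)
 case (pure x y)
 have "lmap R Q P (\<lambda>z. tlift P (\<beta> z) (tens R M N x y)) \<longleftrightarrow> lmap R Q P (\<lambda>z. \<beta> z x y)"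
  by (rule lin_cong[OF assms(4)]) (simp add: tlift_pure[OF assms(1-3) \<beta>] pure)
 then show ?case using l[OF pure] by simp
next
 case (add X Y)
 have "lmap R Q P (\<lambda>z. tlift P (\<beta> z) (X \<oplus>\<^bsub>tensor R M N\<^esub> Y)) \<longleftrightarrow> lmap R Q P (\<lambda>z. tlift P (\<beta> z) X \<oplus>\<^sub>P tlift P (\<beta> z) Y)"
  by (rule lin_cong[OF assms(4)]) (simp add: lin_add[OF lin_tlift[OF assms(1-3) \<beta>]] add)
 then show ?case using lin_sum[OF assms(3) add(3,4)] by simp
qed

lemma tmap_eq:
 "X <: tensor R M N ==> tmap R M N M' N' f g X
   = tlift (tensor R M' N') (\<lambda>x y. tens R M' N' (f x) (g y)) X"
 unfolding tensor_map_def by (simp add: add_monoid_tensor)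

lemma
 assumes "module R M" "module R N" "module R M'" "module R N'" "lmap R M M' f" "lmap R N N' g"
 shows lin_tensor_map: "lmap R (tensor R M N) (tensor R M' N') (tmap R M N M' N' f g)"
  and tmap_pure: "x <: M ==> y <: N
   ==> tmap R M N M' N' f g (tens R M N x y) = tens R M' N' (f x) (g y)"
proof -
 have b: "bilin R M N (tensor R M' N') (\<lambda>x y. tens R M' N' (f x) (g y))"
  by (rule bilin_comp[OF bilin_pure_tensor]) (use assms in auto)
 note m = assms(1,2) module_tensor[OF assms(3,4)]
 have "lmap R (tensor R M N) (tensor R M' N') (tmap R M N M' N' f g)
   \<longleftrightarrow> lmap R (tensor R M N) (tensor R M' N') (tlift (tensor R M' N') (\<lambda>x y. tens R M' N' (f x) (g y)))"
  by (rule lin_cong[OF module_tensor[OF assms(1,2)]]) (rule tmap_eq)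
 then show "lmap R (tensor R M N) (tensor R M' N') (tmap R M N M' N' f g)"
  using lin_tlift[OF m b] by simp
 show "tmap R M N M' N' f g (tens R M N x y) = tens R M' N' (f x) (g y)"
  if "x <: M" "y <: N"
  using tmap_eq[OF tens_closed[OF assms(1,2) that]] tlift_pure[OF m b that] by metis
qed

lemma tensor_mult_eq:
 "X \<otimes>\<^bsub>tensor R M N\<^esub> Y = tlift (tensor R M N) (\<lambda>x y. tlift (tensor R M N)
   (\<lambda>x' y'. tens R M N (x \<otimes>\<^sub>M x') (y \<otimes>\<^sub>N y')) Y) X"
 unfolding add_monoid_tensor by (simp add: tensor_def)

lemma tensor_one: "\<one>\<^bsub>tensor R M N\<^esub> = tens R M N \<one>\<^sub>M \<one>\<^sub>N"
 by (simp add: tensor_def)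

text \<open>Only bilinearity of the two products is assumed, no associativity or unit, so that the
  lemma also applies to a multiplication on \<open>A\<close> that has yet to be shown to be a ring
  structure.\<close>

lemma
 assumes "module R M" "module R N"
  and bM: "bilin R M M M (\<lambda>x y. x \<otimes>\<^sub>M y)" and bN: "bilin R N N N (\<lambda>x y. x \<otimes>\<^sub>N y)"
 shows bilin_tensor_mult: "bilin R (tensor R M N) (tensor R M N) (tensor R M N) (\<lambda>X Y. X \<otimes>\<^bsub>tensor R M N\<^esub> Y)"
  and tensor_mult_pure: "x <: M ==> y <: N ==> x' <: M ==> y' <: N
   ==> tens R M N x y \<otimes>\<^bsub>tensor R M N\<^esub> tens R M N x' y'
    = tens R M N (x \<otimes>\<^sub>M x') (y \<otimes>\<^sub>N y')"
proof -
 let ?T = "tensor R M N"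
 let ?b = "\<lambda>x y x' y'. tens R M N (x \<otimes>\<^sub>M x') (y \<otimes>\<^sub>N y')"
 have mT: "module R ?T" by (rule module_tensor[OF assms(1,2)])
 note m = assms(1,2) mT
 have b1: "bilin R M N ?T (?b x y)" if "x <: M" "y <: N" for x y
  by (rule bilin_comp[OF bilin_pure_tensor[OF assms(1,2)]])
   (use bilin_right[OF bM that(1)] bilin_right[OF bN that(2)] in auto)
 have b2: "bilin R M N ?T (\<lambda>x y. ?b x y x' y')" if "x' <: M" "y' <: N" for x' y'
  by (rule bilin_comp[OF bilin_pure_tensor[OF assms(1,2)]])
   (use bilin_left[OF bM that(1)] bilin_left[OF bN that(2)] in auto)
 \<comment> \<open>The inner lift over \<open>Y\<close> has to be bilinear in the outer variables
   \<open>x\<close>, \<open>y\<close> before the outer lift makes sense.\<close>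
 have b3: "bilin R M N ?T (\<lambda>x y. tlift ?T (?b x y) Y)" if Y: "Y <: ?T" for Y
 proof (rule bilinI)
  show "lmap R N ?T (\<lambda>y. tlift ?T (?b x y) Y)" if "x <: M" for x
   by (rule lin_tlift_param[OF m assms(2) _ _ Y]) (use that b1 bilin_right[OF b2] in auto)
  show "lmap R M ?T (\<lambda>x. tlift ?T (?b x y) Y)" if "y <: N" for y
   by (rule lin_tlift_param[OF m assms(1) _ _ Y]) (use that b1 bilin_left[OF b2] in auto)
 qed
 show "bilin R ?T ?T ?T (\<lambda>X Y. X \<otimes>\<^bsub>?T\<^esub> Y)"
  unfolding tensor_mult_eq
 proof (rule bilinI)
  show "lmap R ?T ?T (\<lambda>Y. tlift ?T (\<lambda>x y. tlift ?T (?b x y) Y) X)" if "X <: ?T" for X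
   by (rule lin_tlift_param[OF m mT _ _ that]) (auto intro: b3 lin_tlift[OF m b1])
  show "lmap R ?T ?T (\<lambda>X. tlift ?T (\<lambda>x y. tlift ?T (?b x y) Y) X)" if "Y <: ?T" for Y
   by (rule lin_tlift[OF m b3[OF that]])
 qed
 show "tens R M N x y \<otimes>\<^bsub>tensor R M N\<^esub> tens R M N x' y' = tens R M N (x \<otimes>\<^sub>M x') (y \<otimes>\<^sub>N y')"
  if a: "x <: M" "y <: N" "x' <: M" "y' <: N" for x y x' y'
  unfolding tensor_mult_eq
  by (simp add: tlift_pure[OF m b3] tlift_pure[OF m b1] a tens_closed[OF assms(1,2)])
qed

section \<open>Equivalences from fully faithful, essentially surjective functors\<close>

text \<open>The quasi-inverse is obtained by choice: an object \<open>G0 Y\<close> with an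
  isomorphism \<open>e Y\<close> from its image to \<open>Y\<close>, and on morphisms the unique
  preimage under \<open>F\<close> of the conjugate by these isomorphisms.\<close>

lemma equivalent_categoriesI:
 assumes C: "is_category C" and D: "is_category D" and F: "is_functor C D F"
  and ff: "\<And>X Y. X \<in> Ob C ==> Y \<in> Ob C
   ==> bij_betw (on_mor F X Y) (Mor C X Y) (Mor D (on_ob F X) (on_ob F Y))"
  and es: "\<And>Y. Y \<in> Ob D ==> \<exists>X\<in>Ob C. \<exists>f. is_iso D (on_ob F X) Y f"
 shows "equivalent_categories C D"
proof -
 have Cc: "Cmp C X Y Z g f \<in> Mor C X Z"
  if "X \<in> Ob C" "Y \<in> Ob C" "Z \<in> Ob C" "f \<in> Mor C X Y" "g \<in> Mor C Y Z" for X Y Z f g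
  using C that unfolding is_category_def by blast
 have Dc: "Cmp D X Y Z g f \<in> Mor D X Z"
  if "X \<in> Ob D" "Y \<in> Ob D" "Z \<in> Ob D" "f \<in> Mor D X Y" "g \<in> Mor D Y Z" for X Y Z f g
  using D that unfolding is_category_def by blast
 have Ci: "Ident C X \<in> Mor C X X" if "X \<in> Ob C" for X
  using C that unfolding is_category_def by blast
 have Di: "Ident D X \<in> Mor D X X" if "X \<in> Ob D" for X
  using D that unfolding is_category_def by blast
 have Dr: "Cmp D X X Y f (Ident D X) = f" if "X \<in> Ob D" "Y \<in> Ob D" "f \<in> Mor D X Y" for X Y f
  using D that unfolding is_category_def by blast
 have Dl: "Cmp D X Y Y (Ident D Y) f = f" if "X \<in> Ob D" "Y \<in> Ob D" "f \<in> Mor D X Y" for X Y f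
  using D that unfolding is_category_def by blast
 have Da: "Cmp D W Y Z h (Cmp D W X Y g f) = Cmp D W X Z (Cmp D X Y Z h g) f"
  if "W \<in> Ob D" "X \<in> Ob D" "Y \<in> Ob D" "Z \<in> Ob D" "f \<in> Mor D W X" "g \<in> Mor D X Y" "h \<in> Mor D Y Z"
  for W X Y Z f g h
  using D that unfolding is_category_def by blast
 have Fo: "on_ob F X \<in> Ob D" if "X \<in> Ob C" for X
  using F that unfolding is_functor_def by blast
 have Fm: "on_mor F X Y f \<in> Mor D (on_ob F X) (on_ob F Y)"
  if "X \<in> Ob C" "Y \<in> Ob C" "f \<in> Mor C X Y" for X Y f
  using F that unfolding is_functor_def by blast
 have Fi: "on_mor F X X (Ident C X) = Ident D (on_ob F X)" if "X \<in> Ob C" for X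
  using F that unfolding is_functor_def by blast
 have Fc: "on_mor F X Z (Cmp C X Y Z g f) =
   Cmp D (on_ob F X) (on_ob F Y) (on_ob F Z) (on_mor F Y Z g) (on_mor F X Y f)"
  if "X \<in> Ob C" "Y \<in> Ob C" "Z \<in> Ob C" "f \<in> Mor C X Y" "g \<in> Mor C Y Z" for X Y Z f g
  using F that unfolding is_functor_def by blast
 have inj: "f = f'"
  if "X \<in> Ob C" "Y \<in> Ob C" "f \<in> Mor C X Y" "f' \<in> Mor C X Y" "on_mor F X Y f = on_mor F X Y f'" for X Y f f'
  using ff[OF that(1,2)] that(3-5) unfolding bij_betw_def inj_on_def by blast
 obtain G0 where G0: "\<And>Y. Y \<in> Ob D ==> G0 Y \<in> Ob C \<and> (\<exists>f. is_iso D (on_ob F (G0 Y)) Y f)"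
  using es by metis
 then obtain e where e: "\<And>Y. Y \<in> Ob D ==> is_iso D (on_ob F (G0 Y)) Y (e Y)" by metis
 then obtain e' where e': "\<And>Y. Y \<in> Ob D ==> e' Y \<in> Mor D Y (on_ob F (G0 Y))
   \<and> Cmp D (on_ob F (G0 Y)) Y (on_ob F (G0 Y)) (e' Y) (e Y) = Ident D (on_ob F (G0 Y))
   \<and> Cmp D Y (on_ob F (G0 Y)) Y (e Y) (e' Y) = Ident D Y"
  unfolding is_iso_def by metis
 have em: "e Y \<in> Mor D (on_ob F (G0 Y)) Y" if "Y \<in> Ob D" for Y
  using e[OF that] unfolding is_iso_def by blast
 define P where "P X Y g = inv_into (Mor C X Y) (on_mor F X Y) g" for X Y g
 have Pm: "P X Y g \<in> Mor C X Y" and FP: "on_mor F X Y (P X Y g) = g"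
  if "X \<in> Ob C" "Y \<in> Ob C" "g \<in> Mor D (on_ob F X) (on_ob F Y)" for X Y g
  using ff[OF that(1,2)] that(3) unfolding P_def bij_betw_def
  by (auto intro: inv_into_into f_inv_into_f)
 \<comment> \<open>The conjugate of \<open>g\<close> by the chosen isomorphisms, that is, the
   morphism that \<open>F\<close> has to assign to \<open>G g\<close>.\<close>
 define W where "W Y Z g = Cmp D (on_ob F (G0 Y)) Z (on_ob F (G0 Z)) (e' Z)
   (Cmp D (on_ob F (G0 Y)) Y Z g (e Y))" for Y Z g
 have Wm: "W Y Z g \<in> Mor D (on_ob F (G0 Y)) (on_ob F (G0 Z))"
  if "Y \<in> Ob D" "Z \<in> Ob D" "g \<in> Mor D Y Z" for Y Z g
  unfolding W_def using that Dc Fo G0 em e' by meson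
 define G where "G = \<lparr>on_ob = G0, on_mor = (\<lambda>Y Z g. P (G0 Y) (G0 Z) (W Y Z g))\<rparr>"
 have FG: "on_mor F (G0 Y) (G0 Z) (on_mor G Y Z g) = W Y Z g" and Gm: "on_mor G Y Z g \<in> Mor C (G0 Y) (G0 Z)"
  if "Y \<in> Ob D" "Z \<in> Ob D" "g \<in> Mor D Y Z" for Y Z g
  unfolding G_def using FP Pm G0 Wm that by auto
 \<comment> \<open>This is naturality of \<open>e\<close>; functoriality of \<open>G\<close> and
   both natural isomorphisms are consequences of it.\<close>
 have eW: "Cmp D (on_ob F (G0 Y)) (on_ob F (G0 Z)) Z (e Z) (W Y Z g) = Cmp D (on_ob F (G0 Y)) Y Z g (e Y)"
  if a: "Y \<in> Ob D" "Z \<in> Ob D" "g \<in> Mor D Y Z" for Y Z g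
 proof -
  have "Cmp D (on_ob F (G0 Y)) (on_ob F (G0 Z)) Z (e Z) (W Y Z g)
   = Cmp D (on_ob F (G0 Y)) Z Z (Cmp D Z (on_ob F (G0 Z)) Z (e Z) (e' Z)) (Cmp D (on_ob F (G0 Y)) Y Z g (e Y))"
   unfolding W_def by (rule Da) (use a Fo G0 em e' Dc in auto)
  also have "\<dots> = Cmp D (on_ob F (G0 Y)) Y Z g (e Y)"
   using e'[OF a(2)] Dl[of "on_ob F (G0 Y)" Z] a Fo G0 em Dc by simp
  finally show ?thesis .
 qed
 have Gfun: "is_functor D C G"
  unfolding is_functor_def
 proof (intro conjI ballI)
  fix Y assume Y: "Y \<in> Ob D"
  show GY: "on_ob G Y \<in> Ob C" using G0[OF Y] by (simp add: G_def)
  have "W Y Y (Ident D Y) = Ident D (on_ob F (G0 Y))"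
   unfolding W_def using Dl[OF _ Y em[OF Y]] e'[OF Y] Fo G0[OF Y] by simp
  then have "on_mor F (G0 Y) (G0 Y) (on_mor G Y Y (Ident D Y)) = on_mor F (G0 Y) (G0 Y) (Ident C (G0 Y))"
   using FG[OF Y Y Di[OF Y]] Fi G0[OF Y] by simp
  then show "on_mor G Y Y (Ident D Y) = Ident C (on_ob G Y)"
   using inj[of "G0 Y" "G0 Y"] Gm[OF Y Y Di[OF Y]] Ci G0[OF Y] by (simp add: G_def)
 next
  fix Y Z g assume a: "Y \<in> Ob D" "Z \<in> Ob D" "g \<in> Mor D Y Z"
  show "on_mor G Y Z g \<in> Mor C (on_ob G Y) (on_ob G Z)"
   using Gm[OF a] by (simp add: G_def)
 next
  fix X Y Z f g assume a: "X \<in> Ob D" "Y \<in> Ob D" "Z \<in> Ob D" "f \<in> Mor D X Y" "g \<in> Mor D Y Z"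
  have o: "G0 X \<in> Ob C" "G0 Y \<in> Ob C" "G0 Z \<in> Ob C" using G0 a by auto
  note o' = Fo[OF o(1)] Fo[OF o(2)] Fo[OF o(3)]
  have "Cmp D (on_ob F (G0 X)) (on_ob F (G0 Y)) (on_ob F (G0 Z)) (W Y Z g) (W X Y f)
    = Cmp D (on_ob F (G0 X)) Z (on_ob F (G0 Z)) (e' Z)
      (Cmp D (on_ob F (G0 X)) (on_ob F (G0 Y)) Z (Cmp D (on_ob F (G0 Y)) Y Z g (e Y)) (W X Y f))"
   unfolding W_def[of Y Z]
   by (rule Da[symmetric]) (use a o' em e' Dc Wm in auto)
  also have "Cmp D (on_ob F (G0 X)) (on_ob F (G0 Y)) Z (Cmp D (on_ob F (G0 Y)) Y Z g (e Y)) (W X Y f)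
    = Cmp D (on_ob F (G0 X)) Y Z g (Cmp D (on_ob F (G0 X)) (on_ob F (G0 Y)) Y (e Y) (W X Y f))"
   by (rule Da[symmetric]) (use a o' em e' Dc Wm in auto)
  also have "\<dots> = Cmp D (on_ob F (G0 X)) Y Z g (Cmp D (on_ob F (G0 X)) X Y f (e X))"
   using eW a by simp
  also have "\<dots> = Cmp D (on_ob F (G0 X)) X Z (Cmp D X Y Z g f) (e X)"
   by (rule Da) (use a o' em e' Dc Wm in auto)
  finally have *: "Cmp D (on_ob F (G0 X)) (on_ob F (G0 Y)) (on_ob F (G0 Z)) (W Y Z g) (W X Y f)
    = W X Z (Cmp D X Y Z g f)"
   unfolding W_def[of X Z] .
  show "on_mor G X Z (Cmp D X Y Z g f) =
    Cmp C (on_ob G X) (on_ob G Y) (on_ob G Z) (on_mor G Y Z g) (on_mor G X Y f)"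
  proof -
   have "on_mor F (G0 X) (G0 Z) (on_mor G X Z (Cmp D X Y Z g f))
    = on_mor F (G0 X) (G0 Z) (Cmp C (G0 X) (G0 Y) (G0 Z) (on_mor G Y Z g) (on_mor G X Y f))"
    using FG[OF a(1,3) Dc[OF a]] Fc[OF o Gm[OF a(1,2,4)] Gm[OF a(2,3,5)]] FG[OF a(1,2,4)] FG[OF a(2,3,5)] *
    by simp
   then have "on_mor G X Z (Cmp D X Y Z g f) = Cmp C (G0 X) (G0 Y) (G0 Z) (on_mor G Y Z g) (on_mor G X Y f)"
    by (rule inj[OF o(1,3) Gm[OF a(1,3) Dc[OF a]] Cc[OF o Gm[OF a(1,2,4)] Gm[OF a(2,3,5)]]])
   then show ?thesis by (simp add: G_def)
  qed
 qed
 have n1: "naturally_isomorphic D D (comp_functor F G) id_functor"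
  unfolding naturally_isomorphic_def
 proof (intro bexI[where x = "restrict e (Ob D)"] ballI)
  fix Y assume Y: "Y \<in> Ob D"
  show "is_iso D (on_ob (comp_functor F G) Y) (on_ob id_functor Y) (restrict e (Ob D) Y)"
   using e[OF Y] Y by (simp add: comp_functor_def id_functor_def G_def)
 next
  show "restrict e (Ob D) \<in> nat_trans D D (comp_functor F G) id_functor"
   unfolding nat_trans_def
  proof (intro CollectI conjI ballI)
   fix Y Z g assume a: "Y \<in> Ob D" "Z \<in> Ob D" "g \<in> Mor D Y Z"
   show "Cmp D (on_ob (comp_functor F G) Y) (on_ob (comp_functor F G) Z) (on_ob id_functor Z)
       (restrict e (Ob D) Z) (on_mor (comp_functor F G) Y Z g) =
      Cmp D (on_ob (comp_functor F G) Y) (on_ob id_functor Y) (on_ob id_functor Z)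
       (on_mor id_functor Y Z g) (restrict e (Ob D) Y)"
    using eW[OF a] FG[OF a] a by (simp add: comp_functor_def id_functor_def G_def)
  qed (use em in \<open>auto simp: comp_functor_def id_functor_def G_def\<close>)
 qed
 \<comment> \<open>The other natural isomorphism is the lift along the full and faithful
   \<open>F\<close> of \<open>e\<close> at \<open>F X\<close>; faithfulness reflects all equations
   it must satisfy.\<close>
 define t where "t X = P (G0 (on_ob F X)) X (e (on_ob F X))" for X
 define t' where "t' X = P X (G0 (on_ob F X)) (e' (on_ob F X))" for X
 have t: "t X \<in> Mor C (G0 (on_ob F X)) X" "on_mor F (G0 (on_ob F X)) X (t X) = e (on_ob F X)"
  "t' X \<in> Mor C X (G0 (on_ob F X))" "on_mor F X (G0 (on_ob F X)) (t' X) = e' (on_ob F X)"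
  "G0 (on_ob F X) \<in> Ob C"
  if X: "X \<in> Ob C" for X
  unfolding t_def t'_def using Pm FP em[OF Fo[OF X]] e'[OF Fo[OF X]] G0[OF Fo[OF X]] X by auto
 have n2: "naturally_isomorphic C C (comp_functor G F) id_functor"
  unfolding naturally_isomorphic_def
 proof (intro bexI[where x = "restrict t (Ob C)"] ballI)
  fix X assume X: "X \<in> Ob C"
  let ?Y = "G0 (on_ob F X)"
  have "Cmp C ?Y X ?Y (t' X) (t X) = Ident C ?Y"
   by (rule inj[of ?Y ?Y]) (use t[OF X] X Cc Ci Fc Fi e'[OF Fo[OF X]] in auto)
  moreover have "Cmp C X ?Y X (t X) (t' X) = Ident C X"
   by (rule inj[of X X]) (use t[OF X] X Cc Ci Fc Fi e'[OF Fo[OF X]] in auto)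
  ultimately show "is_iso C (on_ob (comp_functor G F) X) (on_ob id_functor X) (restrict t (Ob C) X)"
   using t[OF X] X unfolding is_iso_def by (auto simp: comp_functor_def id_functor_def G_def)
 next
  show "restrict t (Ob C) \<in> nat_trans C C (comp_functor G F) id_functor"
   unfolding nat_trans_def
  proof (intro CollectI conjI ballI)
   fix X Y f assume a: "X \<in> Ob C" "Y \<in> Ob C" "f \<in> Mor C X Y"
   let ?X = "G0 (on_ob F X)" and ?Y = "G0 (on_ob F Y)"
   let ?Gf = "on_mor G (on_ob F X) (on_ob F Y) (on_mor F X Y f)"
   note Ff = Fo[OF a(1)] Fo[OF a(2)] Fm[OF a]
   have "Cmp C ?X ?Y Y (t Y) ?Gf = Cmp C ?X X Y f (t X)"
    by (rule inj[of ?X Y])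
     (use t[OF a(1)] t[OF a(2)] a Cc Fc eW[OF Ff] FG[OF Ff] Gm[OF Ff] in auto)
   then show "Cmp C (on_ob (comp_functor G F) X) (on_ob (comp_functor G F) Y) (on_ob id_functor Y)
       (restrict t (Ob C) Y) (on_mor (comp_functor G F) X Y f) =
      Cmp C (on_ob (comp_functor G F) X) (on_ob id_functor X) (on_ob id_functor Y)
       (on_mor id_functor X Y f) (restrict t (Ob C) X)"
    using a by (simp add: comp_functor_def id_functor_def G_def)
  qed (use t in \<open>auto simp: comp_functor_def id_functor_def G_def\<close>)
 qed
 show ?thesis
  unfolding equivalent_categories_def using C D F Gfun n1 n2 by blast
qed

section \<open>Transport of structure into the universe\<close>

lemma ex_inj_list:
 assumes "infinite (UNIV :: 'u set)"
 shows "\<exists>enc :: 'u list => 'u. inj enc"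
proof -
 have "|lists (UNIV :: 'u set)| =o |UNIV :: 'u set|"
  by (rule card_of_lists_infinite[OF assms])
 then have "|lists (UNIV :: 'u set)| \<le>o |UNIV :: 'u set|" by (rule ordIso_imp_ordLeq)
 then show ?thesis unfolding card_of_ordLeq[symmetric] by auto
qed

lemma ex_inj_on_range_list:
 fixes g :: "'u list => 'c"
 assumes "infinite (UNIV :: 'u set)" "X \<subseteq> range g"
 shows "\<exists>\<iota> :: 'c => 'u. inj_on \<iota> X"
proof -
 obtain enc :: "'u list => 'u" where enc: "inj enc" using ex_inj_list[OF assms(1)] by blast
 have "inj_on (inv_into UNIV g) X" using inj_on_inv_into[OF assms(2)] .
 then have "inj_on (enc \<circ> inv_into UNIV g) X"
  using enc by (simp add: comp_inj_on inj_on_subset)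
 then show ?thesis by blast
qed

text \<open>Anything described by finite lists of pairs from an infinite type can be coded in that
  type: pairs are lists of length two, and lists over an infinite set are as many as its
  elements.\<close>

lemma ex_inj_on_range_pairs:
 fixes g :: "('u \<times> 'u) list => 'c"
 assumes "infinite (UNIV :: 'u set)" "X \<subseteq> range g"
 shows "\<exists>\<iota> :: 'c => 'u. inj_on \<iota> X"
proof -
 obtain enc :: "'u list => 'u" where enc: "inj enc" using ex_inj_list[OF assms(1)] by blast
 define p where "p = (\<lambda>(x, y). enc [x, y])"
 have p: "inj p" using enc by (auto simp: p_def inj_on_def)
 have "g l = (g \<circ> map (inv_into UNIV p)) (map p l)" for l
  using p by (simp add: o_def)
 then have "range g \<subseteq> range (g \<circ> map (inv_into UNIV p))" by (metis image_subsetI rangeI)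
 with assms(2) have "X \<subseteq> range (g \<circ> map (inv_into UNIV p))" by (rule subset_trans)
 then show ?thesis by (rule ex_inj_on_range_list[OF assms(1)])
qed

text \<open>The image of a module or algebra under a map whose fibres are the classes of a congruence.\<close>

definition push :: "('b => 'u) => ('r, 'b, 'p) module_scheme => ('r, 'u) module" where
 "push \<pi> B =
   \<lparr>carrier = \<pi> ` carrier B,
   mult = (\<lambda>x y. \<pi> (inv_into (carrier B) \<pi> x \<otimes>\<^sub>B inv_into (carrier B) \<pi> y)),
   one = \<pi> \<one>\<^sub>B,
   zero = \<pi> \<zero>\<^sub>B,
   add = (\<lambda>x y. \<pi> (inv_into (carrier B) \<pi> x \<oplus>\<^sub>B inv_into (carrier B) \<pi> y)),
   smult = (\<lambda>r x. \<pi> (r \<odot>\<^sub>B inv_into (carrier B) \<pi> x))\<rparr>"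

lemma inv_into_push:
 assumes "x <: B"
 shows "inv_into (carrier B) \<pi> (\<pi> x) <: B" "\<pi> (inv_into (carrier B) \<pi> (\<pi> x)) = \<pi> x"
 using assms by (auto intro: inv_into_into f_inv_into_f)

text \<open>The two hypotheses say that the fibres of \<open>\<pi>\<close> form a congruence, which
  makes the preimages chosen in \<open>push\<close> harmless.\<close>

lemma module_push:
 assumes "module R B"
  and ca: "\<And>x x' y y'. x <: B ==> x' <: B ==> y <: B ==> y' <: B
   ==> \<pi> x = \<pi> x' ==> \<pi> y = \<pi> y' ==> \<pi> (x \<oplus>\<^sub>B y) = \<pi> (x' \<oplus>\<^sub>B y')"
  and cs: "\<And>r x x'. r <: R ==> x <: B ==> x' <: B ==> \<pi> x = \<pi> x'
   ==> \<pi> (r \<odot>\<^sub>B x) = \<pi> (r \<odot>\<^sub>B x')"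
 shows "module R (push \<pi> B)" and "lmap R B (push \<pi> B) \<pi>"
proof -
 interpret B: module R B by fact
 let ?C = "push \<pi> B"
 have car: "carrier ?C = \<pi> ` carrier B" by (simp add: push_def)
 have add: "\<pi> x \<oplus>\<^bsub>?C\<^esub> \<pi> y = \<pi> (x \<oplus>\<^sub>B y)" if "x <: B" "y <: B" for x y
  using ca[OF _ _ _ _ inv_into_push(2)[of x B \<pi>] inv_into_push(2)[of y B \<pi>]] that inv_into_push(1)[of _ B \<pi>]
  by (simp add: push_def)
 have sm: "r \<odot>\<^bsub>?C\<^esub> \<pi> x = \<pi> (r \<odot>\<^sub>B x)" if "r <: R" "x <: B" for r x
  using cs[OF _ _ _ inv_into_push(2)[of x B \<pi>]] that inv_into_push(1)[of _ B \<pi>]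
  by (simp add: push_def)
 have zero: "\<zero>\<^bsub>?C\<^esub> = \<pi> \<zero>\<^sub>B" by (simp add: push_def)
 have ab: "abelian_group ?C"
 proof (rule abelian_groupI)
  fix x assume "x <: ?C"
  then obtain b where "b <: B" "x = \<pi> b" unfolding car by auto
  then show "\<exists>y\<in>carrier ?C. y \<oplus>\<^bsub>?C\<^esub> x = \<zero>\<^bsub>?C\<^esub>"
   by (intro bexI[of _ "\<pi> (\<ominus>\<^sub>B b)"]) (simp_all add: car add zero B.l_neg)
 qed (auto simp: car add zero B.M.add.m_ac)
 show "module R ?C"
  by (rule moduleI[OF B.R.cring_axioms ab])
   (auto simp: car add sm B.smult_l_distr B.smult_r_distr B.smult_assoc1)
 show "lmap R B ?C \<pi>"
  by (rule lmapI) (auto simp: car add sm)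
qed

lemma algebra_push:
 assumes "algebra R B"
  and ca: "\<And>x x' y y'. x <: B ==> x' <: B ==> y <: B ==> y' <: B
   ==> \<pi> x = \<pi> x' ==> \<pi> y = \<pi> y' ==> \<pi> (x \<oplus>\<^sub>B y) = \<pi> (x' \<oplus>\<^sub>B y')"
  and cm: "\<And>x x' y y'. x <: B ==> x' <: B ==> y <: B ==> y' <: B
   ==> \<pi> x = \<pi> x' ==> \<pi> y = \<pi> y' ==> \<pi> (x \<otimes>\<^sub>B y) = \<pi> (x' \<otimes>\<^sub>B y')"
  and cs: "\<And>r x x'. r <: R ==> x <: B ==> x' <: B ==> \<pi> x = \<pi> x'
   ==> \<pi> (r \<odot>\<^sub>B x) = \<pi> (r \<odot>\<^sub>B x')"
 shows "algebra R (push \<pi> B)" and "lmap R B (push \<pi> B) \<pi>"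
  and "x <: B ==> y <: B ==> \<pi> (x \<otimes>\<^sub>B y) = \<pi> x \<otimes>\<^bsub>push \<pi> B\<^esub> \<pi> y"
  and "\<pi> \<one>\<^sub>B = \<one>\<^bsub>push \<pi> B\<^esub>" and "carrier (push \<pi> B) = \<pi> ` carrier B"
proof -
 interpret B: algebra R B by fact
 let ?C = "push \<pi> B"
 have mB: "module R B" by (rule B.module)
 interpret C: module R ?C by (rule module_push(1)[OF mB ca cs])
 show lin: "lmap R B (push \<pi> B) \<pi>" by (rule module_push(2)[OF mB ca cs])
 show car: "carrier ?C = \<pi> ` carrier B" by (simp add: push_def)
 have mul: "\<pi> x \<otimes>\<^bsub>?C\<^esub> \<pi> y = \<pi> (x \<otimes>\<^sub>B y)" if "x <: B" "y <: B" for x y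
  using cm[OF _ _ _ _ inv_into_push(2)[of x B \<pi>] inv_into_push(2)[of y B \<pi>]] that inv_into_push(1)[of _ B \<pi>]
  by (simp add: push_def)
 show one: "\<pi> \<one>\<^sub>B = \<one>\<^bsub>?C\<^esub>" by (simp add: push_def)
 note add = lin_add[OF lin, symmetric] and sm = lin_smult[OF lin, symmetric]
 have cr: "cring ?C"
 proof (rule cringI[OF C.abelian_group_axioms])
  show "Group.comm_monoid ?C"
   by (rule comm_monoidI) (auto simp: car mul one[symmetric] B.m_ac)
 qed (auto simp: car mul add B.l_distr)
 show "algebra R ?C"
  unfolding algebra_def algebra_axioms_def
  using C.module_axioms cr by (auto simp: car mul sm B.smult_assoc2)
 show "\<pi> (x \<otimes>\<^sub>B y) = \<pi> x \<otimes>\<^bsub>push \<pi> B\<^esub> \<pi> y" if "x <: B" "y <: B" for x y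
  using mul[OF that] by simp
qed

text \<open>A tensor is a finite sum of pure ones, hence described by a list of pairs. It follows
  that a tensor product of modules in \<open>'u\<close> has a copy in \<open>'u\<close>, which is
  how U \<otimes> U becomes an admissible test algebra.\<close>

lemma tensor_subset_range:
 assumes "module R M" "module R N"
 shows "carrier (tensor R M N) \<subseteq> range (\<lambda>l. foldr (\<lambda>(x, y) Z. tens R M N x y \<oplus>\<^bsub>tensor R M N\<^esub> Z) l \<zero>\<^bsub>tensor R M N\<^esub>)"
  (is "_ \<subseteq> range ?f")
proof
 interpret T: module R "tensor R M N" by (rule module_tensor[OF assms])
 let ?ok = "\<lambda>l. set l \<subseteq> carrier M \<times> carrier N"
 have cl: "?f l <: tensor R M N" if "?ok l" for l
  using that by (induction l) (auto intro: tens_closed[OF assms])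
 have app: "?f (l @ l') = ?f l \<oplus>\<^bsub>tensor R M N\<^esub> ?f l'" if "?ok l" "?ok l'" for l l'
  using that(1)
 proof (induction l)
  case Nil
  then show ?case using cl[OF that(2)] by simp
 next
  case (Cons a l)
  then show ?case
   using cl[of l] cl[OF that(2)] by (auto simp: T.M.add.m_assoc tens_closed[OF assms])
 qed
 fix X assume "X <: tensor R M N"
 with assms have "\<exists>l. ?ok l \<and> X = ?f l"
 proof (induction rule: tensor_induct)
  case (pure x y)
  then show ?case by (intro exI[of _ "[(x, y)]"]) (simp add: tens_closed[OF assms])
 next
  case (add X Y)
  then obtain l l' where "?ok l" "X = ?f l" "?ok l'" "Y = ?f l'" by auto
  then show ?case using app[of l l'] by (intro exI[of _ "l @ l'"]) auto
 qed
 then show "X \<in> range ?f" by auto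
qed

section \<open>Local dual bases\<close>

text \<open>The endomorphisms of the form \<Sum> \<xi>_j(-) e_j, that is, the image of A* \<otimes>
  A in End(A).\<close>

inductive finrank :: "('r, 'y) ring_scheme => ('r, 'a, 'p) module_scheme => ('a => 'a) => bool"
 for R A where
 rank1: "lmap R A (ring_as_module R) \<xi> ==> e <: A ==> finrank R A (\<lambda>p. \<xi> p \<odot>\<^sub>A e)"
| sum: "finrank R A d ==> finrank R A d' ==> finrank R A (\<lambda>p. d p \<oplus>\<^sub>A d' p)"

text \<open>A local form of the dual basis property. Unlike \<open>projective_module\<close> it
  quantifies over no other modules, so it involves no choice of a type for test objects.\<close>

definition loc_proj :: "('r, 'y) ring_scheme => ('r, 'a, 'p) module_scheme => bool" where
 "loc_proj R A \<longleftrightarrow> module R A \<and>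
   (\<forall>F. finite F \<and> F \<subseteq> carrier A --> (\<exists>d. finrank R A d \<and> (\<forall>p\<in>F. d p = p)))"

lemma finrank_linmap:
 assumes "module R A" "finrank R A d"
 shows "lmap R A A d"
 using assms(2) by induction (auto intro: lin_smult_right lin_sum assms(1))

text \<open>A section of the surjection from the free module on the elements of \<open>A\<close>
  gives coordinates of each element. Finitely many elements have finitely many nonzero coordinates
  together, and cutting the dual basis expansion to these gives a finite rank map.\<close>

lemma projective_imp_loc_proj:
 fixes R :: "('u, 'y) ring_scheme" and A :: "('u, 'u, 'p) module_scheme"
 assumes inf: "infinite (UNIV :: 'u set)" and pr: "projective_module R A"
 shows "loc_proj R A"
proof -
 have mA: "module R A" using pr by (simp add: projective_module_def)
 interpret A: module R A by (rule mA)
 define supp where "supp f = {a. f a \<noteq> \<zero>\<^sub>R}" for f :: "'u => 'u"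
 \<comment> \<open>The free module on the set \<open>carrier A\<close>, as finitely supported
   functions. Its elements are functions on \<open>'u\<close>, so it has to be copied into
   \<open>'u\<close> before projectivity can be applied.\<close>
 define L :: "('u, 'u => 'u) module" where "L = \<lparr>carrier = {f :: 'u => 'u. finite (supp f) \<and> supp f \<subseteq> carrier A \<and> range f \<subseteq> carrier R},
   mult = undefined, one = undefined, zero = (\<lambda>a. \<zero>\<^sub>R), add = (\<lambda>f g a. f a \<oplus>\<^sub>R g a),
   smult = (\<lambda>r f a. r \<otimes>\<^sub>R f a)\<rparr>"
 have supp_add: "supp (\<lambda>a. f a \<oplus>\<^sub>R g a) \<subseteq> supp f \<union> supp g" for f g
  by (auto simp: supp_def)
 have supp_sm: "supp (\<lambda>a. r \<otimes>\<^sub>R f a) \<subseteq> supp f" if "r <: R" for r f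
  using that by (auto simp: supp_def)
 have car: "f <: L \<longleftrightarrow> finite (supp f) \<and> supp f \<subseteq> carrier A \<and> (\<forall>a. f a <: R)" for f
  by (auto simp: L_def)
 have Lcl: "f \<oplus>\<^sub>L g <: L" if "f <: L" "g <: L" for f g
  using that supp_add[of f g] finite_subset[OF supp_add[of f g]] unfolding car
  by (auto simp: L_def)
 have Lsm: "r \<odot>\<^sub>L f <: L" if "f <: L" "r <: R" for r f
  using that supp_sm[of r f] finite_subset[OF supp_sm[of r f]] unfolding car
  by (auto simp: L_def)
 have zL: "\<zero>\<^sub>L <: L" unfolding car by (auto simp: L_def supp_def)
 have abL: "abelian_group L"
 proof (rule abelian_groupI[OF Lcl zL])
  fix f assume f: "f <: L"
  have "(\<lambda>a. \<ominus>\<^sub>R \<one>\<^sub>R \<otimes>\<^sub>R f a) <: L"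
   using Lsm[OF f, of "\<ominus>\<^sub>R \<one>\<^sub>R"] by (simp add: L_def)
  then show "\<exists>g\<in>carrier L. g \<oplus>\<^sub>L f = \<zero>\<^sub>L"
   by (rule bexI[rotated]) (use f in \<open>auto simp: L_def A.R.l_minus A.R.l_neg fun_eq_iff image_subset_iff\<close>)
 qed (auto simp: car, auto simp: L_def A.R.add.m_ac)
 have mL: "module R L"
  by (rule moduleI[OF A.R.cring_axioms abL Lsm])
   (auto simp: car, auto simp: L_def A.R.l_distr A.R.r_distr A.R.m_assoc)
 interpret L: module R L by (rule mL)
 define g where "g f = finsum A (\<lambda>a. f a \<odot>\<^sub>A a) (supp f)" for f
 have gsup: "g f = finsum A (\<lambda>a. f a \<odot>\<^sub>A a) S" if "f <: L" "finite S" "supp f \<subseteq> S" "S \<subseteq> carrier A" for f S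
  unfolding g_def
  by (rule A.M.add.finprod_mono_neutral_cong_left)
   (use that in \<open>auto simp: car supp_def\<close>)
 have glin: "lmap R L A g"
 proof (rule lmapI)
  fix f assume f: "f <: L"
  then show "g f <: A" unfolding g_def by (intro A.finsum_closed) (auto simp: car)
  fix r assume r: "r <: R"
  have "g (r \<odot>\<^sub>L f) = finsum A (\<lambda>a. (r \<odot>\<^sub>L f) a \<odot>\<^sub>A a) (supp f)"
   by (rule gsup) (use f r Lsm[OF f r] supp_sm[OF r, of f] in \<open>auto simp: car L_def\<close>)
  also have "\<dots> = finsum A (\<lambda>a. r \<odot>\<^sub>A (f a \<odot>\<^sub>A a)) (supp f)"
   by (rule A.M.finsum_cong') (use f r in \<open>auto simp: car L_def A.smult_assoc1 subset_iff\<close>)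
  also have "\<dots> = r \<odot>\<^sub>A g f"
   unfolding g_def by (rule A.finsum_smult_ldistr[symmetric]) (use f r in \<open>auto simp: car\<close>)
  finally show "g (r \<odot>\<^sub>L f) = r \<odot>\<^sub>A g f" .
 next
  fix f f' assume f: "f <: L" "f' <: L"
  let ?S = "supp f \<union> supp f'"
  have S: "finite ?S" "?S \<subseteq> carrier A" using f by (auto simp: car)
  have "g (f \<oplus>\<^sub>L f') = finsum A (\<lambda>a. (f \<oplus>\<^sub>L f') a \<odot>\<^sub>A a) ?S"
   by (rule gsup) (use f S Lcl[OF f] supp_add[of f f'] in \<open>auto simp: L_def\<close>)
  also have "\<dots> = finsum A (\<lambda>a. f a \<odot>\<^sub>A a \<oplus>\<^sub>A f' a \<odot>\<^sub>A a) ?S"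
   by (rule A.M.finsum_cong') (use f S in \<open>auto simp: car L_def A.smult_l_distr subset_iff\<close>)
  also have "\<dots> = g f \<oplus>\<^sub>A g f'"
   using gsup[OF f(1) S(1) _ S(2)] gsup[OF f(2) S(1) _ S(2)] f S
   by (subst A.M.finsum_addf) (auto simp: car)
  finally show "g (f \<oplus>\<^sub>L f') = g f \<oplus>\<^sub>A g f'" .
 qed
 have gsurj: "\<exists>f\<in>carrier L. g f = a" if a: "a <: A" for a
 proof
  let ?f = "\<lambda>b. if b = a then \<one>\<^sub>R else \<zero>\<^sub>R"
  have s: "supp ?f \<subseteq> {a}" by (auto simp: supp_def)
  show fc: "?f <: L" using s finite_subset[OF s] a by (auto simp: car)
  show "g ?f = a" using gsup[OF fc _ s] a by (simp add: A.M.add.finprod_singleton)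
 qed
 \<comment> \<open>A finitely supported function is recovered from an association list of its
   nonzero values, with zero as default.\<close>
 have "carrier L \<subseteq> range (\<lambda>l a. case map_of l a of None => \<zero>\<^sub>R | Some b => b)"
 proof
  fix f assume "f <: L"
  then have "finite (supp f)" by (simp add: car)
  then obtain ks where ks: "set ks = supp f" using finite_list by metis
  have "f = (\<lambda>a. case map_of (map (\<lambda>k. (k, f k)) ks) a of None => \<zero>\<^sub>R | Some b => b)"
   by (auto simp: map_of_map_restrict fun_eq_iff restrict_map_def ks) (auto simp: supp_def)
  then show "f \<in> range (\<lambda>l a. case map_of l a of None => \<zero>\<^sub>R | Some b => b)" by blast
 qed
 from ex_inj_on_range_pairs[OF inf this]
 obtain \<iota> :: "('u => 'u) => 'u" where \<iota>: "inj_on \<iota> (carrier L)" by blast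
 let ?P = "push \<iota> L"
 have P: "module R ?P" "lmap R L ?P \<iota>"
  by (rule module_push[OF mL]; use \<iota> in \<open>metis inj_onD\<close>)+
 interpret P: module R ?P by (rule P(1))
 define \<kappa> where "\<kappa> = inv_into (carrier L) \<iota>"
 have Pcar: "carrier ?P = \<iota> ` carrier L" by (simp add: push_def)
 have \<kappa>: "\<kappa> (\<iota> f) = f" if "f <: L" for f
  unfolding \<kappa>_def using \<iota> that by simp
 have \<kappa>lin: "lmap R ?P L \<kappa>"
  by (rule lmapI)
   (auto simp: Pcar \<kappa> lin_add[OF P(2), symmetric] lin_smult[OF P(2), symmetric])
 \<comment> \<open>\<open>A\<close> with its additional record fields removed, since the lifting
   property is tested on plain \<open>module\<close> records.\<close>
 let ?N = "\<lparr>carrier = carrier A, mult = mult A, one = one A, zero = zero A, add = add A, smult = smult A\<rparr>"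
 have mN: "module R ?N"
  by (rule moduleI[OF A.R.cring_axioms], rule abelian_groupI)
   (auto simp: A.M.add.m_ac A.smult_l_distr A.smult_r_distr A.smult_assoc1
    intro: bexI[of _ "\<ominus>\<^sub>A x" for x] A.l_neg)
 have g1: "lmap R ?P ?N (\<lambda>x. g (\<kappa> x))"
  using lin_comp[OF \<kappa>lin glin] unfolding lmap_def by simp
 let ?g = "\<lambda>x\<in>carrier ?P. g (\<kappa> x)"
 have "?g \<in> lin_hom R ?P ?N" by (rule restrict_lin_hom[OF P(1) g1])
 moreover have "?g ` carrier ?P = carrier ?N"
 proof
  show "?g ` carrier ?P \<subseteq> carrier ?N" using lin_closed[OF g1] by auto
  show "carrier ?N \<subseteq> ?g ` carrier ?P"
  proof
   fix a assume "a <: ?N"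
   then obtain f where "f <: L" "g f = a" using gsurj by auto
   then show "a \<in> ?g ` carrier ?P" by (intro image_eqI[of _ _ "\<iota> f"]) (auto simp: \<kappa> Pcar)
  qed
 qed
 moreover have "(\<lambda>x\<in>carrier A. x) \<in> lin_hom R A ?N"
  by (rule restrict_lin_hom[OF mA]) (simp add: lmap_def)
 ultimately obtain h where h: "h \<in> lin_hom R A ?P" "compose (carrier A) ?g h = (\<lambda>x\<in>carrier A. x)"
  using pr P(1) mN unfolding projective_module_def by blast
 have hl: "lmap R A ?P h" using h(1) by (simp add: lin_hom_iff)
 \<comment> \<open>The coordinates of \<open>p\<close>: the section followed by decoding. By
   construction \<open>p\<close> is the sum of the elements \<open>a\<close> with coefficients
   \<open>k p a\<close>.\<close>
 define k where "k p = \<kappa> (h p)" for p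
 have kl: "lmap R A L k" unfolding k_def by (rule lin_comp[OF hl \<kappa>lin])
 have gk: "g (k p) = p" if "p <: A" for p
  using fun_cong[OF h(2), of p] that lin_closed[OF hl that] by (simp add: compose_def k_def)
 have \<xi>: "lmap R A (ring_as_module R) (\<lambda>p. k p a)" for a
  using kl unfolding lmap_def ring_as_module_def by (auto simp: car, auto simp: L_def)
 have fr: "\<exists>d. finrank R A d \<and> (\<forall>p\<in>carrier A. d p = finsum A (\<lambda>a. k p a \<odot>\<^sub>A a) E)"
  if "finite E" "E \<subseteq> carrier A" for E
  using that
 proof (induction E)
  case empty
  \<comment> \<open>There is no clause for the zero map, but it has rank one form with vector zero;
    \<open>undefined\<close> merely names some coordinate.\<close>
  have "finrank R A (\<lambda>p. k p undefined \<odot>\<^sub>A \<zero>\<^sub>A)" by (rule rank1[OF \<xi>]) simp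
  then show ?case
   using lin_closed[OF kl] by (intro exI conjI) (assumption, auto simp: car A.smult_r_null)
 next
  case (insert b E)
  then obtain d where d: "finrank R A d" "\<forall>p\<in>carrier A. d p = finsum A (\<lambda>a. k p a \<odot>\<^sub>A a) E" by auto
  have "finrank R A (\<lambda>p. k p b \<odot>\<^sub>A b \<oplus>\<^sub>A d p)"
   by (intro finrank.sum rank1 \<xi> d) (use insert in auto)
  moreover have "k p b \<odot>\<^sub>A b \<oplus>\<^sub>A d p = finsum A (\<lambda>a. k p a \<odot>\<^sub>A a) (insert b E)" if "p <: A" for p
   using insert lin_closed[OF kl that] d(2) that
   by (subst A.M.finsum_insert) (auto simp: car)
  ultimately show ?case by blast
 qed
 show ?thesis
  unfolding loc_proj_def
 proof (intro conjI mA allI impI)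
  fix F assume F: "finite F \<and> F \<subseteq> carrier A"
  \<comment> \<open>All basis elements that occur in the expansion of some element of
    \<open>F\<close>.\<close>
  let ?E = "\<Union>p\<in>F. supp (k p)"
  have E: "finite ?E" "?E \<subseteq> carrier A"
   using F lin_closed[OF kl] by (auto simp: car subset_iff)
  obtain d where d: "finrank R A d" "\<forall>p\<in>carrier A. d p = finsum A (\<lambda>a. k p a \<odot>\<^sub>A a) ?E"
   using fr[OF E] by blast
  have "d p = p" if "p \<in> F" for p
  proof -
   have p: "p <: A" using that F by auto
   have "g (k p) = finsum A (\<lambda>a. k p a \<odot>\<^sub>A a) ?E"
    by (rule gsup[OF lin_closed[OF kl p] E(1) _ E(2)]) (use that in auto)
   then show ?thesis using d(2) gk[OF p] p by simp
  qed
  then show "\<exists>d. finrank R A d \<and> (\<forall>p\<in>F. d p = p)" using d(1) by blast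
 qed
qed

section \<open>Tensors with prescribed second legs, and contraction by functionals\<close>

inductive_set tspan :: "('r, 'y) ring_scheme => ('r, 'a, 'p) module_scheme => ('r, 'b, 'q) module_scheme
  => 'b set => ('a, 'b) tensor_elt set" for R N P F where
 pure: "n <: N ==> p \<in> F ==> tens R N P n p \<in> tspan R N P F"
| add: "X \<in> tspan R N P F ==> Y \<in> tspan R N P F ==> X \<oplus>\<^bsub>tensor R N P\<^esub> Y \<in> tspan R N P F"

lemma tspan_closed:
 assumes "module R N" "module R P" "F \<subseteq> carrier P" "X \<in> tspan R N P F"
 shows "X <: tensor R N P"
proof -
 interpret T: module R "tensor R N P" by (rule module_tensor[OF assms(1,2)])
 show ?thesis using assms(4)
  by induction (use assms(3) in \<open>auto intro: tens_closed[OF assms(1,2)]\<close>)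
qed

lemma tspan_mono:
 assumes "X \<in> tspan R N P F" "F \<subseteq> G"
 shows "X \<in> tspan R N P G"
 using assms(1) by induction (use assms(2) in \<open>auto intro: tspan.intros\<close>)

lemma ex_tspan:
 assumes "module R N" "module R P" "X <: tensor R N P"
 shows "\<exists>F. finite F \<and> F \<subseteq> carrier P \<and> X \<in> tspan R N P F"
 using assms
proof (induction rule: tensor_induct)
 case (pure x y)
 then show ?case by (intro exI[of _ "{y}"]) (auto intro: tspan.intros)
next
 case (add X Y)
 then obtain F G where FG: "finite F" "F \<subseteq> carrier P" "X \<in> tspan R N P F"
  "finite G" "G \<subseteq> carrier P" "Y \<in> tspan R N P G" by auto
 have "X \<in> tspan R N P (F \<union> G)" "Y \<in> tspan R N P (F \<union> G)"
  using tspan_mono[OF FG(3)] tspan_mono[OF FG(6)] by auto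
 then show ?case using FG by (intro exI[of _ "F \<union> G"]) (auto intro: tspan.intros)
qed

lemma tspan_ext:
 assumes "module R N" "module R P" "F \<subseteq> carrier P" "X \<in> tspan R N P F"
  and "lmap R (tensor R N P) Q f" "lmap R (tensor R N P) Q g"
  and "\<And>n p. n <: N ==> p \<in> F ==> f (tens R N P n p) = g (tens R N P n p)"
 shows "f X = g X"
 using assms(4)
 by induction (simp_all add: assms(7) lin_add[OF assms(5)] lin_add[OF assms(6)] tspan_closed[OF assms(1-3)])

text \<open>An endomorphism fixing the second legs fixes the tensor. This turns local projectivity
  of \<open>P\<close> into information about elements of N \<otimes> P.\<close>

lemma tspan_finrank:
 assumes "module R N" "module R P" "F \<subseteq> carrier P" "X \<in> tspan R N P F" "lmap R P P d" "\<And>p. p \<in> F ==> d p = p"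
 shows "rmap R N P P d X = X"
 by (rule tspan_ext[OF assms(1-4) lin_tensor_map lin_id])
  (use assms in \<open>auto simp: tmap_pure lin_id subset_iff\<close>)

text \<open>The map id \<otimes> \<xi> from N \<otimes> P to N, with N \<otimes> R identified with
  N.\<close>

definition contract :: "('r, 'a, 'p) module_scheme => ('b => 'r) => ('a, 'b) tensor_elt => 'a" where
 "contract N \<xi> = tlift N (\<lambda>n p. \<xi> p \<odot>\<^sub>N n)"

lemma bilin_contract:
 assumes "module R N" "module R P" "lmap R P (ring_as_module R) \<xi>"
 shows "bilin R N P N (\<lambda>n p. \<xi> p \<odot>\<^sub>N n)"
 by (rule bilin_flip, rule bilin_comp[OF bilin_smult assms(3) lin_id]) fact

lemma
 assumes "module R N" "module R P" "lmap R P (ring_as_module R) \<xi>"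
 shows lin_contract: "lmap R (tensor R N P) N (contract N \<xi>)"
  and contract_pure: "n <: N ==> p <: P ==> contract N \<xi> (tens R N P n p) = \<xi> p \<odot>\<^sub>N n"
 unfolding contract_def using lin_tlift[OF assms(1,2,1) bilin_contract[OF assms]]
  tlift_pure[OF assms(1,2,1) bilin_contract[OF assms]] by auto

lemma tmap_rank1:
 assumes "module R N" "module R P" "lmap R P (ring_as_module R) \<xi>" "e <: P" "X <: tensor R N P"
 shows "rmap R N P P (\<lambda>p. \<xi> p \<odot>\<^sub>P e) X = tens R N P (contract N \<xi> X) e"
proof (rule tmap_ext[OF assms(1,2) _ _ _ assms(5)])
 note l = lin_smult_right[OF assms(2,3,4)]
 interpret N: module R N by fact
 interpret P: module R P by fact
 show "lmap R (tensor R N P) (tensor R N P) (rmap R N P P (\<lambda>p. \<xi> p \<odot>\<^sub>P e))"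
  by (rule lin_tensor_map) (use assms l lin_id in auto)
 show "lmap R (tensor R N P) (tensor R N P) (\<lambda>X. tens R N P (contract N \<xi> X) e)"
  by (rule lin_comp[OF lin_contract bilin_left[OF bilin_pure_tensor]]) (use assms in auto)
 fix n p assume a: "n <: N" "p <: P"
 have r: "\<xi> p <: R" using lin_closed[OF assms(3) a(2)] by (simp add: ring_as_module_def)
 have "tens R N P n (\<xi> p \<odot>\<^sub>P e) = tens R N P (\<xi> p \<odot>\<^sub>N n) e"
  using tens_group(4)[OF assms(1,2) r a(1) assms(4)] by simp
 then show "rmap R N P P (\<lambda>p. \<xi> p \<odot>\<^sub>P e) (tens R N P n p)
   = tens R N P (contract N \<xi> (tens R N P n p)) e"
  by (subst tmap_pure) (use assms l a lin_id in \<open>auto simp: contract_pure\<close>)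
qed

lemma tmap_sum:
 assumes "module R N" "module R P" "lmap R P P d" "lmap R P P d'" "X <: tensor R N P"
 shows "rmap R N P P (\<lambda>p. d p \<oplus>\<^sub>P d' p) X
   = rmap R N P P d X \<oplus>\<^bsub>tensor R N P\<^esub> rmap R N P P d' X"
proof (rule tmap_ext[OF assms(1,2) _ _ _ assms(5)])
 note l = lin_sum[OF assms(2-4)]
 show "lmap R (tensor R N P) (tensor R N P) (rmap R N P P (\<lambda>p. d p \<oplus>\<^sub>P d' p))"
  by (rule lin_tensor_map) (use assms l lin_id in auto)
 show "lmap R (tensor R N P) (tensor R N P)
   (\<lambda>X. rmap R N P P d X \<oplus>\<^bsub>tensor R N P\<^esub> rmap R N P P d' X)"
  by (intro lin_sum lin_tensor_map module_tensor lin_id assms)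
 show "rmap R N P P (\<lambda>p. d p \<oplus>\<^sub>P d' p) (tens R N P n p)
  = rmap R N P P d (tens R N P n p) \<oplus>\<^bsub>tensor R N P\<^esub> rmap R N P P d' (tens R N P n p)"
  if "n <: N" "p <: P" for n p
  using that lin_closed[OF assms(3)] lin_closed[OF assms(4)]
  by (simp add: tmap_pure[OF assms(1,2,1,2) lin_id] assms l
    lin_add[OF bilin_right[OF bilin_pure_tensor[OF assms(1,2)]]])
qed

text \<open>Choose a finite rank map fixing the second legs of both tensors. Applied to a tensor it
  yields \<Sum> (id \<otimes> \<xi>_j)(X) \<otimes> e_j, which depends on the contractions only, and
  it fixes both \<open>X\<close> and \<open>Y\<close>.\<close>

lemma contract_separates:
 assumes N: "module R N" and P: "loc_proj R P" and X: "X <: tensor R N P" "Y <: tensor R N P"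
  and eq: "\<And>\<xi>. lmap R P (ring_as_module R) \<xi> ==> contract N \<xi> X = contract N \<xi> Y"
 shows "X = Y"
proof -
 have mP: "module R P" using P by (simp add: loc_proj_def)
 obtain F G where FG: "finite F" "F \<subseteq> carrier P" "X \<in> tspan R N P F"
  "finite G" "G \<subseteq> carrier P" "Y \<in> tspan R N P G"
  using ex_tspan[OF N mP] X by meson
 obtain d where d: "finrank R P d" "\<forall>p\<in>F \<union> G. d p = p"
  using P FG unfolding loc_proj_def by (metis Un_subset_iff finite_UnI)
 have "rmap R N P P d X = rmap R N P P d Y"
  using d(1)
 proof induction
  case (rank1 \<xi> e)
  then show ?case using eq X by (simp add: tmap_rank1[OF N mP])
 next
  case (sum d d')
  then show ?case using X by (simp add: tmap_sum[OF N mP] finrank_linmap[OF mP])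
 qed
 moreover have "rmap R N P P d X = X"
  by (rule tspan_finrank[OF N mP FG(2,3) finrank_linmap[OF mP d(1)]]) (use d in auto)
 moreover have "rmap R N P P d Y = Y"
  by (rule tspan_finrank[OF N mP FG(5,6) finrank_linmap[OF mP d(1)]]) (use d in auto)
 ultimately show ?thesis by simp
qed

section \<open>Commutative algebras\<close>

definition alg_map ::
 "('r, 'y) ring_scheme => ('r, 'a, 'p) module_scheme => ('r, 'b, 'q) module_scheme
   => ('a => 'b) => bool" where
 "alg_map R S T h \<longleftrightarrow> lmap R S T h \<and>
   (\<forall>x\<in>carrier S. \<forall>y\<in>carrier S. h (x \<otimes>\<^sub>S y) = h x \<otimes>\<^sub>T h y) \<and> h \<one>\<^sub>S = \<one>\<^sub>T"

lemma alg_map_lin: "alg_map R S T h ==> lmap R S T h"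
 and alg_map_mult: "alg_map R S T h ==> x <: S ==> y <: S ==> h (x \<otimes>\<^sub>S y) = h x \<otimes>\<^sub>T h y"
 and alg_map_one: "alg_map R S T h ==> h \<one>\<^sub>S = \<one>\<^sub>T"
 by (auto simp: alg_map_def)

lemma alg_mapI:
 "lmap R S T h ==> (\<And>x y. x <: S ==> y <: S ==> h (x \<otimes>\<^sub>S y) = h x \<otimes>\<^sub>T h y)
  ==> h \<one>\<^sub>S = \<one>\<^sub>T ==> alg_map R S T h"
 by (auto simp: alg_map_def)

lemma alg_map_id: "alg_map R S S (\<lambda>x. x)"
 by (simp add: alg_map_def lin_id)

lemma alg_map_comp: "alg_map R S T h ==> alg_map R T U k ==> alg_map R S U (\<lambda>x. k (h x))"
 using lin_comp[of R S T h U k] unfolding alg_map_def by (auto simp: lin_closed)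

lemma alg_hom_iff: "h \<in> alg_hom R S T \<longleftrightarrow> alg_map R S T h \<and> h \<in> extensional (carrier S)"
 unfolding alg_hom_def alg_map_def Int_iff lin_hom_iff ring_hom_def by (auto simp: lmap_def)

lemma alg_map_cong:
 assumes "algebra R S" "\<And>x. x <: S ==> h x = k x"
 shows "alg_map R S T h \<longleftrightarrow> alg_map R S T k"
proof -
 interpret S: algebra R S by fact
 show ?thesis
  unfolding alg_map_def using lin_cong[of R S h k T, OF S.module assms(2)] assms(2) by simp
qed

lemma restrict_alg_hom: "algebra R S ==> alg_map R S T h ==> restrict h (carrier S) \<in> alg_hom R S T"
 unfolding alg_hom_iff by (subst alg_map_cong[where k = h]) auto

lemma alg_mod: "algebra R S ==> module R S"
 by (rule algebra.module)

lemma alg_map_unit: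
 assumes "algebra R S"
 shows "alg_map R (ring_as_module R) S (\<lambda>r. r \<odot>\<^sub>S \<one>\<^sub>S)"
proof -
 interpret S: algebra R S by fact
 show ?thesis
  unfolding alg_map_def lmap_def ring_as_module_def
  by (auto simp: S.smult_l_distr S.smult_assoc1 S.smult_assoc2)
qed

text \<open>Gives an isomorphic copy in another type, with the isomorphism and its inverse. Test
  algebras constructed outside \<open>'u\<close> are brought back by it.\<close>

lemma transport_algebra:
 fixes \<iota> :: "'b => 'u" and B :: "('r, 'b, 'p) module_scheme"
 assumes B: "algebra R B" and \<iota>: "inj_on \<iota> (carrier B)"
 obtains C :: "('r, 'u) module" and \<kappa> where "algebra R C" "alg_map R B C \<iota>" "alg_map R C B \<kappa>"
  "\<And>b. b <: B ==> \<kappa> (\<iota> b) = b" "\<And>c. c <: C ==> \<iota> (\<kappa> c) = c"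
proof -
 interpret B: algebra R B by fact
 note p = algebra_push[OF B, of \<iota>]
 have 1: "algebra R (push \<iota> B)" by (rule p(1); use \<iota> in \<open>metis inj_onD\<close>)
 have 2: "lmap R B (push \<iota> B) \<iota>" by (rule p(2); use \<iota> in \<open>metis inj_onD\<close>)
 have 3: "\<iota> (x \<otimes>\<^sub>B y) = \<iota> x \<otimes>\<^bsub>push \<iota> B\<^esub> \<iota> y" if "x <: B" "y <: B" for x y
  by (rule p(3)[OF _ _ _ that]; use \<iota> in \<open>metis inj_onD\<close>)
 have 4: "\<iota> \<one>\<^sub>B = \<one>\<^bsub>push \<iota> B\<^esub>" "carrier (push \<iota> B) = \<iota> ` carrier B" by (simp_all add: push_def)
 have am: "alg_map R B (push \<iota> B) \<iota>" by (rule alg_mapI[OF 2 3 4(1)])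
 let ?\<kappa> = "inv_into (carrier B) \<iota>"
 have \<kappa>: "?\<kappa> (\<iota> b) = b" if "b <: B" for b using \<iota> that by simp
 have "alg_map R (push \<iota> B) B ?\<kappa>"
  by (rule alg_mapI, rule lmapI)
   (auto simp: 4(2) \<kappa> lin_add[OF 2, symmetric] lin_smult[OF 2, symmetric] 3[symmetric] 4(1)[symmetric])
 moreover have "\<iota> (?\<kappa> c) = c" if "c <: (push \<iota> B)" for c using that by (auto simp: 4 \<kappa>)
 ultimately show thesis using that[OF 1 am _ \<kappa>] by simp
qed

lemma algebra_tensor:
 assumes "algebra R S" "algebra R T"
 shows "algebra R (tensor R S T)"
proof -
 interpret S: algebra R S by fact
 interpret T: algebra R T by fact
 note m = alg_mod[OF assms(1)] alg_mod[OF assms(2)]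
 let ?X = "tensor R S T"
 interpret X: module R ?X by (rule module_tensor[OF m])
 note b = bilin_tensor_mult[OF m bilin_mult[OF assms(1)] bilin_mult[OF assms(2)]]
 note mp = tensor_mult_pure[OF m bilin_mult[OF assms(1)] bilin_mult[OF assms(2)]]
 note pc = tens_closed[OF m]
 note bc = bilin_closed[OF b] and bl = lin_add[OF bilin_left[OF b]] and br = lin_add[OF bilin_right[OF b]]
  and bls = lin_smult[OF bilin_left[OF b]]
 have assoc: "(x \<otimes>\<^bsub>?X\<^esub> y) \<otimes>\<^bsub>?X\<^esub> z = x \<otimes>\<^bsub>?X\<^esub> (y \<otimes>\<^bsub>?X\<^esub> z)"
  if x: "x <: ?X" and y: "y <: ?X" and z: "z <: ?X" for x y z
  using m x
 proof (induction rule: tensor_induct)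
  case (pure x1 x2)
  show ?case using m y
  proof (induction rule: tensor_induct)
   case (pure y1 y2)
   show ?case using m z
   proof (induction rule: tensor_induct)
    case (pure z1 z2)
    then show ?case using \<open>x1 <: S\<close> \<open>x2 <: T\<close> \<open>y1 <: S\<close> \<open>y2 <: T\<close>
     by (simp add: mp S.m_assoc T.m_assoc)
   next
    case (add X Y)
    then show ?case using \<open>x1 <: S\<close> \<open>x2 <: T\<close> pure by (simp add: br bc pc)
   qed
  next
   case (add X Y)
   then show ?case using pure z by (simp add: br bl bc pc)
  qed
 next
  case (add X Y)
  then show ?case using y z by (simp add: br bl bc)
 qed
 have comm: "x \<otimes>\<^bsub>?X\<^esub> y = y \<otimes>\<^bsub>?X\<^esub> x" if x: "x <: ?X" and y: "y <: ?X" for x y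
  using m x
 proof (induction rule: tensor_induct)
  case (pure x1 x2)
  show ?case using m y
   by (induction rule: tensor_induct) (use pure in \<open>simp_all add: mp S.m_comm T.m_comm br bl pc\<close>)
 qed (simp add: br bl y)
 have one: "\<one>\<^bsub>?X\<^esub> <: ?X" by (simp add: tensor_one pc)
 have lone: "\<one>\<^bsub>?X\<^esub> \<otimes>\<^bsub>?X\<^esub> x = x" if "x <: ?X" for x
  using m that by (induction rule: tensor_induct) (simp_all add: tensor_one mp br pc)
 have cr: "cring ?X"
 proof (rule cringI[OF X.abelian_group_axioms])
  show "Group.comm_monoid ?X"
   by (rule comm_monoidI) (erule (1) bc, rule one, erule (2) assoc, erule lone, erule (1) comm)
 qed (simp add: bl)
 show ?thesis
  unfolding algebra_def algebra_axioms_def using X.module_axioms cr bls by simp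
qed

text \<open>The tensor product is the coproduct of commutative algebras; commutativity of
  \<open>U\<close> is what makes the induced map multiplicative.\<close>

lemma alg_map_tensor_lift:
 assumes S: "algebra R S" and T: "algebra R T" and U: "algebra R U" and f: "alg_map R S U f" and g: "alg_map R T U g"
 shows "alg_map R (tensor R S T) U (tlift U (\<lambda>x y. f x \<otimes>\<^sub>U g y))"
  and "x <: S ==> y <: T ==> tlift U (\<lambda>x y. f x \<otimes>\<^sub>U g y) (tens R S T x y) = f x \<otimes>\<^sub>U g y"
proof -
 interpret S: algebra R S by fact
 interpret T: algebra R T by fact
 interpret U: algebra R U by fact
 note m = alg_mod[OF S] alg_mod[OF T]
 note m3 = m alg_mod[OF U]
 let ?X = "tensor R S T"
 note b = bilin_tensor_mult[OF m bilin_mult[OF S] bilin_mult[OF T]]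
 note mp = tensor_mult_pure[OF m bilin_mult[OF S] bilin_mult[OF T]]
 have bb: "bilin R S T U (\<lambda>x y. f x \<otimes>\<^sub>U g y)"
  by (rule bilin_comp[OF bilin_mult[OF U] alg_map_lin[OF f] alg_map_lin[OF g]])
 let ?h = "tlift U (\<lambda>x y. f x \<otimes>\<^sub>U g y)"
 note l = lin_tlift[OF m3 bb] and p = tlift_pure[OF m3 bb]
 show "?h (tens R S T x y) = f x \<otimes>\<^sub>U g y" if "x <: S" "y <: T" for x y
  by (rule p[OF that])
 note fc = lin_closed[OF alg_map_lin[OF f]] and gc = lin_closed[OF alg_map_lin[OF g]]
 note bc = bilin_closed[OF b] and bl = lin_add[OF bilin_left[OF b]] and br = lin_add[OF bilin_right[OF b]]
 note lc = lin_closed[OF l] and la = lin_add[OF l]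
 show "alg_map R ?X U ?h"
 proof (rule alg_mapI[OF l])
  fix X Y assume X: "X <: ?X" and Y: "Y <: ?X"
  show "?h (X \<otimes>\<^bsub>?X\<^esub> Y) = ?h X \<otimes>\<^sub>U ?h Y"
   using m X
  proof (induction rule: tensor_induct)
   case (pure x1 x2)
   show ?case using m Y
   proof (induction rule: tensor_induct)
    case (pure y1 y2)
    then show ?case using \<open>x1 <: S\<close> \<open>x2 <: T\<close>
     by (simp add: mp p alg_map_mult[OF f] alg_map_mult[OF g] U.m_ac fc gc)
   next
    case (add Y Z)
    then show ?case using pure by (simp add: br bc la lc U.r_distr tens_closed[OF m])
   qed
  next
   case (add X Z)
   then show ?case using Y by (simp add: bl bc la lc U.l_distr)
  qed
 next
  show "?h \<one>\<^bsub>?X\<^esub> = \<one>\<^sub>U"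
   by (simp add: tensor_one p alg_map_one[OF f] alg_map_one[OF g])
 qed
qed

section \<open>Square zero extensions and dual numbers\<close>

definition triv :: "('r, 's, 'p) module_scheme => ('s, 'n, 'q) module_scheme => ('r, 's \<times> 'n) module" where
 "triv S N =
   \<lparr>carrier = carrier S \<times> carrier N,
   mult = (\<lambda>(s, n) (s', n'). (s \<otimes>\<^sub>S s', s \<odot>\<^sub>N n' \<oplus>\<^sub>N s' \<odot>\<^sub>N n)),
   one = (\<one>\<^sub>S, \<zero>\<^sub>N),
   zero = (\<zero>\<^sub>S, \<zero>\<^sub>N),
   add = (\<lambda>(s, n) (s', n'). (s \<oplus>\<^sub>S s', n \<oplus>\<^sub>N n')),
   smult = (\<lambda>r (s, n). (r \<odot>\<^sub>S s, (r \<odot>\<^sub>S \<one>\<^sub>S) \<odot>\<^sub>N n))\<rparr>"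

lemma algebra_triv:
 assumes "algebra R S" "module S N"
 shows "algebra R (triv S N)"
proof -
 interpret S: algebra R S by fact
 interpret N: module S N by fact
 note 1 = alg_map_unit[OF assms(1)]
 have ua: "(r \<oplus>\<^sub>R r') \<odot>\<^sub>S \<one>\<^sub>S = r \<odot>\<^sub>S \<one>\<^sub>S \<oplus>\<^sub>S r' \<odot>\<^sub>S \<one>\<^sub>S"
  and um: "(r \<otimes>\<^sub>R r') \<odot>\<^sub>S \<one>\<^sub>S = (r \<odot>\<^sub>S \<one>\<^sub>S) \<otimes>\<^sub>S (r' \<odot>\<^sub>S \<one>\<^sub>S)"
  if "r <: R" "r' <: R" for r r'
  using that lin_add[OF alg_map_lin[OF 1], of r r'] alg_map_mult[OF 1, of r r'] by (simp_all add: ring_as_module_def)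
 have us: "r \<odot>\<^sub>S s = (r \<odot>\<^sub>S \<one>\<^sub>S) \<otimes>\<^sub>S s" if "r <: R" "s <: S" for r s
  using that S.smult_assoc2[of r "\<one>\<^sub>S" s] by simp
 have ab: "abelian_group (triv S N)"
  by (rule abelian_groupI)
   (auto simp: triv_def S.a_ac N.M.add.m_ac intro!: bexI[of _ "\<ominus>\<^sub>S x" for x] bexI[of _ "\<ominus>\<^sub>N x" for x] S.l_neg N.l_neg)
 have cr: "cring (triv S N)"
 proof (rule cringI[OF ab])
  show "Group.comm_monoid (triv S N)"
   by (rule comm_monoidI)
    (auto simp: triv_def S.m_ac N.M.add.m_ac N.smult_r_distr N.smult_assoc1[symmetric])
 qed (auto simp: triv_def S.l_distr N.smult_l_distr N.smult_r_distr N.M.add.m_ac)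
 \<comment> \<open>\<open>R\<close> acts on \<open>N\<close> through the structure map of
   \<open>S\<close>, so an \<open>R\<close>-scalar is moved around as the element r 1 of
   \<open>S\<close>.\<close>
 have mul2: "(r \<odot>\<^sub>S s) \<odot>\<^sub>N n = (r \<odot>\<^sub>S \<one>\<^sub>S) \<odot>\<^sub>N (s \<odot>\<^sub>N n)"
  "s \<odot>\<^sub>N ((r \<odot>\<^sub>S \<one>\<^sub>S) \<odot>\<^sub>N n) = (r \<odot>\<^sub>S \<one>\<^sub>S) \<odot>\<^sub>N (s \<odot>\<^sub>N n)"
  if "r <: R" "s <: S" "n <: N" for r s n
 proof -
  have u: "r \<odot>\<^sub>S \<one>\<^sub>S <: S" using that by simp
  show "(r \<odot>\<^sub>S s) \<odot>\<^sub>N n = (r \<odot>\<^sub>S \<one>\<^sub>S) \<odot>\<^sub>N (s \<odot>\<^sub>N n)"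
   using N.smult_assoc1[OF u that(2,3)] us[OF that(1,2)] by simp
  show "s \<odot>\<^sub>N ((r \<odot>\<^sub>S \<one>\<^sub>S) \<odot>\<^sub>N n) = (r \<odot>\<^sub>S \<one>\<^sub>S) \<odot>\<^sub>N (s \<odot>\<^sub>N n)"
   using N.smult_assoc1[OF u that(2,3)] N.smult_assoc1[OF that(2) u that(3)] S.m_comm[OF u that(2)] by simp
 qed
 show ?thesis
 proof (rule algebraI[OF S.R_cring cr])
  fix a x y assume a: "a <: R" and "x <: triv S N" "y <: triv S N"
  then obtain s n s' n' where
   "x = (s, n)" "y = (s', n')" "s <: S" "s' <: S" "n <: N" "n' <: N"
   by (auto simp: triv_def)
  then show "(a \<odot>\<^bsub>triv S N\<^esub> x) \<otimes>\<^bsub>triv S N\<^esub> y = a \<odot>\<^bsub>triv S N\<^esub> (x \<otimes>\<^bsub>triv S N\<^esub> y)"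
   using a mul2(1)[of a s n'] mul2(2)[of a s' n] by (simp add: triv_def S.smult_assoc2 N.smult_r_distr)
 next
  fix a b x assume a: "a <: R" "b <: R" and "x <: triv S N"
  then obtain s n where "x = (s, n)" "s <: S" "n <: N"
   by (auto simp: triv_def)
  then show "(a \<otimes>\<^sub>R b) \<odot>\<^bsub>triv S N\<^esub> x = a \<odot>\<^bsub>triv S N\<^esub> (b \<odot>\<^bsub>triv S N\<^esub> x)"
   using a mul2(1)[of a "b \<odot>\<^sub>S \<one>\<^sub>S" n] by (simp add: triv_def S.smult_assoc1)
 qed (auto simp: triv_def S.smult_l_distr S.smult_r_distr N.smult_r_distr N.smult_l_distr)
qed

lemma ex_inj_pair:
 assumes "infinite (UNIV :: 'u set)"
 shows "\<exists>\<iota> :: 'u \<times> 'u => 'u. inj \<iota>"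
proof -
 obtain enc :: "'u list => 'u" where "inj enc" using ex_inj_list[OF assms] by blast
 then have "inj (\<lambda>(x, y). enc [x, y])" by (auto simp: inj_on_def)
 then show ?thesis by blast
qed

text \<open>\<open>U\<close> is a copy in \<open>'u\<close> of R \<oplus> A, with inclusion
  \<open>u\<close> and projections \<open>p\<close> to A and \<open>c\<close> to R. Linear maps from
  \<open>A\<close> whose values multiply to zero are the same as algebra maps from \<open>U\<close>,
  so \<open>u\<close> is the generic such map.\<close>

lemma ex_square_zero:
 fixes R :: "('u, 'y) ring_scheme" and A :: "('u, 'u, 'p) module_scheme"
 assumes inf: "infinite (UNIV :: 'u set)" and A: "module R A"
 obtains U :: "'u md" and u p c where "algebra R U" "lmap R A U u" "lmap R U A p"
  "lmap R U (ring_as_module R) c" "\<And>a. a <: A ==> p (u a) = a" "\<And>a. a <: A ==> c (u a) = \<zero>\<^sub>R"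
  "\<And>(T :: ('u, 'u) module) w. algebra R T ==> lmap R A T w ==>
    \<forall>a\<in>carrier A. \<forall>b\<in>carrier A. w a \<otimes>\<^sub>T w b = \<zero>\<^sub>T ==>
    alg_map R U T (\<lambda>z. c z \<odot>\<^sub>T \<one>\<^sub>T \<oplus>\<^sub>T w (p z))"
proof -
 interpret A: module R A by fact
 let ?R = "ring_as_module R"
 have R: "algebra R ?R" by (rule algebra_ring_as_module[OF A.R.cring_axioms])
 have cR: "cring ?R" by (rule algebra.M_cring[OF R])
 \<comment> \<open>\<open>triv\<close> expects a module over the algebra, which here is
   \<open>R\<close> regarded as an algebra over itself.\<close>
 have A': "module ?R A"
  by (rule moduleI[OF cR A.abelian_group_axioms])
   (auto simp: ring_as_module_def A.smult_l_distr A.smult_r_distr A.smult_assoc1)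
 let ?V = "triv ?R A"
 have V: "algebra R ?V" by (rule algebra_triv[OF R A'])
 obtain \<iota> :: "'u \<times> 'u => 'u" where \<iota>: "inj \<iota>" using ex_inj_pair[OF inf] by blast
 obtain U :: "'u md" and \<kappa> where U: "algebra R U" "alg_map R ?V U \<iota>" "alg_map R U ?V \<kappa>"
  "\<And>b. b <: ?V ==> \<kappa> (\<iota> b) = b"
  by (rule transport_algebra[OF V inj_on_subset[OF \<iota> subset_UNIV]], rule that)
 have u0: "lmap R A ?V (\<lambda>a. (\<zero>\<^sub>R, a))" and p0: "lmap R ?V A snd" and c0: "lmap R ?V ?R fst"
  unfolding lmap_def by (auto simp: triv_def ring_as_module_def)
 note \<kappa> = alg_map_lin[OF U(3)]
 have am: "alg_map R ?V T (\<lambda>z. fst z \<odot>\<^sub>T \<one>\<^sub>T \<oplus>\<^sub>T w (snd z))"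
  if T: "algebra R T" and w: "lmap R A T w" and w0: "\<forall>a\<in>carrier A. \<forall>b\<in>carrier A. w a \<otimes>\<^sub>T w b = \<zero>\<^sub>T"
  for T :: "'u md" and w
 proof (rule alg_mapI)
  interpret T: algebra R T by (rule T)
  note wc = lin_closed[OF w] and wa = lin_add[OF w] and ws = lin_smult[OF w]
  have sm: "(x \<otimes>\<^sub>T (r \<odot>\<^sub>T y)) = r \<odot>\<^sub>T (x \<otimes>\<^sub>T y)" if "r <: R" "x <: T" "y <: T" for r x y
   using that lin_smult[OF bilin_right[OF bilin_mult[OF T]]] by simp
  show "lmap R ?V T (\<lambda>z. fst z \<odot>\<^sub>T \<one>\<^sub>T \<oplus>\<^sub>T w (snd z))"
   by (intro lin_sum[OF alg_mod[OF T]] lin_comp[OF p0 w]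
     lin_smult_right[OF alg_mod[OF T] c0]) simp
  fix x y assume "x <: ?V" "y <: ?V"
  then obtain r a s b where rs: "x = (r, a)" "y = (s, b)" "r <: R" "s <: R" "a <: A" "b <: A"
   by (auto simp: triv_def ring_as_module_def)
  have sw: "s \<odot>\<^sub>T (r \<odot>\<^sub>T \<one>\<^sub>T) = r \<odot>\<^sub>T (s \<odot>\<^sub>T \<one>\<^sub>T)"
   using rs by (simp add: T.smult_assoc1[symmetric] A.R.m_comm)
  show "fst (x \<otimes>\<^bsub>?V\<^esub> y) \<odot>\<^sub>T \<one>\<^sub>T \<oplus>\<^sub>T w (snd (x \<otimes>\<^bsub>?V\<^esub> y)) =
   (fst x \<odot>\<^sub>T \<one>\<^sub>T \<oplus>\<^sub>T w (snd x)) \<otimes>\<^sub>T (fst y \<odot>\<^sub>T \<one>\<^sub>T \<oplus>\<^sub>T w (snd y))"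
   using rs w0 wc by (simp add: triv_def ring_as_module_def wa ws sw T.smult_r_distr T.l_distr T.r_distr T.smult_assoc2 sm T.smult_assoc1 T.M.add.m_ac)
 next
  interpret T: algebra R T by (rule T)
  show "fst \<one>\<^bsub>?V\<^esub> \<odot>\<^sub>T \<one>\<^sub>T \<oplus>\<^sub>T w (snd \<one>\<^bsub>?V\<^esub>) = \<one>\<^sub>T"
   using lin_zero[OF A alg_mod[OF T] w] by (simp add: triv_def ring_as_module_def)
 qed
 show thesis
 proof (rule that)
  show "algebra R U" by (rule U(1))
  show "lmap R A U (\<lambda>a. \<iota> (\<zero>\<^sub>R, a))" by (rule lin_comp[OF u0 alg_map_lin[OF U(2)]])
  show "lmap R U A (\<lambda>z. snd (\<kappa> z))" by (rule lin_comp[OF \<kappa> p0])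
  show "lmap R U ?R (\<lambda>z. fst (\<kappa> z))" by (rule lin_comp[OF \<kappa> c0])
  fix a assume "a <: A"
  then show "snd (\<kappa> (\<iota> (\<zero>\<^sub>R, a))) = a" "fst (\<kappa> (\<iota> (\<zero>\<^sub>R, a))) = \<zero>\<^sub>R"
   using U(4) by (simp_all add: triv_def ring_as_module_def)
 next
  fix T :: "'u md" and w
  assume "algebra R T" "lmap R A T w" "\<forall>a\<in>carrier A. \<forall>b\<in>carrier A. w a \<otimes>\<^sub>T w b = \<zero>\<^sub>T"
  then show "alg_map R U T (\<lambda>z. fst (\<kappa> z) \<odot>\<^sub>T \<one>\<^sub>T \<oplus>\<^sub>T w (snd (\<kappa> z)))"
   using alg_map_comp[OF U(3) am] by blast
 qed
qed

text \<open>\<open>D\<close> is a copy in \<open>'u\<close> of S[\<epsilon>] with \<epsilon>^2 = 0;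
  \<open>i\<close> embeds constants and \<open>q\<close> reads the coefficient of
  \<epsilon>.\<close>

lemma ex_dual_numbers:
 fixes R :: "('u, 'y) ring_scheme" and S :: "('u, 'u, 'p) module_scheme"
 assumes inf: "infinite (UNIV :: 'u set)" and S: "algebra R S"
 obtains D :: "'u md" and i \<epsilon> q where "algebra R D" "alg_map R S D i" "\<epsilon> <: D"
  "lmap R D S q" "\<epsilon> \<otimes>\<^sub>D \<epsilon> = \<zero>\<^sub>D"
  "\<And>s. s <: S ==> q (i s) = \<zero>\<^sub>S" "\<And>s. s <: S ==> q (\<epsilon> \<otimes>\<^sub>D i s) = s"
proof -
 interpret S: algebra R S by fact
 let ?N = "ring_as_module S"
 have N: "module S ?N" by (rule module_ring_as_module[OF S.M_cring])
 let ?V = "triv S ?N"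
 have V: "algebra R ?V" by (rule algebra_triv[OF S N])
 obtain \<iota> :: "'u \<times> 'u => 'u" where \<iota>: "inj \<iota>" using ex_inj_pair[OF inf] by blast
 obtain D :: "'u md" and \<kappa> where D: "algebra R D" "alg_map R ?V D \<iota>" "alg_map R D ?V \<kappa>"
  "\<And>b. b <: ?V ==> \<kappa> (\<iota> b) = b"
  by (rule transport_algebra[OF V inj_on_subset[OF \<iota> subset_UNIV]], rule that)
 note lin = alg_map_lin[OF D(2)]
 have i0: "alg_map R S ?V (\<lambda>s. (s, \<zero>\<^sub>S))"
  unfolding alg_map_def lmap_def by (auto simp: triv_def ring_as_module_def)
 have us: "(r \<odot>\<^sub>S \<one>\<^sub>S) \<otimes>\<^sub>S s = r \<odot>\<^sub>S s" if "r <: R" "s <: S" for r s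
  using that S.smult_assoc2[of r "\<one>\<^sub>S" s] by simp
 have q0: "lmap R ?V S snd"
  unfolding lmap_def by (auto simp: triv_def ring_as_module_def us)
 let ?e = "(\<zero>\<^sub>S, \<one>\<^sub>S)"
 have e: "?e <: ?V" by (simp add: triv_def ring_as_module_def)
 have e2: "?e \<otimes>\<^bsub>?V\<^esub> ?e = \<zero>\<^bsub>?V\<^esub>" by (simp add: triv_def ring_as_module_def)
 have ei: "(s, \<zero>\<^sub>S) <: ?V" "?e \<otimes>\<^bsub>?V\<^esub> (s, \<zero>\<^sub>S) = (\<zero>\<^sub>S, s)" "(\<zero>\<^sub>S, s) <: ?V" if "s <: S" for s
  using that by (simp_all add: triv_def ring_as_module_def)
 show thesis
 proof (rule that)
  show "algebra R D" by (rule D(1))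
  show "alg_map R S D (\<lambda>s. \<iota> (s, \<zero>\<^sub>S))" by (rule alg_map_comp[OF i0 D(2)])
  show "\<iota> ?e <: D" by (rule lin_closed[OF lin e])
  show "lmap R D S (\<lambda>z. snd (\<kappa> z))" by (rule lin_comp[OF alg_map_lin[OF D(3)] q0])
  show "\<iota> ?e \<otimes>\<^sub>D \<iota> ?e = \<zero>\<^sub>D"
   using alg_map_mult[OF D(2) e e] lin_zero[OF alg_mod[OF V] alg_mod[OF D(1)] lin] e2 by simp
  fix s assume s: "s <: S"
  show "snd (\<kappa> (\<iota> (s, \<zero>\<^sub>S))) = \<zero>\<^sub>S" using D(4) ei[OF s] by simp
  show "snd (\<kappa> (\<iota> ?e \<otimes>\<^sub>D \<iota> (s, \<zero>\<^sub>S))) = s"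
   using alg_map_mult[OF D(2) e ei(1)[OF s], symmetric] D(4) ei[OF s] by simp
 qed
qed

section \<open>Representability of linear and bilinear natural transformations\<close>

text \<open>The scalar multiplication of the values of \<open>quasi_coherent\<close>, where the test
  algebra acts on the right factor.\<close>

definition right_smult ::
 "('r, 'y) ring_scheme => ('r, 'a, 'p) module_scheme => ('r, 'b, 'q) module_scheme
   => 'b => ('a, 'b) tensor_elt => ('a, 'b) tensor_elt" where
 "right_smult R P T t = tlift (tensor R P T) (\<lambda>p t'. tens R P T p (t \<otimes>\<^sub>T t'))"

lemma
 assumes "module R P" "algebra R T" "t <: T"
 shows lin_right_smult: "lmap R (tensor R P T) (tensor R P T) (right_smult R P T t)"
  and right_smult_pure: "p <: P ==> t' <: T
   ==> right_smult R P T t (tens R P T p t') = tens R P T p (t \<otimes>\<^sub>T t')"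
proof -
 note m = assms(1) alg_mod[OF assms(2)]
 have b: "bilin R P T (tensor R P T) (\<lambda>p t'. tens R P T p (t \<otimes>\<^sub>T t'))"
  by (rule bilin_comp[OF bilin_pure_tensor[OF m] lin_id bilin_right[OF bilin_mult[OF assms(2)] assms(3)]])
 show "lmap R (tensor R P T) (tensor R P T) (right_smult R P T t)"
  unfolding right_smult_def by (rule lin_tlift[OF m module_tensor[OF m] b])
 show "right_smult R P T t (tens R P T p t') = tens R P T p (t \<otimes>\<^sub>T t')"
  if "p <: P" "t' <: T"
  unfolding right_smult_def by (rule tlift_pure[OF m module_tensor[OF m] b that])
qed

text \<open>A Yoneda argument although Hom(A, -) is not corepresented by an algebra: for any linear
  w the map \<epsilon> w into T[\<epsilon>] has products zero, so it factors through the generic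
  \<open>u\<close>. Naturality and linearity then express \<epsilon> \<Phi>(w) by \<Phi>(u), and
  reading the coefficient of \<epsilon> gives \<Phi>(w).\<close>

lemma linear_representable:
 fixes R :: "('u, 'y) ring_scheme" and A :: "('u, 'u, 'p) module_scheme"
  and P :: "('u, 'b, 'q) module_scheme"
  and \<Phi> :: "'u md => ('u => 'u) => ('b, 'u) tensor_elt"
 assumes inf: "infinite (UNIV :: 'u set)" and A: "module R A" and P: "module R P"
  and cl: "\<And>T w. algebra R T ==> w \<in> lin_hom R A T ==> \<Phi> T w <: tensor R P T"
  and sm: "\<And>T w t. algebra R T ==> w \<in> lin_hom R A T ==> t <: T
   ==> \<Phi> T (\<lambda>a\<in>carrier A. t \<otimes>\<^sub>T w a) = right_smult R P T t (\<Phi> T w)"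
  and nat: "\<And>T T' h w. algebra R T ==> algebra R T' ==> h \<in> alg_hom R T T' ==> w \<in> lin_hom R A T
   ==> \<Phi> T' (compose (carrier A) h w) = rmap R P T T' h (\<Phi> T w)"
 obtains x where "x <: tensor R P A"
  "\<And>T w. algebra R T ==> w \<in> lin_hom R A T ==> \<Phi> T w = rmap R P A T w x"
proof -
 obtain U :: "'u md" and u p c where U: "algebra R U" "lmap R A U u" "lmap R U A p"
  "lmap R U (ring_as_module R) c"
  and up: "\<And>a. a <: A ==> p (u a) = a" and uc: "\<And>a. a <: A ==> c (u a) = \<zero>\<^sub>R"
  and uni: "\<And>(T :: ('u, 'u) module) w. algebra R T ==> lmap R A T w ==>
    \<forall>a\<in>carrier A. \<forall>b\<in>carrier A. w a \<otimes>\<^sub>T w b = \<zero>\<^sub>T ==>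
    alg_map R U T (\<lambda>z. c z \<odot>\<^sub>T \<one>\<^sub>T \<oplus>\<^sub>T w (p z))"
  by (rule ex_square_zero[OF inf A], rule that)
 note mU = alg_mod[OF U(1)]
 let ?u = "restrict u (carrier A)"
 have u: "?u \<in> lin_hom R A U" by (rule restrict_lin_hom[OF A U(2)])
 let ?Z = "\<Phi> U ?u"
 have Z: "?Z <: tensor R P U" by (rule cl[OF U(1) u])
 \<comment> \<open>The representing tensor is the A-part of the value at the generic map.\<close>
 let ?x = "rmap R P U A p ?Z"
 show thesis
 proof (rule that[of ?x])
  show "?x <: tensor R P A"
   by (rule lin_closed[OF lin_tensor_map Z]) (use P mU A U lin_id in auto)
  fix T :: "'u md" and w assume T: "algebra R T" and w: "w \<in> lin_hom R A T"
  have wl: "lmap R A T w" using w by (simp add: lin_hom_iff)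
  interpret T: algebra R T by (rule T)
  obtain D :: "'u md" and i \<epsilon> q where D: "algebra R D" "alg_map R T D i" "\<epsilon> <: D"
   "lmap R D T q" "\<epsilon> \<otimes>\<^sub>D \<epsilon> = \<zero>\<^sub>D"
   and qi: "\<And>s. s <: T ==> q (i s) = \<zero>\<^sub>T" and qe: "\<And>s. s <: T ==> q (\<epsilon> \<otimes>\<^sub>D i s) = s"
  by (rule ex_dual_numbers[OF inf T], rule that)
  interpret D: algebra R D by (rule D(1))
  note mT = alg_mod[OF T] and mD = alg_mod[OF D(1)]
  note il = alg_map_lin[OF D(2)] and ic = lin_closed[OF alg_map_lin[OF D(2)]]
  let ?i = "restrict i (carrier T)"
  have i: "?i \<in> alg_hom R T D" by (rule restrict_alg_hom[OF T D(2)])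
  have iw: "compose (carrier A) ?i w \<in> lin_hom R A D"
   using restrict_lin_hom[OF A lin_comp[OF wl il]] lin_closed[OF wl]
   by (simp add: compose_def cong: restrict_cong)
  let ?e = "\<lambda>a. \<epsilon> \<otimes>\<^sub>D i (w a)"
  have el: "lmap R A D ?e"
   by (rule lin_comp[OF lin_comp[OF wl il] bilin_right[OF bilin_mult[OF D(1)] D(3)]])
  have "?e a \<otimes>\<^sub>D ?e b = \<zero>\<^sub>D" if "a <: A" "b <: A" for a b
  proof -
   have "?e a \<otimes>\<^sub>D ?e b = (\<epsilon> \<otimes>\<^sub>D \<epsilon>) \<otimes>\<^sub>D (i (w a) \<otimes>\<^sub>D i (w b))"
    using that D(3) by (simp add: D.m_ac ic lin_closed[OF wl])
   then show ?thesis using D(5) that by (simp add: ic lin_closed[OF wl])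
  qed
  then have al: "alg_map R U D (\<lambda>z. c z \<odot>\<^sub>D \<one>\<^sub>D \<oplus>\<^sub>D ?e (p z))"
   using uni[OF D(1) el] by simp
  let ?\<alpha> = "restrict (\<lambda>z. c z \<odot>\<^sub>D \<one>\<^sub>D \<oplus>\<^sub>D ?e (p z)) (carrier U)"
  have \<alpha>: "?\<alpha> \<in> alg_hom R U D" by (rule restrict_alg_hom[OF U(1) al])
  have \<alpha>l: "lmap R U D ?\<alpha>" using \<alpha> by (simp add: alg_hom_iff alg_map_def)
  have e1: "compose (carrier A) ?\<alpha> ?u = (\<lambda>a\<in>carrier A. \<epsilon> \<otimes>\<^sub>D compose (carrier A) ?i w a)"
  proof
   fix a show "compose (carrier A) ?\<alpha> ?u a = (\<lambda>a\<in>carrier A. \<epsilon> \<otimes>\<^sub>D compose (carrier A) ?i w a) a"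
    using lin_closed[OF U(2)] lin_closed[OF wl] lin_closed[OF el]
    by (simp add: compose_def up uc)
  qed
  \<comment> \<open>The map \<epsilon> w is at once a multiple of a base change of \<open>w\<close>
    and a base change of \<open>u\<close>, which gives two expressions for its value under
    \<open>\<Phi>\<close>.\<close>
  have e2: "rmap R P U D ?\<alpha> ?Z
   = right_smult R P D \<epsilon> (rmap R P T D ?i (\<Phi> T w))"
   using nat[OF U(1) D(1) \<alpha> u] sm[OF D(1) iw D(3)] nat[OF T D(1) i w] e1 by simp
  let ?q = "rmap R P D T q"
  have ql: "lmap R (tensor R P D) (tensor R P T) ?q"
   by (rule lin_tensor_map) (use P mD mT D lin_id in auto)
  have il': "lmap R T D ?i" using i by (simp add: alg_hom_iff alg_map_def)
  have f1: "?q (right_smult R P D \<epsilon> (rmap R P T D ?i Y)) = Y"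
   if Y: "Y <: tensor R P T" for Y
  proof (rule tmap_ext[OF P mT _ lin_id _ Y])
   show "lmap R (tensor R P T) (tensor R P T) (\<lambda>Y. ?q (right_smult R P D \<epsilon> (rmap R P T D ?i Y)))"
    by (rule lin_comp[OF lin_comp[OF lin_tensor_map lin_right_smult] ql])
     (use P mD mT D lin_id il' in auto)
   show "?q (right_smult R P D \<epsilon> (rmap R P T D ?i (tens R P T x t))) = tens R P T x t"
    if "x <: P" "t <: T" for x t
    using that D(3) ic[OF that(2)]
    by (simp add: tmap_pure[OF P mT P mD lin_id il'] right_smult_pure[OF P D(1)]
      tmap_pure[OF P mD P mT lin_id D(4)] qe)
  qed
  \<comment> \<open>The constant part of \<open>?\<alpha>\<close> contributes nothing after
    \<open>q\<close>, so that \<open>q\<close> after \<open>?\<alpha>\<close> equals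
    \<open>w\<close> after \<open>p\<close>.\<close>
  have f2: "?q (rmap R P U D ?\<alpha> Y)
    = rmap R P A T w (rmap R P U A p Y)"
   if Y: "Y <: tensor R P U" for Y
  proof (rule tmap_ext[OF P mU _ _ _ Y])
   show "lmap R (tensor R P U) (tensor R P T) (\<lambda>Y. ?q (rmap R P U D ?\<alpha> Y))"
    by (rule lin_comp[OF lin_tensor_map ql]) (use P mD mU lin_id \<alpha>l in auto)
   show "lmap R (tensor R P U) (tensor R P T) (\<lambda>Y. rmap R P A T w (rmap R P U A p Y))"
    by (rule lin_comp[OF lin_tensor_map lin_tensor_map]) (use P mT A mU lin_id U wl in auto)
   fix x z assume x: "x <: P" and z: "z <: U"
   have pz: "p z <: A" and cz: "c z <: R"
    using lin_closed[OF U(3) z] lin_closed[OF U(4) z] by (simp_all add: ring_as_module_def)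
   have "q (?\<alpha> z) = c z \<odot>\<^sub>T q \<one>\<^sub>D \<oplus>\<^sub>T w (p z)"
    using z cz lin_closed[OF el pz] lin_closed[OF wl pz]
    by (simp add: lin_add[OF D(4)] lin_smult[OF D(4)] qe)
   also have "q \<one>\<^sub>D = \<zero>\<^sub>T" using qi[of "\<one>\<^sub>T"] alg_map_one[OF D(2)] by simp
   finally have "q (?\<alpha> z) = w (p z)" using cz lin_closed[OF wl pz] by (simp add: T.smult_r_null)
   then show "?q (rmap R P U D ?\<alpha> (tens R P U x z)) =
     rmap R P A T w (rmap R P U A p (tens R P U x z))"
    using x z pz lin_closed[OF \<alpha>l z]
    by (simp add: tmap_pure[OF P mU P mD lin_id \<alpha>l] tmap_pure[OF P mD P mT lin_id D(4)]
      tmap_pure[OF P mU P A lin_id U(3)] tmap_pure[OF P A P mT lin_id wl] del: restrict_apply)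
  qed
  show "\<Phi> T w = rmap R P A T w ?x"
   using f1[OF cl[OF T w]] f2[OF Z] e2 by simp
 qed
qed

text \<open>The same argument with two independent square zero parameters: the generic pair lives
  over U \<otimes> U, and for given \<open>v\<close>, \<open>w\<close> it specializes to (\<epsilon>
  v, \<epsilon>' w) over T[\<epsilon>][\<epsilon>'], where the coefficient of \<epsilon> \<epsilon>'
  is read off.\<close>

lemma bilinear_representable:
 fixes R :: "('u, 'y) ring_scheme" and A :: "('u, 'u, 'p) module_scheme"
  and m :: "'u md => ('u => 'u) => ('u => 'u) => ('u => 'u)"
 assumes inf: "infinite (UNIV :: 'u set)" and A: "module R A"
  and cl: "\<And>T v w. algebra R T ==> v \<in> lin_hom R A T ==> w \<in> lin_hom R A T ==> m T v w \<in> lin_hom R A T"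
  and sl: "\<And>T v w t. algebra R T ==> v \<in> lin_hom R A T ==> w \<in> lin_hom R A T ==> t <: T
   ==> m T (\<lambda>a\<in>carrier A. t \<otimes>\<^sub>T v a) w = (\<lambda>a\<in>carrier A. t \<otimes>\<^sub>T m T v w a)"
  and sr: "\<And>T v w t. algebra R T ==> v \<in> lin_hom R A T ==> w \<in> lin_hom R A T ==> t <: T
   ==> m T v (\<lambda>a\<in>carrier A. t \<otimes>\<^sub>T w a) = (\<lambda>a\<in>carrier A. t \<otimes>\<^sub>T m T v w a)"
  and nat: "\<And>T T' h v w. algebra R T ==> algebra R T' ==> h \<in> alg_hom R T T' ==> v \<in> lin_hom R A T ==> w \<in> lin_hom R A T
   ==> m T' (compose (carrier A) h v) (compose (carrier A) h w) = compose (carrier A) h (m T v w)"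
 obtains \<Delta> where "lmap R A (tensor R A A) \<Delta>"
  "\<And>T v w a. algebra R T ==> v \<in> lin_hom R A T ==> w \<in> lin_hom R A T ==> a <: A
   ==> m T v w a = tlift T (\<lambda>a b. v a \<otimes>\<^sub>T w b) (\<Delta> a)"
proof -
 obtain U :: "'u md" and u p c where U: "algebra R U" "lmap R A U u" "lmap R U A p"
  "lmap R U (ring_as_module R) c"
  and up: "\<And>a. a <: A ==> p (u a) = a" and uc: "\<And>a. a <: A ==> c (u a) = \<zero>\<^sub>R"
  and uni: "\<And>(T :: ('u, 'u) module) w. algebra R T ==> lmap R A T w ==>
    \<forall>a\<in>carrier A. \<forall>b\<in>carrier A. w a \<otimes>\<^sub>T w b = \<zero>\<^sub>T ==>
    alg_map R U T (\<lambda>z. c z \<odot>\<^sub>T \<one>\<^sub>T \<oplus>\<^sub>T w (p z))"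
  by (rule ex_square_zero[OF inf A], rule that)
 note mU = alg_mod[OF U(1)]
 interpret U: algebra R U by (rule U(1))
 let ?V = "tensor R U U"
 have V: "algebra R ?V" by (rule algebra_tensor[OF U(1) U(1)])
 note pt = bilin_pure_tensor[OF mU mU]
 obtain \<iota> :: "('u, 'u) tensor_elt => 'u" where \<iota>: "inj_on \<iota> (carrier ?V)"
  using ex_inj_on_range_pairs[OF inf tensor_subset_range[OF mU mU]] by blast
 obtain W :: "'u md" and \<kappa> where W: "algebra R W" "alg_map R ?V W \<iota>" "alg_map R W ?V \<kappa>"
  "\<And>b. b <: ?V ==> \<kappa> (\<iota> b) = b"
  by (rule transport_algebra[OF V \<iota>], rule that)
 \<comment> \<open>\<open>?v0\<close> and \<open>?w0\<close> are the generic linear maps in the two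
   factors of the copy \<open>W\<close> of U \<otimes> U.\<close>
 let ?v0 = "restrict (\<lambda>a. \<iota> (tens R U U (u a) \<one>\<^sub>U)) (carrier A)"
 let ?w0 = "restrict (\<lambda>a. \<iota> (tens R U U \<one>\<^sub>U (u a))) (carrier A)"
 have v0: "?v0 \<in> lin_hom R A W"
  by (rule restrict_lin_hom[OF A lin_comp[OF lin_comp[OF U(2) bilin_left[OF pt]] alg_map_lin[OF W(2)]]]) simp
 have w0: "?w0 \<in> lin_hom R A W"
  by (rule restrict_lin_hom[OF A lin_comp[OF lin_comp[OF U(2) bilin_right[OF pt]] alg_map_lin[OF W(2)]]]) simp
 have M: "lmap R A W (m W ?v0 ?w0)" using cl[OF W(1) v0 w0] by (simp add: lin_hom_iff)
 note pp = lin_tensor_map[OF mU mU A A U(3) U(3)]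
 let ?\<Delta> = "\<lambda>a. tmap R U U A A p p (\<kappa> (m W ?v0 ?w0 a))"
 show thesis
 proof (rule that[of ?\<Delta>])
  show "lmap R A (tensor R A A) ?\<Delta>"
   by (rule lin_comp[OF lin_comp[OF M alg_map_lin[OF W(3)]] pp])
  fix T :: "'u md" and v w a0
  assume T: "algebra R T" and v: "v \<in> lin_hom R A T" and w: "w \<in> lin_hom R A T" and a0: "a0 <: A"
  have vl: "lmap R A T v" and wl: "lmap R A T w" using v w by (simp_all add: lin_hom_iff)
  note vc = lin_closed[OF vl] and wc = lin_closed[OF wl]
  interpret T: algebra R T by (rule T)
  obtain D :: "'u md" and i \<epsilon> q where D: "algebra R D" "alg_map R T D i" "\<epsilon> <: D"
   "lmap R D T q" "\<epsilon> \<otimes>\<^sub>D \<epsilon> = \<zero>\<^sub>D"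
   and qi: "\<And>s. s <: T ==> q (i s) = \<zero>\<^sub>T" and qe: "\<And>s. s <: T ==> q (\<epsilon> \<otimes>\<^sub>D i s) = s"
  by (rule ex_dual_numbers[OF inf T], rule that)
  interpret D: algebra R D by (rule D(1))
  obtain D' :: "'u md" and i' \<epsilon>' q' where D': "algebra R D'" "alg_map R D D' i'" "\<epsilon>' <: D'"
   "lmap R D' D q'" "\<epsilon>' \<otimes>\<^sub>D' \<epsilon>' = \<zero>\<^sub>D'"
   and qi': "\<And>s. s <: D ==> q' (i' s) = \<zero>\<^sub>D" and qe': "\<And>s. s <: D ==> q' (\<epsilon>' \<otimes>\<^sub>D' i' s) = s"
  by (rule ex_dual_numbers[OF inf D(1)], rule that)
  interpret D': algebra R D' by (rule D'(1))
  note mT = alg_mod[OF T] and mD = alg_mod[OF D(1)] and mD' = alg_mod[OF D'(1)]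
  note il = alg_map_lin[OF D(2)] and ic = lin_closed[OF alg_map_lin[OF D(2)]]
  note il' = alg_map_lin[OF D'(2)] and ic' = lin_closed[OF alg_map_lin[OF D'(2)]]
  let ?j = "restrict (\<lambda>t. i' (i t)) (carrier T)"
  have j: "?j \<in> alg_hom R T D'" by (rule restrict_alg_hom[OF T alg_map_comp[OF D(2) D'(2)]])
  have jv: "compose (carrier A) ?j x \<in> lin_hom R A D'" if "lmap R A T x" for x
   using restrict_lin_hom[OF A lin_comp[OF that lin_comp[OF il il']]] lin_closed[OF that]
   by (simp add: compose_def cong: restrict_cong)
  let ?f1 = "\<lambda>a. \<epsilon> \<otimes>\<^sub>D i (v a)"
  let ?f2 = "\<lambda>a. \<epsilon>' \<otimes>\<^sub>D' i' (i (w a))"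
  have f1l: "lmap R A D ?f1"
   by (rule lin_comp[OF lin_comp[OF vl il] bilin_right[OF bilin_mult[OF D(1)] D(3)]])
  have f2l: "lmap R A D' ?f2"
   by (rule lin_comp[OF lin_comp[OF wl lin_comp[OF il il']] bilin_right[OF bilin_mult[OF D'(1)] D'(3)]])
  have "i' (?f1 a) \<otimes>\<^sub>D' i' (?f1 b) = \<zero>\<^sub>D'" if "a <: A" "b <: A" for a b
  proof -
   have "i' (?f1 a) \<otimes>\<^sub>D' i' (?f1 b) = i' (?f1 a \<otimes>\<^sub>D ?f1 b)"
    by (rule alg_map_mult[OF D'(2), symmetric]) (use lin_closed[OF f1l] that in auto)
   also have "?f1 a \<otimes>\<^sub>D ?f1 b = (\<epsilon> \<otimes>\<^sub>D \<epsilon>) \<otimes>\<^sub>D (i (v a) \<otimes>\<^sub>D i (v b))"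
    using that D(3) by (simp add: D.m_ac ic vc)
   also have "\<dots> = \<zero>\<^sub>D" using D(5) that by (simp add: ic vc)
   finally show ?thesis using lin_zero[OF mD mD' il'] by simp
  qed
  then have al: "alg_map R U D' (\<lambda>z. c z \<odot>\<^sub>D' \<one>\<^sub>D' \<oplus>\<^sub>D' i' (?f1 (p z)))" (is "alg_map _ _ _ ?\<alpha>")
   using uni[OF D'(1) lin_comp[OF f1l il']] by simp
  have "?f2 a \<otimes>\<^sub>D' ?f2 b = \<zero>\<^sub>D'" if "a <: A" "b <: A" for a b
  proof -
   have "?f2 a \<otimes>\<^sub>D' ?f2 b = (\<epsilon>' \<otimes>\<^sub>D' \<epsilon>') \<otimes>\<^sub>D' (i' (i (w a)) \<otimes>\<^sub>D' i' (i (w b)))"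
    using that D'(3) by (simp add: D'.m_ac ic ic' wc)
   then show ?thesis using D'(5) that by (simp add: ic ic' wc)
  qed
  then have be: "alg_map R U D' (\<lambda>z. c z \<odot>\<^sub>D' \<one>\<^sub>D' \<oplus>\<^sub>D' ?f2 (p z))" (is "alg_map _ _ _ ?\<beta>")
   using uni[OF D'(1) f2l] by simp
  \<comment> \<open>The specialization of the generic pair: \<open>?\<alpha>\<close> on the left
    factor gives \<epsilon> v, \<open>?\<beta>\<close> on the right one gives \<epsilon>' w.\<close>
  define \<gamma> where "\<gamma> = tlift D' (\<lambda>x y. ?\<alpha> x \<otimes>\<^sub>D' ?\<beta> y)"
  have \<gamma>: "alg_map R ?V D' \<gamma>" unfolding \<gamma>_def by (rule alg_map_tensor_lift(1)[OF U(1) U(1) D'(1) al be])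
  have \<gamma>p: "\<gamma> (tens R U U x y) = ?\<alpha> x \<otimes>\<^sub>D' ?\<beta> y" if "x <: U" "y <: U" for x y
   unfolding \<gamma>_def by (rule alg_map_tensor_lift(2)[OF U(1) U(1) D'(1) al be that])
  let ?g = "restrict (\<lambda>z. \<gamma> (\<kappa> z)) (carrier W)"
  have g: "?g \<in> alg_hom R W D'" by (rule restrict_alg_hom[OF W(1) alg_map_comp[OF W(3) \<gamma>]])
  note uU = lin_closed[OF U(2)]
  have pc: "tens R U U x y <: ?V" if "x <: U" "y <: U" for x y
   by (rule tens_closed[OF mU mU that])
  note \<iota>c = lin_closed[OF alg_map_lin[OF W(2)]]
  have gv: "compose (carrier A) ?g ?v0 = (\<lambda>a\<in>carrier A. i' \<epsilon> \<otimes>\<^sub>D' compose (carrier A) ?j v a)"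
  proof (rule ext)
   fix a
   show "compose (carrier A) ?g ?v0 a = (\<lambda>a\<in>carrier A. i' \<epsilon> \<otimes>\<^sub>D' compose (carrier A) ?j v a) a"
   proof (cases "a <: A")
    case True
    have "compose (carrier A) ?g ?v0 a = ?\<alpha> (u a) \<otimes>\<^sub>D' ?\<beta> \<one>\<^sub>U"
     using True by (simp add: compose_def \<iota>c pc uU W(4) \<gamma>p)
    also have "?\<beta> \<one>\<^sub>U = \<one>\<^sub>D'" by (rule alg_map_one[OF be])
    also have "?\<alpha> (u a) = i' (?f1 a)"
     using True lin_closed[OF f1l] by (simp add: up uc ic')
    also have "i' (?f1 a) \<otimes>\<^sub>D' \<one>\<^sub>D' = i' \<epsilon> \<otimes>\<^sub>D' i' (i (v a))"
     using True D(3) by (simp add: alg_map_mult[OF D'(2)] ic ic' vc)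
    finally show ?thesis using True by (simp add: compose_def vc)
   qed (simp add: compose_def)
  qed
  have gw: "compose (carrier A) ?g ?w0 = (\<lambda>a\<in>carrier A. \<epsilon>' \<otimes>\<^sub>D' compose (carrier A) ?j w a)"
  proof (rule ext)
   fix a
   show "compose (carrier A) ?g ?w0 a = (\<lambda>a\<in>carrier A. \<epsilon>' \<otimes>\<^sub>D' compose (carrier A) ?j w a) a"
   proof (cases "a <: A")
    case True
    have "compose (carrier A) ?g ?w0 a = ?\<alpha> \<one>\<^sub>U \<otimes>\<^sub>D' ?\<beta> (u a)"
     using True by (simp add: compose_def \<iota>c pc uU W(4) \<gamma>p)
    also have "?\<alpha> \<one>\<^sub>U = \<one>\<^sub>D'" by (rule alg_map_one[OF al])
    also have "?\<beta> (u a) = ?f2 a"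
     using True lin_closed[OF f2l] by (simp add: up uc)
    finally show ?thesis using True lin_closed[OF f2l True] by (simp add: compose_def wc)
   qed (simp add: compose_def)
  qed
  let ?jm = "m D' (compose (carrier A) ?j v) (compose (carrier A) ?j w)"
  have mc: "m T v w a0 <: T" using cl[OF T v w] a0 by (auto simp: lin_hom_iff lmap_def)
  have "compose (carrier A) ?g (m W ?v0 ?w0)
    = m D' (\<lambda>a\<in>carrier A. i' \<epsilon> \<otimes>\<^sub>D' compose (carrier A) ?j v a) (\<lambda>a\<in>carrier A. \<epsilon>' \<otimes>\<^sub>D' compose (carrier A) ?j w a)"
   using nat[OF W(1) D'(1) g v0 w0] gv gw by simp
  also have "\<dots> = (\<lambda>a\<in>carrier A. i' \<epsilon> \<otimes>\<^sub>D' m D' (compose (carrier A) ?j v) (\<lambda>a\<in>carrier A. \<epsilon>' \<otimes>\<^sub>D' compose (carrier A) ?j w a) a)"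
  proof (rule sl[OF D'(1) jv[OF vl] _ ic'[OF D(3)]])
   show "(\<lambda>a\<in>carrier A. \<epsilon>' \<otimes>\<^sub>D' compose (carrier A) ?j w a) \<in> lin_hom R A D'"
    by (rule restrict_lin_hom[OF A lin_comp[OF _ bilin_right[OF bilin_mult[OF D'(1)] D'(3)]]])
     (use jv[OF wl] in \<open>simp add: lin_hom_iff\<close>)
  qed
  also have "m D' (compose (carrier A) ?j v) (\<lambda>a\<in>carrier A. \<epsilon>' \<otimes>\<^sub>D' compose (carrier A) ?j w a)
    = (\<lambda>a\<in>carrier A. \<epsilon>' \<otimes>\<^sub>D' ?jm a)"
   by (rule sr[OF D'(1) jv[OF vl] jv[OF wl] D'(3)])
  also have "?jm = compose (carrier A) ?j (m T v w)" by (rule nat[OF T D'(1) j v w])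
  finally have ge: "compose (carrier A) ?g (m W ?v0 ?w0)
   = (\<lambda>a\<in>carrier A. i' \<epsilon> \<otimes>\<^sub>D' (\<lambda>a\<in>carrier A. \<epsilon>' \<otimes>\<^sub>D' compose (carrier A) ?j (m T v w) a) a)" .
  have "compose (carrier A) ?g (m W ?v0 ?w0) a0 = i' \<epsilon> \<otimes>\<^sub>D' (\<epsilon>' \<otimes>\<^sub>D' i' (i (m T v w a0)))"
   unfolding ge using a0 mc by (simp add: compose_def)
  moreover have "compose (carrier A) ?g f a0 = \<gamma> (\<kappa> (f a0))" if "f a0 <: W" for f
   using that a0 by (simp add: compose_def)
  ultimately have "\<gamma> (\<kappa> (m W ?v0 ?w0 a0)) = i' \<epsilon> \<otimes>\<^sub>D' (\<epsilon>' \<otimes>\<^sub>D' i' (i (m T v w a0)))"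
   using lin_closed[OF M a0] by metis
  also have "\<dots> = \<epsilon>' \<otimes>\<^sub>D' i' (\<epsilon> \<otimes>\<^sub>D i (m T v w a0))"
   using mc D(3) D'(3) by (simp add: alg_map_mult[OF D'(2)] ic ic' D'.m_ac)
  \<comment> \<open>Reading first the \<epsilon>'-coefficient and then the \<epsilon>-coefficient
    recovers \<open>m T v w\<close>.\<close>
  finally have 1: "q (q' (\<gamma> (\<kappa> (m W ?v0 ?w0 a0)))) = m T v w a0"
   using mc D(3) by (simp add: qe' ic qe)
  have bvw: "bilin R A A T (\<lambda>a b. v a \<otimes>\<^sub>T w b)" by (rule bilin_comp[OF bilin_mult[OF T] vl wl])
  \<comment> \<open>Of the product of (c x + \<epsilon> v(p x)) and (c y + \<epsilon>' w(p y)) only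
    the mixed term survives the two coefficient maps.\<close>
  have 2: "q (q' (\<gamma> Z)) = tlift T (\<lambda>a b. v a \<otimes>\<^sub>T w b) (tmap R U U A A p p Z)" if Z: "Z <: ?V" for Z
  proof (rule tmap_ext[OF mU mU _ _ _ Z])
   show "lmap R ?V T (\<lambda>Z. q (q' (\<gamma> Z)))" by (rule lin_comp[OF lin_comp[OF alg_map_lin[OF \<gamma>] D'(4)] D(4)])
   show "lmap R ?V T (\<lambda>Z. tlift T (\<lambda>a b. v a \<otimes>\<^sub>T w b) (tmap R U U A A p p Z))"
    by (rule lin_comp[OF pp lin_tlift[OF A A mT bvw]])
   fix x y assume x: "x <: U" and y: "y <: U"
   have px: "p x <: A" and cx: "c x <: R" and py: "p y <: A" and cy: "c y <: R"
    using lin_closed[OF U(3)] lin_closed[OF U(4)] x y by (simp_all add: ring_as_module_def)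
   let ?X = "c x \<odot>\<^sub>D \<one>\<^sub>D \<oplus>\<^sub>D ?f1 (p x)"
   have f1c: "?f1 (p x) <: D" by (rule lin_closed[OF f1l px])
   have X: "?X <: D" using cx f1c by simp
   have ax: "?\<alpha> x = i' ?X"
    using cx f1c by (simp add: lin_add[OF il'] lin_smult[OF il'] alg_map_one[OF D'(2)])
   have iwc: "i (w (p y)) <: D" by (rule ic[OF wc[OF py]])
   have by': "?\<beta> y = i' (c y \<odot>\<^sub>D \<one>\<^sub>D) \<oplus>\<^sub>D' ?f2 (p y)"
    using cy by (simp add: lin_smult[OF il'] alg_map_one[OF D'(2)])
   have "?\<alpha> x \<otimes>\<^sub>D' ?\<beta> y = i' (?X \<otimes>\<^sub>D (c y \<odot>\<^sub>D \<one>\<^sub>D)) \<oplus>\<^sub>D' \<epsilon>' \<otimes>\<^sub>D' i' (?X \<otimes>\<^sub>D i (w (p y)))"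
    unfolding ax by'
    using X cy iwc D'(3) ic'[OF X] ic'[OF iwc] ic'[of "c y \<odot>\<^sub>D \<one>\<^sub>D"]
    by (simp only: D'.r_distr D'.m_closed D.smult_closed D.one_closed alg_map_mult[OF D'(2)] D'.m_lcomm)
   then have "q' (?\<alpha> x \<otimes>\<^sub>D' ?\<beta> y) = ?X \<otimes>\<^sub>D i (w (p y))"
    using X cy iwc D'(3) ic' by (simp add: lin_add[OF D'(4)] qi' qe' del: D'.m_closed add: D'.m_closed)
   also have "\<dots> = i (c x \<odot>\<^sub>T w (p y)) \<oplus>\<^sub>D \<epsilon> \<otimes>\<^sub>D i (v (p x) \<otimes>\<^sub>T w (p y))"
    using cx f1c iwc D(3) vc[OF px] wc[OF py] ic
    by (simp add: D.l_distr D.smult_assoc2 lin_smult[OF il] alg_map_mult[OF D(2)] D.m_assoc)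
   finally have "q (q' (?\<alpha> x \<otimes>\<^sub>D' ?\<beta> y)) = v (p x) \<otimes>\<^sub>T w (p y)"
    using cx D(3) vc[OF px] wc[OF py] ic by (simp add: lin_add[OF D(4)] qi qe)
   then show "q (q' (\<gamma> (tens R U U x y))) = tlift T (\<lambda>a b. v a \<otimes>\<^sub>T w b) (tmap R U U A A p p (tens R U U x y))"
    using x y px py by (simp add: \<gamma>p tmap_pure[OF mU mU A A U(3) U(3)] tlift_pure[OF A A mT bvw])
  qed
  show "m T v w a0 = tlift T (\<lambda>a b. v a \<otimes>\<^sub>T w b) (?\<Delta> a0)"
   using 1 2[OF lin_closed[OF alg_map_lin[OF W(3)] lin_closed[OF M a0]]] by simp
 qed
qed

section \<open>Coalgebras and convolution\<close>

lemma
 assumes "module R M" "module R N" "module R P"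
 shows lin_tensor_assoc: "lmap R (tensor R (tensor R M N) P) (tensor R M (tensor R N P)) (tensor_assoc R M N P)"
  and tensor_assoc_pure: "x <: M ==> y <: N ==> z <: P ==>
   tensor_assoc R M N P (tens R (tensor R M N) P (tens R M N x y) z)
    = tens R M (tensor R N P) x (tens R N P y z)"
proof -
 note NP = module_tensor[OF assms(2,3)] and MN = module_tensor[OF assms(1,2)]
 note T = module_tensor[OF assms(1) NP]
 let ?b = "\<lambda>z x y. tens R M (tensor R N P) x (tens R N P y z)"
 let ?B = "\<lambda>X z. tlift (tensor R M (tensor R N P)) (?b z) X"
 have b1: "bilin R M N (tensor R M (tensor R N P)) (?b z)" if "z <: P" for z
  by (rule bilin_comp[OF bilin_pure_tensor[OF assms(1) NP] lin_id bilin_left[OF bilin_pure_tensor[OF assms(2,3)] that]])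
 have b2: "bilin R (tensor R M N) P (tensor R M (tensor R N P)) ?B"
 proof (rule bilinI)
  show "lmap R P (tensor R M (tensor R N P)) (?B X)" if "X <: tensor R M N" for X
  proof (rule lin_tlift_param[OF assms(1,2) T assms(3) b1 _ that])
   fix x y assume "x <: M" "y <: N"
   then show "lmap R P (tensor R M (tensor R N P)) (\<lambda>z. ?b z x y)"
    by (intro lin_comp[OF bilin_right[OF bilin_pure_tensor[OF assms(2,3)]] bilin_right[OF bilin_pure_tensor[OF assms(1) NP]]])
  qed
  show "lmap R (tensor R M N) (tensor R M (tensor R N P)) (\<lambda>X. ?B X z)" if "z <: P" for z
   by (rule lin_tlift[OF assms(1,2) T b1[OF that]])
 qed
 have e: "tensor_assoc R M N P = tlift (tensor R M (tensor R N P)) ?B"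
  unfolding tensor_assoc_def add_monoid_tensor ..
 show "lmap R (tensor R (tensor R M N) P) (tensor R M (tensor R N P)) (tensor_assoc R M N P)"
  unfolding e by (rule lin_tlift[OF MN assms(3) T b2])
 show "tensor_assoc R M N P (tens R (tensor R M N) P (tens R M N x y) z)
    = tens R M (tensor R N P) x (tens R N P y z)"
  if "x <: M" "y <: N" "z <: P" for x y z
  unfolding e using that
  by (simp add: tlift_pure[OF MN assms(3) T b2] tlift_pure[OF assms(1,2) T b1] tens_closed[OF assms(1,2)])
qed

lemma
 assumes "module R M" "module R N"
 shows lin_tensor_swap: "lmap R (tensor R M N) (tensor R N M) (tensor_swap R M N)"
  and tensor_swap_pure: "x <: M ==> y <: N ==>
   tensor_swap R M N (tens R M N x y) = tens R N M y x"
proof -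
 note NM = module_tensor[OF assms(2,1)]
 note b = bilin_flip[OF bilin_pure_tensor[OF assms(2,1)]]
 have e: "tensor_swap R M N = tlift (tensor R N M) (\<lambda>x y. tens R N M y x)"
  unfolding tensor_swap_def add_monoid_tensor ..
 show "lmap R (tensor R M N) (tensor R N M) (tensor_swap R M N)"
  unfolding e by (rule lin_tlift[OF assms NM b])
 show "tensor_swap R M N (tens R M N x y) = tens R N M y x"
  if "x <: M" "y <: N" for x y
  unfolding e by (rule tlift_pure[OF assms NM b that])
qed

definition pairing ::
 "('r, 'c, 's) module_scheme => ('a => 'c) => ('b => 'c) => ('a, 'b) tensor_elt => 'c" where
 "pairing T f g = tlift T (\<lambda>x y. f x \<otimes>\<^sub>T g y)"

lemma
 assumes "module R M" "module R N" "algebra R T" "lmap R M T f" "lmap R N T g"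
 shows lin_pairing: "lmap R (tensor R M N) T (pairing T f g)"
  and pairing_pure: "x <: M ==> y <: N ==> pairing T f g (tens R M N x y) = f x \<otimes>\<^sub>T g y"
 unfolding pairing_def
 using lin_tlift[OF assms(1,2) alg_mod[OF assms(3)] bilin_comp[OF bilin_mult[OF assms(3)] assms(4,5)]]
  tlift_pure[OF assms(1,2) alg_mod[OF assms(3)] bilin_comp[OF bilin_mult[OF assms(3)] assms(4,5)]]
 by auto

lemma pairing_cong:
 assumes "module R M" "module R N" "algebra R T" "lmap R M T f" "lmap R N T g"
  and "\<And>x. x <: M ==> f x = f' x" "\<And>y. y <: N ==> g y = g' y" "X <: tensor R M N"
 shows "pairing T f g X = pairing T f' g' X"
proof -
 have 1: "lmap R M T f'" "lmap R N T g'"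
  using lin_cong[OF assms(1), of f f' T] lin_cong[OF assms(2), of g g' T] assms by auto
 show ?thesis
  by (rule tmap_ext[OF assms(1,2) lin_pairing lin_pairing _ assms(8)])
   (use assms 1 in \<open>simp_all add: pairing_pure\<close>)
qed

text \<open>The type of \<open>T\<close> is independent of the one of \<open>A\<close>, because
  convolution is also taken with values in the tensor algebras S \<otimes> T.\<close>

definition conv ::
 "('r, 'a, 'p) bialg_scheme => ('r, 'c, 's) module_scheme => ('a => 'c) => ('a => 'c) => ('a => 'c)" where
 "conv A T v w = (\<lambda>a\<in>carrier A. pairing T v w (comult A a))"

definition conv_one :: "('r, 'a, 'p) bialg_scheme => ('r, 'c, 's) module_scheme => ('a => 'c)" where
 "conv_one A T = (\<lambda>a\<in>carrier A. counit A a \<odot>\<^sub>T \<one>\<^sub>T)"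

locale coalg_data =
 fixes R :: "('r, 'y) ring_scheme" and A :: "('r, 'a, 'p) bialg_scheme"
 assumes A: "module R A" and comult: "lmap R A (tensor R A A) (comult A)"
  and counit: "lmap R A (ring_as_module R) (counit A)"
begin

lemma R_cring: "cring R"
proof -
 interpret A: module R A by (rule A)
 show ?thesis by (rule A.R.cring_axioms)
qed

lemmas comult_closed = lin_closed[OF comult]

lemma conv_apply: "a <: A ==> conv A T v w a = pairing T v w (comult A a)"
 by (simp add: conv_def)

lemma conv_lin: "algebra R T ==> lmap R A T v ==> lmap R A T w ==> lmap R A T (conv A T v w)"
 unfolding conv_def by (rule lin_restrict[OF A lin_comp[OF comult lin_pairing[OF A A]]])

lemma conv_lin_hom: "algebra R T ==> lmap R A T v ==> lmap R A T w ==> conv A T v w \<in> lin_hom R A T"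
 unfolding lin_hom_iff by (simp add: conv_lin) (simp add: conv_def)

lemma conv_one_lin:
 assumes "algebra R T"
 shows "lmap R A T (conv_one A T)"
proof -
 interpret T: algebra R T by fact
 show ?thesis
  unfolding conv_one_def
  by (rule lin_restrict[OF A lin_smult_right[OF T.module counit]]) simp
qed

lemma conv_one_lin_hom: "algebra R T ==> conv_one A T \<in> lin_hom R A T"
 unfolding lin_hom_iff by (simp add: conv_one_lin) (simp add: conv_one_def)

lemma conv_cong:
 assumes "algebra R T" "lmap R A T v" "lmap R A T w"
  and "\<And>a. a <: A ==> v a = v' a" "\<And>a. a <: A ==> w a = w' a"
 shows "conv A T v w = conv A T v' w'"
 unfolding conv_def
 by (rule restrict_ext, rule pairing_cong[OF A A assms]) (auto simp: comult_closed)

lemma conv_nat: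
 assumes "algebra R T" "algebra R T'" "alg_map R T T' h" "lmap R A T v" "lmap R A T w" "a <: A"
 shows "conv A T' (\<lambda>a. h (v a)) (\<lambda>a. h (w a)) a = h (conv A T v w a)"
proof -
 note h = alg_map_lin[OF assms(3)]
 have "pairing T' (\<lambda>a. h (v a)) (\<lambda>a. h (w a)) X = h (pairing T v w X)" if "X <: tensor R A A" for X
  by (rule tmap_ext[OF A A lin_pairing lin_comp[OF lin_pairing h] _ that])
   (use assms lin_comp[OF _ h] in \<open>simp_all add: pairing_pure[OF A A assms(2) lin_comp[OF assms(4) h] lin_comp[OF assms(5) h]]
    pairing_pure[OF A A assms(1)] A alg_map_mult[OF assms(3)] lin_closed\<close>)
 then show ?thesis using assms(6) by (simp add: conv_apply comult_closed)
qed

lemma conv_one_nat: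
 assumes "algebra R T" "algebra R T'" "alg_map R T T' h" "a <: A"
 shows "conv_one A T' a = h (conv_one A T a)"
proof -
 interpret T: algebra R T by fact
 show ?thesis
  using assms(4) lin_closed[OF counit assms(4)] lin_smult[OF alg_map_lin[OF assms(3)], of "counit A a" "\<one>\<^sub>T"]
  by (simp add: conv_one_def alg_map_one[OF assms(3)] ring_as_module_def)
qed

lemma pairing_bilin:
 assumes T: "algebra R T" and X: "X <: tensor R A A" and v: "lmap R A T v" and w: "lmap R A T w"
 shows "lmap R A T v' ==> pairing T (\<lambda>a. v a \<oplus>\<^sub>T v' a) w X = pairing T v w X \<oplus>\<^sub>T pairing T v' w X"
  and "lmap R A T w' ==> pairing T v (\<lambda>a. w a \<oplus>\<^sub>T w' a) X = pairing T v w X \<oplus>\<^sub>T pairing T v w' X"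
  and "t <: T ==> pairing T (\<lambda>a. t \<otimes>\<^sub>T v a) w X = t \<otimes>\<^sub>T pairing T v w X"
  and "t <: T ==> pairing T v (\<lambda>a. t \<otimes>\<^sub>T w a) X = t \<otimes>\<^sub>T pairing T v w X"
proof -
 interpret T: algebra R T by fact
 note s = lin_sum[OF T.module] and t = lin_comp[OF _ bilin_right[OF bilin_mult[OF T]]]
 note p = lin_pairing[OF A A T] and pp = pairing_pure[OF A A T]
 show "pairing T (\<lambda>a. v a \<oplus>\<^sub>T v' a) w X = pairing T v w X \<oplus>\<^sub>T pairing T v' w X" if "lmap R A T v'"
  by (rule tmap_ext[OF A A p[OF s] s[OF p p] _ X])
   (use that v w in \<open>simp_all add: pp pp[OF s] lin_closed T.l_distr\<close>)
 show "pairing T v (\<lambda>a. w a \<oplus>\<^sub>T w' a) X = pairing T v w X \<oplus>\<^sub>T pairing T v w' X" if "lmap R A T w'"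
  by (rule tmap_ext[OF A A p[OF _ s] s[OF p p] _ X])
   (use that v w in \<open>simp_all add: pp pp[OF _ s] lin_closed T.r_distr\<close>)
 show "pairing T (\<lambda>a. t \<otimes>\<^sub>T v a) w X = t \<otimes>\<^sub>T pairing T v w X" if "t <: T"
  by (rule tmap_ext[OF A A p[OF t[OF v that] w] t[OF p[OF v w] that] _ X])
   (use that v w t[OF v that] in \<open>simp_all add: pp lin_closed T.m_assoc\<close>)
 show "pairing T v (\<lambda>a. t \<otimes>\<^sub>T w a) X = t \<otimes>\<^sub>T pairing T v w X" if "t <: T"
  by (rule tmap_ext[OF A A p[OF v t[OF w that]] t[OF p[OF v w] that] _ X])
   (use that v w t[OF w that] in \<open>simp_all add: pp lin_closed T.m_lcomm\<close>)
qed

text \<open>The map \<open>a \<otimes> (b \<otimes> c) \<mapsto> u a \<cdot> (v b \<cdot> w c)\<close> sees the two sides of coassociativity as the two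
 bracketings of a triple convolution.\<close>

lemma triple_pairing:
 assumes T: "algebra R T" and u: "lmap R A T u" and v: "lmap R A T v" and w: "lmap R A T w"
  and Z: "Z <: tensor R A A"
 shows "pairing T u (pairing T v w) (tensor_assoc R A A A (tmap R A A (tensor R A A) A (comult A) (\<lambda>y. y) Z))
      = pairing T (conv A T u v) w Z"
  and "pairing T u (pairing T v w) (rmap R A A (tensor R A A) (comult A) Z)
      = pairing T u (conv A T v w) Z"
proof -
 interpret T: algebra R T by fact
 note AA = module_tensor[OF A A]
 note p = lin_pairing[OF A A T] and pp = pairing_pure[OF A A T]
 note vw = p[OF v w] and uv = p[OF u v]
 note E = lin_pairing[OF A AA T u vw] and Ep = pairing_pure[OF A AA T u vw]
 note as = lin_tensor_assoc[OF A A A]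
 note m1 = lin_tensor_map[OF A A AA A comult lin_id] and m1p = tmap_pure[OF A A AA A comult lin_id]
 note m2 = lin_tensor_map[OF A A A AA lin_id comult] and m2p = tmap_pure[OF A A A AA lin_id comult]
 have 1: "pairing T u (pairing T v w) (tensor_assoc R A A A (tens R (tensor R A A) A X c)) = pairing T u v X \<otimes>\<^sub>T w c"
  if c: "c <: A" and X: "X <: tensor R A A" for X c
 proof (rule tmap_ext[OF A A _ _ _ X])
  show "lmap R (tensor R A A) T (\<lambda>X. pairing T u (pairing T v w) (tensor_assoc R A A A (tens R (tensor R A A) A X c)))"
   by (rule lin_comp[OF lin_comp[OF bilin_left[OF bilin_pure_tensor[OF AA A] c] as] E])
  show "lmap R (tensor R A A) T (\<lambda>X. pairing T u v X \<otimes>\<^sub>T w c)"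
   by (rule lin_comp[OF uv bilin_left[OF bilin_mult[OF T]]]) (use w c in \<open>simp add: lin_closed\<close>)
  show "pairing T u (pairing T v w) (tensor_assoc R A A A (tens R (tensor R A A) A (tens R A A x y) c))
    = pairing T u v (tens R A A x y) \<otimes>\<^sub>T w c" if "x <: A" "y <: A" for x y
   using that c u v w
   by (simp add: tensor_assoc_pure[OF A A A] Ep pp tens_closed[OF A A] lin_closed T.m_assoc)
 qed
 show "pairing T u (pairing T v w) (tensor_assoc R A A A (tmap R A A (tensor R A A) A (comult A) (\<lambda>y. y) Z))
      = pairing T (conv A T u v) w Z"
 proof (rule tmap_ext[OF A A lin_comp[OF lin_comp[OF m1 as] E] p[OF conv_lin[OF T u v] w] _ Z])
  fix x y assume "x <: A" "y <: A"
  then show "pairing T u (pairing T v w) (tensor_assoc R A A A (tmap R A A (tensor R A A) A (comult A) (\<lambda>y. y) (tens R A A x y)))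
   = pairing T (conv A T u v) w (tens R A A x y)"
   by (simp add: m1p 1 comult_closed pp[OF conv_lin[OF T u v] w] conv_apply)
 qed
 show "pairing T u (pairing T v w) (rmap R A A (tensor R A A) (comult A) Z)
      = pairing T u (conv A T v w) Z"
 proof (rule tmap_ext[OF A A lin_comp[OF m2 E] p[OF u conv_lin[OF T v w]] _ Z])
  fix x y assume "x <: A" "y <: A"
  then show "pairing T u (pairing T v w) (rmap R A A (tensor R A A) (comult A) (tens R A A x y))
   = pairing T u (conv A T v w) (tens R A A x y)"
   by (simp add: m2p Ep comult_closed pp[OF u conv_lin[OF T v w]] conv_apply)
 qed
qed

lemma pairing_swap:
 assumes T: "algebra R T" and v: "lmap R A T v" and w: "lmap R A T w" and Z: "Z <: tensor R A A"
 shows "pairing T v w (tensor_swap R A A Z) = pairing T w v Z"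
proof -
 interpret T: algebra R T by fact
 show ?thesis
  by (rule tmap_ext[OF A A lin_comp[OF lin_tensor_swap[OF A A] lin_pairing[OF A A T v w]]
     lin_pairing[OF A A T w v] _ Z])
   (use v w in \<open>simp add: tensor_swap_pure[OF A A] pairing_pure[OF A A T] lin_closed T.m_comm\<close>)
qed

text \<open>Pairing with the convolution unit collapses one leg by the counit. Thus the counit
  axioms turn into unit laws and, with enough functionals, conversely.\<close>

lemma pairing_counit:
 assumes T: "algebra R T" and w: "lmap R A T w" and Z: "Z <: tensor R A A"
 shows "pairing T (conv_one A T) w Z = w (tlift A (\<lambda>y z. counit A y \<odot>\<^sub>A z) Z)"
  and "pairing T w (conv_one A T) Z = w (tlift A (\<lambda>y z. counit A z \<odot>\<^sub>A y) Z)"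
proof -
 interpret T: algebra R T by fact
 interpret A: module R A by (rule A)
 have b: "bilin R A A A (\<lambda>y z. counit A y \<odot>\<^sub>A z)" by (rule bilin_comp[OF bilin_smult[OF A] counit lin_id])
 have b': "bilin R A A A (\<lambda>y z. counit A z \<odot>\<^sub>A y)" by (rule bilin_flip[OF b])
 note o = conv_one_lin[OF T]
 have cl: "counit A x <: R" if "x <: A" for x
  using lin_closed[OF counit that] by (simp add: ring_as_module_def)
 have co: "conv_one A T x = counit A x \<odot>\<^sub>T \<one>\<^sub>T" if "x <: A" for x
  using that by (simp add: conv_one_def)
 show "pairing T (conv_one A T) w Z = w (tlift A (\<lambda>y z. counit A y \<odot>\<^sub>A z) Z)"
  by (rule tmap_ext[OF A A lin_pairing[OF A A T o w] lin_comp[OF lin_tlift[OF A A A b] w] _ Z])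
   (use w cl in \<open>simp add: pairing_pure[OF A A T o] tlift_pure[OF A A A b] lin_closed lin_smult co T.smult_assoc2\<close>)
 show "pairing T w (conv_one A T) Z = w (tlift A (\<lambda>y z. counit A z \<odot>\<^sub>A y) Z)"
  by (rule tmap_ext[OF A A lin_pairing[OF A A T w o] lin_comp[OF lin_tlift[OF A A A b'] w] _ Z])
   (use w cl in \<open>simp add: pairing_pure[OF A A T w o] tlift_pure[OF A A A b'] lin_closed lin_smult co
     lin_smult[OF bilin_right[OF bilin_mult[OF T]]]\<close>)
qed

end

locale cocomm_coalg = coalg_data +
 assumes coalgebra: "coalgebra R A" and cocomm: "cocommutative R A"
begin

lemma conv_assoc:
 assumes "algebra R T" "lmap R A T u" "lmap R A T v" "lmap R A T w"
 shows "conv A T (conv A T u v) w = conv A T u (conv A T v w)"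
proof (rule ext)
 fix a
 show "conv A T (conv A T u v) w a = conv A T u (conv A T v w) a"
 proof (cases "a <: A")
  case True
  have "tensor_assoc R A A A (tmap R A A (tensor R A A) A (comult A) (\<lambda>y. y) (comult A a)) =
   rmap R A A (tensor R A A) (comult A) (comult A a)"
   using coalgebra True unfolding coalgebra_def by blast
  then show ?thesis
   using triple_pairing[OF assms comult_closed[OF True]] True by (simp add: conv_apply)
 qed (simp add: conv_def)
qed

lemma conv_comm:
 assumes "algebra R T" "lmap R A T v" "lmap R A T w"
 shows "conv A T v w = conv A T w v"
proof (rule ext)
 fix a
 show "conv A T v w a = conv A T w v a"
 proof (cases "a <: A")
  case True
  then have "tensor_swap R A A (comult A a) = comult A a" using cocomm unfolding cocommutative_def by blast
  then show ?thesis
   using pairing_swap[OF assms comult_closed[OF True]] True by (simp add: conv_apply)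
 qed (simp add: conv_def)
qed

lemma conv_unit:
 assumes "algebra R T" "w \<in> lin_hom R A T"
 shows "conv A T (conv_one A T) w = w"
proof (rule ext)
 fix a
 have w: "lmap R A T w" "w \<in> extensional (carrier A)" using assms(2) by (auto simp: lin_hom_iff)
 show "conv A T (conv_one A T) w a = w a"
 proof (cases "a <: A")
  case True
  then have "tlift A (\<lambda>y z. counit A y \<odot>\<^sub>A z) (comult A a) = a" using coalgebra unfolding coalgebra_def by blast
  then show ?thesis
   using pairing_counit(1)[OF assms(1) w(1) comult_closed[OF True]] True by (simp add: conv_apply)
 qed (use w in \<open>simp add: conv_def extensional_def\<close>)
qed

end

section \<open>Separation by functionals\<close>

lemma loc_proj_module: "loc_proj R A ==> module R A"
 by (simp add: loc_proj_def)

text \<open>A finite rank map fixing \<open>x\<close> and \<open>y\<close> takes values that depend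
  only on functionals.\<close>

lemma functionals_separate:
 assumes A: "loc_proj R A" and x: "x <: A" "y <: A"
  and eq: "\<And>\<xi>. lmap R A (ring_as_module R) \<xi> ==> \<xi> x = \<xi> y"
 shows "x = y"
proof -
 obtain d where d: "finrank R A d" "\<forall>p\<in>{x, y}. d p = p"
  using A x unfolding loc_proj_def by (metis empty_subsetI finite.emptyI finite.insertI insert_subset)
 have "d x = d y" using d(1) by induction (simp_all add: eq)
 then show ?thesis using d(2) by simp
qed

text \<open>Surjectivity of the associator suffices to move separation statements from (M \<otimes>
  N) \<otimes> P to M \<otimes> (N \<otimes> P), so an inverse is not constructed.\<close>

lemma tensor_assoc_surj:
 assumes "module R M" "module R N" "module R P" and Z: "Z <: tensor R M (tensor R N P)"
 shows "\<exists>Y\<in>carrier (tensor R (tensor R M N) P). tensor_assoc R M N P Y = Z"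
proof -
 note NP = module_tensor[OF assms(2,3)] and MN = module_tensor[OF assms(1,2)]
 interpret Q: module R "tensor R (tensor R M N) P" by (rule module_tensor[OF MN assms(3)])
 note as = lin_tensor_assoc[OF assms(1-3)] and ap = tensor_assoc_pure[OF assms(1-3)]
 show ?thesis
  using assms(1) NP Z
 proof (induction rule: tensor_induct)
  case (pure x Y)
  from assms(2,3) pure(2) show ?case
  proof (induction rule: tensor_induct)
   case (pure y z)
   then show ?case
    using \<open>x <: M\<close>
    by (intro bexI[of _ "tens R (tensor R M N) P (tens R M N x y) z"])
     (simp_all add: ap tens_closed[OF MN assms(3)] tens_closed[OF assms(1,2)])
  next
   case (add X Y)
   then obtain X' Y' where "X' <: tensor R (tensor R M N) P" "Y' <: tensor R (tensor R M N) P"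
    "tensor_assoc R M N P X' = tens R M (tensor R N P) x X"
    "tensor_assoc R M N P Y' = tens R M (tensor R N P) x Y" by blast
   then show ?case
    using add \<open>x <: M\<close> lin_add[OF bilin_right[OF bilin_pure_tensor[OF assms(1) NP]], of x X Y]
    by (intro bexI[of _ "X' \<oplus>\<^bsub>tensor R (tensor R M N) P\<^esub> Y'"]) (simp_all add: lin_add[OF as])
  qed
 next
  case (add X Y)
  then obtain X' Y' where "X' <: tensor R (tensor R M N) P" "Y' <: tensor R (tensor R M N) P"
   "tensor_assoc R M N P X' = X" "tensor_assoc R M N P Y' = Y" by blast
  then show ?case
   by (intro bexI[of _ "X' \<oplus>\<^bsub>tensor R (tensor R M N) P\<^esub> Y'"]) (simp_all add: lin_add[OF as])
 qed
qed

text \<open>Products of two functionals suffice to separate elements of S \<otimes> (A \<otimes> A):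
  after rebracketing, the two copies of \<open>A\<close> are contracted one at a time. This is the
  form that fits convolution, which knows A \<otimes> A only through such products.\<close>

lemma contract_pairing_separates:
 assumes S: "module R S" and A: "loc_proj R A"
  and Z: "Z <: tensor R S (tensor R A A)" "Z' <: tensor R S (tensor R A A)"
  and eq: "\<And>v w. lmap R A (ring_as_module R) v ==> lmap R A (ring_as_module R) w
   ==> contract S (pairing (ring_as_module R) v w) Z = contract S (pairing (ring_as_module R) v w) Z'"
 shows "Z = Z'"
proof -
 note mA = loc_proj_module[OF A]
 interpret A: module R A by (rule mA)
 interpret S: module R S by (rule S)
 note RR = algebra_ring_as_module[OF A.R.cring_axioms]
 note AA = module_tensor[OF mA mA] and SA = module_tensor[OF S mA]
 obtain Y Y' where Y: "Y <: tensor R (tensor R S A) A" "tensor_assoc R S A A Y = Z"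
  "Y' <: tensor R (tensor R S A) A" "tensor_assoc R S A A Y' = Z'"
  using tensor_assoc_surj[OF S mA mA] Z by meson
 have c: "contract S v (contract (tensor R S A) w Y) = contract S (pairing (ring_as_module R) v w) (tensor_assoc R S A A Y)"
  if v: "lmap R A (ring_as_module R) v" and w: "lmap R A (ring_as_module R) w"
   and Y: "Y <: tensor R (tensor R S A) A" for v w Y
 proof (rule tmap_ext[OF SA mA _ _ _ Y])
  note p = lin_pairing[OF mA mA RR v w]
  note cS = lin_contract[OF S AA p] and cv = lin_contract[OF S mA v] and cw = lin_contract[OF SA mA w]
  show "lmap R (tensor R (tensor R S A) A) S (\<lambda>Y. contract S v (contract (tensor R S A) w Y))"
   by (rule lin_comp[OF cw cv])
  show "lmap R (tensor R (tensor R S A) A) S (\<lambda>Y. contract S (pairing (ring_as_module R) v w) (tensor_assoc R S A A Y))"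
   by (rule lin_comp[OF lin_tensor_assoc[OF S mA mA] cS])
  fix X b assume X: "X <: tensor R S A" and b: "b <: A"
  show "contract S v (contract (tensor R S A) w (tens R (tensor R S A) A X b)) =
    contract S (pairing (ring_as_module R) v w) (tensor_assoc R S A A (tens R (tensor R S A) A X b))"
  proof (rule tmap_ext[OF S mA _ _ _ X])
   note b' = bilin_left[OF bilin_pure_tensor[OF SA mA] b]
   show "lmap R (tensor R S A) S (\<lambda>X. contract S v (contract (tensor R S A) w (tens R (tensor R S A) A X b)))"
    by (rule lin_comp[OF b' lin_comp[OF cw cv]])
   show "lmap R (tensor R S A) S (\<lambda>X. contract S (pairing (ring_as_module R) v w) (tensor_assoc R S A A (tens R (tensor R S A) A X b)))"
    by (rule lin_comp[OF lin_comp[OF b' lin_tensor_assoc[OF S mA mA]] cS])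
   fix s a assume s: "s <: S" and a: "a <: A"
   have wb: "w b <: R" and va: "v a <: R"
    using lin_closed[OF w b] lin_closed[OF v a] by (simp_all add: ring_as_module_def)
   have r: "v a \<otimes>\<^bsub>ring_as_module R\<^esub> w b = w b \<otimes>\<^sub>R v a"
    using wb va by (simp add: ring_as_module_def A.R.m_comm)
   show "contract S v (contract (tensor R S A) w (tens R (tensor R S A) A (tens R S A s a) b)) =
    contract S (pairing (ring_as_module R) v w) (tensor_assoc R S A A (tens R (tensor R S A) A (tens R S A s a) b))"
    using s a b wb va
    by (simp add: contract_pure[OF SA mA w] tensor_assoc_pure[OF S mA mA] contract_pure[OF S AA p]
      tens_closed[OF mA mA] tens_closed[OF S mA] pairing_pure[OF mA mA RR v w]
      lin_smult[OF cv] contract_pure[OF S mA v] r S.smult_assoc1)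
  qed
 qed
 have "Y = Y'"
 proof (rule contract_separates[OF SA A Y(1,3)])
  fix w assume w: "lmap R A (ring_as_module R) w"
  show "contract (tensor R S A) w Y = contract (tensor R S A) w Y'"
  proof (rule contract_separates[OF S A])
   show "contract (tensor R S A) w Y <: tensor R S A" "contract (tensor R S A) w Y' <: tensor R S A"
    using lin_closed[OF lin_contract[OF SA mA w]] Y by auto
   show "contract S v (contract (tensor R S A) w Y) = contract S v (contract (tensor R S A) w Y')"
    if "lmap R A (ring_as_module R) v" for v
    using c[OF that w Y(1)] c[OF that w Y(3)] eq[OF that w] Y by simp
  qed
 qed
 then show ?thesis using Y by auto
qed

text \<open>A product of functionals is a contraction followed by a functional. With
  \<open>functionals_separate\<close> it reduces equations between tensors to scalar equations
  between pairings.\<close>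

lemma pairing_contract:
 assumes A: "module R A" and B: "module R B" and u: "lmap R A (ring_as_module R) u" and g: "lmap R B (ring_as_module R) g"
  and Z: "Z <: tensor R A B"
 shows "pairing (ring_as_module R) u g Z = u (contract A g Z)"
proof -
 interpret A: module R A by fact
 note RR = algebra_ring_as_module[OF A.R.cring_axioms]
 show ?thesis
 proof (rule tmap_ext[OF A B lin_pairing[OF A B RR u g] lin_comp[OF lin_contract[OF A B g] u] _ Z])
  fix x y assume a: "x <: A" "y <: B"
  have "g y <: R" "u x <: R"
   using lin_closed[OF g a(2)] lin_closed[OF u a(1)] by (simp_all add: ring_as_module_def)
  then show "pairing (ring_as_module R) u g (tens R A B x y) = u (contract A g (tens R A B x y))"
   using a by (simp add: pairing_pure[OF A B RR u g] contract_pure[OF A B g] lin_smult[OF u])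
    (simp add: ring_as_module_def A.R.m_comm)
 qed
qed

section \<open>Modules with the same underlying data\<close>

text \<open>Tensor products as modules, linear maps and coalgebra axioms depend on these four fields
  alone. The relation is used when coalgebra data are added to a module and when the multiplication
  of a record is replaced.\<close>

definition same_mod :: "('r, 'a, 'p) module_scheme => ('r, 'a, 'q) module_scheme => bool" where
 "same_mod M M' \<longleftrightarrow> carrier M = carrier M' \<and> add M = add M' \<and> zero M = zero M' \<and> smult M = smult M'"

lemma same_mod_refl: "same_mod M M"
 by (simp add: same_mod_def)

lemma same_mod_sym: "same_mod M M' ==> same_mod M' M"
 by (simp add: same_mod_def)

lemma same_mod_linmap:
 "same_mod M M' ==> same_mod N N' ==> lmap R M N = lmap R M' N'"
 by (simp add: same_mod_def lmap_def fun_eq_iff)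

lemma same_mod_lin_hom: "same_mod M M' ==> same_mod N N' ==> lin_hom R M N = lin_hom R M' N'"
 by (simp add: same_mod_def lin_hom_def)

lemma same_mod_tlift: "same_mod M M' ==> tlift M = tlift M'"
 by (rule tensor_lift_monoid_cong) (simp_all add: same_mod_def)

lemma same_mod_tensor_group: "same_mod M M' ==> same_mod N N' ==> tensor_group R M N = tensor_group R M' N'"
 by (simp add: same_mod_def tensor_group_def tensor_kernel_def tensor_relators_def)

lemma same_mod_pure_tensor: "same_mod M M' ==> same_mod N N' ==> tens R M N = tens R M' N'"
 by (simp add: same_mod_def pure_tensor_def tensor_kernel_def tensor_relators_def fun_eq_iff)

lemma same_mod_tensor: "same_mod M M' ==> same_mod N N' ==> same_mod (tensor R M N) (tensor R M' N')"
 using same_mod_tensor_group[of M M' N N' R] same_mod_pure_tensor[of M M' N N' R]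
 by (simp add: same_mod_def tensor_def)

lemma same_mod_carrier_tensor: "same_mod M M' ==> same_mod N N' ==> carrier (tensor R M N) = carrier (tensor R M' N')"
 using same_mod_tensor[of M M' N N' R] by (simp add: same_mod_def)

lemma same_mod_tensor_map:
 assumes "same_mod M M1" "same_mod N N1" "same_mod M' M1'" "same_mod N' N1'"
 shows "tmap R M N M' N' = tmap R M1 N1 M1' N1'"
 unfolding tensor_map_def same_mod_tensor_group[OF assms(3,4)] same_mod_pure_tensor[OF assms(3,4)]
  same_mod_carrier_tensor[OF assms(1,2)] ..

lemma same_mod_tensor_swap:
 assumes "same_mod M M1" "same_mod N N1"
 shows "tensor_swap R M N = tensor_swap R M1 N1"
 unfolding tensor_swap_def same_mod_tensor_group[OF assms(2,1)] same_mod_pure_tensor[OF assms(2,1)] ..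

lemma same_mod_tensor_assoc:
 assumes "same_mod M M1" "same_mod N N1" "same_mod P P1"
 shows "tensor_assoc R M N P = tensor_assoc R M1 N1 P1"
 unfolding tensor_assoc_def same_mod_tensor_group[OF assms(1) same_mod_tensor[OF assms(2,3)]]
  same_mod_pure_tensor[OF assms(1) same_mod_tensor[OF assms(2,3)]] same_mod_pure_tensor[OF assms(2,3)] ..

lemma same_mod_module:
 assumes "same_mod M M'" "module R M"
 shows "module R M'"
proof -
 interpret M: module R M by fact
 have e: "carrier M' = carrier M" "add M' = add M" "zero M' = zero M" "smult M' = smult M"
  using assms(1) by (simp_all add: same_mod_def)
 have "abelian_group M'"
  by (rule abelian_groupI) (auto simp: e M.M.add.m_ac intro: bexI[of _ "\<ominus>\<^sub>M x" for x] M.l_neg)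
 then show ?thesis
  by (rule moduleI[OF M.R.cring_axioms]) (auto simp: e M.smult_l_distr M.smult_r_distr M.smult_assoc1)
qed

lemma same_mod_projective:
 assumes "same_mod M M'" "projective_module R M"
 shows "projective_module R M'"
proof -
 have c: "carrier M = carrier M'" using assms(1) by (simp add: same_mod_def)
 have m: "module R M" using assms(2) by (simp add: projective_module_def)
 show ?thesis
  using assms(2) same_mod_module[OF assms(1) m]
  unfolding projective_module_def c same_mod_lin_hom[OF assms(1) same_mod_refl]
  by (elim conjE) (intro conjI)
qed

lemma same_mod_loc_proj:
 assumes e: "same_mod M M'" and "loc_proj R M"
 shows "loc_proj R M'"
proof -
 have d: "carrier M = carrier M'" "smult M = smult M'" "add M = add M'" using e by (simp_all add: same_mod_def)
 have "finrank R M' f" if "finrank R M f" for f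
  using that
 proof induction
  case (rank1 \<xi> x)
  then show ?case
   using finrank.rank1[of R M' \<xi> x] same_mod_linmap[OF e same_mod_refl, of R "ring_as_module R"] d by simp
 next
  case (sum f g)
  then show ?case using finrank.sum[of R M' f g] d by simp
 qed
 then show ?thesis
  using assms(2) same_mod_module[OF e, of R] unfolding loc_proj_def d(1) by blast
qed

lemma same_mod_coalgebra:
 assumes e: "same_mod A A'" and c: "comult A = comult A'" "counit A = counit A'" and co: "coalgebra R A"
 shows "coalgebra R A'"
proof -
 note eAA = same_mod_tensor[OF e e]
 have m: "module R A" using co by (simp add: coalgebra_def)
 have d: "carrier A = carrier A'" "smult A = smult A'" using e by (simp_all add: same_mod_def)
 show ?thesis
  using co same_mod_module[OF e m]
  unfolding coalgebra_def same_mod_tlift[OF e]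
  unfolding c d same_mod_lin_hom[OF e eAA] same_mod_lin_hom[OF e same_mod_refl, of R "ring_as_module R"]
   same_mod_tensor_assoc[OF e e e] same_mod_tensor_map[OF e e eAA e] same_mod_tensor_map[OF e e e eAA]
  by (elim conjE) (intro conjI)
qed

lemma same_mod_cocommutative:
 assumes e: "same_mod A A'" and c: "comult A = comult A'" and co: "cocommutative R A"
 shows "cocommutative R A'"
 using co e c same_mod_tensor_swap[OF e e, of R] unfolding cocommutative_def by (simp add: same_mod_def)

section \<open>Duality between coalgebras and functors of algebras\<close>

text \<open>Removes the coalgebra fields, since \<open>dual_functor\<close> and the definition of
  formal schemes take plain modules.\<close>

definition mod_of :: "('r, 'a, 'p) module_scheme => ('r, 'a) module" where
 "mod_of A = \<lparr>carrier = carrier A, mult = mult A, one = one A, zero = zero A, add = add A, smult = smult A\<rparr>"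

lemma same_mod_mod_of: "same_mod A (mod_of A)"
 by (simp add: same_mod_def mod_of_def)

lemma mod_of_simps:
 "carrier (mod_of A) = carrier A" "lin_hom R (mod_of A) N = lin_hom R A N"
 by (simp_all add: mod_of_def lin_hom_def)

lemma comm_algs_simps:
 "Ob (comm_algs R) = {S. algebra R S}" "Mor (comm_algs R) = alg_hom R"
 "Ident (comm_algs R) S = (\<lambda>x\<in>carrier S. x)" "Cmp (comm_algs R) S T U g f = compose (carrier S) g f"
 by (simp_all add: comm_algs_def)

lemma dual_functor_simps:
 "carrier (on_ob (dual_functor R A m e) S) = lin_hom R A S"
 "mult (on_ob (dual_functor R A m e) S) = m S"
 "one (on_ob (dual_functor R A m e) S) = e S"
 "zero (on_ob (dual_functor R A m e) S) = (\<lambda>a\<in>carrier A. \<zero>\<^sub>S)"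
 "add (on_ob (dual_functor R A m e) S) = (\<lambda>v w. \<lambda>a\<in>carrier A. v a \<oplus>\<^sub>S w a)"
 "smult (on_ob (dual_functor R A m e) S) = (\<lambda>s w. \<lambda>a\<in>carrier A. s \<otimes>\<^sub>S w a)"
 "on_mor (dual_functor R A m e) S T h = (\<lambda>w\<in>lin_hom R A S. compose (carrier A) h w)"
 by (simp_all add: dual_functor_def)

lemma lin_hom_ext:
 "v \<in> lin_hom R A S ==> w \<in> lin_hom R A S ==> (\<And>a. a <: A ==> v a = w a) ==> v = w"
 by (auto simp: lin_hom_iff intro: extensionalityI)

lemma compose_lin_hom:
 "module R A ==> w \<in> lin_hom R A S ==> lmap R S T h ==> compose (carrier A) h w \<in> lin_hom R A T"
 unfolding compose_def by (rule restrict_lin_hom) (auto simp: lin_hom_iff intro: lin_comp)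

locale universe_coalg = cocomm_coalg R A
 for R :: "('u, 'y) ring_scheme" and A :: "('u, 'u, 'p) bialg_scheme"
begin

abbreviation "DF \<equiv> dual_functor R (mod_of A) (conv A) (conv_one A)"

lemma algebra_dual:
 assumes S: "algebra R S"
 shows "algebra S (on_ob DF S)"
proof -
 interpret A: module R A by (rule A)
 interpret S: algebra R S by (rule S)
 let ?F = "on_ob DF S"
 note simps = dual_functor_simps mod_of_simps
 note L = lin_hom_iff[of _ R A S]
 note r = restrict_lin_hom[OF A]
 have add: "(\<lambda>a\<in>carrier A. v a \<oplus>\<^sub>S w a) \<in> lin_hom R A S" if "v \<in> lin_hom R A S" "w \<in> lin_hom R A S" for v w
  using that by (intro r lin_sum[OF S.module]) (auto simp: L)
 have sm: "(\<lambda>a\<in>carrier A. s \<otimes>\<^sub>S v a) \<in> lin_hom R A S" if "v \<in> lin_hom R A S" "s <: S" for v s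
  using that by (intro r lin_comp[OF _ bilin_right[OF bilin_mult[OF S]]]) (auto simp: L)
 have zero: "(\<lambda>a\<in>carrier A. \<zero>\<^sub>S) \<in> lin_hom R A S"
  by (intro r lin_const_zero[OF S.module])
 have cl: "v a <: S" if "v \<in> lin_hom R A S" "a <: A" for v a
  using that by (auto simp: L lin_closed)
 have ext: "v \<in> extensional (carrier A)" if "v \<in> lin_hom R A S" for v using that by (simp add: L)
 have ab: "abelian_group ?F"
 proof (rule abelian_groupI)
  fix x assume "x <: ?F"
  then have x: "x \<in> lin_hom R A S" by (simp add: simps)
  show "\<exists>y\<in>carrier ?F. y \<oplus>\<^bsub>?F\<^esub> x = \<zero>\<^bsub>?F\<^esub>"
   using sm[OF x, of "\<ominus>\<^sub>S \<one>\<^sub>S"] cl[OF x]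
   by (intro bexI[of _ "\<lambda>a\<in>carrier A. \<ominus>\<^sub>S \<one>\<^sub>S \<otimes>\<^sub>S x a"])
    (auto simp: simps S.l_minus S.l_neg cong: restrict_cong)
 qed (auto simp: simps add zero cl S.a_ac intro!: restrict_ext extensionalityI[OF _ ext])
 have lin: "lmap R A S v" if "v \<in> lin_hom R A S" for v using that by (simp add: L)
 have cm: "Group.comm_monoid ?F"
  by (rule comm_monoidI)
   (auto simp: simps lin conv_lin_hom[OF S] conv_one_lin_hom[OF S] conv_assoc[OF S] conv_unit[OF S] intro: conv_comm[OF S])
 have cla: "conv A S (\<lambda>a\<in>carrier A. u a \<oplus>\<^sub>S v a) w a = conv A S u w a \<oplus>\<^sub>S conv A S v w a"
  if "u \<in> lin_hom R A S" "v \<in> lin_hom R A S" "w \<in> lin_hom R A S" "a <: A" for u v w a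
  using conv_cong[OF S lin[OF add[OF that(1,2)]] lin[OF that(3)], of "\<lambda>a. u a \<oplus>\<^sub>S v a" w]
   pairing_bilin(1)[OF S comult_closed[OF that(4)] lin[OF that(1)] lin[OF that(3)] lin[OF that(2)]] that
  by (simp add: conv_apply)
 have csm: "conv A S (\<lambda>a\<in>carrier A. s \<otimes>\<^sub>S v a) w a = s \<otimes>\<^sub>S conv A S v w a"
  if "s <: S" "v \<in> lin_hom R A S" "w \<in> lin_hom R A S" "a <: A" for s v w a
  using conv_cong[OF S lin[OF sm[OF that(2,1)]] lin[OF that(3)], of "\<lambda>a. s \<otimes>\<^sub>S v a" w]
   pairing_bilin(3)[OF S comult_closed[OF that(4)] lin[OF that(2)] lin[OF that(3)] that(1)] that
  by (simp add: conv_apply)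
 have cr: "cring ?F"
 proof (rule cringI[OF ab cm])
  fix x y z assume "x <: ?F" "y <: ?F" "z <: ?F"
  then have x: "x \<in> lin_hom R A S" "y \<in> lin_hom R A S" "z \<in> lin_hom R A S" by (simp_all add: simps)
  show "(x \<oplus>\<^bsub>?F\<^esub> y) \<otimes>\<^bsub>?F\<^esub> z = x \<otimes>\<^bsub>?F\<^esub> z \<oplus>\<^bsub>?F\<^esub> y \<otimes>\<^bsub>?F\<^esub> z"
   unfolding simps
   by (rule lin_hom_ext[of _ R A S])
    (use x in \<open>auto simp: cla add lin conv_lin_hom[OF S]\<close>)
 qed
 show ?thesis
 proof (rule algebraI[OF S.M_cring cr])
  fix s x y assume "s <: S" "x <: ?F" "y <: ?F"
  then have x: "s <: S" "x \<in> lin_hom R A S" "y \<in> lin_hom R A S" by (simp_all add: simps)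
  show "(s \<odot>\<^bsub>?F\<^esub> x) \<otimes>\<^bsub>?F\<^esub> y = s \<odot>\<^bsub>?F\<^esub> (x \<otimes>\<^bsub>?F\<^esub> y)"
   unfolding simps
   by (rule lin_hom_ext[of _ R A S])
    (use x in \<open>auto simp: csm sm lin conv_lin_hom[OF S]\<close>)
 qed (auto simp: simps sm add cl S.l_distr S.r_distr S.m_assoc intro!: restrict_ext extensionalityI[OF _ ext])
qed

lemma comm_algebra_functor_dual: "comm_algebra_functor R DF"
proof -
 note simps = dual_functor_simps mod_of_simps comm_algs_simps
 have comp: "compose (carrier A) h w \<in> lin_hom R A T" if "h \<in> alg_hom R S T" "w \<in> lin_hom R A S" for S T h w
  by (rule compose_lin_hom[OF A that(2)]) (use that(1) in \<open>simp add: alg_hom_iff alg_map_def\<close>)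
 have fnc: "is_functor (comm_algs R) set_cat (carrier_functor DF)"
  unfolding is_functor_def
 proof (intro conjI ballI)
  fix S T U f g
  assume S: "S \<in> Ob (comm_algs R)" "T \<in> Ob (comm_algs R)" "U \<in> Ob (comm_algs R)"
   and f: "f \<in> Mor (comm_algs R) S T" and g: "g \<in> Mor (comm_algs R) T U"
  show "on_mor (carrier_functor DF) S U (Cmp (comm_algs R) S T U g f) =
    Cmp set_cat (on_ob (carrier_functor DF) S) (on_ob (carrier_functor DF) T) (on_ob (carrier_functor DF) U)
     (on_mor (carrier_functor DF) T U g) (on_mor (carrier_functor DF) S T f)"
   using f comp[of f S T]
   by (auto simp: simps carrier_functor_def set_cat_def compose_def fun_eq_iff lin_hom_iff lin_closed)
 next
  fix S assume "S \<in> Ob (comm_algs R)"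
  show "on_mor (carrier_functor DF) S S (Ident (comm_algs R) S) = Ident set_cat (on_ob (carrier_functor DF) S)"
   by (auto simp: simps carrier_functor_def set_cat_def compose_def fun_eq_iff lin_hom_iff lin_closed extensional_def)
 next
  fix S T f assume "f \<in> Mor (comm_algs R) S T"
  then show "on_mor (carrier_functor DF) S T f \<in> Mor set_cat (on_ob (carrier_functor DF) S) (on_ob (carrier_functor DF) T)"
   using comp by (auto simp: simps carrier_functor_def set_cat_def)
 qed (auto simp: set_cat_def)
 show ?thesis
  unfolding comm_algebra_functor_def
 proof (intro conjI ballI fnc)
  show "algebra S (on_ob DF S)" if "S \<in> Ob (comm_algs R)" for S
   using algebra_dual that by (simp add: simps)
  fix S T h assume "S \<in> Ob (comm_algs R)" "T \<in> Ob (comm_algs R)" and "h \<in> Mor (comm_algs R) S T"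
  then have S: "algebra R S" and T: "algebra R T" and h: "h \<in> alg_hom R S T" by (simp_all add: simps)
  have hm: "alg_map R S T h" using h by (simp add: alg_hom_iff)
  note hl = alg_map_lin[OF hm]
  interpret A: module R A by (rule A)
  have lin: "lmap R A S v" if "v \<in> lin_hom R A S" for v using that by (simp add: lin_hom_iff)
  have c1: "compose (carrier A) h (conv A S x y) = conv A T (compose (carrier A) h x) (compose (carrier A) h y)"
   if "x \<in> lin_hom R A S" "y \<in> lin_hom R A S" for x y
  proof (rule lin_hom_ext[of _ R A T])
   show "compose (carrier A) h (conv A S x y) \<in> lin_hom R A T"
    by (rule comp[OF h conv_lin_hom[OF S]]) (use that lin in auto)
   show "conv A T (compose (carrier A) h x) (compose (carrier A) h y) \<in> lin_hom R A T"
    by (rule conv_lin_hom[OF T]) (use that comp[OF h] in \<open>auto simp: lin_hom_iff\<close>)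
   fix a assume a: "a <: A"
   have "conv A T (\<lambda>a. h (x a)) (\<lambda>a. h (y a)) = conv A T (compose (carrier A) h x) (compose (carrier A) h y)"
    by (rule conv_cong[OF T lin_comp[OF lin hl] lin_comp[OF lin hl]]) (use that in \<open>auto simp: compose_def\<close>)
   then show "compose (carrier A) h (conv A S x y) a = conv A T (compose (carrier A) h x) (compose (carrier A) h y) a"
    using conv_nat[OF S T hm lin lin a, of x y] that a by (simp add: compose_def)
  qed
  have c2: "compose (carrier A) h (conv_one A S) = conv_one A T"
   by (rule lin_hom_ext[of _ R A T])
    (use comp[OF h conv_one_lin_hom[OF S]] conv_one_lin_hom[OF T] conv_one_nat[OF S T hm] in \<open>auto simp: compose_def\<close>)
  interpret S: algebra R S by (rule S)
  have sum: "(\<lambda>a\<in>carrier A. x a \<oplus>\<^sub>S y a) \<in> lin_hom R A S" if "x \<in> lin_hom R A S" "y \<in> lin_hom R A S" for x y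
   by (rule restrict_lin_hom[OF A lin_sum[OF S.module]]) (use that lin in auto)
  have sm: "(\<lambda>a\<in>carrier A. s \<otimes>\<^sub>S v a) \<in> lin_hom R A S" if "v \<in> lin_hom R A S" "s <: S" for v s
   by (rule restrict_lin_hom[OF A lin_comp[OF _ bilin_right[OF bilin_mult[OF S]]]]) (use that lin in auto)
  have c3: "compose (carrier A) h (\<lambda>a\<in>carrier A. x a \<oplus>\<^sub>S y a)
    = (\<lambda>a\<in>carrier A. compose (carrier A) h x a \<oplus>\<^sub>T compose (carrier A) h y a)"
   if "x \<in> lin_hom R A S" "y \<in> lin_hom R A S" for x y
   using lin[OF that(1)] lin[OF that(2)]
   by (auto simp: compose_def fun_eq_iff lin_closed lin_add[OF hl])
  show "on_mor DF S T h \<in> ring_hom (on_ob DF S) (on_ob DF T)"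
   unfolding ring_hom_def
   using comp[OF h] lin
   by (auto simp: simps c1 c2 c3 sum conv_lin_hom[OF S] conv_one_lin_hom[OF S])
  fix s x assume "s <: S" "x <: on_ob DF S"
  then show "on_mor DF S T h (s \<odot>\<^bsub>on_ob DF S\<^esub> x) = h s \<odot>\<^bsub>on_ob DF T\<^esub> on_mor DF S T h x"
   by (auto simp: simps sm compose_def fun_eq_iff lin_closed[OF lin] alg_map_mult[OF hm])
 qed
qed

end

definition mk_bialg :: "('r, 'a, 'p) module_scheme => ('a => ('a, 'a) tensor_elt) => ('a => 'r) => ('r, 'a) bialg" where
 "mk_bialg A \<Delta> \<epsilon> = \<lparr>carrier = carrier A, mult = mult A, one = one A, zero = zero A, add = add A, smult = smult A,
   comult = \<Delta>, counit = \<epsilon>\<rparr>"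

lemma same_mod_mk_bialg: "same_mod A (mk_bialg A \<Delta> \<epsilon>)"
 by (simp add: same_mod_def mk_bialg_def)

lemma mk_bialg_simps: "carrier (mk_bialg A \<Delta> \<epsilon>) = carrier A" "comult (mk_bialg A \<Delta> \<epsilon>) = \<Delta>" "counit (mk_bialg A \<Delta> \<epsilon>) = \<epsilon>"
 by (simp_all add: mk_bialg_def)

text \<open>The bilinear multiplication is represented by a comultiplication. Each coalgebra axiom
  is an equation of tensors, so it can be tested on functionals with values in \<open>R\<close>,
  where it is the corresponding law of the algebra A*(R).\<close>

lemma coalgebra_of_dual:
 fixes R :: "('u, 'y) ring_scheme" and A :: "'u md"
 assumes inf: "infinite (UNIV :: 'u set)" and R: "cring R" and pr: "loc_proj R A"
  and F: "comm_algebra_functor R (dual_functor R A m e)"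
 shows "\<exists>B :: ('u, 'u) bialg. same_mod A B \<and> cocomm_coalg R B \<and>
  (\<forall>T v w. algebra R T --> v \<in> lin_hom R A T --> w \<in> lin_hom R A T --> m T v w = conv B T v w) \<and>
  (\<forall>T. algebra R T --> e T = conv_one B T)"
proof -
 let ?F = "dual_functor R A m e"
 let ?R = "ring_as_module R"
 note simps = dual_functor_simps comm_algs_simps
 note A = loc_proj_module[OF pr]
 have alg: "algebra T (on_ob ?F T)" if "algebra R T" for T :: "'u md"
  using F that unfolding comm_algebra_functor_def by (simp add: simps)
 have rh: "on_mor ?F S T h \<in> ring_hom (on_ob ?F S) (on_ob ?F T)"
  if "algebra R S" "algebra R T" "h \<in> alg_hom R S T" for S T :: "'u md" and h
  using F that unfolding comm_algebra_functor_def by (simp add: simps)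
 have cl: "m T v w \<in> lin_hom R A T" if "algebra R T" "v \<in> lin_hom R A T" "w \<in> lin_hom R A T" for T :: "'u md" and v w
 proof -
  interpret F: algebra T "on_ob ?F T" by (rule alg[OF that(1)])
  show ?thesis using F.m_closed[of v w] that by (simp add: simps)
 qed
 have comm: "m T v w = m T w v" if "algebra R T" "v \<in> lin_hom R A T" "w \<in> lin_hom R A T" for T :: "'u md" and v w
 proof -
  interpret F: algebra T "on_ob ?F T" by (rule alg[OF that(1)])
  show ?thesis using F.m_comm[of v w] that by (simp add: simps)
 qed
 have assoc: "m T (m T u v) w = m T u (m T v w)" if "algebra R T" "u \<in> lin_hom R A T" "v \<in> lin_hom R A T" "w \<in> lin_hom R A T" for T :: "'u md" and u v w
 proof -
  interpret F: algebra T "on_ob ?F T" by (rule alg[OF that(1)])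
  show ?thesis using F.m_assoc[of u v w] that by (simp add: simps)
 qed
 have ecl: "e T \<in> lin_hom R A T" if "algebra R T" for T :: "'u md"
 proof -
  interpret F: algebra T "on_ob ?F T" by (rule alg[OF that(1)])
  show ?thesis using F.one_closed by (simp add: simps)
 qed
 have unit: "m T (e T) w = w" "m T w (e T) = w" if "algebra R T" "w \<in> lin_hom R A T" for T :: "'u md" and w
 proof -
  interpret F: algebra T "on_ob ?F T" by (rule alg[OF that(1)])
  show "m T (e T) w = w" "m T w (e T) = w" using F.l_one[of w] F.r_one[of w] that by (simp_all add: simps)
 qed
 have sl: "m T (\<lambda>a\<in>carrier A. t \<otimes>\<^sub>T v a) w = (\<lambda>a\<in>carrier A. t \<otimes>\<^sub>T m T v w a)"
  if "algebra R T" "v \<in> lin_hom R A T" "w \<in> lin_hom R A T" "t <: T" for T :: "'u md" and v w t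
 proof -
  interpret F: algebra T "on_ob ?F T" by (rule alg[OF that(1)])
  show ?thesis using F.smult_assoc2[of t v w] that by (simp add: simps)
 qed
 have sc: "(\<lambda>a\<in>carrier A. t \<otimes>\<^sub>T v a) \<in> lin_hom R A T" if "algebra R T" "v \<in> lin_hom R A T" "t <: T" for T :: "'u md" and v t
 proof -
  interpret F: algebra T "on_ob ?F T" by (rule alg[OF that(1)])
  show ?thesis using F.smult_closed[of t v] that by (simp add: simps)
 qed
 have sr: "m T v (\<lambda>a\<in>carrier A. t \<otimes>\<^sub>T w a) = (\<lambda>a\<in>carrier A. t \<otimes>\<^sub>T m T v w a)"
  if "algebra R T" "v \<in> lin_hom R A T" "w \<in> lin_hom R A T" "t <: T" for T :: "'u md" and v w t
  using comm[OF that(1,2) sc[OF that(1,3,4)]] sl[OF that(1,3,2,4)] comm[OF that(1-3)] by simp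
 have comp: "compose (carrier A) h w \<in> lin_hom R A T" if "h \<in> alg_hom R S T" "w \<in> lin_hom R A S" for S T :: "'u md" and h w
  by (rule compose_lin_hom[OF A that(2)]) (use that(1) in \<open>simp add: alg_hom_iff alg_map_def\<close>)
 have nat: "m T' (compose (carrier A) h v) (compose (carrier A) h w) = compose (carrier A) h (m T v w)"
  if "algebra R T" "algebra R T'" "h \<in> alg_hom R T T'" "v \<in> lin_hom R A T" "w \<in> lin_hom R A T" for T T' :: "'u md" and h v w
  using ring_hom_mult[OF rh[OF that(1-3)], of v w] that cl[OF that(1,4,5)] by (simp add: simps)
 obtain \<Delta> where \<Delta>: "lmap R A (tensor R A A) \<Delta>"
  and m\<Delta>: "\<And>T v w a. algebra R T ==> v \<in> lin_hom R A T ==> w \<in> lin_hom R A T ==> a <: A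
   ==> m T v w a = tlift T (\<lambda>a b. v a \<otimes>\<^sub>T w b) (\<Delta> a)"
  by (rule bilinear_representable[of R A m, OF inf A cl sl sr nat], assumption+, rule that)
 \<comment> \<open>The unit over \<open>R\<close> itself is a functional on \<open>A\<close>; it is
   the counit.\<close>
 define \<epsilon> where "\<epsilon> = e ?R"
 define \<Delta>' where "\<Delta>' = restrict \<Delta> (carrier A)"
 have RR: "algebra R ?R" by (rule algebra_ring_as_module[OF R])
 have \<epsilon>: "\<epsilon> \<in> lin_hom R A ?R" unfolding \<epsilon>_def by (rule ecl[OF RR])
 have \<Delta>': "\<Delta>' \<in> lin_hom R A (tensor R A A)" unfolding \<Delta>'_def by (rule restrict_lin_hom[OF A \<Delta>])
 let ?B = "mk_bialg A \<Delta>' \<epsilon>"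
 note sB = same_mod_mk_bialg[of A \<Delta>' \<epsilon>]
 note sB' = same_mod_sym[OF sB]
 have BL: "lin_hom R ?B T = lin_hom R A T" for T :: "'u md"
  by (rule same_mod_lin_hom[OF sB' same_mod_refl])
 have Bl: "lmap R ?B T = lmap R A T" for T :: "'u md"
  by (rule same_mod_linmap[OF sB' same_mod_refl])
 have B: "module R ?B" by (rule same_mod_module[OF sB A])
 have BLl: "lin_hom R ?B (tensor R ?B ?B) = lin_hom R A (tensor R A A)"
  by (rule same_mod_lin_hom[OF sB' same_mod_tensor[OF sB' sB']])
 have \<Delta>B: "\<Delta>' \<in> lin_hom R ?B (tensor R ?B ?B)" and \<epsilon>B: "\<epsilon> \<in> lin_hom R ?B ?R"
  using \<Delta>' \<epsilon> unfolding BLl BL .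
 interpret B: coalg_data R ?B
 proof (rule coalg_data.intro)
  show "module R ?B" by (rule B)
  show "lmap R ?B (tensor R ?B ?B) (comult ?B)"
   using \<Delta>B unfolding lin_hom_iff mk_bialg_simps by (rule conjunct1)
  show "lmap R ?B ?R (counit ?B)"
   using \<epsilon>B unfolding lin_hom_iff mk_bialg_simps by (rule conjunct1)
 qed
 have mB: "m T v w = conv ?B T v w" if "algebra R T" "v \<in> lin_hom R A T" "w \<in> lin_hom R A T" for T :: "'u md" and v w
 proof (rule lin_hom_ext[of _ R A T, OF cl[OF that]])
  show "conv ?B T v w \<in> lin_hom R A T"
   using B.conv_lin_hom[OF that(1), of v w] that(2,3) unfolding BL by (simp add: lin_hom_iff Bl)
  show "m T v w a = conv ?B T v w a" if "a <: A" for a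
   using m\<Delta>[OF \<open>algebra R T\<close> \<open>v \<in> _\<close> \<open>w \<in> _\<close> that] that by (simp add: conv_def mk_bialg_simps pairing_def \<Delta>'_def)
 qed
 \<comment> \<open>The transition along the structure map from \<open>R\<close> to \<open>T\<close>
   is unital, so the unit over \<open>T\<close> is determined by the one over
   \<open>R\<close>.\<close>
 have eB: "e T = conv_one ?B T" if "algebra R T" for T :: "'u md"
 proof -
  let ?h = "\<lambda>r\<in>carrier ?R. r \<odot>\<^sub>T \<one>\<^sub>T"
  have h: "?h \<in> alg_hom R ?R T" by (rule restrict_alg_hom[OF RR alg_map_unit[OF that]])
  have "e T = compose (carrier A) ?h \<epsilon>"
   using ring_hom_one[OF rh[OF RR that h]] \<epsilon> by (simp add: simps \<epsilon>_def)
  also have "\<dots> = conv_one ?B T"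
   using \<epsilon> by (auto simp: conv_one_def compose_def mk_bialg_simps fun_eq_iff lin_hom_iff lin_closed)
  finally show ?thesis .
 qed
 have prB: "loc_proj R ?B" by (rule same_mod_loc_proj[OF sB pr])
 have R_lin: "lmap R ?B ?R v \<longleftrightarrow> restrict v (carrier A) \<in> lin_hom R A ?R" for v
  using lin_cong[OF A, of v "restrict v (carrier A)" ?R] by (simp add: lin_hom_iff Bl)
 note AA = module_tensor[OF B B]
 \<comment> \<open>Tested against three functionals u, v, w, the two sides become the two
   bracketings of a triple convolution over \<open>R\<close>.\<close>
 have coassoc: "tensor_assoc R ?B ?B ?B (tmap R ?B ?B (tensor R ?B ?B) ?B (comult ?B) (\<lambda>y. y) (comult ?B x)) =
   rmap R ?B ?B (tensor R ?B ?B) (comult ?B) (comult ?B x)" (is "?l = ?r") if x: "x <: ?B" for x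
 proof (rule contract_pairing_separates[OF B prB])
  show l: "?l <: tensor R ?B (tensor R ?B ?B)"
   by (rule lin_closed[OF lin_comp[OF lin_tensor_map[OF B B AA B B.comult lin_id] lin_tensor_assoc[OF B B B]] B.comult_closed[OF x]])
  show r: "?r <: tensor R ?B (tensor R ?B ?B)"
   by (rule lin_closed[OF lin_tensor_map[OF B B B AA lin_id B.comult] B.comult_closed[OF x]])
  fix v w assume v: "lmap R ?B ?R v" and w: "lmap R ?B ?R w"
  note pvw = lin_pairing[OF B B RR v w]
  note c = lin_contract[OF B AA pvw]
  show "contract ?B (pairing ?R v w) ?l = contract ?B (pairing ?R v w) ?r"
  proof (rule functionals_separate[OF prB lin_closed[OF c l] lin_closed[OF c r]])
   fix u assume u: "lmap R ?B ?R u"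
   have "conv ?B ?R (conv ?B ?R u v) w = conv ?B ?R u (conv ?B ?R v w)"
   proof -
    let ?u = "restrict u (carrier A)" and ?v = "restrict v (carrier A)" and ?w = "restrict w (carrier A)"
    have uvw: "?u \<in> lin_hom R A ?R" "?v \<in> lin_hom R A ?R" "?w \<in> lin_hom R A ?R"
     using u v w R_lin by auto
    have l: "lmap R ?B ?R ?u" "lmap R ?B ?R ?v" "lmap R ?B ?R ?w" using uvw by (auto simp: lin_hom_iff Bl)
    have "conv ?B ?R ?u ?v = conv ?B ?R u v" by (rule B.conv_cong[OF RR l(1,2)]) (simp_all add: mk_bialg_simps)
    moreover have "conv ?B ?R ?v ?w = conv ?B ?R v w" by (rule B.conv_cong[OF RR l(2,3)]) (simp_all add: mk_bialg_simps)
    moreover have "conv ?B ?R (conv ?B ?R u v) ?w = conv ?B ?R (conv ?B ?R u v) w"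
     by (rule B.conv_cong[OF RR B.conv_lin[OF RR u v] l(3)]) (simp_all add: mk_bialg_simps)
    moreover have "conv ?B ?R ?u (conv ?B ?R v w) = conv ?B ?R u (conv ?B ?R v w)"
     by (rule B.conv_cong[OF RR l(1) B.conv_lin[OF RR v w]]) (simp_all add: mk_bialg_simps)
    ultimately show ?thesis
     using assoc[OF RR uvw] mB[OF RR cl[OF RR uvw(1,2)] uvw(3)] mB[OF RR uvw(1) cl[OF RR uvw(2,3)]]
      mB[OF RR uvw(1,2)] mB[OF RR uvw(2,3)] by simp
   qed
   then have "conv ?B ?R (conv ?B ?R u v) w x = conv ?B ?R u (conv ?B ?R v w) x" by simp
   then show "u (contract ?B (pairing ?R v w) ?l) = u (contract ?B (pairing ?R v w) ?r)"
    unfolding pairing_contract[OF B AA u pvw l, symmetric] pairing_contract[OF B AA u pvw r, symmetric]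
    using B.triple_pairing[OF RR u v w B.comult_closed[OF x]] x by (simp add: B.conv_apply)
  qed
 qed
 have restr: "conv ?B ?R (restrict v (carrier A)) (restrict w (carrier A)) = conv ?B ?R v w"
  if "lmap R ?B ?R v" "lmap R ?B ?R w" for v w
  by (rule B.conv_cong[OF RR]) (use that R_lin in \<open>auto simp: mk_bialg_simps lin_hom_iff Bl\<close>)
 have swap: "tensor_swap R ?B ?B (comult ?B x) = comult ?B x" if x: "x <: ?B" for x
 proof (rule contract_separates[OF B prB])
  show l: "tensor_swap R ?B ?B (comult ?B x) <: tensor R ?B ?B"
   by (rule lin_closed[OF lin_tensor_swap[OF B B] B.comult_closed[OF x]])
  show r: "comult ?B x <: tensor R ?B ?B" by (rule B.comult_closed[OF x])
  fix w assume w: "lmap R ?B ?R w"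
  note c = lin_contract[OF B B w]
  show "contract ?B w (tensor_swap R ?B ?B (comult ?B x)) = contract ?B w (comult ?B x)"
  proof (rule functionals_separate[OF prB lin_closed[OF c l] lin_closed[OF c r]])
   fix v assume v: "lmap R ?B ?R v"
   have "conv ?B ?R w v = conv ?B ?R v w"
    using restr[OF v w] restr[OF w v] v w R_lin comm[OF RR] mB[OF RR] by metis
   then have "conv ?B ?R w v x = conv ?B ?R v w x" by simp
   then show "v (contract ?B w (tensor_swap R ?B ?B (comult ?B x))) = v (contract ?B w (comult ?B x))"
    unfolding pairing_contract[OF B B v w l, symmetric] pairing_contract[OF B B v w r, symmetric]
     B.pairing_swap[OF RR v w r] using x by (simp add: B.conv_apply)
  qed
 qed
 have counitl: "tlift ?B (\<lambda>y z. counit ?B y \<odot>\<^bsub>?B\<^esub> z) (comult ?B x) = x"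
  and counitr: "tlift ?B (\<lambda>y z. counit ?B z \<odot>\<^bsub>?B\<^esub> y) (comult ?B x) = x" if x: "x <: ?B" for x
 proof -
  have b: "bilin R ?B ?B ?B (\<lambda>y z. counit ?B y \<odot>\<^bsub>?B\<^esub> z)"
   by (rule bilin_comp[OF bilin_smult[OF B] B.counit lin_id])
  note r = B.comult_closed[OF x]
  have u: "conv ?B ?R (conv_one ?B ?R) w = restrict w (carrier A)" "conv ?B ?R w (conv_one ?B ?R) = restrict w (carrier A)"
   if w: "lmap R ?B ?R w" for w
  proof -
   have o: "lmap R ?B ?R (conv_one ?B ?R)" "conv_one ?B ?R \<in> lin_hom R A ?R"
    using B.conv_one_lin[OF RR] B.conv_one_lin_hom[OF RR] BL[of ?R] by auto
   have oe: "restrict (conv_one ?B ?R) (carrier A) = conv_one ?B ?R"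
    using o(2) by (auto simp: lin_hom_iff extensional_restrict)
   have w': "restrict w (carrier A) \<in> lin_hom R A ?R" using R_lin w by auto
   show "conv ?B ?R (conv_one ?B ?R) w = restrict w (carrier A)"
    using restr[OF o(1) w] unit(1)[OF RR w'] mB[OF RR o(2) w'] eB[OF RR] oe by simp
   show "conv ?B ?R w (conv_one ?B ?R) = restrict w (carrier A)"
    using restr[OF w o(1)] unit(2)[OF RR w'] mB[OF RR w' o(2)] eB[OF RR] oe by simp
  qed
  show "tlift ?B (\<lambda>y z. counit ?B y \<odot>\<^bsub>?B\<^esub> z) (comult ?B x) = x"
  proof (rule functionals_separate[OF prB lin_closed[OF lin_tlift[OF B B B b] r] x])
   fix w assume w: "lmap R ?B ?R w"
   show "w (tlift ?B (\<lambda>y z. counit ?B y \<odot>\<^bsub>?B\<^esub> z) (comult ?B x)) = w x"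
    using B.pairing_counit(1)[OF RR w r] fun_cong[OF u(1)[OF w], of x] x by (simp add: B.conv_apply) (simp add: mk_bialg_simps)
  qed
  show "tlift ?B (\<lambda>y z. counit ?B z \<odot>\<^bsub>?B\<^esub> y) (comult ?B x) = x"
  proof (rule functionals_separate[OF prB lin_closed[OF lin_tlift[OF B B B bilin_flip[OF b]] r] x])
   fix w assume w: "lmap R ?B ?R w"
   show "w (tlift ?B (\<lambda>y z. counit ?B z \<odot>\<^bsub>?B\<^esub> y) (comult ?B x)) = w x"
    using B.pairing_counit(2)[OF RR w r] fun_cong[OF u(2)[OF w], of x] x by (simp add: B.conv_apply) (simp add: mk_bialg_simps)
  qed
 qed
 have "coalgebra R ?B"
  unfolding coalgebra_def
  using B \<Delta>' \<epsilon> BLl BL[of ?R] coassoc counitl counitr by (simp add: mk_bialg_simps(2,3))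
 moreover have "cocommutative R ?B" unfolding cocommutative_def using swap by blast
 ultimately have "cocomm_coalg R ?B"
  unfolding cocomm_coalg_def cocomm_coalg_axioms_def using B.coalg_data_axioms by blast
 then show ?thesis using sB mB eB by blast
qed

section \<open>Small quotients\<close>

text \<open>Hom(A, S) is given as an algebra over \<open>S\<close>, whereas linear maps and
  quotients are handled over \<open>R\<close>.\<close>

lemma algebra_restrict_scalars:
 assumes S: "algebra R S" and F: "algebra S F"
 shows "algebra R (F\<lparr>smult := \<lambda>r x. (r \<odot>\<^sub>S \<one>\<^sub>S) \<odot>\<^sub>F x\<rparr>)"
proof -
 interpret S: algebra R S by (rule S)
 interpret F: algebra S F by (rule F)
 note 1 = alg_map_unit[OF S]
 have ua: "(r \<oplus>\<^sub>R r') \<odot>\<^sub>S \<one>\<^sub>S = r \<odot>\<^sub>S \<one>\<^sub>S \<oplus>\<^sub>S r' \<odot>\<^sub>S \<one>\<^sub>S"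
  and um: "(r \<otimes>\<^sub>R r') \<odot>\<^sub>S \<one>\<^sub>S = (r \<odot>\<^sub>S \<one>\<^sub>S) \<otimes>\<^sub>S (r' \<odot>\<^sub>S \<one>\<^sub>S)"
  if "r <: R" "r' <: R" for r r'
  using that lin_add[OF alg_map_lin[OF 1], of r r'] alg_map_mult[OF 1, of r r'] by (simp_all add: ring_as_module_def)
 let ?F = "F\<lparr>smult := \<lambda>r x. (r \<odot>\<^sub>S \<one>\<^sub>S) \<odot>\<^sub>F x\<rparr>"
 have "abelian_group ?F"
  by (rule abelian_groupI) (auto simp: F.a_ac intro: bexI[of _ "\<ominus>\<^sub>F x" for x] F.l_neg)
 then have "cring ?F"
  by (rule cringI, intro comm_monoidI) (auto simp: F.m_ac F.l_distr F.r_distr)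
 then show ?thesis
  by (rule algebraI[OF S.R_cring])
   (simp_all add: ua um F.smult_l_distr F.smult_r_distr F.smult_assoc1 F.smult_assoc2)
qed

lemma minus_eq_zero_iff:
 assumes "module R M" "x <: M" "y <: M"
 shows "x \<ominus>\<^sub>M y = \<zero>\<^sub>M \<longleftrightarrow> x = y"
proof -
 interpret M: module R M by fact
 show ?thesis
  using assms(2,3) M.minus_equality[of x "\<ominus>\<^sub>M y"] by (auto simp: a_minus_def M.r_neg)
qed

lemma factor_linmap:
 assumes B: "module R B" and C: "module R C" and T: "module R T" and \<pi>: "lmap R B C \<pi>" and surj: "\<pi> ` carrier B = carrier C"
  and \<chi>: "lmap R B T \<chi>" and ker: "\<And>f. f <: B ==> \<pi> f = \<zero>\<^sub>C ==> \<chi> f = \<zero>\<^sub>T"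
 obtains \<chi>' where "lmap R C T \<chi>'" "\<And>f. f <: B ==> \<chi>' (\<pi> f) = \<chi> f"
proof -
 interpret B: module R B by (rule B)
 interpret C: module R C by (rule C)
 interpret T: module R T by (rule T)
 define \<chi>' where "\<chi>' c = \<chi> (inv_into (carrier B) \<pi> c)" for c
 have eq: "\<chi> f = \<chi> g" if "f <: B" "g <: B" "\<pi> f = \<pi> g" for f g
 proof -
  have "\<pi> (f \<ominus>\<^sub>B g) = \<zero>\<^sub>C"
   using that lin_closed[OF \<pi>] by (simp add: lin_minus[OF B C \<pi>] minus_eq_zero_iff[OF C])
  then have "\<chi> (f \<ominus>\<^sub>B g) = \<zero>\<^sub>T" using ker that by simp
  then show ?thesis
   using that lin_closed[OF \<chi>] by (simp add: lin_minus[OF B T \<chi>] minus_eq_zero_iff[OF T])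
 qed
 have \<chi>': "\<chi>' (\<pi> f) = \<chi> f" if "f <: B" for f
  unfolding \<chi>'_def using that by (intro eq) (auto intro: inv_into_into f_inv_into_f)
 have "lmap R C T \<chi>'"
 proof (rule lmapI)
  fix x assume "x <: C"
  then obtain f where f: "f <: B" "x = \<pi> f" using surj by auto
  then show "\<chi>' x <: T" using lin_closed[OF \<chi>] by (simp add: \<chi>')
  show "\<chi>' (r \<odot>\<^sub>C x) = r \<odot>\<^sub>T \<chi>' x" if "r <: R" for r
   using \<chi>'[of "r \<odot>\<^sub>B f"] f that by (simp add: lin_smult[OF \<pi>] lin_smult[OF \<chi>] \<chi>')
  fix y assume "y <: C"
  then obtain g where g: "g <: B" "y = \<pi> g" using surj by auto
  then show "\<chi>' (x \<oplus>\<^sub>C y) = \<chi>' x \<oplus>\<^sub>T \<chi>' y"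
   using \<chi>'[of "f \<oplus>\<^sub>B g"] f by (simp add: lin_add[OF \<pi>] lin_add[OF \<chi>] \<chi>')
 qed
 then show thesis using that \<chi>' by blast
qed

lemma alg_map_factor:
 assumes B: "algebra R B" and \<pi>: "alg_map R B C \<pi>" and surj: "\<pi> ` carrier B = carrier C"
  and \<chi>: "alg_map R B T \<chi>" and \<chi>': "lmap R C T \<chi>'" "\<And>f. f <: B ==> \<chi>' (\<pi> f) = \<chi> f"
 shows "alg_map R C T \<chi>'"
proof (rule alg_mapI[OF \<chi>'(1)])
 interpret B: algebra R B by (rule B)
 show "\<chi>' \<one>\<^sub>C = \<one>\<^sub>T"
  using \<chi>'(2)[of "\<one>\<^sub>B"] by (simp add: alg_map_one[OF \<pi>] alg_map_one[OF \<chi>])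
 fix x y assume "x <: C" "y <: C"
 then obtain f g where "f <: B" "x = \<pi> f" "g <: B" "y = \<pi> g" using surj by (metis imageE)
 then show "\<chi>' (x \<otimes>\<^sub>C y) = \<chi>' x \<otimes>\<^sub>T \<chi>' y"
  using \<chi>'(2)[of "f \<otimes>\<^sub>B g"] by (simp add: alg_map_mult[OF \<pi>] alg_map_mult[OF \<chi>] \<chi>'(2))
qed

text \<open>A quotient of an algebra of functions by an ideal containing all functions that vanish on a
 fixed finite set fits into the universe: a class is determined by the finitely many values of a
 chosen representative.\<close>

lemma ex_small_quotient:
 fixes B :: "('r, 'a => 'u, 'p) module_scheme"
 assumes inf: "infinite (UNIV :: 'u set)" and B: "algebra R B" and J: "ideal J B" and M: "finite M"
  and eq: "\<And>f g. f <: B ==> g <: B ==> (\<forall>p\<in>M. f p = g p) ==> f \<ominus>\<^sub>B g \<in> J"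
 obtains C :: "('r, 'u) module" and \<pi> where "algebra R C" "alg_map R B C \<pi>" "\<pi> ` carrier B = carrier C"
  "\<And>f. f <: B ==> \<pi> f = \<zero>\<^sub>C \<longleftrightarrow> f \<in> J"
proof -
 interpret B: algebra R B by (rule B)
 interpret J: ideal J B by (rule J)
 obtain enc :: "'u list => 'u" where enc: "inj enc" using ex_inj_list[OF inf] by blast
 obtain ms where ms: "set ms = M" using finite_list[OF M] by blast
 have q: "f \<ominus>\<^sub>B g \<in> J \<longleftrightarrow> J +>\<^bsub>B\<^esub> f = J +>\<^bsub>B\<^esub> g" if "f <: B" "g <: B" for f g
  by (rule B.quotient_eq_iff_same_a_r_cos[OF J that])
 \<comment> \<open>A representative depending only on the coset, so that reading its values on
   \<open>M\<close> is well defined on cosets.\<close>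
 define c where "c f = (SOME g. g <: B \<and> J +>\<^bsub>B\<^esub> f = J +>\<^bsub>B\<^esub> g)" for f
 have c: "c f <: B \<and> J +>\<^bsub>B\<^esub> f = J +>\<^bsub>B\<^esub> c f" if "f <: B" for f
  unfolding c_def by (rule someI[of _ f]) (use that in simp)
 \<comment> \<open>The code of a coset. Equal codes mean representatives agreeing on
   \<open>M\<close>, hence equal cosets by the hypothesis on \<open>J\<close>.\<close>
 define \<pi> where "\<pi> f = enc (map (c f) ms)" for f
 have \<pi>: "\<pi> f = \<pi> g \<longleftrightarrow> J +>\<^bsub>B\<^esub> f = J +>\<^bsub>B\<^esub> g" if f: "f <: B" and g: "g <: B" for f g
 proof
  assume "\<pi> f = \<pi> g"
  then have "map (c f) ms = map (c g) ms" unfolding \<pi>_def by (rule injD[OF enc])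
  then have "\<forall>p\<in>M. c f p = c g p" using ms by auto
  then show "J +>\<^bsub>B\<^esub> f = J +>\<^bsub>B\<^esub> g"
   using eq[of "c f" "c g"] q[of "c f" "c g"] c[OF f] c[OF g] by simp
 next
  assume "J +>\<^bsub>B\<^esub> f = J +>\<^bsub>B\<^esub> g"
  then show "\<pi> f = \<pi> g" unfolding \<pi>_def c_def by simp
 qed
 have ca: "\<pi> (x \<oplus>\<^sub>B y) = \<pi> (x' \<oplus>\<^sub>B y')" if "x <: B" "x' <: B" "y <: B" "y' <: B" "\<pi> x = \<pi> x'" "\<pi> y = \<pi> y'" for x x' y y'
  using J.a_rcos_sum[of x y] J.a_rcos_sum[of x' y'] that by (simp add: \<pi>)
 have cm: "\<pi> (x \<otimes>\<^sub>B y) = \<pi> (x' \<otimes>\<^sub>B y')" if "x <: B" "x' <: B" "y <: B" "y' <: B" "\<pi> x = \<pi> x'" "\<pi> y = \<pi> y'" for x x' y y'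
  using J.rcoset_mult_add[of x y] J.rcoset_mult_add[of x' y'] that by (simp add: \<pi>)
 \<comment> \<open>Scalar multiplication is multiplication by r 1, so it respects the congruence
   because the ring product does.\<close>
 have cs: "\<pi> (r \<odot>\<^sub>B x) = \<pi> (r \<odot>\<^sub>B x')" if "r <: R" "x <: B" "x' <: B" "\<pi> x = \<pi> x'" for r x x'
  using cm[of "r \<odot>\<^sub>B \<one>\<^sub>B" "r \<odot>\<^sub>B \<one>\<^sub>B" x x'] that by (simp add: B.smult_assoc2)
 note p = algebra_push[of R B \<pi>, OF B]
 have P: "algebra R (push \<pi> B)" by (rule p(1); (fact ca | fact cm | fact cs))
 have l: "lmap R B (push \<pi> B) \<pi>" by (rule p(2); (fact ca | fact cm | fact cs))
 have mu: "\<pi> (x \<otimes>\<^sub>B y) = \<pi> x \<otimes>\<^bsub>push \<pi> B\<^esub> \<pi> y" if "x <: B" "y <: B" for x y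
  by (rule p(3)[OF _ _ _ that]; (fact ca | fact cm | fact cs))
 have a: "alg_map R B (push \<pi> B) \<pi>" 
  using l mu unfolding alg_map_def by (simp add: push_def)
 have s: "\<pi> ` carrier B = carrier (push \<pi> B)" by (simp add: push_def)
 have "\<pi> f = \<zero>\<^bsub>push \<pi> B\<^esub> \<longleftrightarrow> f \<in> J" if f: "f <: B" for f
 proof -
  have "f \<ominus>\<^sub>B \<zero>\<^sub>B = f" using f by (simp add: a_minus_def)
  then show ?thesis
   using lin_zero[OF alg_mod[OF B] alg_mod[OF P] l] \<pi>[OF f, of "\<zero>\<^sub>B"] q[OF f, of "\<zero>\<^sub>B"] by simp
 qed
 then show thesis by (rule that[OF P a s])
qed

section \<open>Group-like elements\<close>

locale lp_coalg = universe_coalg R A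
 for R :: "('u, 'y) ring_scheme" and A :: "('u, 'u, 'p) bialg_scheme" +
 assumes inf: "infinite (UNIV :: 'u set)" and lp: "loc_proj R A"
begin

abbreviation "Rm \<equiv> ring_as_module R"

lemma RR: "algebra R Rm"
 by (rule algebra_ring_as_module[OF R_cring])

lemmas AA = module_tensor[OF A A]

abbreviation unit_map :: "('u, 'c, 's) module_scheme => ('u => 'u) => 'u => 'c" where
 "unit_map T \<xi> \<equiv> \<lambda>a. \<xi> a \<odot>\<^sub>T \<one>\<^sub>T"

lemma lin_unit_map: "algebra R T ==> lmap R A Rm \<xi> ==> lmap R A T (unit_map T \<xi>)"
 using lin_comp[OF _ alg_map_lin[OF alg_map_unit]] .

text \<open>Group-like elements, described by functionals: \<xi> \<mapsto> (id \<otimes> \<xi>)(x)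
  is multiplicative for convolution and unital. In this form base change and the comparison with
  algebra maps out of A* are immediate; \<open>gr_iff\<close> gives the usual form.\<close>

definition gr :: "('u, 'c, 's) module_scheme => ('c, 'u) tensor_elt set" where
 "gr S = {x \<in> carrier (tensor R S A).
   (\<forall>v w. lmap R A Rm v --> lmap R A Rm w
    --> contract S (conv A Rm v w) x = contract S v x \<otimes>\<^sub>S contract S w x) \<and>
   contract S (counit A) x = \<one>\<^sub>S}"

lemma gr_closed: "x \<in> gr S ==> x <: tensor R S A"
 by (simp add: gr_def)

text \<open>The element x \<otimes> y of (S \<otimes> A) \<otimes>_S (S \<otimes> A), with the
  latter identified with S \<otimes> (A \<otimes> A).\<close>

definition box :: "('u, 'c, 's) module_scheme => ('c, 'u) tensor_elt => ('c, 'u) tensor_elt => ('c, ('u, 'u) tensor_elt) tensor_elt" where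
 "box S x y = tlift (tensor R S (tensor R A A)) (\<lambda>s a. tlift (tensor R S (tensor R A A))
   (\<lambda>t b. tens R S (tensor R A A) (s \<otimes>\<^sub>S t) (tens R A A a b)) y) x"

lemma
 assumes S: "algebra R S"
 shows bilin_box: "bilin R (tensor R S A) (tensor R S A) (tensor R S (tensor R A A)) (box S)"
  and box_pure: "s <: S ==> a <: A ==> t <: S ==> b <: A
   ==> box S (tens R S A s a) (tens R S A t b) = tens R S (tensor R A A) (s \<otimes>\<^sub>S t) (tens R A A a b)"
proof -
 interpret S: algebra R S by (rule S)
 note mS = S.module
 note SA = module_tensor[OF mS A] and SAA = module_tensor[OF mS AA]
 let ?b = "\<lambda>s a t b. tens R S (tensor R A A) (s \<otimes>\<^sub>S t) (tens R A A a b)"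
 note pt = bilin_pure_tensor[OF mS AA] and pA = bilin_pure_tensor[OF A A] and bm = bilin_mult[OF S]
 have b1: "bilin R S A (tensor R S (tensor R A A)) (?b s a)" if "s <: S" "a <: A" for s a
  by (rule bilin_comp[OF pt bilin_right[OF bm that(1)] bilin_right[OF pA that(2)]])
 have b2: "bilin R S A (tensor R S (tensor R A A)) (\<lambda>s a. ?b s a t b)" if "t <: S" "b <: A" for t b
  by (rule bilin_comp[OF pt bilin_left[OF bm that(1)] bilin_left[OF pA that(2)]])
 have b3: "bilin R S A (tensor R S (tensor R A A)) (\<lambda>s a. tlift (tensor R S (tensor R A A)) (?b s a) Y)"
  if Y: "Y <: tensor R S A" for Y
 proof (rule bilinI)
  show "lmap R A (tensor R S (tensor R A A)) (\<lambda>a. tlift (tensor R S (tensor R A A)) (?b s a) Y)" if "s <: S" for s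
   by (rule lin_tlift_param[OF mS A SAA A _ _ Y]) (use that b1 bilin_right[OF b2] in auto)
  show "lmap R S (tensor R S (tensor R A A)) (\<lambda>s. tlift (tensor R S (tensor R A A)) (?b s a) Y)" if "a <: A" for a
   by (rule lin_tlift_param[OF mS A SAA mS _ _ Y]) (use that b1 bilin_left[OF b2] in auto)
 qed
 show "bilin R (tensor R S A) (tensor R S A) (tensor R S (tensor R A A)) (box S)"
  unfolding box_def
 proof (rule bilinI)
  show "lmap R (tensor R S A) (tensor R S (tensor R A A)) (\<lambda>y. tlift (tensor R S (tensor R A A)) (\<lambda>s a. tlift (tensor R S (tensor R A A)) (?b s a) y) x)"
   if "x <: tensor R S A" for x
   by (rule lin_tlift_param[OF mS A SAA SA b3 _ that]) (auto intro: lin_tlift[OF mS A SAA b1])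
  show "lmap R (tensor R S A) (tensor R S (tensor R A A)) (\<lambda>x. tlift (tensor R S (tensor R A A)) (\<lambda>s a. tlift (tensor R S (tensor R A A)) (?b s a) y) x)"
   if "y <: tensor R S A" for y
   by (rule lin_tlift[OF mS A SAA b3[OF that]])
 qed
 show "box S (tens R S A s a) (tens R S A t b) = tens R S (tensor R A A) (s \<otimes>\<^sub>S t) (tens R A A a b)"
  if a: "s <: S" "a <: A" "t <: S" "b <: A" for s a t b
  unfolding box_def
  by (simp add: tlift_pure[OF mS A SAA b3] tlift_pure[OF mS A SAA b1] a tens_closed[OF mS A])
qed

text \<open>Relates the two ways of evaluating a point: contraction by a functional over
  \<open>R\<close>, and pairing with a linear map into a \<open>T\<close> that receives
  \<open>S\<close>.\<close>

lemma contract_val: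
 assumes S: "algebra R S" and T: "algebra R T" and h: "alg_map R S T h" and \<xi>: "lmap R A Rm \<xi>"
  and x: "x <: tensor R S A"
 shows "pairing T h (unit_map T \<xi>) x = h (contract S \<xi> x)"
proof -
 interpret S: algebra R S by (rule S)
 interpret T: algebra R T by (rule T)
 note hl = alg_map_lin[OF h] and u = lin_unit_map[OF T \<xi>]
 show ?thesis
 proof (rule tmap_ext[OF S.module A lin_pairing[OF S.module A T hl u] lin_comp[OF lin_contract[OF S.module A \<xi>] hl] _ x])
  fix s a assume a: "s <: S" "a <: A"
  have r: "\<xi> a <: R" using lin_closed[OF \<xi> a(2)] by (simp add: ring_as_module_def)
  have "h s \<otimes>\<^sub>T (\<xi> a \<odot>\<^sub>T \<one>\<^sub>T) = \<xi> a \<odot>\<^sub>T h s"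
   using lin_smult[OF bilin_right[OF bilin_mult[OF T]], of "h s" "\<xi> a" "\<one>\<^sub>T"] r lin_closed[OF hl a(1)] by simp
  then show "pairing T h (unit_map T \<xi>) (tens R S A s a) = h (contract S \<xi> (tens R S A s a))"
   using a r by (simp add: pairing_pure[OF S.module A T hl u] contract_pure[OF S.module A \<xi>] lin_smult[OF hl])
 qed
qed

lemma pairing_comult:
 assumes S: "algebra R S" and T: "algebra R T" and h: "alg_map R S T h" and v: "lmap R A T v" and w: "lmap R A T w"
 shows "x <: tensor R S A ==>
   pairing T h (pairing T v w) (rmap R S A (tensor R A A) (comult A) x) = pairing T h (conv A T v w) x"
  and "x <: tensor R S A ==> y <: tensor R S A ==>
   pairing T h (pairing T v w) (box S x y) = pairing T h v x \<otimes>\<^sub>T pairing T h w y"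
proof -
 interpret S: algebra R S by (rule S)
 interpret T: algebra R T by (rule T)
 note hl = alg_map_lin[OF h] and p = lin_pairing[OF A A T v w]
 note E = lin_pairing[OF S.module AA T hl p] and Ep = pairing_pure[OF S.module AA T hl p]
 note c = conv_lin[OF T v w]
 show "pairing T h (pairing T v w) (rmap R S A (tensor R A A) (comult A) x) = pairing T h (conv A T v w) x"
  if x: "x <: tensor R S A" for x
  by (rule tmap_ext[OF S.module A lin_comp[OF lin_tensor_map[OF S.module A S.module AA lin_id comult] E]
     lin_pairing[OF S.module A T hl c] _ x])
   (simp add: tmap_pure[OF S.module A S.module AA lin_id comult] Ep comult_closed pairing_pure[OF S.module A T hl c] conv_apply)
 show "pairing T h (pairing T v w) (box S x y) = pairing T h v x \<otimes>\<^sub>T pairing T h w y"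
  if x: "x <: tensor R S A" and y: "y <: tensor R S A" for x y
 proof (rule tmap_ext[OF S.module A _ _ _ x])
  note pv = lin_pairing[OF S.module A T hl v] and pw = lin_pairing[OF S.module A T hl w]
  note b = bilin_box[OF S] and bm = bilin_mult[OF T]
  show "lmap R (tensor R S A) T (\<lambda>x. pairing T h (pairing T v w) (box S x y))"
   by (rule lin_comp[OF bilin_left[OF b y] E])
  show "lmap R (tensor R S A) T (\<lambda>x. pairing T h v x \<otimes>\<^sub>T pairing T h w y)"
   by (rule lin_comp[OF pv bilin_left[OF bm lin_closed[OF pw y]]])
  fix s a assume s: "s <: S" and a: "a <: A"
  note sa = tens_closed[OF S.module A s a]
  show "pairing T h (pairing T v w) (box S (tens R S A s a) y) = pairing T h v (tens R S A s a) \<otimes>\<^sub>T pairing T h w y"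
  proof (rule tmap_ext[OF S.module A _ _ _ y])
   show "lmap R (tensor R S A) T (\<lambda>y. pairing T h (pairing T v w) (box S (tens R S A s a) y))"
    by (rule lin_comp[OF bilin_right[OF b sa] E])
   show "lmap R (tensor R S A) T (\<lambda>y. pairing T h v (tens R S A s a) \<otimes>\<^sub>T pairing T h w y)"
    by (rule lin_comp[OF pw bilin_right[OF bm lin_closed[OF pv sa]]])
   fix t b assume "t <: S" "b <: A"
   then show "pairing T h (pairing T v w) (box S (tens R S A s a) (tens R S A t b)) =
     pairing T h v (tens R S A s a) \<otimes>\<^sub>T pairing T h w (tens R S A t b)"
    using s a lin_closed[OF hl] lin_closed[OF v] lin_closed[OF w]
    by (simp add: box_pure[OF S] Ep tens_closed[OF A A] pairing_pure[OF A A T v w] pairing_pure[OF S.module A T hl v]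
      pairing_pure[OF S.module A T hl w] alg_map_mult[OF h] T.m_ac)
  qed
 qed
qed

lemma conv_unit_map:
 assumes T: "algebra R T" and v: "lmap R A Rm v" and w: "lmap R A Rm w" and a: "a <: A"
 shows "conv A T (unit_map T v) (unit_map T w) a = unit_map T (conv A Rm v w) a"
 by (rule conv_nat[OF RR T alg_map_unit[OF T] v w a])

text \<open>Contracting the coproduct of x by v \<otimes> w gives the convolution of v and w at x,
  and contracting x \<box> x gives the product of the values. The contractions by products of
  functionals separate, so the two descriptions agree.\<close>

lemma gr_iff:
 assumes S: "algebra R S"
 shows "x \<in> gr S \<longleftrightarrow> x <: tensor R S A \<and>
   rmap R S A (tensor R A A) (comult A) x = box S x x \<and> contract S (counit A) x = \<one>\<^sub>S"
proof -
 interpret S: algebra R S by (rule S)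
 let ?d = "rmap R S A (tensor R A A) (comult A) x"
 have 1: "contract S (conv A Rm v w) x = contract S (pairing Rm v w) ?d \<and>
   contract S v x \<otimes>\<^sub>S contract S w x = contract S (pairing Rm v w) (box S x x)"
  if x: "x <: tensor R S A" and v: "lmap R A Rm v" and w: "lmap R A Rm w" for v w
 proof -
  note i = alg_map_id[of R S]
  note u = lin_unit_map[OF S v] lin_unit_map[OF S w]
  have pw: "pairing S (unit_map S v) (unit_map S w) Z = pairing Rm v w Z \<odot>\<^sub>S \<one>\<^sub>S" if Z: "Z <: tensor R A A" for Z
   by (rule tmap_ext[OF A A lin_pairing[OF A A S u] lin_comp[OF lin_pairing[OF A A RR v w] alg_map_lin[OF alg_map_unit[OF S]]] _ Z])
    (use lin_closed[OF v] lin_closed[OF w] alg_map_mult[OF alg_map_unit[OF S]] in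
     \<open>simp add: pairing_pure[OF A A S u] pairing_pure[OF A A RR v w]\<close>)
  have c: "contract S (pairing Rm v w) Z = pairing S (\<lambda>s. s) (pairing S (unit_map S v) (unit_map S w)) Z"
   if Z: "Z <: tensor R S (tensor R A A)" for Z
  proof (rule tmap_ext[OF S.module AA lin_contract[OF S.module AA lin_pairing[OF A A RR v w]]
     lin_pairing[OF S.module AA S lin_id lin_pairing[OF A A S u]] _ Z])
   fix s Z assume s: "s <: S" and Z: "Z <: tensor R A A"
   have r: "pairing Rm v w Z <: R" using lin_closed[OF lin_pairing[OF A A RR v w] Z] by (simp add: ring_as_module_def)
   show "contract S (pairing Rm v w) (tens R S (tensor R A A) s Z)
     = pairing S (\<lambda>s. s) (pairing S (unit_map S v) (unit_map S w)) (tens R S (tensor R A A) s Z)"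
    using s Z r lin_smult[OF bilin_right[OF bilin_mult[OF S]], of s "pairing Rm v w Z" "\<one>\<^sub>S"]
    by (simp add: contract_pure[OF S.module AA lin_pairing[OF A A RR v w]]
      pairing_pure[OF S.module AA S lin_id lin_pairing[OF A A S u]] pw)
  qed
  note dc = lin_closed[OF lin_tensor_map[OF S.module A S.module AA lin_id comult] x]
  note bc = bilin_closed[OF bilin_box[OF S] x x]
  have "contract S (conv A Rm v w) x = pairing S (\<lambda>s. s) (unit_map S (conv A Rm v w)) x"
   by (rule contract_val[OF S S i conv_lin[OF RR v w] x, symmetric])
  also have "\<dots> = pairing S (\<lambda>s. s) (conv A S (unit_map S v) (unit_map S w)) x"
   by (rule pairing_cong[OF S.module A S lin_id lin_unit_map[OF S conv_lin[OF RR v w]] _ _ x])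
    (simp_all add: conv_unit_map[OF S v w])
  also have "\<dots> = contract S (pairing Rm v w) ?d"
   using pairing_comult(1)[OF S S i u x] c[OF dc] by simp
  finally have a1: "contract S (conv A Rm v w) x = contract S (pairing Rm v w) ?d" .
  have "contract S v x \<otimes>\<^sub>S contract S w x = contract S (pairing Rm v w) (box S x x)"
   using pairing_comult(2)[OF S S i u x x] c[OF bc] contract_val[OF S S i v x] contract_val[OF S S i w x] by simp
  then show ?thesis using a1 by simp
 qed
 show ?thesis
 proof
  assume g: "x \<in> gr S"
  have x: "x <: tensor R S A" using g by (rule gr_closed)
  have "?d = box S x x"
   by (rule contract_pairing_separates[OF S.module lp
      lin_closed[OF lin_tensor_map[OF S.module A S.module AA lin_id comult] x] bilin_closed[OF bilin_box[OF S] x x]])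
    (use 1[OF x] g in \<open>simp add: gr_def\<close>)
  then show "x <: tensor R S A \<and> ?d = box S x x \<and> contract S (counit A) x = \<one>\<^sub>S"
   using g by (simp add: gr_def)
 next
  assume "x <: tensor R S A \<and> ?d = box S x x \<and> contract S (counit A) x = \<one>\<^sub>S"
  then show "x \<in> gr S" using 1 by (simp add: gr_def)
 qed
qed

text \<open>Multiplicativity was imposed for functionals with values in \<open>R\<close>; through
  the identity \<open>gr_iff\<close> it extends to linear maps into any algebra over
  \<open>S\<close>.\<close>

lemma gr_pairing:
 assumes S: "algebra R S" and T: "algebra R T" and h: "alg_map R S T h" and x: "x \<in> gr S"
 shows "lmap R A T v ==> lmap R A T w ==> pairing T h (conv A T v w) x = pairing T h v x \<otimes>\<^sub>T pairing T h w x"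
  and "pairing T h (conv_one A T) x = \<one>\<^sub>T"
proof -
 interpret S: algebra R S by (rule S)
 have x': "x <: tensor R S A" "rmap R S A (tensor R A A) (comult A) x = box S x x"
  "contract S (counit A) x = \<one>\<^sub>S"
  using x gr_iff[OF S] by auto
 show "pairing T h (conv A T v w) x = pairing T h v x \<otimes>\<^sub>T pairing T h w x" if "lmap R A T v" "lmap R A T w"
  using pairing_comult(1)[OF S T h that x'(1)] pairing_comult(2)[OF S T h that x'(1,1)] x'(2) by simp
 have "pairing T h (conv_one A T) x = pairing T h (unit_map T (counit A)) x"
  by (rule pairing_cong[OF S.module A T alg_map_lin[OF h] conv_one_lin[OF T] _ _ x'(1)]) (simp_all add: conv_one_def)
 then show "pairing T h (conv_one A T) x = \<one>\<^sub>T"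
  using contract_val[OF S T h counit x'(1)] x'(3) alg_map_one[OF h] by simp
qed

abbreviation push_pt :: "('u, 'c, 's) module_scheme => ('u, 'd, 't) module_scheme => ('c => 'd) => ('c, 'u) tensor_elt => ('d, 'u) tensor_elt" where
 "push_pt S T k \<equiv> tmap R S A T A k (\<lambda>a. a)"

lemma pairing_push:
 assumes S: "module R S" and T: "module R T" and U: "algebra R U" and k: "lmap R S T k" and h: "lmap R T U h"
  and v: "lmap R A U v" and x: "x <: tensor R S A"
 shows "pairing U h v (push_pt S T k x) = pairing U (\<lambda>s. h (k s)) v x"
 by (rule tmap_ext[OF S A lin_comp[OF lin_tensor_map[OF S A T A k lin_id] lin_pairing[OF T A U h v]]
    lin_pairing[OF S A U lin_comp[OF k h] v] _ x])
  (simp add: tmap_pure[OF S A T A k lin_id] pairing_pure[OF T A U h v] pairing_pure[OF S A U lin_comp[OF k h] v] lin_closed[OF k])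

lemma contract_push:
 assumes S: "module R S" and T: "module R T" and k: "lmap R S T k" and \<xi>: "lmap R A Rm \<xi>" and x: "x <: tensor R S A"
 shows "contract T \<xi> (push_pt S T k x) = k (contract S \<xi> x)"
 by (rule tmap_ext[OF S A lin_comp[OF lin_tensor_map[OF S A T A k lin_id] lin_contract[OF T A \<xi>]]
    lin_comp[OF lin_contract[OF S A \<xi>] k] _ x])
  (use lin_closed[OF \<xi>] in \<open>simp add: tmap_pure[OF S A T A k lin_id] contract_pure[OF T A \<xi>] contract_pure[OF S A \<xi>] lin_closed[OF k]
   lin_smult[OF k] ring_as_module_def\<close>)

lemma gr_push:
 assumes S: "algebra R S" and T: "algebra R T" and k: "alg_map R S T k" and x: "x \<in> gr S"
 shows "push_pt S T k x \<in> gr T"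
proof -
 note mS = alg_mod[OF S] and mT = alg_mod[OF T] and kl = alg_map_lin[OF k]
 note x' = gr_closed[OF x]
 note c = contract_push[OF mS mT kl _ x']
 show ?thesis
  unfolding gr_def
  using x lin_closed[OF lin_tensor_map[OF mS A mT A kl lin_id] x'] lin_closed[OF lin_contract[OF mS A] x']
  by (auto simp: c conv_lin[OF RR] counit gr_def alg_map_mult[OF k] alg_map_one[OF k])
qed

end

section \<open>Generic group-like elements\<close>

lemma tmap_surj:
 assumes B: "module R B" and C: "module R C" and P: "module R P" and \<pi>: "lmap R B C \<pi>" and surj: "\<pi> ` carrier B = carrier C"
  and Y: "Y <: tensor R C P"
 shows "\<exists>X\<in>carrier (tensor R B P). tmap R B P C P \<pi> (\<lambda>p. p) X = Y"
 using C P Y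
proof (induction rule: tensor_induct)
 case (pure c p)
 then obtain b where "b <: B" "c = \<pi> b" using surj by auto
 then show ?case
  using pure by (intro bexI[of _ "tens R B P b p"]) (simp_all add: tmap_pure[OF B P C P \<pi> lin_id] tens_closed[OF B P])
next
 case (add X Y)
 interpret BP: module R "tensor R B P" by (rule module_tensor[OF B P])
 from add obtain X' Y' where "X' <: tensor R B P" "tmap R B P C P \<pi> (\<lambda>p. p) X' = X"
  "Y' <: tensor R B P" "tmap R B P C P \<pi> (\<lambda>p. p) Y' = Y" by blast
 then show ?case
  by (intro bexI[of _ "X' \<oplus>\<^bsub>tensor R B P\<^esub> Y'"]) (simp_all add: lin_add[OF lin_tensor_map[OF B P C P \<pi> lin_id]])
qed

lemma tmap_comp:
 assumes "module R M" "module R N" "module R M'" "module R N'" "module R M''" "module R N''"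
  "lmap R M M' f" "lmap R N N' g" "lmap R M' M'' f'" "lmap R N' N'' g'" "X <: tensor R M N"
 shows "tmap R M' N' M'' N'' f' g' (tmap R M N M' N' f g X) = tmap R M N M'' N'' (\<lambda>x. f' (f x)) (\<lambda>y. g' (g y)) X"
proof (rule tmap_ext[OF assms(1,2) _ _ _ assms(11)])
 note f = lin_comp[OF assms(7,9)] and g = lin_comp[OF assms(8,10)]
 show "lmap R (tensor R M N) (tensor R M'' N'') (\<lambda>X. tmap R M' N' M'' N'' f' g' (tmap R M N M' N' f g X))"
  by (rule lin_comp[OF lin_tensor_map lin_tensor_map]) (use assms in auto)
 show "lmap R (tensor R M N) (tensor R M'' N'') (tmap R M N M'' N'' (\<lambda>x. f' (f x)) (\<lambda>y. g' (g y)))"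
  by (rule lin_tensor_map) (use assms f g in auto)
 show "tmap R M' N' M'' N'' f' g' (tmap R M N M' N' f g (tens R M N x y))
   = tmap R M N M'' N'' (\<lambda>x. f' (f x)) (\<lambda>y. g' (g y)) (tens R M N x y)"
  if "x <: M" "y <: N" for x y
  using that by (simp add: tmap_pure[OF assms(1-4,7,8)] tmap_pure[OF assms(3-6,9,10)]
    tmap_pure[OF assms(1,2,5,6) f g] lin_closed[OF assms(7)] lin_closed[OF assms(8)])
qed

lemma tmap_cong:
 assumes "module R M" "module R N" "module R M'" "module R N'" "lmap R M M' f" "lmap R N N' g"
  "\<And>x. x <: M ==> f x = f' x" "\<And>y. y <: N ==> g y = g' y" "X <: tensor R M N"
 shows "tmap R M N M' N' f g X = tmap R M N M' N' f' g' X"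
proof (rule tmap_ext[OF assms(1,2) _ _ _ assms(9)])
 have f: "lmap R M M' f'" and g: "lmap R N N' g'"
  using lin_cong[OF assms(1), of f f' M'] lin_cong[OF assms(2), of g g' N'] assms by auto
 show "lmap R (tensor R M N) (tensor R M' N') (tmap R M N M' N' f g)"
  "lmap R (tensor R M N) (tensor R M' N') (tmap R M N M' N' f' g')"
  by (intro lin_tensor_map assms f g)+
 show "tmap R M N M' N' f g (tens R M N x y) = tmap R M N M' N' f' g' (tens R M N x y)"
  if "x <: M" "y <: N" for x y
  using that assms by (simp add: tmap_pure[OF assms(1-6)] tmap_pure[OF assms(1-4) f g])
qed

lemma tmap_ident:
 assumes "module R M" "module R N" "X <: tensor R M N"
 shows "rmap R M N N (\<lambda>y. y) X = X"
 by (rule tmap_ext[OF assms(1,2) lin_tensor_map[OF assms(1,2,1,2) lin_id lin_id] lin_id _ assms(3)])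
  (simp add: tmap_pure[OF assms(1,2,1,2) lin_id lin_id])

context lp_coalg
begin

text \<open>The convolution algebra Hom(A, S) over \<open>R\<close>. Its elements are functions on
  \<open>'u\<close>, so it is not itself one of the test algebras.\<close>

definition cB :: "'u md => ('u, 'u => 'u) module" where
 "cB S = (on_ob DF S)\<lparr>smult := \<lambda>r x. (r \<odot>\<^sub>S \<one>\<^sub>S) \<odot>\<^bsub>on_ob DF S\<^esub> x\<rparr>"

lemma cB_simps:
 "carrier (cB S) = lin_hom R A S" "mult (cB S) = conv A S" "one (cB S) = conv_one A S"
 "zero (cB S) = (\<lambda>a\<in>carrier A. \<zero>\<^sub>S)" "add (cB S) = (\<lambda>v w. \<lambda>a\<in>carrier A. v a \<oplus>\<^sub>S w a)"
 "smult (cB S) = (\<lambda>r w. \<lambda>a\<in>carrier A. (r \<odot>\<^sub>S \<one>\<^sub>S) \<otimes>\<^sub>S w a)"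
 by (simp_all add: cB_def dual_functor_simps mod_of_simps)

lemma algebra_cB: "algebra R S ==> algebra R (cB S)"
 unfolding cB_def by (rule algebra_restrict_scalars[OF _ algebra_dual])

lemma lin_eval:
 assumes S: "algebra R S" and a: "a <: A"
 shows "lmap R (cB S) S (\<lambda>f. f a)"
proof -
 interpret S: algebra R S by (rule S)
 show ?thesis
  by (rule lmapI) (use a in \<open>auto simp: cB_simps lin_hom_iff lin_closed S.smult_assoc2\<close>)
qed

text \<open>The structure map from \<open>S\<close> to Hom(A, S), multiples of the convolution
  unit.\<close>

definition cK :: "'u md => 'u => 'u => 'u" where
 "cK S s = (\<lambda>a\<in>carrier A. s \<otimes>\<^sub>S conv_one A S a)"

lemma
 assumes S: "algebra R S" and s: "s <: S"
 shows cK_lin_hom: "cK S s \<in> lin_hom R A S"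
  and conv_cK: "f \<in> lin_hom R A S ==> conv A S f (cK S s) = (\<lambda>a\<in>carrier A. s \<otimes>\<^sub>S f a)"
proof -
 interpret S: algebra R S by (rule S)
 note o = conv_one_lin[OF S]
 show k: "cK S s \<in> lin_hom R A S"
  unfolding cK_def by (rule restrict_lin_hom[OF A lin_comp[OF o bilin_right[OF bilin_mult[OF S] s]]])
 show "conv A S f (cK S s) = (\<lambda>a\<in>carrier A. s \<otimes>\<^sub>S f a)" if f: "f \<in> lin_hom R A S"
 proof (rule ext)
  fix a
  have fl: "lmap R A S f" and kl: "lmap R A S (cK S s)" using f k by (auto simp: lin_hom_iff)
  show "conv A S f (cK S s) a = (\<lambda>a\<in>carrier A. s \<otimes>\<^sub>S f a) a"
  proof (cases "a <: A")
   case True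
   have "pairing S f (cK S s) (comult A a) = pairing S f (\<lambda>a. s \<otimes>\<^sub>S conv_one A S a) (comult A a)"
    by (rule pairing_cong[OF A A S fl kl _ _ comult_closed[OF True]]) (simp_all add: cK_def)
   also have "\<dots> = s \<otimes>\<^sub>S pairing S f (conv_one A S) (comult A a)"
    by (rule pairing_bilin(4)[OF S comult_closed[OF True] fl o s])
   also have "pairing S f (conv_one A S) (comult A a) = conv A S f (conv_one A S) a"
    using True by (simp add: conv_apply)
   also have "\<dots> = f a" using conv_comm[OF S fl o] conv_unit[OF S f] by simp
   finally show ?thesis using True by (simp add: conv_apply)
  qed (simp add: conv_def)
 qed
qed

lemma alg_map_cK:
 assumes S: "algebra R S"
 shows "alg_map R S (cB S) (cK S)"
proof -
 interpret S: algebra R S by (rule S)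
 have oc: "conv_one A S a <: S" if "a <: A" for a using lin_closed[OF conv_one_lin[OF S] that] .
 have e: "conv_one A S \<in> extensional (carrier A)" by (simp add: conv_one_def)
 show ?thesis
 proof (rule alg_mapI, rule lmapI)
  fix x y assume xy: "x <: S" "y <: S"
  show "cK S x <: cB S" using cK_lin_hom[OF S xy(1)] by (simp add: cB_simps)
  show "cK S (x \<oplus>\<^sub>S y) = cK S x \<oplus>\<^bsub>cB S\<^esub> cK S y"
   using xy oc by (auto simp: cB_simps cK_def S.l_distr)
  show "cK S (x \<otimes>\<^sub>S y) = cK S x \<otimes>\<^bsub>cB S\<^esub> cK S y"
   unfolding cB_simps conv_cK[OF S xy(2) cK_lin_hom[OF S xy(1)]] using xy oc
   by (auto simp: cK_def S.m_ac)
  show "cK S (r \<odot>\<^sub>S x) = r \<odot>\<^bsub>cB S\<^esub> cK S x" if "r <: R" for r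
   using xy oc that by (auto simp: cB_simps cK_def S.smult_assoc2)
 next
  show "cK S \<one>\<^sub>S = \<one>\<^bsub>cB S\<^esub>"
   using oc e by (auto simp: cB_simps cK_def fun_eq_iff extensional_def)
 qed
qed

lemma bilin_mult_left_comp:
 "algebra R T ==> lmap R M T v ==> bilin R T M T (\<lambda>t a. t \<otimes>\<^sub>T v a)"
 by (rule bilin_comp[OF bilin_mult lin_id])

text \<open>For x = \<Sum> t_i \<otimes> a_i this is f \<mapsto> \<Sum> t_i h(f(a_i)), evaluation of
  functions at x. It is an algebra map when x is group-like.\<close>

lemma lin_psi:
 assumes S: "algebra R S" and T: "algebra R T" and h: "lmap R S T h" and x: "x <: tensor R T A"
 shows "lmap R (cB S) T (\<lambda>f. pairing T (\<lambda>t. t) (\<lambda>a. h (f a)) x)"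
 unfolding pairing_def
proof (rule lin_tlift_param[OF alg_mod[OF T] A alg_mod[OF T] alg_mod[OF algebra_cB[OF S]] _ _ x])
 show "bilin R T A T (\<lambda>t a. t \<otimes>\<^sub>T h (f a))" if "f <: cB S" for f
  by (rule bilin_mult_left_comp[OF T lin_comp[OF _ h]]) (use that in \<open>simp add: cB_simps lin_hom_iff\<close>)
 show "lmap R (cB S) T (\<lambda>f. t \<otimes>\<^sub>T h (f a))" if "t <: T" "a <: A" for t a
  by (rule lin_comp[OF lin_comp[OF lin_eval[OF S that(2)] h] bilin_right[OF bilin_mult[OF T] that(1)]])
qed

text \<open>The element \<open>\<Sum> \<xi>\<^sub>j \<otimes> e\<^sub>j\<close> of \<open>A\<^sup>*(S) \<otimes> A\<close> attached to the finite rank map \<open>\<Sum> \<xi>\<^sub>j(-) e\<^sub>j\<close>.\<close>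

definition finrank_pt :: "'u md => ('u => 'u) => ('u => 'u, 'u) tensor_elt => bool" where
 "finrank_pt S d X \<longleftrightarrow> X <: tensor R (cB S) A \<and>
  (\<forall>f\<in>lin_hom R A S. pairing (cB S) (\<lambda>b. b) (\<lambda>a. cK S (f a)) X = (\<lambda>a\<in>carrier A. f (d a))) \<and>
  (\<forall>(T :: ('u, 'u) module) h x. algebra R T --> alg_map R S T h --> x <: tensor R T A -->
    tmap R (cB S) A T A (\<lambda>f. pairing T (\<lambda>t. t) (\<lambda>a. h (f a)) x) (\<lambda>a. a) X = rmap R T A A d x)"

text \<open>The element is built along the generation of \<open>d\<close>. The second clause of
  \<open>finrank_pt\<close> says that evaluating the tautological element on a function f gives f
  after d; the third that specializing it by evaluation at x gives d applied to x.\<close>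

lemma ex_finrank_pt:
 assumes S: "algebra R S" and d: "finrank R A d"
 shows "\<exists>X. finrank_pt S d X"
 using d
proof induction
 interpret S: algebra R S by (rule S)
 note B = algebra_cB[OF S]
 note mB = alg_mod[OF B]
 interpret BA: module R "tensor R (cB S) A" by (rule module_tensor[OF mB A])
 interpret B: algebra R "cB S" by (rule B)
 note Kl = alg_map_lin[OF alg_map_cK[OF S]]
 have kf: "lmap R A (cB S) (\<lambda>a. cK S (f a))" if "f \<in> lin_hom R A S" for f
  by (rule lin_comp[OF _ Kl]) (use that in \<open>simp add: lin_hom_iff\<close>)
 {
  case (rank1 \<xi> e)
  let ?u = "restrict (unit_map S \<xi>) (carrier A)"
  have ul: "lmap R A S (unit_map S \<xi>)" by (rule lin_unit_map[OF S rank1(1)])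
  have u: "?u \<in> lin_hom R A S" by (rule restrict_lin_hom[OF A ul])
  have \<xi>c: "\<xi> a <: R" if "a <: A" for a using lin_closed[OF rank1(1) that] by (simp add: ring_as_module_def)
  show ?case
   unfolding finrank_pt_def
  \<comment> \<open>For rank one the element is \<xi> \<otimes> e, with the functional \<xi> read as
    an \<open>S\<close>-valued function.\<close>
  proof (intro exI[of _ "tens R (cB S) A ?u e"] conjI ballI allI impI)
   show "tens R (cB S) A ?u e <: tensor R (cB S) A"
    by (rule tens_closed[OF mB A]) (use u rank1 in \<open>simp_all add: cB_simps\<close>)
   fix f assume f: "f \<in> lin_hom R A S"
   have fl: "lmap R A S f" using f by (simp add: lin_hom_iff)
   have fe: "f e <: S" by (rule lin_closed[OF fl rank1(2)])
   have "pairing (cB S) (\<lambda>b. b) (\<lambda>a. cK S (f a)) (tens R (cB S) A ?u e) = conv A S ?u (cK S (f e))"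
    using u by (simp add: pairing_pure[OF mB A B lin_id kf[OF f]] cB_simps rank1(2))
   also have "\<dots> = (\<lambda>a\<in>carrier A. f e \<otimes>\<^sub>S ?u a)" by (rule conv_cK[OF S fe u])
   also have "\<dots> = (\<lambda>a\<in>carrier A. f (\<xi> a \<odot>\<^sub>A e))"
   proof (rule restrict_ext)
    fix a assume a: "a <: A"
    show "f e \<otimes>\<^sub>S ?u a = f (\<xi> a \<odot>\<^sub>A e)"
     using a fe \<xi>c[OF a] lin_smult[OF bilin_right[OF bilin_mult[OF S]], of "f e" "\<xi> a" "\<one>\<^sub>S"]
     by (simp add: lin_smult[OF fl] rank1(2))
   qed
   finally show "pairing (cB S) (\<lambda>b. b) (\<lambda>a. cK S (f a)) (tens R (cB S) A ?u e) = (\<lambda>a\<in>carrier A. f (\<xi> a \<odot>\<^sub>A e))" .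
  next
   fix T :: "'u md" and h x
   assume T: "algebra R T" and h: "alg_map R S T h" and x: "x <: tensor R T A"
   note mT = alg_mod[OF T] and hl = alg_map_lin[OF h]
   let ?\<psi> = "\<lambda>f. pairing T (\<lambda>t. t) (\<lambda>a. h (f a)) x"
   note \<psi> = lin_psi[OF S T hl x]
   have "lmap R A S ?u" using u unfolding lin_hom_iff by (rule conjunct1)
   from lin_comp[OF this hl] have hu: "lmap R A T (\<lambda>a. h (?u a))" .
   have "?\<psi> ?u = pairing T (\<lambda>t. t) (unit_map T \<xi>) x"
    by (rule pairing_cong[OF mT A T lin_id hu _ _ x])
     (use \<xi>c in \<open>simp_all add: lin_smult[OF hl] alg_map_one[OF h]\<close>)
   also have "\<dots> = contract T \<xi> x" by (rule contract_val[OF T T alg_map_id rank1(1) x])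
   finally have "?\<psi> ?u = contract T \<xi> x" .
   moreover have "tmap R (cB S) A T A ?\<psi> (\<lambda>a. a) (tens R (cB S) A ?u e) = tens R T A (?\<psi> ?u) e"
    by (rule tmap_pure[OF mB A mT A \<psi> lin_id]) (use u rank1(2) in \<open>simp_all add: cB_simps\<close>)
   ultimately show "tmap R (cB S) A T A ?\<psi> (\<lambda>a. a) (tens R (cB S) A ?u e) = rmap R T A A (\<lambda>p. \<xi> p \<odot>\<^sub>A e) x"
    using tmap_rank1[OF mT A rank1 x] by simp
  qed
 next
  case (sum d d')
  then obtain X X' where fX: "finrank_pt S d X" "finrank_pt S d' X'" by blast
  have X: "X <: tensor R (cB S) A" "X' <: tensor R (cB S) A"
   using fX by (simp_all add: finrank_pt_def)
  have 1: "pairing (cB S) (\<lambda>b. b) (\<lambda>a. cK S (f a)) X = (\<lambda>a\<in>carrier A. f (d a))"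
   "pairing (cB S) (\<lambda>b. b) (\<lambda>a. cK S (f a)) X' = (\<lambda>a\<in>carrier A. f (d' a))" if "f \<in> lin_hom R A S" for f
   using fX that unfolding finrank_pt_def by blast+
  have 2: "tmap R (cB S) A T A (\<lambda>f. pairing T (\<lambda>t. t) (\<lambda>a. h (f a)) x) (\<lambda>a. a) X = rmap R T A A d x"
   "tmap R (cB S) A T A (\<lambda>f. pairing T (\<lambda>t. t) (\<lambda>a. h (f a)) x) (\<lambda>a. a) X' = rmap R T A A d' x"
   if "algebra R T" "alg_map R S T h" "x <: tensor R T A" for T :: "'u md" and h x
   using fX that unfolding finrank_pt_def by blast+
  note dl = finrank_linmap[OF A sum(1)] finrank_linmap[OF A sum(2)]
  show ?case
   unfolding finrank_pt_def
  proof (intro exI[of _ "X \<oplus>\<^bsub>tensor R (cB S) A\<^esub> X'"] conjI ballI allI impI)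
   show "X \<oplus>\<^bsub>tensor R (cB S) A\<^esub> X' <: tensor R (cB S) A" using X by simp
   fix f assume f: "f \<in> lin_hom R A S"
   have fl: "lmap R A S f" using f by (simp add: lin_hom_iff)
   show "pairing (cB S) (\<lambda>b. b) (\<lambda>a. cK S (f a)) (X \<oplus>\<^bsub>tensor R (cB S) A\<^esub> X') = (\<lambda>a\<in>carrier A. f (d a \<oplus>\<^sub>A d' a))"
    using lin_closed[OF dl(1)] lin_closed[OF dl(2)]
    by (auto simp: lin_add[OF lin_pairing[OF mB A B lin_id kf[OF f]] X] 1[OF f] cB_simps lin_add[OF fl])
  next
   fix T :: "'u md" and h x
   assume T: "algebra R T" and h: "alg_map R S T h" and x: "x <: tensor R T A"
   note mT = alg_mod[OF T] and hl = alg_map_lin[OF h]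
   show "tmap R (cB S) A T A (\<lambda>f. pairing T (\<lambda>t. t) (\<lambda>a. h (f a)) x) (\<lambda>a. a) (X \<oplus>\<^bsub>tensor R (cB S) A\<^esub> X')
     = rmap R T A A (\<lambda>p. d p \<oplus>\<^sub>A d' p) x"
    unfolding lin_add[OF lin_tensor_map[OF mB A mT A lin_psi[OF S T hl x] lin_id] X] 2[OF T h x]
     tmap_sum[OF mT A dl x] ..
  qed
 }
qed

text \<open>\<open>C\<close> is a quotient of Hom(A, S) within the universe and \<open>x\<close> a
  group-like element over it with \<langle>f, x\<rangle> = \<pi>(f). Every group-like element over
  an \<open>S\<close>-algebra with second legs in \<open>M\<close> arises from \<open>x\<close> by a
  base change. Finally, evaluation at \<open>a\<close> descends to \<open>C\<close> when the second
  legs of the coproduct of \<open>a\<close> lie in \<open>M\<close>, and for \<open>a\<close> in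
  \<open>M\<close> it sends \<open>x\<close> to 1 \<otimes> a.\<close>

definition generic_pt :: "'u md => 'u set => 'u md => (('u => 'u) => 'u) => ('u, 'u) tensor_elt => bool" where
 "generic_pt S M C \<pi> x \<longleftrightarrow> algebra R C \<and> alg_map R (cB S) C \<pi> \<and> \<pi> ` carrier (cB S) = carrier C \<and> x \<in> gr C \<and>
   (\<forall>f\<in>lin_hom R A S. pairing C (\<lambda>c. c) (\<lambda>a. \<pi> (cK S (f a))) x = \<pi> f) \<and>
   (\<forall>(T :: ('u, 'u) module) h y. algebra R T --> alg_map R S T h --> y \<in> gr T --> y \<in> tspan R T A M -->
    (\<exists>k. alg_map R C T k \<and> push_pt C T k x = y \<and>
      (\<forall>f\<in>lin_hom R A S. k (\<pi> f) = pairing T (\<lambda>t. t) (\<lambda>a. h (f a)) y))) \<and>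
   (\<forall>a\<in>carrier A. comult A a \<in> tspan R A A M -->
    (\<exists>ev. lmap R C S ev \<and> (\<forall>f\<in>lin_hom R A S. ev (\<pi> f) = f a) \<and>
      (a \<in> M --> push_pt C S ev x = tens R S A \<one>\<^sub>S a)))"

lemma ideal_kernel:
 assumes B: "algebra R B" and T: "algebra R T" and \<psi>: "alg_map R B T \<psi>"
 shows "ideal {f \<in> carrier B. \<psi> f = \<zero>\<^sub>T} B"
proof -
 interpret B: algebra R B by (rule B)
 interpret T: algebra R T by (rule T)
 note l = alg_map_lin[OF \<psi>] and mB = alg_mod[OF B] and mT = alg_mod[OF T]
 show ?thesis
 proof (rule idealI)
  show "ring B" by (rule cring.axioms(1)[OF B.M_cring])
  show "subgroup {f \<in> carrier B. \<psi> f = \<zero>\<^sub>T} (add_monoid B)"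
   by (rule group.subgroupI)
    (auto simp: B.add.is_group lin_zero[OF mB mT l] lin_add[OF l] lin_uminus[OF mB mT l, unfolded a_inv_def]
     a_inv_def[symmetric] lin_uminus[OF mB mT l] B.add.inv_closed[simplified])
 qed (auto simp: alg_map_mult[OF \<psi>] lin_closed[OF l])
qed

text \<open>Divide Hom(A, S) by the ideal generated by the functions vanishing on \<open>M\<close>.
  The tautological element of a finite rank \<open>d\<close> satisfies \<langle>f, X\<rangle> = f
  \<circ> d, and since f \<circ> d and f agree on \<open>M\<close>, it becomes tautological, hence
  group-like, in the quotient.\<close>

lemma ex_generic_pt:
 fixes S :: "'u md"
 assumes S: "algebra R S" and M: "finite M" "M \<subseteq> carrier A"
 shows "\<exists>C \<pi> x. generic_pt S M C \<pi> x"
proof -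
 interpret A: module R A by (rule A)
 interpret S: algebra R S by (rule S)
 note B = algebra_cB[OF S]
 note mB = alg_mod[OF B]
 interpret B: algebra R "cB S" by (rule B)
 have rB: "ring (cB S)" by (rule cring.axioms(1)[OF B.M_cring])
 define N where "N = {f \<in> carrier (cB S). \<forall>p\<in>M. f p = \<zero>\<^sub>S}"
 have Nc: "N \<subseteq> carrier (cB S)" by (auto simp: N_def)
 define J where "J = genideal (cB S) N"
 have J: "ideal J (cB S)" unfolding J_def by (rule ring.genideal_ideal[OF rB Nc])
 have NJ: "f \<in> J" if "f \<in> N" for f unfolding J_def using ring.genideal_self[OF rB Nc] that by blast
 have Jmin: "J \<subseteq> I" if "ideal I (cB S)" "N \<subseteq> I" for I
  unfolding J_def by (rule ring.genideal_minimal[OF rB that])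
 have ev: "(f \<ominus>\<^bsub>cB S\<^esub> g) a = f a \<ominus>\<^sub>S g a" if "f <: cB S" "g <: cB S" "a <: A" for f g a
  by (rule lin_minus[OF mB S.module lin_eval[OF S that(3)] that(1,2)])
 have fc: "f a <: S" if "f <: cB S" "a <: A" for f a
  using lin_closed[OF lin_eval[OF S that(2)] that(1)] .
 \<comment> \<open>This is the finiteness condition under which the quotient fits into
   \<open>'u\<close>.\<close>
 have eqJ: "f \<ominus>\<^bsub>cB S\<^esub> g \<in> J" if fg: "f <: cB S" "g <: cB S" and e: "\<forall>p\<in>M. f p = g p" for f g
 proof (rule NJ)
  have "(f \<ominus>\<^bsub>cB S\<^esub> g) p = \<zero>\<^sub>S" if "p \<in> M" for p
   using ev[OF fg, of p] that M(2) e fc[OF fg(2), of p] by (auto simp: a_minus_def S.r_neg)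
  then show "f \<ominus>\<^bsub>cB S\<^esub> g \<in> N" using fg by (simp add: N_def)
 qed
 obtain C :: "'u md" and \<pi> where C: "algebra R C" "alg_map R (cB S) C \<pi>" "\<pi> ` carrier (cB S) = carrier C"
  and kerJ: "\<And>f. f <: cB S ==> \<pi> f = \<zero>\<^sub>C \<longleftrightarrow> f \<in> J"
  by (rule ex_small_quotient[OF inf B J M(1) eqJ], assumption+, rule that)
 interpret C: algebra R C by (rule C(1))
 note mC = alg_mod[OF C(1)] and \<pi>l = alg_map_lin[OF C(2)]
 have \<pi>eq: "\<pi> f = \<pi> g" if fg: "f <: cB S" "g <: cB S" and e: "\<forall>p\<in>M. f p = g p" for f g
 proof -
  have "\<pi> (f \<ominus>\<^bsub>cB S\<^esub> g) = \<zero>\<^sub>C" using kerJ[of "f \<ominus>\<^bsub>cB S\<^esub> g"] eqJ[OF that] fg by simp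
  then show ?thesis
   using fg lin_closed[OF \<pi>l] by (simp add: lin_minus[OF mB mC \<pi>l] minus_eq_zero_iff[OF mC])
 qed
 obtain d where d: "finrank R A d" "\<forall>p\<in>M. d p = p" using lp M unfolding loc_proj_def by blast
 note dl = finrank_linmap[OF A d(1)]
 obtain X where fX: "finrank_pt S d X" using ex_finrank_pt[OF S d(1)] by blast
 have X: "X <: tensor R (cB S) A" using fX by (simp add: finrank_pt_def)
 have X1: "pairing (cB S) (\<lambda>b. b) (\<lambda>a. cK S (f a)) X = (\<lambda>a\<in>carrier A. f (d a))" if "f \<in> lin_hom R A S" for f
  using fX that unfolding finrank_pt_def by blast
 have X3: "tmap R (cB S) A T A (\<lambda>f. pairing T (\<lambda>t. t) (\<lambda>a. h (f a)) x) (\<lambda>a. a) X = rmap R T A A d x"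
  if "algebra R T" "alg_map R S T h" "x <: tensor R T A" for T :: "'u md" and h x
  using fX that unfolding finrank_pt_def by blast
 let ?x = "push_pt (cB S) C \<pi> X"
 have x: "?x <: tensor R C A" by (rule lin_closed[OF lin_tensor_map[OF mB A mC A \<pi>l lin_id] X])
 note K = alg_map_cK[OF S]
 note Kl = alg_map_lin[OF K]
 have Kf: "lmap R A (cB S) (\<lambda>a. cK S (f a))" if "f \<in> lin_hom R A S" for f
  by (rule lin_comp[OF _ Kl]) (use that in \<open>simp add: lin_hom_iff\<close>)
 have x1: "pairing C (\<lambda>c. c) (\<lambda>a. \<pi> (cK S (f a))) ?x = \<pi> f" if f: "f \<in> lin_hom R A S" for f
 proof -
  have fl: "lmap R A S f" using f by (simp add: lin_hom_iff)
  note Kf = Kf[OF f]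
  have fd: "(\<lambda>a\<in>carrier A. f (d a)) \<in> lin_hom R A S" by (rule restrict_lin_hom[OF A lin_comp[OF dl fl]])
  have "pairing C (\<lambda>c. c) (\<lambda>a. \<pi> (cK S (f a))) ?x = pairing C \<pi> (\<lambda>a. \<pi> (cK S (f a))) X"
   by (rule pairing_push[OF mB mC C(1) \<pi>l lin_id lin_comp[OF Kf \<pi>l] X])
  also have "\<dots> = \<pi> (pairing (cB S) (\<lambda>b. b) (\<lambda>a. cK S (f a)) X)"
   by (rule tmap_ext[OF mB A lin_pairing[OF mB A C(1) \<pi>l lin_comp[OF Kf \<pi>l]]
      lin_comp[OF lin_pairing[OF mB A B lin_id Kf] \<pi>l] _ X])
    (simp add: pairing_pure[OF mB A C(1) \<pi>l lin_comp[OF Kf \<pi>l]] pairing_pure[OF mB A B lin_id Kf]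
     alg_map_mult[OF C(2)] lin_closed[OF Kf])
  also have "\<dots> = \<pi> f"
   unfolding X1[OF f]
   by (rule \<pi>eq) (use f fd d(2) M(2) in \<open>auto simp: cB_simps subset_iff\<close>)
  finally show ?thesis .
 qed
 \<comment> \<open>Contraction of the element by a functional \<xi> is the class of \<xi>, and both
   the product and the unit of the quotient come from convolution.\<close>
 have xg: "?x \<in> gr C"
 proof -
  have cv: "contract C \<xi> ?x = \<pi> (restrict (unit_map S \<xi>) (carrier A))" if \<xi>: "lmap R A Rm \<xi>" for \<xi>
  proof -
   let ?u = "restrict (unit_map S \<xi>) (carrier A)"
   have u: "?u \<in> lin_hom R A S" by (rule restrict_lin_hom[OF A lin_unit_map[OF S \<xi>]])
   have \<xi>c: "\<xi> a <: R" if "a <: A" for a using lin_closed[OF \<xi> that] by (simp add: ring_as_module_def)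
   have "contract C \<xi> ?x = pairing C (\<lambda>c. c) (unit_map C \<xi>) ?x"
    by (rule contract_val[OF C(1) C(1) alg_map_id \<xi> x, symmetric])
   also have "\<dots> = pairing C (\<lambda>c. c) (\<lambda>a. \<pi> (cK S (?u a))) ?x"
    by (rule pairing_cong[OF mC A C(1) lin_id lin_unit_map[OF C(1) \<xi>] _ _ x])
     (simp_all add: lin_smult[OF Kl] lin_smult[OF \<pi>l] alg_map_one[OF K] alg_map_one[OF C(2)] \<xi>c)
   also have "\<dots> = \<pi> ?u" by (rule x1[OF u])
   finally show ?thesis .
  qed
  have u: "restrict (unit_map S \<xi>) (carrier A) <: cB S" if "lmap R A Rm \<xi>" for \<xi>
   using restrict_lin_hom[OF A lin_unit_map[OF S that]] by (simp add: cB_simps)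
  have "contract C (conv A Rm v w) ?x = contract C v ?x \<otimes>\<^sub>C contract C w ?x"
   if v: "lmap R A Rm v" and w: "lmap R A Rm w" for v w
  proof -
   note vl = lin_unit_map[OF S v] and wl = lin_unit_map[OF S w]
   have "conv A S (unit_map S v) (unit_map S w)
     = conv A S (restrict (unit_map S v) (carrier A)) (restrict (unit_map S w) (carrier A))"
    by (rule conv_cong[OF S vl wl]) simp_all
   moreover have "restrict (unit_map S (conv A Rm v w)) (carrier A) = conv A S (unit_map S v) (unit_map S w)"
    using conv_unit_map[OF S v w] by (auto simp: fun_eq_iff) (simp add: conv_def)
   ultimately show ?thesis
    using alg_map_mult[OF C(2) u[OF v] u[OF w]] by (simp only: cv[OF v] cv[OF w] cv[OF conv_lin[OF RR v w]] cB_simps)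
  qed
  moreover have "contract C (counit A) ?x = \<one>\<^sub>C"
   using alg_map_one[OF C(2)] by (simp add: cv[OF counit] cB_simps conv_one_def)
  ultimately show ?thesis using x by (simp add: gr_def)
 qed
 have uni: "\<exists>k. alg_map R C T k \<and> push_pt C T k ?x = y \<and>
   (\<forall>f\<in>lin_hom R A S. k (\<pi> f) = pairing T (\<lambda>t. t) (\<lambda>a. h (f a)) y)"
  if T: "algebra R T" and h: "alg_map R S T h" and y: "y \<in> gr T" and ys: "y \<in> tspan R T A M" for T :: "'u md" and h y
 proof -
  interpret T: algebra R T by (rule T)
  note mT = alg_mod[OF T] and hl = alg_map_lin[OF h]
  have y': "y <: tensor R T A" by (rule gr_closed[OF y])
  \<comment> \<open>The required base change is evaluation of functions at \<open>y\<close>;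
    multiplicativity is exactly the group-like property of \<open>y\<close>.\<close>
  let ?\<psi> = "\<lambda>f. pairing T (\<lambda>t. t) (\<lambda>a. h (f a)) y"
  note \<psi>l = lin_psi[OF S T hl y']
  have hf: "lmap R A T (\<lambda>a. h (f a))" if "f \<in> lin_hom R A S" for f
   by (rule lin_comp[OF _ hl]) (use that in \<open>simp add: lin_hom_iff\<close>)
  have \<psi>: "alg_map R (cB S) T ?\<psi>"
  proof (rule alg_mapI[OF \<psi>l])
   fix f g assume fg: "f <: cB S" "g <: cB S"
   then have fg': "f \<in> lin_hom R A S" "g \<in> lin_hom R A S" by (simp_all add: cB_simps)
   have fl: "lmap R A S f" "lmap R A S g" using fg' by (simp_all add: lin_hom_iff)
   have "?\<psi> (f \<otimes>\<^bsub>cB S\<^esub> g) = pairing T (\<lambda>t. t) (conv A T (\<lambda>a. h (f a)) (\<lambda>a. h (g a))) y"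
    unfolding cB_simps
    by (rule pairing_cong[OF mT A T lin_id lin_comp[OF conv_lin[OF S fl] hl] _ _ y'])
     (simp_all add: conv_nat[OF S T h fl])
   also have "\<dots> = ?\<psi> f \<otimes>\<^sub>T ?\<psi> g"
    by (rule gr_pairing(1)[OF T T alg_map_id y hf[OF fg'(1)] hf[OF fg'(2)]])
   finally show "?\<psi> (f \<otimes>\<^bsub>cB S\<^esub> g) = ?\<psi> f \<otimes>\<^sub>T ?\<psi> g" .
  next
   have "?\<psi> \<one>\<^bsub>cB S\<^esub> = pairing T (\<lambda>t. t) (conv_one A T) y"
    unfolding cB_simps
    by (rule pairing_cong[OF mT A T lin_id lin_comp[OF conv_one_lin[OF S] hl] _ _ y'])
     (simp_all add: conv_one_nat[OF S T h])
   then show "?\<psi> \<one>\<^bsub>cB S\<^esub> = \<one>\<^sub>T" using gr_pairing(2)[OF T T alg_map_id y] by simp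
  qed
  \<comment> \<open>A function vanishing on \<open>M\<close> has value zero at \<open>y\<close>,
    because the second legs of \<open>y\<close> lie in \<open>M\<close>.\<close>
  have "N \<subseteq> {f \<in> carrier (cB S). ?\<psi> f = \<zero>\<^sub>T}"
  proof
   fix f assume f: "f \<in> N"
   then have f': "f \<in> lin_hom R A S" by (simp add: N_def cB_simps)
   have "?\<psi> f = \<zero>\<^sub>T"
    by (rule tspan_ext[OF mT A M(2) ys lin_pairing[OF mT A T lin_id hf[OF f']] lin_const_zero[OF mT]])
     (use f M(2) lin_zero[OF S.module mT hl] in \<open>auto simp: pairing_pure[OF mT A T lin_id hf[OF f']] N_def subset_iff\<close>)
   then show "f \<in> {f \<in> carrier (cB S). ?\<psi> f = \<zero>\<^sub>T}" using f Nc by auto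
  qed
  then have ker: "?\<psi> f = \<zero>\<^sub>T" if "f <: cB S" "\<pi> f = \<zero>\<^sub>C" for f
   using Jmin[OF ideal_kernel[OF B T \<psi>]] kerJ that by blast
  obtain k where k: "lmap R C T k" "\<And>f. f <: cB S ==> k (\<pi> f) = ?\<psi> f"
   by (rule factor_linmap[OF mB mC mT \<pi>l C(3) \<psi>l ker], assumption+, rule that)
  have ka: "alg_map R C T k" by (rule alg_map_factor[OF B C(2,3) \<psi> k])
  have "push_pt C T k ?x = push_pt (cB S) T (\<lambda>f. k (\<pi> f)) X"
   by (rule tmap_comp[OF mB A mC A mT A \<pi>l lin_id k(1) lin_id X])
  also have "\<dots> = push_pt (cB S) T ?\<psi> X"
   by (rule tmap_cong[OF mB A mT A lin_comp[OF \<pi>l k(1)] lin_id k(2) _ X]) simp_all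
  also have "\<dots> = rmap R T A A d y" by (rule X3[OF T h y'])
  also have "\<dots> = y" by (rule tspan_finrank[OF mT A M(2) ys dl]) (use d(2) in simp)
  finally show ?thesis using ka k(2) by (auto simp: cB_simps)
 qed
 have evl: "\<exists>ev. lmap R C S ev \<and> (\<forall>f\<in>lin_hom R A S. ev (\<pi> f) = f a) \<and>
   (a \<in> M --> push_pt C S ev ?x = tens R S A \<one>\<^sub>S a)"
  if a: "a <: A" and good: "comult A a \<in> tspan R A A M" for a
 proof -
  \<comment> \<open>Evaluation at \<open>a\<close> is not multiplicative, so its kernel is no ideal
    in general. This is the largest ideal contained in that kernel.\<close>
  let ?I = "{f \<in> carrier (cB S). \<forall>g\<in>carrier (cB S). (g \<otimes>\<^bsub>cB S\<^esub> f) a = \<zero>\<^sub>S}"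
  note el = lin_eval[OF S a]
  have Ii: "ideal ?I (cB S)"
  proof (rule idealI[OF rB])
   show "subgroup ?I (add_monoid (cB S))"
   proof (rule group.subgroupI)
    show "group (add_monoid (cB S))" by (rule B.add.is_group)
    show "?I \<noteq> {}" using lin_zero[OF mB S.module el] by (auto intro!: exI[of _ "\<zero>\<^bsub>cB S\<^esub>"])
    show "inv\<^bsub>add_monoid (cB S)\<^esub> f \<in> ?I" if "f \<in> ?I" for f
     using that lin_uminus[OF mB S.module el] by (simp add: a_inv_def[symmetric] B.r_minus)
    show "f \<otimes>\<^bsub>add_monoid (cB S)\<^esub> g \<in> ?I" if "f \<in> ?I" "g \<in> ?I" for f g
     using that by (simp add: B.r_distr lin_add[OF el])
   qed auto
   show "h \<otimes>\<^bsub>cB S\<^esub> f \<in> ?I" if f: "f \<in> ?I" and h: "h <: cB S" for f h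
   proof -
    have "(g \<otimes>\<^bsub>cB S\<^esub> (h \<otimes>\<^bsub>cB S\<^esub> f)) a = \<zero>\<^sub>S" if g: "g <: cB S" for g
    proof -
     have "g \<otimes>\<^bsub>cB S\<^esub> (h \<otimes>\<^bsub>cB S\<^esub> f) = (g \<otimes>\<^bsub>cB S\<^esub> h) \<otimes>\<^bsub>cB S\<^esub> f" using f g h by (simp add: B.m_assoc)
     then show ?thesis using f g h by simp
    qed
    then show ?thesis using f h by simp
   qed
   then show "f \<otimes>\<^bsub>cB S\<^esub> h \<in> ?I" if f: "f \<in> ?I" and h: "h <: cB S" for f h
    using that B.m_comm[of f h] by simp
  qed
  \<comment> \<open>Here the support condition on the coproduct of \<open>a\<close> is used: in (g
    f)(a) the factor f is applied to second legs only.\<close>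
  have "N \<subseteq> ?I"
  proof (intro subsetI CollectI conjI ballI)
   fix f assume f: "f \<in> N"
   then show fB: "f <: cB S" using Nc by blast
   fix g assume g: "g <: cB S"
   have fl: "lmap R A S f" and gl: "lmap R A S g" using fB g by (simp_all add: cB_simps lin_hom_iff)
   have "pairing S g f (comult A a) = \<zero>\<^sub>S"
    by (rule tspan_ext[OF A A M(2) good lin_pairing[OF A A S gl fl] lin_const_zero[OF S.module]])
     (use f M(2) in \<open>auto simp: pairing_pure[OF A A S gl fl] N_def subset_iff lin_closed[OF gl]\<close>)
   then show "(g \<otimes>\<^bsub>cB S\<^esub> f) a = \<zero>\<^sub>S" using a by (simp add: cB_simps conv_apply)
  qed
  then have JI: "J \<subseteq> ?I" by (rule Jmin[OF Ii])
  have ker: "f a = \<zero>\<^sub>S" if f: "f <: cB S" and "\<pi> f = \<zero>\<^sub>C" for f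
  proof -
   have "f \<in> ?I" using kerJ[OF f] that JI by blast
   then have "(\<one>\<^bsub>cB S\<^esub> \<otimes>\<^bsub>cB S\<^esub> f) a = \<zero>\<^sub>S" using B.one_closed by blast
   then show ?thesis using f by simp
  qed
  obtain e where e: "lmap R C S e" "\<And>f. f <: cB S ==> e (\<pi> f) = f a"
   by (rule factor_linmap[OF mB mC S.module \<pi>l C(3) el], erule (1) ker, rule that)
  \<comment> \<open>Evaluation at \<open>a\<close> is pairing with 1 \<otimes> a, so the element
    specializes to 1 \<otimes> d(a), and \<open>d\<close> fixes the elements of
    \<open>M\<close>.\<close>
  have "push_pt C S e ?x = tens R S A \<one>\<^sub>S a" if aM: "a \<in> M"
  proof -
   have p: "tens R S A \<one>\<^sub>S a <: tensor R S A" by (rule tens_closed[OF S.module A]) (use a in simp_all)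
   have "push_pt C S e ?x = push_pt (cB S) S (\<lambda>f. e (\<pi> f)) X"
    by (rule tmap_comp[OF mB A mC A S.module A \<pi>l lin_id e(1) lin_id X])
   also have "\<dots> = push_pt (cB S) S (\<lambda>f. pairing S (\<lambda>t. t) (\<lambda>a. f a) (tens R S A \<one>\<^sub>S a)) X"
   proof (rule tmap_cong[OF mB A S.module A lin_comp[OF \<pi>l e(1)] lin_id _ _ X])
    fix f assume f: "f <: cB S"
    have fl: "lmap R A S f" using f by (simp add: cB_simps lin_hom_iff)
    show "e (\<pi> f) = pairing S (\<lambda>t. t) (\<lambda>a. f a) (tens R S A \<one>\<^sub>S a)"
     using a fc[OF f a] by (simp add: e(2)[OF f] pairing_pure[OF S.module A S lin_id fl])
   qed simp
   also have "\<dots> = rmap R S A A d (tens R S A \<one>\<^sub>S a)"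
    by (rule X3[OF S alg_map_id p])
   also have "\<dots> = tens R S A \<one>\<^sub>S a"
    using a d(2) aM by (simp add: tmap_pure[OF S.module A S.module A lin_id dl])
   finally show ?thesis .
  qed
  then show ?thesis using e by (auto simp: cB_simps)
 qed
 have "generic_pt S M C \<pi> ?x"
  unfolding generic_pt_def using C xg x1 uni evl by blast
 then show ?thesis by blast
qed

end

section \<open>Functions on group-like elements are linear\<close>

lemma pairing_smult_right:
 assumes M: "module R M" and N: "module R N" and T: "algebra R T" and f: "lmap R M T f" and g: "lmap R N T g"
  and t: "t <: T" and X: "X <: tensor R M N"
 shows "pairing T f (\<lambda>y. t \<otimes>\<^sub>T g y) X = t \<otimes>\<^sub>T pairing T f g X"
proof -
 interpret T: algebra R T by (rule T)
 note mt = bilin_right[OF bilin_mult[OF T] t]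
 note tg = lin_comp[OF g mt]
 show ?thesis
  by (rule tmap_ext[OF M N lin_pairing[OF M N T f tg] lin_comp[OF lin_pairing[OF M N T f g] mt] _ X])
   (use t in \<open>simp add: pairing_pure[OF M N T f tg] pairing_pure[OF M N T f g] lin_closed[OF f] lin_closed[OF g] T.m_lcomm\<close>)
qed

text \<open>Base change along \<open>h\<close> followed by multiplication by
  \<open>t\<close>.\<close>

definition act :: "('r, 'y) ring_scheme => ('r, 'c, 's) module_scheme => ('r, 'b, 'q) module_scheme => ('a => 'c)
  => 'c => ('a, 'b) tensor_elt => ('c, 'b) tensor_elt" where
 "act R T P h t z = tlift (tensor R T P) (\<lambda>s p. tens R T P (t \<otimes>\<^sub>T h s) p) z"

lemma
 assumes S: "module R S" and T: "algebra R T" and P: "module R P" and h: "lmap R S T h"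
 shows bilin_act: "bilin R T (tensor R S P) (tensor R T P) (act R T P h)"
  and act_pure: "t <: T ==> s <: S ==> p <: P
   ==> act R T P h t (tens R S P s p) = tens R T P (t \<otimes>\<^sub>T h s) p"
proof -
 note mT = alg_mod[OF T]
 note TP = module_tensor[OF mT P]
 have b: "bilin R S P (tensor R T P) (\<lambda>s p. tens R T P (t \<otimes>\<^sub>T h s) p)" if "t <: T" for t
  by (rule bilin_comp[OF bilin_pure_tensor[OF mT P] lin_comp[OF h bilin_right[OF bilin_mult[OF T] that]] lin_id])
 show "bilin R T (tensor R S P) (tensor R T P) (act R T P h)"
 proof (rule bilinI)
  show "lmap R (tensor R S P) (tensor R T P) (act R T P h t)" if "t <: T" for t
   unfolding act_def by (rule lin_tlift[OF S P TP b[OF that]])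
  show "lmap R T (tensor R T P) (\<lambda>t. act R T P h t z)" if z: "z <: tensor R S P" for z
   unfolding act_def
  proof (rule lin_tlift_param[OF S P TP mT b _ z])
   fix s p assume "s <: S" "p <: P"
   then show "lmap R T (tensor R T P) (\<lambda>t. tens R T P (t \<otimes>\<^sub>T h s) p)"
    by (intro lin_comp[OF bilin_left[OF bilin_mult[OF T]] bilin_left[OF bilin_pure_tensor[OF mT P]]] lin_closed[OF h])
  qed
 qed
 show "act R T P h t (tens R S P s p) = tens R T P (t \<otimes>\<^sub>T h s) p"
  if "t <: T" "s <: S" "p <: P"
  unfolding act_def by (rule tlift_pure[OF S P TP b[OF that(1)] that(2,3)])
qed

text \<open>The \<open>T\<close>-linear map from T \<otimes> A to T \<otimes> P that extends an
  R-linear map from A to S \<otimes> P, for an \<open>S\<close>-algebra \<open>T\<close>. It is the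
  form in which natural maps on points over \<open>S\<close> are represented.\<close>

definition ext_map :: "('r, 'y) ring_scheme => ('r, 'c, 's) module_scheme => ('r, 'b, 'q) module_scheme => ('s1 => 'c)
  => ('a => ('s1, 'b) tensor_elt) => ('c, 'a) tensor_elt => ('c, 'b) tensor_elt" where
 "ext_map R T P h \<tau> x = tlift (tensor R T P) (\<lambda>t a. act R T P h t (\<tau> a)) x"

lemma
 assumes A: "module R A" and S: "module R S" and T: "algebra R T" and P: "module R P" and h: "lmap R S T h"
  and \<tau>: "lmap R A (tensor R S P) \<tau>"
 shows lin_ext_map: "lmap R (tensor R T A) (tensor R T P) (ext_map R T P h \<tau>)"
  and ext_map_pure: "t <: T ==> a <: A ==> ext_map R T P h \<tau> (tens R T A t a) = act R T P h t (\<tau> a)"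
proof -
 note mT = alg_mod[OF T]
 note TP = module_tensor[OF mT P]
 have b: "bilin R T A (tensor R T P) (\<lambda>t a. act R T P h t (\<tau> a))"
  by (rule bilin_comp[OF bilin_act[OF S T P h] lin_id \<tau>])
 show "lmap R (tensor R T A) (tensor R T P) (ext_map R T P h \<tau>)"
  unfolding ext_map_def by (rule lin_tlift[OF mT A TP b])
 show "ext_map R T P h \<tau> (tens R T A t a) = act R T P h t (\<tau> a)" if "t <: T" "a <: A"
  unfolding ext_map_def by (rule tlift_pure[OF mT A TP b that])
qed

lemma act_nat:
 assumes S: "module R S" and T: "algebra R T" and T': "algebra R T'" and P: "module R P" and h: "lmap R S T h"
  and k: "alg_map R T T' k" and t: "t <: T" and z: "z <: tensor R S P"
 shows "tmap R T P T' P k (\<lambda>p. p) (act R T P h t z) = act R T' P (\<lambda>s. k (h s)) (k t) z"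
proof -
 note mT = alg_mod[OF T] and mT' = alg_mod[OF T'] and kl = alg_map_lin[OF k]
 note kh = lin_comp[OF h kl] and kt = lin_closed[OF kl t]
 show ?thesis
  by (rule tmap_ext[OF S P lin_comp[OF bilin_right[OF bilin_act[OF S T P h] t] lin_tensor_map[OF mT P mT' P kl lin_id]]
     bilin_right[OF bilin_act[OF S T' P kh] kt] _ z])
   (use t kt bilin_closed[OF bilin_mult[OF T] t] in
    \<open>simp add: act_pure[OF S T P h] act_pure[OF S T' P kh] tmap_pure[OF mT P mT' P kl lin_id] alg_map_mult[OF k] lin_closed[OF h]\<close>)
qed

lemma ext_map_nat:
 assumes A: "module R A" and S: "module R S" and T: "algebra R T" and T': "algebra R T'" and P: "module R P" and h: "lmap R S T h"
  and \<tau>: "lmap R A (tensor R S P) \<tau>" and k: "alg_map R T T' k" and x: "x <: tensor R T A"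
 shows "tmap R T P T' P k (\<lambda>p. p) (ext_map R T P h \<tau> x)
  = ext_map R T' P (\<lambda>s. k (h s)) \<tau> (tmap R T A T' A k (\<lambda>a. a) x)"
proof -
 note mT = alg_mod[OF T] and mT' = alg_mod[OF T'] and kl = alg_map_lin[OF k]
 note kh = lin_comp[OF h kl]
 show ?thesis
  by (rule tmap_ext[OF mT A lin_comp[OF lin_ext_map[OF A S T P h \<tau>] lin_tensor_map[OF mT P mT' P kl lin_id]]
     lin_comp[OF lin_tensor_map[OF mT A mT' A kl lin_id] lin_ext_map[OF A S T' P kh \<tau>]] _ x])
   (simp add: ext_map_pure[OF A S T P h \<tau>] tmap_pure[OF mT A mT' A kl lin_id] ext_map_pure[OF A S T' P kh \<tau>]
    act_nat[OF S T T' P h k] lin_closed[OF kl] lin_closed[OF \<tau>])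
qed

lemma act_one:
 assumes S: "algebra R S" and P: "module R P" and z: "z <: tensor R S P"
 shows "act R S P (\<lambda>s. s) \<one>\<^sub>S z = z"
proof -
 interpret S: algebra R S by (rule S)
 show ?thesis
  by (rule tmap_ext[OF S.module P bilin_right[OF bilin_act[OF S.module S P lin_id]] lin_id _ z])
   (simp_all add: act_pure[OF S.module S P lin_id])
qed

lemma ext_map_one:
 assumes A: "module R A" and S: "algebra R S" and P: "module R P" and \<tau>: "lmap R A (tensor R S P) \<tau>" and a: "a <: A"
 shows "ext_map R S P (\<lambda>s. s) \<tau> (tens R S A \<one>\<^sub>S a) = \<tau> a"
proof -
 interpret S: algebra R S by (rule S)
 show ?thesis
  using a by (simp add: ext_map_pure[OF A S.module S P lin_id \<tau>] act_one[OF S P] lin_closed[OF \<tau>])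
qed

context lp_coalg
begin

lemma generic_ptD:
 assumes "generic_pt S M C \<pi> x"
 shows "algebra R C" "alg_map R (cB S) C \<pi>" "\<pi> ` carrier (cB S) = carrier C" "x \<in> gr C"
  "\<And>f. f \<in> lin_hom R A S ==> pairing C (\<lambda>c. c) (\<lambda>a. \<pi> (cK S (f a))) x = \<pi> f"
proof -
 note * = assms[unfolded generic_pt_def]
 show "algebra R C" by (rule *[THEN conjunct1])
 show "alg_map R (cB S) C \<pi>" by (rule *[THEN conjunct2, THEN conjunct1])
 show "\<pi> ` carrier (cB S) = carrier C" by (rule *[THEN conjunct2, THEN conjunct2, THEN conjunct1])
 show "x \<in> gr C" by (rule *[THEN conjunct2, THEN conjunct2, THEN conjunct2, THEN conjunct1])
 have "\<forall>f\<in>lin_hom R A S. pairing C (\<lambda>c. c) (\<lambda>a. \<pi> (cK S (f a))) x = \<pi> f"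
  by (rule *[THEN conjunct2, THEN conjunct2, THEN conjunct2, THEN conjunct2, THEN conjunct1])
 then show "\<And>f. f \<in> lin_hom R A S ==> pairing C (\<lambda>c. c) (\<lambda>a. \<pi> (cK S (f a))) x = \<pi> f" by (rule bspec)
qed

lemma generic_pt_unit: "algebra R S ==> generic_pt S M C \<pi> x ==> alg_map R S C (\<lambda>s. \<pi> (cK S s))"
 by (rule alg_map_comp[OF alg_map_cK generic_ptD(2)])

text \<open>The last clause says that the base change is one of \<open>S\<close>-algebras: pairing
  the group-like \<open>y\<close> with a multiple of the convolution unit returns that
  multiple.\<close>

lemma generic_pt_universal:
 fixes T :: "'u md"
 assumes g: "generic_pt S M C \<pi> x" and S: "algebra R S" and T: "algebra R T" and h: "alg_map R S T h" and y: "y \<in> gr T" "y \<in> tspan R T A M"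
 obtains k where "alg_map R C T k" "push_pt C T k x = y"
  "\<And>f. f \<in> lin_hom R A S ==> k (\<pi> f) = pairing T (\<lambda>t. t) (\<lambda>a. h (f a)) y"
  "\<And>s. s <: S ==> k (\<pi> (cK S s)) = h s"
proof -
 interpret S: algebra R S by (rule S)
 interpret T: algebra R T by (rule T)
 have "\<forall>(T :: ('u, 'u) module) h y. algebra R T --> alg_map R S T h --> y \<in> gr T --> y \<in> tspan R T A M -->
    (\<exists>k. alg_map R C T k \<and> push_pt C T k x = y \<and>
      (\<forall>f\<in>lin_hom R A S. k (\<pi> f) = pairing T (\<lambda>t. t) (\<lambda>a. h (f a)) y))"
  by (rule g[unfolded generic_pt_def, THEN conjunct2, THEN conjunct2, THEN conjunct2, THEN conjunct2, THEN conjunct2, THEN conjunct1])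
 from this[rule_format, OF T h y]
 have "\<exists>k. alg_map R C T k \<and> push_pt C T k x = y \<and>
      (\<forall>f\<in>lin_hom R A S. k (\<pi> f) = pairing T (\<lambda>t. t) (\<lambda>a. h (f a)) y)" .
 then obtain k where k: "alg_map R C T k" "push_pt C T k x = y"
  and kf: "\<And>f. f \<in> lin_hom R A S ==> k (\<pi> f) = pairing T (\<lambda>t. t) (\<lambda>a. h (f a)) y" by blast
 have "k (\<pi> (cK S s)) = h s" if s: "s <: S" for s
 proof -
  note hl = alg_map_lin[OF h] and y' = gr_closed[OF y(1)]
  note hs = lin_closed[OF hl s]
  have cl: "lmap R A S (cK S s)" using cK_lin_hom[OF S s] by (simp add: lin_hom_iff)
  have oc: "conv_one A S a <: S" if "a <: A" for a using lin_closed[OF conv_one_lin[OF S] that] .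
  have "k (\<pi> (cK S s)) = pairing T (\<lambda>t. t) (\<lambda>a. h (cK S s a)) y" by (rule kf[OF cK_lin_hom[OF S s]])
  also have "\<dots> = pairing T (\<lambda>t. t) (\<lambda>a. h s \<otimes>\<^sub>T conv_one A T a) y"
   by (rule pairing_cong[OF T.module A T lin_id lin_comp[OF cl hl] _ _ y'])
    (simp_all add: cK_def alg_map_mult[OF h s oc] conv_one_nat[OF S T h])
  also have "\<dots> = h s \<otimes>\<^sub>T pairing T (\<lambda>t. t) (conv_one A T) y"
   by (rule pairing_smult_right[OF T.module A T lin_id conv_one_lin[OF T] hs y'])
  also have "\<dots> = h s" using gr_pairing(2)[OF T T alg_map_id y(1)] hs by simp
  finally show ?thesis .
 qed
 then show thesis using that k kf by blast
qed

text \<open>Although evaluation is not multiplicative, it is linear over \<open>S\<close>, since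
  multiplying by the image of s multiplies a function pointwise by s.\<close>

lemma generic_pt_eval:
 assumes g: "generic_pt S M C \<pi> x" and S: "algebra R S" and a: "a <: A" "comult A a \<in> tspan R A A M"
 obtains ev where "lmap R C S ev" "\<And>f. f \<in> lin_hom R A S ==> ev (\<pi> f) = f a"
  "a \<in> M ==> push_pt C S ev x = tens R S A \<one>\<^sub>S a"
  "\<And>c s. c <: C ==> s <: S ==> ev (c \<otimes>\<^sub>C \<pi> (cK S s)) = ev c \<otimes>\<^sub>S s"
proof -
 interpret S: algebra R S by (rule S)
 have "\<forall>a\<in>carrier A. comult A a \<in> tspan R A A M -->
    (\<exists>ev. lmap R C S ev \<and> (\<forall>f\<in>lin_hom R A S. ev (\<pi> f) = f a) \<and>
      (a \<in> M --> push_pt C S ev x = tens R S A \<one>\<^sub>S a))"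
  by (rule g[unfolded generic_pt_def, THEN conjunct2, THEN conjunct2, THEN conjunct2, THEN conjunct2, THEN conjunct2, THEN conjunct2])
 from this[rule_format, OF a]
 have "\<exists>ev. lmap R C S ev \<and> (\<forall>f\<in>lin_hom R A S. ev (\<pi> f) = f a) \<and>
      (a \<in> M --> push_pt C S ev x = tens R S A \<one>\<^sub>S a)" by simp
 then obtain ev where ev: "lmap R C S ev" and evf: "\<And>f. f \<in> lin_hom R A S ==> ev (\<pi> f) = f a"
  and e: "a \<in> M ==> push_pt C S ev x = tens R S A \<one>\<^sub>S a" by blast
 have "ev (c \<otimes>\<^sub>C \<pi> (cK S s)) = ev c \<otimes>\<^sub>S s" if c: "c <: C" and s: "s <: S" for c s
 proof -
  obtain f where f: "f \<in> lin_hom R A S" "c = \<pi> f" using generic_ptD(3)[OF g] c by (auto simp: cB_simps)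
  have fl: "lmap R A S f" using f by (simp add: lin_hom_iff)
  have "c \<otimes>\<^sub>C \<pi> (cK S s) = \<pi> (conv A S f (cK S s))"
   using alg_map_mult[OF generic_ptD(2)[OF g], of f "cK S s"] f cK_lin_hom[OF S s] by (simp add: cB_simps)
  moreover have "conv A S f (cK S s) \<in> lin_hom R A S"
   by (rule conv_lin_hom[OF S fl]) (use cK_lin_hom[OF S s] in \<open>simp add: lin_hom_iff\<close>)
  ultimately have "ev (c \<otimes>\<^sub>C \<pi> (cK S s)) = conv A S f (cK S s) a" using evf by simp
  also have "\<dots> = s \<otimes>\<^sub>S f a" using a by (simp add: conv_cK[OF S s f(1)])
  finally show ?thesis using evf[OF f(1)] f(2) lin_closed[OF fl a(1)] s by (simp add: S.m_comm)
 qed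
 then show thesis using that ev evf e by blast
qed

text \<open>Add to the given elements the second legs of their coproducts; the coproducts of the
  added elements need not be controlled.\<close>

lemma ex_good:
 assumes "finite F" "F \<subseteq> carrier A"
 shows "\<exists>M. finite M \<and> M \<subseteq> carrier A \<and> F \<subseteq> M \<and> (\<forall>a\<in>F. comult A a \<in> tspan R A A M)"
proof -
 have "\<forall>a\<in>F. \<exists>M. finite M \<and> M \<subseteq> carrier A \<and> comult A a \<in> tspan R A A M"
  using ex_tspan[OF A A] comult_closed assms(2) by blast
 then obtain N where N: "\<And>a. a \<in> F ==> finite (N a) \<and> N a \<subseteq> carrier A \<and> comult A a \<in> tspan R A A (N a)" by metis
 have "comult A a \<in> tspan R A A (F \<union> (\<Union>a\<in>F. N a))" if "a \<in> F" for a
  by (rule tspan_mono[of _ _ _ _ "N a"]) (use N that in auto)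
 then show ?thesis using N assms by (intro exI[of _ "F \<union> (\<Union>a\<in>F. N a)"]) auto
qed

text \<open>Compare at a generic element over \<open>C\<close> and apply the \<open>S\<close>-linear
  evaluation at \<open>a\<close>, which sends the generic element to 1 \<otimes> a, where the
  extension of \<open>\<tau>\<close> takes the value \<open>\<tau> a\<close>.\<close>

theorem points_unique:
 fixes S :: "'u md" and P :: "('u, 'b, 'q) module_scheme"
 assumes S: "algebra R S" and P: "module R P"
  and \<tau>: "lmap R A (tensor R S P) \<tau>" "lmap R A (tensor R S P) \<tau>'"
  and eq: "\<And>(T :: ('u, 'u) module) h x. algebra R T ==> alg_map R S T h ==> x \<in> gr T
   ==> ext_map R T P h \<tau> x = ext_map R T P h \<tau>' x"
  and a: "a <: A"
 shows "\<tau> a = \<tau>' a"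
proof -
 interpret S: algebra R S by (rule S)
 obtain M where M: "finite M" "M \<subseteq> carrier A" "a \<in> M" "comult A a \<in> tspan R A A M"
  using ex_good[of "{a}"] a by auto
 obtain C \<pi> x where g: "generic_pt S M C \<pi> x" using ex_generic_pt[OF S M(1,2)] by blast
 note C = generic_ptD(1)[OF g] and x = generic_ptD(4)[OF g]
 note mC = alg_mod[OF C] and \<kappa> = generic_pt_unit[OF S g]
 note \<kappa>l = alg_map_lin[OF \<kappa>] and x' = gr_closed[OF x]
 obtain ev where ev: "lmap R C S ev" "a \<in> M ==> push_pt C S ev x = tens R S A \<one>\<^sub>S a"
  "\<And>c s. c <: C ==> s <: S ==> ev (c \<otimes>\<^sub>C \<pi> (cK S s)) = ev c \<otimes>\<^sub>S s"
  using generic_pt_eval[OF g S a M(4)] by metis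
 note evP = lin_tensor_map[OF mC P S.module P ev(1) lin_id] and evPp = tmap_pure[OF mC P S.module P ev(1) lin_id]
 have key: "\<tau> a = tmap R C P S P ev (\<lambda>p. p) (ext_map R C P (\<lambda>s. \<pi> (cK S s)) \<tau> x)"
  if \<tau>: "lmap R A (tensor R S P) \<tau>" for \<tau>
 proof -
  \<comment> \<open>Only linearity of \<open>ev\<close> over \<open>S\<close> enters; an algebra map
    would make this an instance of base change.\<close>
  have act: "tmap R C P S P ev (\<lambda>p. p) (act R C P (\<lambda>s. \<pi> (cK S s)) c z) = act R S P (\<lambda>s. s) (ev c) z"
   if c: "c <: C" and z: "z <: tensor R S P" for c z
   by (rule tmap_ext[OF S.module P lin_comp[OF bilin_right[OF bilin_act[OF S.module C P \<kappa>l] c] evP]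
      bilin_right[OF bilin_act[OF S.module S P lin_id] lin_closed[OF ev(1) c]] _ z])
    (use c lin_closed[OF ev(1) c] bilin_closed[OF bilin_mult[OF C] c] lin_closed[OF \<kappa>l] in
     \<open>simp add: act_pure[OF S.module C P \<kappa>l] act_pure[OF S.module S P lin_id] evPp ev(3)\<close>)
  have "tmap R C P S P ev (\<lambda>p. p) (ext_map R C P (\<lambda>s. \<pi> (cK S s)) \<tau> x) = ext_map R S P (\<lambda>s. s) \<tau> (push_pt C S ev x)"
   by (rule tmap_ext[OF mC A lin_comp[OF lin_ext_map[OF A S.module C P \<kappa>l \<tau>] evP]
      lin_comp[OF lin_tensor_map[OF mC A S.module A ev(1) lin_id] lin_ext_map[OF A S.module S P lin_id \<tau>]] _ x'])
    (simp add: ext_map_pure[OF A S.module C P \<kappa>l \<tau>] tmap_pure[OF mC A S.module A ev(1) lin_id]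
     ext_map_pure[OF A S.module S P lin_id \<tau>] act lin_closed[OF \<tau>] lin_closed[OF ev(1)])
  then show ?thesis using ev(2)[OF M(3)] ext_map_one[OF A S P \<tau> a] by simp
 qed
 show ?thesis using key[OF \<tau>(1)] key[OF \<tau>(2)] eq[OF C \<kappa> x] by simp
qed

text \<open>The value at the generic element for \<open>M\<close> lifts to Hom(A, S) \<otimes> P,
  and evaluating the lift at a defines \<tau>(a). Both the lift and \<open>M\<close> are choices;
  they cease to matter once evaluation at a factors through the quotient, and every finite set of
  elements admits a common \<open>M\<close> with this property.\<close>

theorem points_linear:
 fixes S :: "'u md" and P :: "('u, 'b, 'q) module_scheme"
  and \<phi> :: "'u md => ('u => 'u) => ('u, 'u) tensor_elt => ('u, 'b) tensor_elt"
 assumes S: "algebra R S" and P: "module R P"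
  and cl: "\<And>T h x. algebra R T ==> alg_map R S T h ==> x \<in> gr T ==> \<phi> T h x <: tensor R T P"
  and cg: "\<And>T h h' x. algebra R T ==> alg_map R S T h ==> (\<And>s. s <: S ==> h s = h' s) ==> x \<in> gr T ==> \<phi> T h x = \<phi> T h' x"
  and nat: "\<And>T T' h k x. algebra R T ==> algebra R T' ==> alg_map R S T h ==> alg_map R T T' k ==> x \<in> gr T
   ==> \<phi> T' (\<lambda>s. k (h s)) (push_pt T T' k x) = tmap R T P T' P k (\<lambda>p. p) (\<phi> T h x)"
 obtains \<tau> where "lmap R A (tensor R S P) \<tau>"
  "\<And>T h x. algebra R T ==> alg_map R S T h ==> x \<in> gr T ==> \<phi> T h x = ext_map R T P h \<tau> x"
proof -
 interpret S: algebra R S by (rule S)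
 note B = algebra_cB[OF S]
 note mB = alg_mod[OF B]
 interpret A: module R A by (rule A)
 have "\<forall>M. \<exists>C \<pi> x. finite M \<and> M \<subseteq> carrier A --> generic_pt S M C \<pi> x" using ex_generic_pt[OF S] by blast
 then obtain C \<pi> x where g: "\<And>M. finite M ==> M \<subseteq> carrier A ==> generic_pt S M (C M) (\<pi> M) (x M)" by metis
 define \<kappa> where "\<kappa> M s = \<pi> M (cK S s)" for M s
 \<comment> \<open>The value of \<open>\<phi>\<close> at the generic element, to be lifted along the
   surjection onto \<open>C M\<close>.\<close>
 define Y where "Y M = \<phi> (C M) (\<kappa> M) (x M)" for M
 define fin where "fin M \<longleftrightarrow> finite M \<and> M \<subseteq> carrier A" for M
 have g: "generic_pt S M (C M) (\<pi> M) (x M)" if "fin M" for M using g that by (simp add: fin_def)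
 note C = generic_ptD(1)[OF g] and \<pi> = generic_ptD(2)[OF g] and xg = generic_ptD(4)[OF g]
 note mC = alg_mod[OF C] and \<pi>l = alg_map_lin[OF \<pi>] and xc = gr_closed[OF xg]
 have \<kappa>: "alg_map R S (C M) (\<kappa> M)" if "fin M" for M unfolding \<kappa>_def by (rule generic_pt_unit[OF S g[OF that]])
 have Yc: "Y M <: tensor R (C M) P" if "fin M" for M
  unfolding Y_def by (rule cl[OF C[OF that] \<kappa>[OF that] xg[OF that]])
 have "\<exists>X\<in>carrier (tensor R (cB S) P). tmap R (cB S) P (C M) P (\<pi> M) (\<lambda>p. p) X = Y M" if "fin M" for M
  by (rule tmap_surj[OF mB mC[OF that] P \<pi>l[OF that] generic_ptD(3)[OF g[OF that]] Yc[OF that]])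
 then obtain L where L: "\<And>M. fin M ==> L M <: tensor R (cB S) P"
  and LY: "\<And>M. fin M ==> tmap R (cB S) P (C M) P (\<pi> M) (\<lambda>p. p) (L M) = Y M" by metis
 \<comment> \<open>If the generic element for \<open>M\<close> has second legs in \<open>M'\<close>,
   it is a base change of the one for \<open>M'\<close>, and the base change is compatible with the
   projections from Hom(A, S). Hence the lift chosen for \<open>M'\<close> also lifts the value for
   \<open>M\<close>. Inclusion of \<open>M\<close> in \<open>M'\<close> would not suffice, as the
   legs of the generic element may lie outside \<open>M\<close>.\<close>
 have trans: "tmap R (cB S) P (C M) P (\<pi> M) (\<lambda>p. p) (L M') = Y M"
  if M: "fin M" and M': "fin M'" and s: "x M \<in> tspan R (C M) A M'" for M M'
 proof -
  obtain k where k: "alg_map R (C M') (C M) k" "push_pt (C M') (C M) k (x M') = x M"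
   and kf: "\<And>f. f \<in> lin_hom R A S ==> k (\<pi> M' f) = pairing (C M) (\<lambda>t. t) (\<lambda>a. \<kappa> M (f a)) (x M)"
   and ks: "\<And>s. s <: S ==> k (\<pi> M' (cK S s)) = \<kappa> M s"
   by (rule generic_pt_universal[OF g[OF M'] S C[OF M] \<kappa>[OF M] xg[OF M] s], rule that)
  note kl = alg_map_lin[OF k(1)]
  have k\<pi>: "k (\<pi> M' f) = \<pi> M f" if "f <: cB S" for f
   using kf[of f] generic_ptD(5)[OF g[OF M], of f] that unfolding \<kappa>_def by (simp add: cB_simps)
  have "Y M = \<phi> (C M) (\<lambda>s. k (\<kappa> M' s)) (push_pt (C M') (C M) k (x M'))"
   unfolding Y_def k(2) by (rule cg[OF C[OF M] \<kappa>[OF M] _ xg[OF M]]) (use ks in \<open>simp add: \<kappa>_def[of M']\<close>)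
  also have "\<dots> = tmap R (C M') P (C M) P k (\<lambda>p. p) (Y M')"
   unfolding Y_def[of M'] by (rule nat[OF C[OF M'] C[OF M] \<kappa>[OF M'] k(1) xg[OF M']])
  also have "\<dots> = tmap R (cB S) P (C M) P (\<lambda>f. k (\<pi> M' f)) (\<lambda>p. p) (L M')"
   unfolding LY[OF M', symmetric]
   by (rule tmap_comp[OF mB P mC[OF M'] P mC[OF M] P \<pi>l[OF M'] lin_id kl lin_id L[OF M']])
  also have "\<dots> = tmap R (cB S) P (C M) P (\<pi> M) (\<lambda>p. p) (L M')"
   by (rule tmap_cong[OF mB P mC[OF M] P lin_comp[OF \<pi>l[OF M'] kl] lin_id k\<pi> _ L[OF M']]) simp_all
  finally show ?thesis by simp
 qed
 \<comment> \<open>The lift as a function of \<open>a\<close>, with values in S \<otimes> P.\<close>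
 define t where "t M a = tmap R (cB S) P S P (\<lambda>f. f a) (\<lambda>p. p) (L M)" for M a
 define good where "good M a \<longleftrightarrow> fin M \<and> comult A a \<in> tspan R A A M" for M a
 \<comment> \<open>Evaluation at \<open>a\<close> factors through \<open>C M\<close>, where the two
   lifts have the same image.\<close>
 have step: "t M' a = t M a" if gd: "good M a" and a: "a <: A" and M': "fin M'" and s: "x M \<in> tspan R (C M) A M'" for M M' a
 proof -
  have M: "fin M" and ca: "comult A a \<in> tspan R A A M" using gd by (simp_all add: good_def)
  obtain ev where ev: "lmap R (C M) S ev" and evf: "\<And>f. f \<in> lin_hom R A S ==> ev (\<pi> M f) = f a"
   using generic_pt_eval[OF g[OF M] S a ca] by metis
  have "t N a = tmap R (C M) P S P ev (\<lambda>p. p) (tmap R (cB S) P (C M) P (\<pi> M) (\<lambda>p. p) (L N))" if N: "fin N" for N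
  proof -
   have "tmap R (C M) P S P ev (\<lambda>p. p) (tmap R (cB S) P (C M) P (\<pi> M) (\<lambda>p. p) (L N))
    = tmap R (cB S) P S P (\<lambda>f. ev (\<pi> M f)) (\<lambda>p. p) (L N)"
    by (rule tmap_comp[OF mB P mC[OF M] P S.module P \<pi>l[OF M] lin_id ev lin_id L[OF N]])
   also have "\<dots> = t N a"
    unfolding t_def
    by (rule tmap_cong[OF mB P S.module P lin_comp[OF \<pi>l[OF M] ev] lin_id _ _ L[OF N]])
     (simp_all add: evf cB_simps)
   finally show ?thesis by simp
  qed
  then show ?thesis using trans[OF M M' s] LY[OF M] M M' by metis
 qed
 have ex_span: "\<exists>F. fin F \<and> x M \<in> tspan R (C M) A F" if "fin M" for M
  using ex_tspan[OF mC[OF that] A xc[OF that]] by (auto simp: fin_def)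
 \<comment> \<open>Both values are compared with a third one, for a finite set containing the legs
   of both generic elements.\<close>
 have indep: "t M a = t M' a" if gd: "good M a" "good M' a" and a: "a <: A" for M M' a
 proof -
  have M: "fin M" "fin M'" using gd by (simp_all add: good_def)
  obtain F F' where F: "fin F" "x M \<in> tspan R (C M) A F" "fin F'" "x M' \<in> tspan R (C M') A F'"
   using ex_span M by meson
  have "fin (F \<union> F')" using F by (simp add: fin_def)
  then show ?thesis
   using step[OF gd(1) a, of "F \<union> F'"] step[OF gd(2) a, of "F \<union> F'"]
    tspan_mono[OF F(2), of "F \<union> F'"] tspan_mono[OF F(4), of "F \<union> F'"] by simp
 qed
 define \<tau> where "\<tau> a = t (SOME M. good M a) a" for a
 have \<tau>t: "\<tau> a = t M a" if "good M a" "a <: A" for M a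
  unfolding \<tau>_def by (rule indep[OF someI[of "\<lambda>M. good M a"] that]) (rule that)
 have goods: "\<exists>M. fin M \<and> F \<subseteq> M \<and> (\<forall>a\<in>F. good M a)" if "fin F" for F
  using ex_good[of F] that by (auto simp: fin_def good_def)
 have tl: "lmap R A (tensor R S P) (t M)" if M: "fin M" for M
 proof -
  have SP: "module R (tensor R S P)" by (rule module_tensor[OF S.module P])
  have "lmap R A (tensor R S P) (\<lambda>a. tlift (tensor R S P) (\<lambda>f p. tens R S P (f a) p) (L M))"
  proof (rule lin_tlift_param[OF mB P SP A _ _ L[OF M]])
   show "bilin R (cB S) P (tensor R S P) (\<lambda>f p. tens R S P (f a) p)" if "a <: A" for a
    by (rule bilin_comp[OF bilin_pure_tensor[OF S.module P] lin_eval[OF S that] lin_id])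
   show "lmap R A (tensor R S P) (\<lambda>a. tens R S P (f a) p)" if "f <: cB S" "p <: P" for f p
    by (rule lin_comp[OF _ bilin_left[OF bilin_pure_tensor[OF S.module P] that(2)]]) (use that in \<open>simp add: cB_simps lin_hom_iff\<close>)
  qed
  then show ?thesis unfolding t_def tmap_eq[OF L[OF M]] .
 qed
 have \<tau>l: "lmap R A (tensor R S P) \<tau>"
 proof (rule lmapI)
  fix a assume a: "a <: A"
  obtain M where M: "fin M" "good M a" using goods[of "{a}"] a by (auto simp: fin_def)
  show "\<tau> a <: tensor R S P" using \<tau>t[OF M(2) a] lin_closed[OF tl[OF M(1)] a] by simp
  fix b assume b: "b <: A"
  obtain M where M: "fin M" "good M a" "good M b" "good M (a \<oplus>\<^sub>A b)" using goods[of "{a, b, a \<oplus>\<^sub>A b}"] a b by (auto simp: fin_def)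
  show "\<tau> (a \<oplus>\<^sub>A b) = \<tau> a \<oplus>\<^bsub>tensor R S P\<^esub> \<tau> b"
   using \<tau>t[OF M(2) a] \<tau>t[OF M(3) b] \<tau>t[OF M(4)] lin_add[OF tl[OF M(1)] a b] a b by simp
 next
  fix r a assume r: "r <: R" and a: "a <: A"
  obtain M where M: "fin M" "good M a" "good M (r \<odot>\<^sub>A a)" using goods[of "{a, r \<odot>\<^sub>A a}"] a r by (auto simp: fin_def)
  show "\<tau> (r \<odot>\<^sub>A a) = r \<odot>\<^bsub>tensor R S P\<^esub> \<tau> a"
   using \<tau>t[OF M(2) a] \<tau>t[OF M(3)] lin_smult[OF tl[OF M(1)] r a] a r by simp
 qed
 \<comment> \<open>On the finitely many legs of the generic element \<open>\<tau>\<close> coincides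
   with a single \<open>t M'\<close>. For that function the extension at the generic element is the
   class of the lift, which is the prescribed value by \<open>trans\<close>.\<close>
 have gen: "ext_map R (C M) P (\<kappa> M) \<tau> (x M) = Y M" if M: "fin M" for M
 proof -
  obtain F where F: "fin F" "x M \<in> tspan R (C M) A F" using ex_span[OF M] by blast
  obtain M' where M': "fin M'" "F \<subseteq> M'" "\<forall>a\<in>F. good M' a" using goods[OF F(1)] by blast
  note \<kappa>l = alg_map_lin[OF \<kappa>[OF M]]
  note CP = module_tensor[OF mC[OF M] P]
  have Fc: "F \<subseteq> carrier A" using F by (simp add: fin_def)
  have "ext_map R (C M) P (\<kappa> M) \<tau> (x M) = ext_map R (C M) P (\<kappa> M) (t M') (x M)"
   by (rule tspan_ext[OF mC[OF M] A Fc F(2) lin_ext_map[OF A S.module C[OF M] P \<kappa>l \<tau>l] lin_ext_map[OF A S.module C[OF M] P \<kappa>l tl[OF M'(1)]]])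
    (use M'(3) Fc \<tau>t in \<open>auto simp: subset_iff ext_map_pure[OF A S.module C[OF M] P \<kappa>l \<tau>l] ext_map_pure[OF A S.module C[OF M] P \<kappa>l tl[OF M'(1)]]\<close>)
  also have "\<dots> = tmap R (cB S) P (C M) P (\<lambda>f. pairing (C M) (\<lambda>c. c) (\<lambda>a. \<kappa> M (f a)) (x M)) (\<lambda>p. p) (L M')"
  proof -
   have SP: "module R (tensor R S P)" by (rule module_tensor[OF S.module P])
   have evl: "lmap R (tensor R (cB S) P) (tensor R S P) (tmap R (cB S) P S P (\<lambda>f. f a) (\<lambda>p. p))" if "a <: A" for a
    by (rule lin_tensor_map[OF mB P S.module P lin_eval[OF S that] lin_id])
   have evp: "tmap R (cB S) P S P (\<lambda>f. f a) (\<lambda>p. p) (tens R (cB S) P f p) = tens R S P (f a) p"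
    if "a <: A" "f <: cB S" "p <: P" for a f p
    by (rule tmap_pure[OF mB P S.module P lin_eval[OF S that(1)] lin_id that(2,3)])
   have kf: "lmap R A (C M) (\<lambda>a. \<kappa> M (f a))" if "f <: cB S" for f
    by (rule lin_comp[OF _ \<kappa>l]) (use that in \<open>simp add: cB_simps lin_hom_iff\<close>)
   note th = lin_psi[OF S C[OF M] \<kappa>l xc[OF M]]
   have bl: "bilin R (C M) A (tensor R (C M) P) (\<lambda>c a. act R (C M) P (\<kappa> M) c (tmap R (cB S) P S P (\<lambda>f. f a) (\<lambda>p. p) Z))"
    if Z: "Z <: tensor R (cB S) P" for Z
   proof (rule bilin_comp[OF bilin_act[OF S.module C[OF M] P \<kappa>l] lin_id])
    have "lmap R A (tensor R S P) (\<lambda>a. tlift (tensor R S P) (\<lambda>f p. tens R S P (f a) p) Z)"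
    proof (rule lin_tlift_param[OF mB P SP A _ _ Z])
     show "bilin R (cB S) P (tensor R S P) (\<lambda>f p. tens R S P (f a) p)" if "a <: A" for a
      by (rule bilin_comp[OF bilin_pure_tensor[OF S.module P] lin_eval[OF S that] lin_id])
     show "lmap R A (tensor R S P) (\<lambda>a. tens R S P (f a) p)" if "f <: cB S" "p <: P" for f p
      by (rule lin_comp[OF _ bilin_left[OF bilin_pure_tensor[OF S.module P] that(2)]]) (use that in \<open>simp add: cB_simps lin_hom_iff\<close>)
    qed
    then show "lmap R A (tensor R S P) (\<lambda>a. tmap R (cB S) P S P (\<lambda>f. f a) (\<lambda>p. p) Z)"
     unfolding tmap_eq[OF Z] .
   qed
   show ?thesis
   \<comment> \<open>The identity is linear in the lift, so it may be checked when the lift is a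
     pure tensor f \<otimes> p.\<close>
   proof (rule tmap_ext[OF mB P _ _ _ L[OF M'(1)], where f = "\<lambda>Z. ext_map R (C M) P (\<kappa> M) (\<lambda>a. tmap R (cB S) P S P (\<lambda>f. f a) (\<lambda>p. p) Z) (x M)", folded t_def])
    show "lmap R (tensor R (cB S) P) (tensor R (C M) P) (tmap R (cB S) P (C M) P (\<lambda>f. pairing (C M) (\<lambda>c. c) (\<lambda>a. \<kappa> M (f a)) (x M)) (\<lambda>p. p))"
     by (rule lin_tensor_map[OF mB P mC[OF M] P th lin_id])
    show "lmap R (tensor R (cB S) P) (tensor R (C M) P) (\<lambda>Z. ext_map R (C M) P (\<kappa> M) (\<lambda>a. tmap R (cB S) P S P (\<lambda>f. f a) (\<lambda>p. p) Z) (x M))"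
     unfolding ext_map_def
     by (rule lin_tlift_param[OF mC[OF M] A CP module_tensor[OF mB P] bl _ xc[OF M]])
      (auto intro: lin_comp[OF evl bilin_right[OF bilin_act[OF S.module C[OF M] P \<kappa>l]]])
    fix f p assume f: "f <: cB S" and p: "p <: P"
    note ptp = bilin_left[OF bilin_pure_tensor[OF mC[OF M] P] p]
    have fc: "f a <: S" if "a <: A" for a using lin_closed[OF lin_eval[OF S that] f] .
    have "ext_map R (C M) P (\<kappa> M) (\<lambda>a. tmap R (cB S) P S P (\<lambda>f. f a) (\<lambda>p. p) (tens R (cB S) P f p)) (x M)
     = tens R (C M) P (pairing (C M) (\<lambda>c. c) (\<lambda>a. \<kappa> M (f a)) (x M)) p"
     unfolding ext_map_def
     by (rule tmap_ext[OF mC[OF M] A lin_tlift[OF mC[OF M] A CP bl[OF tens_closed[OF mB P f p]]]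
        lin_comp[OF lin_pairing[OF mC[OF M] A C[OF M] lin_id kf[OF f]] ptp] _ xc[OF M]])
      (use f p fc in \<open>simp add: tlift_pure[OF mC[OF M] A CP bl[OF tens_closed[OF mB P f p]]] evp
       act_pure[OF S.module C[OF M] P \<kappa>l] pairing_pure[OF mC[OF M] A C[OF M] lin_id kf[OF f]]\<close>)
    then show "ext_map R (C M) P (\<kappa> M) (\<lambda>a. tmap R (cB S) P S P (\<lambda>f. f a) (\<lambda>p. p) (tens R (cB S) P f p)) (x M)
     = tmap R (cB S) P (C M) P (\<lambda>f. pairing (C M) (\<lambda>c. c) (\<lambda>a. \<kappa> M (f a)) (x M)) (\<lambda>p. p) (tens R (cB S) P f p)"
     using f p by (simp add: tmap_pure[OF mB P mC[OF M] P th lin_id])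
   qed
  qed
  also have "\<dots> = tmap R (cB S) P (C M) P (\<pi> M) (\<lambda>p. p) (L M')"
   by (rule tmap_cong[OF mB P mC[OF M] P lin_psi[OF S C[OF M] \<kappa>l xc[OF M]] lin_id _ _ L[OF M'(1)]])
    (simp_all add: \<kappa>_def generic_ptD(5)[OF g[OF M]] cB_simps)
  also have "\<dots> = Y M" by (rule trans[OF M M'(1) tspan_mono[OF F(2) M'(2)]])
  finally show ?thesis .
 qed
 \<comment> \<open>An arbitrary point is a base change of a generic element, and both sides are
   natural.\<close>
 have "\<phi> T h y = ext_map R T P h \<tau> y" if T: "algebra R T" and h: "alg_map R S T h" and y: "y \<in> gr T" for T h y
 proof -
  obtain M where M: "fin M" "y \<in> tspan R T A M"
   using ex_tspan[OF alg_mod[OF T] A gr_closed[OF y]] by (auto simp: fin_def)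
  obtain k where k: "alg_map R (C M) T k" "push_pt (C M) T k (x M) = y"
   and ks: "\<And>s. s <: S ==> k (\<pi> M (cK S s)) = h s"
   by (rule generic_pt_universal[OF g[OF M(1)] S T h y M(2)], rule that)
  have ks': "k (\<kappa> M s) = h s" if "s <: S" for s using ks[OF that] by (simp add: \<kappa>_def)
  note kk = alg_map_comp[OF \<kappa>[OF M(1)] k(1)]
  have "\<phi> T h y = \<phi> T (\<lambda>s. k (\<kappa> M s)) (push_pt (C M) T k (x M))"
   unfolding k(2) by (rule cg[OF T h _ y]) (simp add: ks')
  also have "\<dots> = tmap R (C M) P T P k (\<lambda>p. p) (Y M)"
   unfolding Y_def by (rule nat[OF C[OF M(1)] T \<kappa>[OF M(1)] k(1) xg[OF M(1)]])
  also have "\<dots> = ext_map R T P (\<lambda>s. k (\<kappa> M s)) \<tau> (push_pt (C M) T k (x M))"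
   unfolding gen[OF M(1), symmetric]
   by (rule ext_map_nat[OF A S.module C[OF M(1)] T P alg_map_lin[OF \<kappa>[OF M(1)]] \<tau>l k(1) xc[OF M(1)]])
  also have "\<dots> = ext_map R T P h \<tau> y"
   unfolding k(2)
   by (rule tmap_ext[OF alg_mod[OF T] A lin_ext_map[OF A S.module T P alg_map_lin[OF kk] \<tau>l]
      lin_ext_map[OF A S.module T P alg_map_lin[OF h] \<tau>l] _ gr_closed[OF y]])
    (simp add: ext_map_pure[OF A S.module T P alg_map_lin[OF kk] \<tau>l] ext_map_pure[OF A S.module T P alg_map_lin[OF h] \<tau>l],
     rule tmap_ext[OF S.module P bilin_right[OF bilin_act[OF S.module T P alg_map_lin[OF kk]]]
      bilin_right[OF bilin_act[OF S.module T P alg_map_lin[OF h]]] _ lin_closed[OF \<tau>l]],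
     simp_all add: act_pure[OF S.module T P alg_map_lin[OF kk]] act_pure[OF S.module T P alg_map_lin[OF h]] ks')
  finally show ?thesis .
 qed
 then show thesis using that \<tau>l by blast
qed

end

section \<open>Points of the spectrum are group-like elements\<close>

lemma qc_simps:
 "carrier (on_ob (quasi_coherent R S) T) = carrier (tensor R S T)"
 "add (on_ob (quasi_coherent R S) T) = add (tensor R S T)"
 "mult (on_ob (quasi_coherent R S) T) = mult (tensor R S T)"
 "one (on_ob (quasi_coherent R S) T) = one (tensor R S T)"
 "smult (on_ob (quasi_coherent R S) T) = right_smult R S T"
 "on_mor (quasi_coherent R S) T T' h = rmap R S T T' h"
 by (simp_all add: quasi_coherent_def right_smult_def add_monoid_tensor fun_eq_iff)

context lp_coalg
begin

text \<open>An element of S \<otimes> A acts on linear maps v by id \<otimes> v. The restrictions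
  provide the extensionality required by \<open>alg_functor_homs\<close>.\<close>

definition pt :: "'u md => ('u, 'u) tensor_elt => 'u spec_point" where
 "pt S x = (\<lambda>T\<in>{T. algebra R T}. \<lambda>v\<in>lin_hom R A T. rmap R S A T v x)"

text \<open>Writes id \<otimes> v as a pairing with values in S \<otimes> T, so that
  \<open>gr_pairing\<close> applies and shows that \<open>pt\<close> is multiplicative.\<close>

lemma tmap_pairing:
 assumes S: "algebra R S" and T: "algebra R T" and v: "lmap R A T v" and x: "x <: tensor R S A"
 shows "pairing (tensor R S T) (\<lambda>s. tens R S T s \<one>\<^sub>T) (\<lambda>a. tens R S T \<one>\<^sub>S (v a)) x
   = rmap R S A T v x"
  and "alg_map R S (tensor R S T) (\<lambda>s. tens R S T s \<one>\<^sub>T)"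
  and "alg_map R T (tensor R S T) (\<lambda>t. tens R S T \<one>\<^sub>S t)"
proof -
 interpret S: algebra R S by (rule S)
 interpret T: algebra R T by (rule T)
 note ST = algebra_tensor[OF S T] and pb = bilin_pure_tensor[OF S.module T.module]
 note mp = tensor_mult_pure[OF S.module T.module bilin_mult[OF S] bilin_mult[OF T]]
 show l: "alg_map R S (tensor R S T) (\<lambda>s. tens R S T s \<one>\<^sub>T)"
  by (rule alg_mapI[OF bilin_left[OF pb]]) (simp_all add: mp tensor_one)
 show r: "alg_map R T (tensor R S T) (\<lambda>t. tens R S T \<one>\<^sub>S t)"
  by (rule alg_mapI[OF bilin_right[OF pb]]) (simp_all add: mp tensor_one)
 note rv = lin_comp[OF v alg_map_lin[OF r]]
 show "pairing (tensor R S T) (\<lambda>s. tens R S T s \<one>\<^sub>T) (\<lambda>a. tens R S T \<one>\<^sub>S (v a)) x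
   = rmap R S A T v x"
  by (rule tmap_ext[OF S.module A lin_pairing[OF S.module A ST alg_map_lin[OF l] rv]
     lin_tensor_map[OF S.module A S.module T.module lin_id v] _ x])
   (simp add: pairing_pure[OF S.module A ST alg_map_lin[OF l] rv] mp lin_closed[OF v]
    tmap_pure[OF S.module A S.module T.module lin_id v])
qed

lemma pt_mem:
 assumes S: "algebra R S" and x: "x \<in> gr S"
 shows "pt S x \<in> alg_functor_homs R DF (quasi_coherent R S)"
proof -
 interpret S: algebra R S by (rule S)
 note x' = gr_closed[OF x]
 note simps = dual_functor_simps mod_of_simps qc_simps comm_algs_simps
 let ?m = "\<lambda>T v. rmap R S A T v x"
 have pt: "pt S x T v = ?m T v" if "algebra R T" "v \<in> lin_hom R A T" for T v
  using that by (simp add: pt_def)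
 have "pt S x T \<in> alg_hom T (on_ob DF T) (on_ob (quasi_coherent R S) T)" if T: "algebra R T" for T :: "'u md"
 proof -
  interpret T: algebra R T by (rule T)
  interpret F: algebra T "on_ob DF T" by (rule algebra_dual[OF T])
  note mv = lin_tensor_map[OF S.module A S.module T.module lin_id] and mp = tmap_pure[OF S.module A S.module T.module lin_id]
  note ST = algebra_tensor[OF S T]
  interpret ST: algebra R "tensor R S T" by (rule ST)
  note pb = bilin_pure_tensor[OF S.module T.module]
  have lin: "lmap R A T v" if "v \<in> lin_hom R A T" for v using that by (simp add: lin_hom_iff)
  have cl: "?m T v <: tensor R S T" if "v \<in> lin_hom R A T" for v
   by (rule lin_closed[OF mv[OF lin[OF that]] x'])
  have sum: "?m T (\<lambda>a\<in>carrier A. v a \<oplus>\<^sub>T w a) = ?m T v \<oplus>\<^bsub>tensor R S T\<^esub> ?m T w"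
   "(\<lambda>a\<in>carrier A. v a \<oplus>\<^sub>T w a) \<in> lin_hom R A T" if v: "v \<in> lin_hom R A T" and w: "w \<in> lin_hom R A T" for v w
  proof -
   show vw: "(\<lambda>a\<in>carrier A. v a \<oplus>\<^sub>T w a) \<in> lin_hom R A T"
    by (rule restrict_lin_hom[OF A lin_sum[OF T.module lin[OF v] lin[OF w]]])
   show "?m T (\<lambda>a\<in>carrier A. v a \<oplus>\<^sub>T w a) = ?m T v \<oplus>\<^bsub>tensor R S T\<^esub> ?m T w"
    by (rule tmap_ext[OF S.module A mv[OF lin[OF vw]] lin_sum[OF ST.module mv[OF lin[OF v]] mv[OF lin[OF w]]] _ x'])
     (simp add: mp[OF lin[OF vw]] mp[OF lin[OF v]] mp[OF lin[OF w]] lin_closed[OF lin[OF v]] lin_closed[OF lin[OF w]]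
      lin_add[OF bilin_right[OF pb]])
  qed
  have sm: "?m T (\<lambda>a\<in>carrier A. t \<otimes>\<^sub>T v a) = right_smult R S T t (?m T v)"
   "(\<lambda>a\<in>carrier A. t \<otimes>\<^sub>T v a) \<in> lin_hom R A T" if t: "t <: T" and v: "v \<in> lin_hom R A T" for t v
  proof -
   show tv: "(\<lambda>a\<in>carrier A. t \<otimes>\<^sub>T v a) \<in> lin_hom R A T"
    by (rule restrict_lin_hom[OF A lin_comp[OF lin[OF v] bilin_right[OF bilin_mult[OF T] t]]])
   show "?m T (\<lambda>a\<in>carrier A. t \<otimes>\<^sub>T v a) = right_smult R S T t (?m T v)"
    by (rule tmap_ext[OF S.module A mv[OF lin[OF tv]] lin_comp[OF mv[OF lin[OF v]] lin_right_smult[OF S.module T t]] _ x'])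
     (simp add: mp[OF lin[OF tv]] mp[OF lin[OF v]] lin_closed[OF lin[OF v]] right_smult_pure[OF S.module T t])
  qed
  note tp = tmap_pairing[OF S T]
  have mul: "?m T (conv A T v w) = ?m T v \<otimes>\<^bsub>tensor R S T\<^esub> ?m T w" if v: "v \<in> lin_hom R A T" and w: "w \<in> lin_hom R A T" for v w
  proof -
   let ?l = "\<lambda>s. tens R S T s \<one>\<^sub>T" and ?r = "\<lambda>t. tens R S T \<one>\<^sub>S t"
   note l = tp(2)[OF lin[OF v] x'] and r = tp(3)[OF lin[OF v] x']
   note rl = lin_comp[OF _ alg_map_lin[OF r]]
   have "?m T (conv A T v w) = pairing (tensor R S T) ?l (\<lambda>a. ?r (conv A T v w a)) x"
    by (rule tp(1)[OF conv_lin[OF T lin[OF v] lin[OF w]] x', symmetric])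
   also have "\<dots> = pairing (tensor R S T) ?l (conv A (tensor R S T) (\<lambda>a. ?r (v a)) (\<lambda>a. ?r (w a))) x"
    by (rule pairing_cong[OF S.module A ST alg_map_lin[OF l] rl[OF conv_lin[OF T lin[OF v] lin[OF w]]] _ _ x'])
     (simp_all add: conv_nat[OF T ST r lin[OF v] lin[OF w]])
   also have "\<dots> = ?m T v \<otimes>\<^bsub>tensor R S T\<^esub> ?m T w"
    using gr_pairing(1)[OF S ST l x rl[OF lin[OF v]] rl[OF lin[OF w]]] tp(1)[OF lin[OF v] x'] tp(1)[OF lin[OF w] x'] by simp
   finally show ?thesis .
  qed
  have one: "?m T (conv_one A T) = \<one>\<^bsub>tensor R S T\<^esub>"
  proof -
   let ?l = "\<lambda>s. tens R S T s \<one>\<^sub>T" and ?r = "\<lambda>t. tens R S T \<one>\<^sub>S t"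
   note o = conv_one_lin[OF T]
   note l = tp(2)[OF o x'] and r = tp(3)[OF o x']
   have "?m T (conv_one A T) = pairing (tensor R S T) ?l (\<lambda>a. ?r (conv_one A T a)) x" by (rule tp(1)[OF o x', symmetric])
   also have "\<dots> = pairing (tensor R S T) ?l (conv_one A (tensor R S T)) x"
    by (rule pairing_cong[OF S.module A ST alg_map_lin[OF l] lin_comp[OF o alg_map_lin[OF r]] _ _ x'])
     (simp_all add: conv_one_nat[OF T ST r])
   finally show ?thesis using gr_pairing(2)[OF S ST l x] by simp
  qed
  show ?thesis
   unfolding alg_hom_def lin_hom_def ring_hom_def
   using T cl sum sm mul one conv_lin_hom[OF T lin lin] conv_one_lin_hom[OF T]
   by (auto simp: simps pt_def)
 qed
 moreover have "pt S x T' (on_mor DF T T' h v) = on_mor (quasi_coherent R S) T T' h (pt S x T v)"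
  if T: "algebra R T" and T': "algebra R T'" and h: "h \<in> alg_hom R T T'" and v: "v \<in> lin_hom R A T" for T T' h v
 proof -
  have hl: "lmap R T T' h" and vl: "lmap R A T v" using h v by (simp_all add: alg_hom_iff alg_map_def lin_hom_iff)
  note mT = alg_mod[OF T] and mT' = alg_mod[OF T']
  have c: "compose (carrier A) h v \<in> lin_hom R A T'" by (rule compose_lin_hom[OF A v hl])
  have "?m T' (compose (carrier A) h v) = ?m T' (\<lambda>a. h (v a))"
   by (rule tmap_cong[OF S.module A S.module mT' lin_id _ _ _ x']) (use c in \<open>auto simp: lin_hom_iff compose_def\<close>)
  also have "\<dots> = rmap R S T T' h (?m T v)"
   by (rule tmap_comp[OF S.module A S.module mT S.module mT' lin_id vl lin_id hl x', symmetric])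
  finally show ?thesis using pt[OF T v] pt[OF T' c] v by (simp add: simps)
 qed
 ultimately show ?thesis
  unfolding alg_functor_homs_def by (simp add: simps) (simp add: pt_def)
qed

lemma alg_map_collapse:
 assumes S: "algebra R S"
 defines "c \<equiv> tlift S (\<lambda>s r. s \<otimes>\<^sub>S (r \<odot>\<^sub>S \<one>\<^sub>S))"
 shows "alg_map R (tensor R S Rm) S c"
  and "lmap R A Rm v ==> x <: tensor R S A ==> c (rmap R S A Rm v x) = contract S v x"
proof -
 interpret S: algebra R S by (rule S)
 note t = alg_map_tensor_lift[OF S RR S alg_map_id alg_map_unit[OF S]]
 note mR = alg_mod[OF RR]
 show c: "alg_map R (tensor R S Rm) S c" unfolding c_def by (rule t(1))
 show "c (rmap R S A Rm v x) = contract S v x" if v: "lmap R A Rm v" and x: "x <: tensor R S A"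
 proof (rule tmap_ext[OF S.module A lin_comp[OF lin_tensor_map[OF S.module A S.module mR lin_id v] alg_map_lin[OF c]]
    lin_contract[OF S.module A v] _ x])
  fix s a assume a: "s <: S" "a <: A"
  have "v a <: R" using lin_closed[OF v a(2)] by (simp add: ring_as_module_def)
  then show "c (rmap R S A Rm v (tens R S A s a)) = contract S v (tens R S A s a)"
   using a lin_smult[OF bilin_right[OF bilin_mult[OF S]], of s "v a" "\<one>\<^sub>S"] lin_closed[OF v a(2)]
   by (simp add: tmap_pure[OF S.module A S.module mR lin_id v] c_def t(2) contract_pure[OF S.module A v])
 qed
qed

text \<open>The components over \<open>R\<close> itself already give all contractions by
  functionals, and these determine a tensor.\<close>

lemma pt_inj:
 assumes S: "algebra R S" and x: "x \<in> gr S" "y \<in> gr S" and eq: "pt S x = pt S y"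
 shows "x = y"
proof (rule contract_separates[OF alg_mod[OF S] lp gr_closed[OF x(1)] gr_closed[OF x(2)]])
 fix v assume v: "lmap R A Rm v"
 let ?v = "restrict v (carrier A)"
 have v': "?v \<in> lin_hom R A Rm" by (rule restrict_lin_hom[OF A v])
 have "rmap R S A Rm v z = pt S z Rm ?v" if "z \<in> gr S" for z
  using v' RR tmap_cong[OF alg_mod[OF S] A alg_mod[OF S] alg_mod[OF RR] lin_id v, of "\<lambda>s. s" ?v z] gr_closed[OF that]
  by (simp add: pt_def)
 then show "contract S v x = contract S v y"
  using alg_map_collapse(2)[OF S v gr_closed[OF x(1)]] alg_map_collapse(2)[OF S v gr_closed[OF x(2)]] x eq by metis
qed

text \<open>\<open>linear_representable\<close> supplies the tensor without using multiplicativity.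
  The component over \<open>R\<close>, collapsed to \<open>S\<close>, is then an algebra map, and
  this is the group-like condition.\<close>

lemma pt_surj:
 assumes S: "algebra R S" and \<phi>: "\<phi> \<in> alg_functor_homs R DF (quasi_coherent R S)"
 shows "\<exists>x\<in>gr S. \<phi> = pt S x"
proof -
 interpret S: algebra R S by (rule S)
 note simps = dual_functor_simps mod_of_simps qc_simps comm_algs_simps
 have \<phi>e: "\<phi> \<in> extensional {T. algebra R T}"
  and \<phi>h: "\<And>T. algebra R T ==> \<phi> T \<in> alg_hom T (on_ob DF T) (on_ob (quasi_coherent R S) T)"
  and \<phi>n: "\<And>T T' h w. algebra R T ==> algebra R T' ==> h \<in> alg_hom R T T' ==> w \<in> lin_hom R A T
   ==> \<phi> T' (compose (carrier A) h w) = rmap R S T T' h (\<phi> T w)"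
  using \<phi> unfolding alg_functor_homs_def by (auto simp: simps)
 have \<phi>l: "lmap T (on_ob DF T) (on_ob (quasi_coherent R S) T) (\<phi> T)"
  and \<phi>r: "\<phi> T \<in> ring_hom (on_ob DF T) (on_ob (quasi_coherent R S) T)"
  and \<phi>x: "\<phi> T \<in> extensional (lin_hom R A T)" if "algebra R T" for T
  using \<phi>h[OF that] by (simp_all add: alg_hom_def lin_hom_iff simps)
 have cl: "\<phi> T w <: tensor R S T" if "algebra R T" "w \<in> lin_hom R A T" for T w
  using lin_closed[OF \<phi>l[OF that(1)], of w] that(2) by (simp add: simps)
 have sm: "\<phi> T (\<lambda>a\<in>carrier A. t \<otimes>\<^sub>T w a) = right_smult R S T t (\<phi> T w)" if "algebra R T" "w \<in> lin_hom R A T" "t <: T" for T w t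
  using lin_smult[OF \<phi>l[OF that(1)], of t w] that(2,3) by (simp add: simps)
 obtain x where x: "x <: tensor R S A"
  and xw: "\<And>T w. algebra R T ==> w \<in> lin_hom R A T ==> \<phi> T w = rmap R S A T w x"
  by (rule linear_representable[of R A S \<phi>, OF inf A S.module cl sm \<phi>n], assumption+, rule that)
 let ?c = "tlift S (\<lambda>s r. s \<otimes>\<^sub>S (r \<odot>\<^sub>S \<one>\<^sub>S))"
 note c = alg_map_collapse[OF S]
 have con: "contract S v x = ?c (\<phi> Rm (restrict v (carrier A)))" if v: "lmap R A Rm v" for v
 proof -
  have v': "restrict v (carrier A) \<in> lin_hom R A Rm" by (rule restrict_lin_hom[OF A v])
  have "rmap R S A Rm v x = rmap R S A Rm (restrict v (carrier A)) x"
   by (rule tmap_cong[OF S.module A S.module alg_mod[OF RR] lin_id v _ _ x]) simp_all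
  then show ?thesis using c(2)[OF v x] xw[OF RR v'] by simp
 qed
 have "x \<in> gr S"
  unfolding gr_def
 proof (intro CollectI conjI allI impI x)
  fix v w assume v: "lmap R A Rm v" and w: "lmap R A Rm w"
  let ?v = "restrict v (carrier A)" and ?w = "restrict w (carrier A)"
  have v': "?v \<in> lin_hom R A Rm" and w': "?w \<in> lin_hom R A Rm"
   using restrict_lin_hom[OF A v] restrict_lin_hom[OF A w] by auto
  have "restrict (conv A Rm v w) (carrier A) = conv A Rm ?v ?w"
   using conv_cong[OF RR v w, of ?v ?w] by (auto simp: conv_def)
  moreover have "\<phi> Rm (conv A Rm ?v ?w) = \<phi> Rm ?v \<otimes>\<^bsub>tensor R S Rm\<^esub> \<phi> Rm ?w"
   using ring_hom_mult[OF \<phi>r[OF RR], of ?v ?w] v' w' by (simp add: simps)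
  ultimately show "contract S (conv A Rm v w) x = contract S v x \<otimes>\<^sub>S contract S w x"
   using alg_map_mult[OF c(1) cl[OF RR v'] cl[OF RR w']] con[OF v] con[OF w] con[OF conv_lin[OF RR v w]] by simp
 next
  have "restrict (counit A) (carrier A) = conv_one A Rm"
   using lin_closed[OF counit] by (auto simp: conv_one_def ring_as_module_def cring.cring_simprules(12)[OF R_cring] R_cring cring.cring_simprules(13)[OF R_cring] monoid.r_one[OF ring.is_monoid[OF cring.axioms(1)[OF R_cring]]])
  moreover have "\<phi> Rm (conv_one A Rm) = \<one>\<^bsub>tensor R S Rm\<^esub>"
   using ring_hom_one[OF \<phi>r[OF RR]] by (simp add: simps)
  ultimately show "contract S (counit A) x = \<one>\<^sub>S" using con[OF counit] alg_map_one[OF c(1)] by simp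
 qed
 moreover have "\<phi> = pt S x"
 proof (rule extensionalityI[OF \<phi>e])
  show "pt S x \<in> extensional {T. algebra R T}" by (simp add: pt_def)
  fix T :: "'u md" assume "T \<in> {T. algebra R T}"
  then have T: "algebra R T" by simp
  show "\<phi> T = pt S x T"
   by (rule extensionalityI[OF \<phi>x[OF T]]) (use T xw[OF T] in \<open>auto simp: pt_def\<close>)
 qed
 ultimately show ?thesis by blast
qed

lemma on_ob_Spec: "on_ob (Spec R F) S = alg_functor_homs R F (quasi_coherent R S)"
 by (simp add: Spec_def)

lemma bij_pt:
 assumes S: "algebra R S"
 shows "bij_betw (pt S) (gr S) (on_ob (Spec R DF) S)"
proof (rule bij_betw_imageI)
 show "inj_on (pt S) (gr S)" by (rule inj_onI, rule pt_inj[OF S])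
 show "pt S ` gr S = on_ob (Spec R DF) S"
 proof (rule subset_antisym; rule subsetI)
  show "\<phi> \<in> on_ob (Spec R DF) S" if "\<phi> \<in> pt S ` gr S" for \<phi>
   using that pt_mem[OF S] unfolding on_ob_Spec by fast
  show "\<phi> \<in> pt S ` gr S" if "\<phi> \<in> on_ob (Spec R DF) S" for \<phi>
   using pt_surj[OF S] that unfolding on_ob_Spec by fast
 qed
qed

lemma pt_nat:
 assumes S: "algebra R S" and T: "algebra R T" and h: "lmap R S T h" and x: "x \<in> gr S"
 shows "on_mor (Spec R DF) S T h (pt S x) = pt T (push_pt S T h x)"
proof (rule ext)
 fix S' :: "'u md"
 note mS = alg_mod[OF S] and mT = alg_mod[OF T]
 show "on_mor (Spec R DF) S T h (pt S x) S' = pt T (push_pt S T h x) S'"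
 proof (cases "algebra R S'")
  case True
  note mS' = alg_mod[OF True]
  have e: "tmap R S S' T S' h (\<lambda>s. s) (rmap R S A S' v x) = rmap R T A S' v (push_pt S T h x)"
   if v: "v \<in> lin_hom R A S'" for v
  proof -
   have vl: "lmap R A S' v" using v by (simp add: lin_hom_iff)
   show ?thesis
    unfolding tmap_comp[OF mS A mS mS' mT mS' lin_id vl h lin_id gr_closed[OF x]]
     tmap_comp[OF mS A mT A mT mS' h lin_id lin_id vl gr_closed[OF x]] ..
  qed
  have m: "pt S x \<in> alg_functor_homs R DF (quasi_coherent R S)" by (rule pt_mem[OF S x])
  show ?thesis
   using True m e by (auto simp: Spec_def comm_algs_simps dual_functor_simps mod_of_simps compose_def pt_def fun_eq_iff)
 qed (use pt_mem[OF S x] in \<open>simp add: Spec_def comm_algs_simps pt_def\<close>)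
qed

end

section \<open>Linear and bilinear maps determined by points\<close>

context lp_coalg
begin

section \<open>The case of the base R, and the case of two variables\<close>

definition lact :: "('u, 'b, 'q) module_scheme => ('u, 'b) tensor_elt => 'b" where
 "lact P = tlift P (\<lambda>r p. r \<odot>\<^sub>P p)"

lemma
 assumes P: "module R P"
 shows lin_lact: "lmap R (tensor R Rm P) P (lact P)"
  and lact_pure: "r <: R ==> p <: P ==> lact P (tens R Rm P r p) = r \<odot>\<^sub>P p"
  and lact_one: "p <: P ==> lact P (tens R Rm P \<one>\<^sub>R p) = p"
  and one_lact: "z <: tensor R Rm P ==> tens R Rm P \<one>\<^sub>R (lact P z) = z"
proof -
 interpret P: module R P by (rule P)
 note mR = alg_mod[OF RR]
 note b = bilin_smult[OF P] and cR = ring_as_module_def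
 show l: "lmap R (tensor R Rm P) P (lact P)" unfolding lact_def by (rule lin_tlift[OF mR P P b])
 show pu: "r <: R ==> p <: P ==> lact P (tens R Rm P r p) = r \<odot>\<^sub>P p" for r p
  unfolding lact_def using tlift_pure[OF mR P P b, of r p] by (simp add: cR)
 then show "p <: P ==> lact P (tens R Rm P \<one>\<^sub>R p) = p" for p by simp
 note pb = bilin_pure_tensor[OF mR P]
 have o: "\<one>\<^sub>R <: Rm" by (simp add: cR)
 show "tens R Rm P \<one>\<^sub>R (lact P z) = z" if z: "z <: tensor R Rm P" for z
 proof (rule tmap_ext[OF mR P lin_comp[OF l bilin_right[OF pb o]] lin_id _ z])
  fix r p assume rp: "r <: Rm" "p <: P"
  then have r: "r <: R" by (simp add: cR)
  have "tens R Rm P \<one>\<^sub>R (r \<odot>\<^sub>P p) = tens R Rm P (r \<odot>\<^sub>Rm \<one>\<^sub>R) p"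
   using tens_group(4)[OF mR P r o rp(2)] by simp
  then show "tens R Rm P \<one>\<^sub>R (lact P (tens R Rm P r p)) = tens R Rm P r p"
   using r rp by (simp add: pu) (simp add: cR)
 qed
qed

lemma points_unique0:
 assumes P: "module R P" and f: "lmap R A P f" "lmap R A P f'"
  and eq: "\<And>(T :: ('u, 'u) module) x. algebra R T ==> x \<in> gr T
   ==> rmap R T A P f x = rmap R T A P f' x"
  and a: "a <: A"
 shows "f a = f' a"
proof -
 note mR = alg_mod[OF RR]
 note pb = bilin_pure_tensor[OF mR P]
 have o: "\<one>\<^sub>R <: Rm" using cring.cring_simprules(6)[OF R_cring] by (simp add: ring_as_module_def)
 note l = lin_comp[OF _ bilin_right[OF pb o]]
 have e: "ext_map R T P h (\<lambda>a. tens R Rm P \<one>\<^sub>R (g a)) x = rmap R T A P g x"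
  if T: "algebra R T" and h: "alg_map R Rm T h" and x: "x <: tensor R T A" and g: "lmap R A P g"
  for T :: "'u md" and h x g
 proof (rule tmap_ext[OF alg_mod[OF T] A lin_ext_map[OF A mR T P alg_map_lin[OF h] l[OF g]]
    lin_tensor_map[OF alg_mod[OF T] A alg_mod[OF T] P lin_id g] _ x])
  interpret T: algebra R T by (rule T)
  fix t a assume t: "t <: T" and a: "a <: A"
  have "h \<one>\<^sub>R = \<one>\<^sub>T" using alg_map_one[OF h] by (simp add: ring_as_module_def)
  then show "ext_map R T P h (\<lambda>a. tens R Rm P \<one>\<^sub>R (g a)) (tens R T A t a) = rmap R T A P g (tens R T A t a)"
   using t a ext_map_pure[OF A mR T P alg_map_lin[OF h] l[OF g] t a] act_pure[OF mR T P alg_map_lin[OF h] t o lin_closed[OF g a]]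
   by (simp add: tmap_pure[OF T.module A T.module P lin_id g])
 qed
 have "tens R Rm P \<one>\<^sub>R (f a) = tens R Rm P \<one>\<^sub>R (f' a)"
  by (rule points_unique[OF RR P l[OF f(1)] l[OF f(2)] _ a]) (simp add: e f eq gr_closed)
 from arg_cong[where f = "lact P", OF this] show ?thesis
  unfolding lact_one[OF P lin_closed[OF f(1) a]] lact_one[OF P lin_closed[OF f(2) a]] .
qed

text \<open>Apply the relative statement with base \<open>R\<close> and identify R \<otimes> P with
  P.\<close>

lemma points_linear0:
 fixes P :: "('u, 'b, 'q) module_scheme" and \<phi> :: "'u md => ('u, 'u) tensor_elt => ('u, 'b) tensor_elt"
 assumes P: "module R P"
  and cl: "\<And>T x. algebra R T ==> x \<in> gr T ==> \<phi> T x <: tensor R T P"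
  and nat: "\<And>T T' k x. algebra R T ==> algebra R T' ==> alg_map R T T' k ==> x \<in> gr T
   ==> \<phi> T' (push_pt T T' k x) = tmap R T P T' P k (\<lambda>p. p) (\<phi> T x)"
 obtains f where "lmap R A P f" "\<And>T x. algebra R T ==> x \<in> gr T ==> \<phi> T x = rmap R T A P f x"
proof -
 note mR = alg_mod[OF RR]
 interpret P: module R P by (rule P)
 obtain \<tau> where \<tau>: "lmap R A (tensor R Rm P) \<tau>"
  and e: "\<And>T h x. algebra R T ==> alg_map R Rm T h ==> x \<in> gr T ==> \<phi> T x = ext_map R T P h \<tau> x"
  by (rule points_linear[OF RR P, of "\<lambda>T h. \<phi> T"]) (use cl nat in \<open>blast+\<close>)
 note f = lin_comp[OF \<tau> lin_lact[OF P]]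
 have "\<phi> T x = rmap R T A P (\<lambda>a. lact P (\<tau> a)) x" if T: "algebra R T" and x: "x \<in> gr T" for T :: "'u md" and x
 proof -
  interpret T: algebra R T by (rule T)
  let ?h = "\<lambda>r. r \<odot>\<^sub>T \<one>\<^sub>T"
  note h = alg_map_unit[OF T]
  note hl = alg_map_lin[OF h] and pb = bilin_pure_tensor[OF T.module P]
  have ac: "act R T P ?h t z = tens R T P t (lact P z)" if t: "t <: T" and z: "z <: tensor R Rm P" for t z
  proof (rule tmap_ext[OF mR P bilin_right[OF bilin_act[OF mR T P hl] t] lin_comp[OF lin_lact[OF P] bilin_right[OF pb t]] _ z])
   fix r p assume rp: "r <: Rm" "p <: P"
   then have r: "r <: R" by (simp add: ring_as_module_def)
   have "t \<otimes>\<^sub>T (r \<odot>\<^sub>T \<one>\<^sub>T) = r \<odot>\<^sub>T t" using lin_smult[OF bilin_right[OF bilin_mult[OF T] t] r T.one_closed] t by simp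
   then show "act R T P ?h t (tens R Rm P r p) = tens R T P t (lact P (tens R Rm P r p))"
    using r rp t by (simp add: act_pure[OF mR T P hl] lact_pure[OF P] tens_group(4)[OF T.module P])
  qed
  have "ext_map R T P ?h \<tau> x = rmap R T A P (\<lambda>a. lact P (\<tau> a)) x"
   by (rule tmap_ext[OF T.module A lin_ext_map[OF A mR T P hl \<tau>] lin_tensor_map[OF T.module A T.module P lin_id f] _ gr_closed[OF x]])
    (simp add: ext_map_pure[OF A mR T P hl \<tau>] ac lin_closed[OF \<tau>] tmap_pure[OF T.module A T.module P lin_id f])
  then show ?thesis using e[OF T h x] by simp
 qed
 with f show thesis by (rule that)
qed

lemma lin_tensor_map_param:
 assumes S: "module R S" and M: "module R M" and P: "module R P" and \<beta>: "bilin R M A P \<beta>" and y: "y <: tensor R S A"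
 shows "lmap R M (tensor R S P) (\<lambda>a. rmap R S A P (\<beta> a) y)"
 unfolding tmap_eq[OF y]
 by (rule lin_tlift_param[OF S A module_tensor[OF S P] M _ _ y])
  (auto intro: bilin_comp[OF bilin_pure_tensor[OF S P] lin_id] bilin_right[OF \<beta>]
   lin_comp[OF bilin_left[OF \<beta>] bilin_right[OF bilin_pure_tensor[OF S P]]])

text \<open>A bilinear map evaluated at two points is obtained by inserting the second point, over
  \<open>S\<close>, and then extending linearly in the first. It matches the one-variable statements
  with \<open>box\<close>.\<close>

lemma ext_map_box:
 assumes S: "algebra R S" and T: "algebra R T" and h: "alg_map R S T h" and P: "module R P" and \<beta>: "bilin R A A P \<beta>"
  and x: "x <: tensor R T A" and y: "y <: tensor R S A"
 shows "ext_map R T P h (\<lambda>a. rmap R S A P (\<beta> a) y) x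
  = rmap R T (tensor R A A) P (tlift P \<beta>) (box T x (push_pt S T h y))"
proof -
 note mS = alg_mod[OF S] and mT = alg_mod[OF T] and hl = alg_map_lin[OF h] and AA = module_tensor[OF A A]
 note l = lin_tlift[OF A A P \<beta>] and tb = tlift_pure[OF A A P \<beta>]
 note tm = lin_tensor_map[OF mT AA mT P lin_id l] and bb = bilin_box[OF T]
 note pu = lin_tensor_map[OF mS A mT A hl lin_id]
 note \<tau> = lin_tensor_map_param[OF mS A P \<beta> y]
 show ?thesis
 proof (rule tmap_ext[OF mT A lin_ext_map[OF A mS T P hl \<tau>] lin_comp[OF bilin_left[OF bb lin_closed[OF pu y]] tm] _ x])
  fix t a assume t: "t <: T" and a: "a <: A"
  note ta = tens_closed[OF mT A t a] and \<beta>a = bilin_right[OF \<beta> a]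
  have "act R T P h t (rmap R S A P (\<beta> a) y)
   = rmap R T (tensor R A A) P (tlift P \<beta>) (box T (tens R T A t a) (push_pt S T h y))"
  proof (rule tmap_ext[OF mS A lin_comp[OF lin_tensor_map[OF mS A mS P lin_id \<beta>a] bilin_right[OF bilin_act[OF mS T P hl] t]]
     lin_comp[OF lin_comp[OF pu bilin_right[OF bb ta]] tm] _ y])
   fix s b assume s: "s <: S" and b: "b <: A"
   show "act R T P h t (rmap R S A P (\<beta> a) (tens R S A s b))
    = rmap R T (tensor R A A) P (tlift P \<beta>) (box T (tens R T A t a) (push_pt S T h (tens R S A s b)))"
    using s b t a lin_closed[OF hl s] bilin_closed[OF \<beta> a b] bilin_closed[OF bilin_mult[OF T] t lin_closed[OF hl s]]
    by (simp add: tmap_pure[OF mS A mS P lin_id \<beta>a] act_pure[OF mS T P hl] tmap_pure[OF mS A mT A hl lin_id]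
      box_pure[OF T] tmap_pure[OF mT AA mT P lin_id l] tb tens_closed[OF A A])
  qed
  then show "ext_map R T P h (\<lambda>a. rmap R S A P (\<beta> a) y) (tens R T A t a)
   = rmap R T (tensor R A A) P (tlift P \<beta>) (box T (tens R T A t a) (push_pt S T h y))"
   using ext_map_pure[OF A mS T P hl \<tau> t a] by simp
 qed
qed

text \<open>Two applications of uniqueness: with y fixed over \<open>S\<close> the first variable is
  freed from points, then the second one over the base \<open>R\<close>.\<close>

lemma points_unique2:
 assumes P: "module R P" and \<beta>: "bilin R A A P \<beta>" "bilin R A A P \<beta>'"
  and eq: "\<And>(T :: ('u, 'u) module) x y. algebra R T ==> x \<in> gr T ==> y \<in> gr T
   ==> rmap R T (tensor R A A) P (tlift P \<beta>) (box T x y)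
    = rmap R T (tensor R A A) P (tlift P \<beta>') (box T x y)"
  and a: "a <: A" and b: "b <: A"
 shows "\<beta> a b = \<beta>' a b"
proof (rule points_unique0[OF P bilin_right[OF \<beta>(1) a] bilin_right[OF \<beta>(2) a] _ b])
 fix S :: "'u md" and y assume S: "algebra R S" and y: "y \<in> gr S"
 note l = lin_tensor_map_param[OF alg_mod[OF S] A P _ gr_closed[OF y]]
 show "rmap R S A P (\<beta> a) y = rmap R S A P (\<beta>' a) y"
  by (rule points_unique[OF S P l[OF \<beta>(1)] l[OF \<beta>(2)] _ a])
   (simp add: ext_map_box[OF S _ _ P \<beta>(1) gr_closed gr_closed[OF y]] ext_map_box[OF S _ _ P \<beta>(2) gr_closed gr_closed[OF y]] eq gr_push[OF S _ _ y])
qed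

lemma ext_map_push:
 assumes S: "algebra R S" and S': "algebra R S'" and k: "alg_map R S S' k" and T: "algebra R T" and h: "alg_map R S' T h" and P: "module R P"
  and \<tau>: "lmap R A (tensor R S P) \<tau>" and x: "x <: tensor R T A"
 shows "ext_map R T P h (\<lambda>a. tmap R S P S' P k (\<lambda>p. p) (\<tau> a)) x = ext_map R T P (\<lambda>s. h (k s)) \<tau> x"
proof -
 note mS = alg_mod[OF S] and mS' = alg_mod[OF S'] and mT = alg_mod[OF T]
 note kl = alg_map_lin[OF k] and hl = alg_map_lin[OF h] and hkl = alg_map_lin[OF alg_map_comp[OF k h]]
 note kp = lin_tensor_map[OF mS P mS' P kl lin_id]
 note \<tau>' = lin_comp[OF \<tau> kp]
 have e: "act R T P h t (tmap R S P S' P k (\<lambda>p. p) z) = act R T P (\<lambda>s. h (k s)) t z" if t: "t <: T" and z: "z <: tensor R S P" for t z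
  by (rule tmap_ext[OF mS P lin_comp[OF kp bilin_right[OF bilin_act[OF mS' T P hl] t]] bilin_right[OF bilin_act[OF mS T P hkl] t] _ z])
   (simp add: tmap_pure[OF mS P mS' P kl lin_id] act_pure[OF mS' T P hl t] act_pure[OF mS T P hkl t] lin_closed[OF kl])
 show ?thesis
  by (rule tmap_ext[OF mT A lin_ext_map[OF A mS' T P hl \<tau>'] lin_ext_map[OF A mS T P hkl \<tau>] _ x])
   (simp add: ext_map_pure[OF A mS' T P hl \<tau>'] ext_map_pure[OF A mS T P hkl \<tau>] e lin_closed[OF \<tau>])
qed

text \<open>Fix y over \<open>S\<close>. As a function of the first argument over
  \<open>S\<close>-algebras, \<mu>(-, y) is represented by a linear \<open>L S y\<close>; for each a
  the assignment y \<mapsto> L S y a is natural again and so is represented by a linear map, which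
  is \<beta>(a, -).\<close>

lemma points_bilinear:
 fixes P :: "('u, 'b, 'q) module_scheme" and \<mu> :: "'u md => ('u, 'u) tensor_elt => ('u, 'u) tensor_elt => ('u, 'b) tensor_elt"
 assumes P: "module R P"
  and cl: "\<And>T x y. algebra R T ==> x \<in> gr T ==> y \<in> gr T ==> \<mu> T x y <: tensor R T P"
  and nat: "\<And>T T' k x y. algebra R T ==> algebra R T' ==> alg_map R T T' k ==> x \<in> gr T ==> y \<in> gr T
   ==> \<mu> T' (push_pt T T' k x) (push_pt T T' k y) = tmap R T P T' P k (\<lambda>p. p) (\<mu> T x y)"
 obtains \<beta> where "bilin R A A P \<beta>" "\<And>T x y. algebra R T ==> x \<in> gr T ==> y \<in> gr T
   ==> \<mu> T x y = rmap R T (tensor R A A) P (tlift P \<beta>) (box T x y)"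
proof -
 interpret P: module R P by (rule P)
 interpret Am: module R A by (rule A)
 have ex: "\<exists>\<tau>. lmap R A (tensor R S P) \<tau> \<and> (\<forall>T h x. algebra R T --> alg_map R S T h --> x \<in> gr T --> \<mu> T x (push_pt S T h y) = ext_map R T P h \<tau> x)"
  if S: "algebra R S" and y: "y \<in> gr S" for S :: "'u md" and y
 proof -
  obtain \<tau> where "lmap R A (tensor R S P) \<tau>"
   "\<And>T h x. algebra R T ==> alg_map R S T h ==> x \<in> gr T ==> \<mu> T x (push_pt S T h y) = ext_map R T P h \<tau> x"
  proof (rule points_linear[OF S P, of "\<lambda>T h x. \<mu> T x (push_pt S T h y)"])
   fix T :: "'u md" and h x assume T: "algebra R T" and h: "alg_map R S T h" and x: "x \<in> gr T"
   show "\<mu> T x (push_pt S T h y) <: tensor R T P" by (rule cl[OF T x gr_push[OF S T h y]])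
   show "\<mu> T x (push_pt S T h y) = \<mu> T x (push_pt S T h' y)" if "\<And>s. s <: S ==> h s = h' s" for h'
    using tmap_cong[OF alg_mod[OF S] A alg_mod[OF T] A alg_map_lin[OF h] lin_id that refl gr_closed[OF y]] by simp
   fix T' :: "'u md" and k assume T': "algebra R T'" and k: "alg_map R T T' k"
   show "\<mu> T' (push_pt T T' k x) (push_pt S T' (\<lambda>s. k (h s)) y) = tmap R T P T' P k (\<lambda>p. p) (\<mu> T x (push_pt S T h y))"
    using nat[OF T T' k x gr_push[OF S T h y]]
     tmap_comp[OF alg_mod[OF S] A alg_mod[OF T] A alg_mod[OF T'] A alg_map_lin[OF h] lin_id alg_map_lin[OF k] lin_id gr_closed[OF y]] by simp
  qed (rule that)
  then show ?thesis by blast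
 qed
 define L where "L S y = (SOME \<tau>. lmap R A (tensor R S P) \<tau> \<and> (\<forall>T h x. algebra R T --> alg_map R S T h --> x \<in> gr T --> \<mu> T x (push_pt S T h y) = ext_map R T P h \<tau> x))" for S :: "'u md" and y
 have L: "lmap R A (tensor R S P) (L S y)"
  and Le: "\<And>T h x. algebra R T ==> alg_map R S T h ==> x \<in> gr T ==> \<mu> T x (push_pt S T h y) = ext_map R T P h (L S y) x"
  if "algebra R S" "y \<in> gr S" for S :: "'u md" and y
  using someI_ex[OF ex[OF that]] unfolding L_def[symmetric] by blast+
 \<comment> \<open>The chosen representing maps are compatible with base change because they are
   unique.\<close>
 have Ln: "L S' (push_pt S S' k y) a = tmap R S P S' P k (\<lambda>p. p) (L S y a)"
  if S: "algebra R S" and S': "algebra R S'" and k: "alg_map R S S' k" and y: "y \<in> gr S" and a: "a <: A" for S S' :: "'u md" and k y a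
 proof (rule points_unique[OF S' P L[OF S' gr_push[OF S S' k y]] _ _ a])
  show "lmap R A (tensor R S' P) (\<lambda>a. tmap R S P S' P k (\<lambda>p. p) (L S y a))"
   by (rule lin_comp[OF L[OF S y] lin_tensor_map[OF alg_mod[OF S] P alg_mod[OF S'] P alg_map_lin[OF k] lin_id]])
  fix T :: "'u md" and h x assume T: "algebra R T" and h: "alg_map R S' T h" and x: "x \<in> gr T"
  show "ext_map R T P h (L S' (push_pt S S' k y)) x = ext_map R T P h (\<lambda>a. tmap R S P S' P k (\<lambda>p. p) (L S y a)) x"
   unfolding ext_map_push[OF S S' k T h P L[OF S y] gr_closed[OF x]]
   using Le[OF S y T alg_map_comp[OF k h] x] Le[OF S' gr_push[OF S S' k y] T h x]
    tmap_comp[OF alg_mod[OF S] A alg_mod[OF S'] A alg_mod[OF T] A alg_map_lin[OF k] lin_id alg_map_lin[OF h] lin_id gr_closed[OF y]] by simp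
 qed
 have ex2: "\<exists>f. lmap R A P f \<and> (\<forall>S y. algebra R S --> y \<in> gr S --> L S y a = rmap R S A P f y)" if a: "a <: A" for a
 proof -
  obtain f where "lmap R A P f" "\<And>S y. algebra R S ==> y \<in> gr S ==> L S y a = rmap R S A P f y"
  proof (rule points_linear0[OF P, of "\<lambda>S y. L S y a"])
   show "L S y a <: tensor R S P" if "algebra R S" "y \<in> gr S" for S y
    by (rule lin_closed[OF L[OF that] a])
   show "L S' (push_pt S S' k y) a = tmap R S P S' P k (\<lambda>p. p) (L S y a)"
    if "algebra R S" "algebra R S'" "alg_map R S S' k" "y \<in> gr S" for S S' k y by (rule Ln[OF that a])
  qed (rule that)
  then show ?thesis by blast
 qed
 define \<beta> where "\<beta> a = (SOME f. lmap R A P f \<and> (\<forall>S y. algebra R S --> y \<in> gr S --> L S y a = rmap R S A P f y))" for a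
 have \<beta>l: "lmap R A P (\<beta> a)" and \<beta>e: "\<And>S y. algebra R S ==> y \<in> gr S ==> L S y a = rmap R S A P (\<beta> a) y"
  if "a <: A" for a
  using someI_ex[OF ex2[OF that]] unfolding \<beta>_def[symmetric] by blast+
 have bil: "bilin R A A P \<beta>"
 proof (rule bilinI[OF \<beta>l])
  fix b assume b: "b <: A"
  \<comment> \<open>Linearity in the first argument is inherited from \<open>L S y\<close>, by
    uniqueness of the linear map representing the values at all y.\<close>
  show "lmap R A P (\<lambda>a. \<beta> a b)"
  proof (rule lmapI)
   show "\<beta> a b <: P" if "a <: A" for a by (rule lin_closed[OF \<beta>l[OF that] b])
   show "\<beta> (a \<oplus>\<^sub>A a') b = \<beta> a b \<oplus>\<^sub>P \<beta> a' b" if a: "a <: A" "a' <: A" for a a'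
   proof (rule points_unique0[OF P \<beta>l lin_sum[OF P \<beta>l[OF a(1)] \<beta>l[OF a(2)]] _ b])
    show aa: "a \<oplus>\<^sub>A a' <: A" using a by simp
    fix S :: "'u md" and y assume S: "algebra R S" and y: "y \<in> gr S"
    note mS = alg_mod[OF S] and y' = gr_closed[OF y]
    note tl = lin_tensor_map[OF mS A mS P lin_id] and tp = tmap_pure[OF mS A mS P lin_id]
    have "rmap R S A P (\<lambda>b. \<beta> a b \<oplus>\<^sub>P \<beta> a' b) y
     = rmap R S A P (\<beta> a) y \<oplus>\<^bsub>tensor R S P\<^esub> rmap R S A P (\<beta> a') y"
     by (rule tmap_ext[OF mS A tl[OF lin_sum[OF P \<beta>l[OF a(1)] \<beta>l[OF a(2)]]] lin_sum[OF module_tensor[OF mS P] tl[OF \<beta>l[OF a(1)]] tl[OF \<beta>l[OF a(2)]]] _ y'])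
      (simp add: tp[OF lin_sum[OF P \<beta>l[OF a(1)] \<beta>l[OF a(2)]]] tp[OF \<beta>l[OF a(1)]] tp[OF \<beta>l[OF a(2)]] lin_add[OF bilin_right[OF bilin_pure_tensor[OF mS P]]]
       lin_closed[OF \<beta>l[OF a(1)]] lin_closed[OF \<beta>l[OF a(2)]])
    then show "rmap R S A P (\<beta> (a \<oplus>\<^sub>A a')) y = rmap R S A P (\<lambda>b. \<beta> a b \<oplus>\<^sub>P \<beta> a' b) y"
     using \<beta>e[OF aa S y] \<beta>e[OF a(1) S y] \<beta>e[OF a(2) S y] lin_add[OF L[OF S y] a] by simp
   qed
   show "\<beta> (r \<odot>\<^sub>A a) b = r \<odot>\<^sub>P \<beta> a b" if r: "r <: R" and a: "a <: A" for r a
   proof (rule points_unique0[OF P \<beta>l lin_smult_left[OF P \<beta>l[OF a] r] _ b])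
    show aa: "r \<odot>\<^sub>A a <: A" using r a by simp
    fix S :: "'u md" and y assume S: "algebra R S" and y: "y \<in> gr S"
    note mS = alg_mod[OF S] and y' = gr_closed[OF y]
    note tl = lin_tensor_map[OF mS A mS P lin_id] and tp = tmap_pure[OF mS A mS P lin_id]
    have "rmap R S A P (\<lambda>b. r \<odot>\<^sub>P \<beta> a b) y = r \<odot>\<^bsub>tensor R S P\<^esub> rmap R S A P (\<beta> a) y"
     by (rule tmap_ext[OF mS A tl[OF lin_smult_left[OF P \<beta>l[OF a] r]] lin_smult_left[OF module_tensor[OF mS P] tl[OF \<beta>l[OF a]] r] _ y'])
      (simp add: tp[OF lin_smult_left[OF P \<beta>l[OF a] r]] tp[OF \<beta>l[OF a]] lin_smult[OF bilin_right[OF bilin_pure_tensor[OF mS P]] r]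
       lin_closed[OF \<beta>l[OF a]])
    then show "rmap R S A P (\<beta> (r \<odot>\<^sub>A a)) y = rmap R S A P (\<lambda>b. r \<odot>\<^sub>P \<beta> a b) y"
     using \<beta>e[OF aa S y] \<beta>e[OF a S y] lin_smult[OF L[OF S y] r a] by simp
   qed
  qed
 qed
 moreover have "\<mu> T x y = rmap R T (tensor R A A) P (tlift P \<beta>) (box T x y)" if T: "algebra R T" and x: "x \<in> gr T" and y: "y \<in> gr T" for T :: "'u md" and x y
 proof -
  note mT = alg_mod[OF T]
  note i = tmap_ident[OF mT A gr_closed[OF y]]
  note l = lin_tensor_map_param[OF mT A P bil gr_closed[OF y]]
  have "\<mu> T x y = ext_map R T P (\<lambda>t. t) (L T y) x" using Le[OF T y T alg_map_id x] i by simp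
  also have "\<dots> = ext_map R T P (\<lambda>t. t) (\<lambda>a. rmap R T A P (\<beta> a) y) x"
   by (rule tmap_ext[OF mT A lin_ext_map[OF A mT T P lin_id L[OF T y]] lin_ext_map[OF A mT T P lin_id l] _ gr_closed[OF x]])
    (simp add: ext_map_pure[OF A mT T P lin_id L[OF T y]] ext_map_pure[OF A mT T P lin_id l] \<beta>e[OF _ T y])
  also have "\<dots> = rmap R T (tensor R A A) P (tlift P \<beta>) (box T x y)"
   using ext_map_box[OF T T alg_map_id P bil gr_closed[OF x] gr_closed[OF y]] i by simp
  finally show ?thesis .
 qed
 ultimately show thesis by (rule that)
qed

end

section \<open>Bialgebra structures and monoid structures on points\<close>

lemma tensor_bilin_ext:
 assumes "module R M" "module R N" "module R M'" "module R N'"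
  and f: "bilin R (tensor R M N) (tensor R M' N') P f" and g: "bilin R (tensor R M N) (tensor R M' N') P g"
  and eq: "\<And>x y x' y'. x <: M ==> y <: N ==> x' <: M' ==> y' <: N'
   ==> f (tens R M N x y) (tens R M' N' x' y') = g (tens R M N x y) (tens R M' N' x' y')"
  and X: "X <: tensor R M N" and Y: "Y <: tensor R M' N'"
 shows "f X Y = g X Y"
proof (rule tmap_ext[OF assms(1,2) bilin_left[OF f Y] bilin_left[OF g Y] _ X])
 fix x y assume xy: "x <: M" "y <: N"
 note p = tens_closed[OF assms(1,2) xy]
 show "f (tens R M N x y) Y = g (tens R M N x y) Y"
  by (rule tmap_ext[OF assms(3,4) bilin_right[OF f p] bilin_right[OF g p] eq[OF xy] Y])
qed

lemma assoc_algebra_bilin: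
 assumes "assoc_algebra R A"
 shows "bilin R A A A (mult A)"
proof -
 interpret ring A using assms by (simp add: assoc_algebra_def)
 show ?thesis by (intro bilinI lmapI) (use assms in \<open>auto simp: assoc_algebra_def l_distr r_distr\<close>)
qed

context lp_coalg
begin

text \<open>The points over \<open>S\<close> with the multiplication inherited from S \<otimes> A;
  whether this is a monoid is a condition on the structure of \<open>A\<close>.\<close>

definition grm :: "'u md => ('u, 'u) tensor_elt monoid" where
 "grm S = \<lparr>carrier = gr S, mult = mult (tensor R S A), one = one (tensor R S A)\<rparr>"

lemma grm_simps: "carrier (grm S) = gr S" "mult (grm S) = mult (tensor R S A)" "one (grm S) = one (tensor R S A)"
 by (simp_all add: grm_def)

lemma tmap_contract:
 assumes S: "module R S" and \<xi>: "lmap R A Rm \<xi>" and x: "x <: tensor R S A"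
 shows "rmap R S A Rm \<xi> x = tens R S Rm (contract S \<xi> x) \<one>\<^sub>R"
proof -
 note mR = alg_mod[OF RR]
 have o: "\<one>\<^sub>R <: Rm" using cring.cring_simprules(6)[OF R_cring] by (simp add: ring_as_module_def)
 show ?thesis
 proof (rule tmap_ext[OF S A lin_tensor_map[OF S A S mR lin_id \<xi>]
    lin_comp[OF lin_contract[OF S A \<xi>] bilin_left[OF bilin_pure_tensor[OF S mR] o]] _ x])
  fix s a assume s: "s <: S" and a: "a <: A"
  have r: "\<xi> a <: R" using lin_closed[OF \<xi> a] by (simp add: ring_as_module_def)
  have "tens R S Rm (\<xi> a \<odot>\<^sub>S s) \<one>\<^sub>R = tens R S Rm s (\<xi> a)"
   unfolding tens_group(4)[OF S mR r s o] using r cring.cring_simprules(12)[OF R_cring r]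
   by (simp add: ring_as_module_def monoid.r_one[OF ring.is_monoid[OF cring.axioms(1)[OF R_cring]]])
  then show "rmap R S A Rm \<xi> (tens R S A s a) = tens R S Rm (contract S \<xi> (tens R S A s a)) \<one>\<^sub>R"
   by (simp add: tmap_pure[OF S A S mR lin_id \<xi> s a] contract_pure[OF S A \<xi> s a])
 qed
qed

section \<open>Bilinear multiplications that are not yet known to be associative\<close>

context
 assumes bA: "bilin R A A A (mult A)"
begin

lemma bAA: "bilin R (tensor R A A) (tensor R A A) (tensor R A A) (mult (tensor R A A))"
 by (rule bilin_tensor_mult[OF A A bA bA])

lemma
 assumes S: "algebra R S"
 shows bSA: "bilin R (tensor R S A) (tensor R S A) (tensor R S A) (mult (tensor R S A))"
  and SA_pure: "s <: S ==> a <: A ==> t <: S ==> b <: A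
   ==> tens R S A s a \<otimes>\<^bsub>tensor R S A\<^esub> tens R S A t b = tens R S A (s \<otimes>\<^sub>S t) (a \<otimes>\<^sub>A b)"
  and bSAA: "bilin R (tensor R S (tensor R A A)) (tensor R S (tensor R A A)) (tensor R S (tensor R A A)) (mult (tensor R S (tensor R A A)))"
  and SAA_pure: "s <: S ==> Z <: tensor R A A ==> t <: S ==> W <: tensor R A A
   ==> tens R S (tensor R A A) s Z \<otimes>\<^bsub>tensor R S (tensor R A A)\<^esub> tens R S (tensor R A A) t W
    = tens R S (tensor R A A) (s \<otimes>\<^sub>S t) (Z \<otimes>\<^bsub>tensor R A A\<^esub> W)"
 by (rule bilin_tensor_mult[OF alg_mod[OF S] A bilin_mult[OF S] bA] tensor_mult_pure[OF alg_mod[OF S] A bilin_mult[OF S] bA]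
   bilin_tensor_mult[OF alg_mod[OF S] module_tensor[OF A A] bilin_mult[OF S] bAA]
   tensor_mult_pure[OF alg_mod[OF S] module_tensor[OF A A] bilin_mult[OF S] bAA]; assumption)+

text \<open>Multiplication in S \<otimes> A factors through \<open>box\<close>. This links products
  of points with the two-variable uniqueness statement.\<close>

lemma mult_box:
 assumes S: "algebra R S" and x: "x <: tensor R S A" "y <: tensor R S A" and P: "module R P" and f: "lmap R A P f"
 shows "rmap R S (tensor R A A) P (tlift P (\<lambda>a b. f (a \<otimes>\<^sub>A b))) (box S x y)
  = rmap R S A P f (x \<otimes>\<^bsub>tensor R S A\<^esub> y)"
proof -
 note mS = alg_mod[OF S] and AA = module_tensor[OF A A] and fb = bilin_post[OF bA f]
 note l = lin_tlift[OF A A P fb] and tp = tlift_pure[OF A A P fb]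
 show ?thesis
  by (rule tensor_bilin_ext[OF mS A mS A bilin_post[OF bilin_box[OF S] lin_tensor_map[OF mS AA mS P lin_id l]]
     bilin_post[OF bSA[OF S] lin_tensor_map[OF mS A mS P lin_id f]] _ x])
   (simp add: box_pure[OF S] SA_pure[OF S] tmap_pure[OF mS AA mS P lin_id l] tmap_pure[OF mS A mS P lin_id f]
    bilin_closed[OF bilin_mult[OF S]] bilin_closed[OF bA] tens_closed[OF A A] tp)
qed

text \<open>With x = y and x' = y' it compares the square of a product with the product of squares,
  which is what closure of group-like elements under multiplication requires.\<close>

lemma box_mult:
 assumes S: "algebra R S" and x: "x <: tensor R S A" "y <: tensor R S A"
  and x': "x' <: tensor R S A" "y' <: tensor R S A"
 shows "box S (x \<otimes>\<^bsub>tensor R S A\<^esub> x') (y \<otimes>\<^bsub>tensor R S A\<^esub> y') = box S x y \<otimes>\<^bsub>tensor R S (tensor R A A)\<^esub> box S x' y'"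
proof -
 interpret S: algebra R S by (rule S)
 note mS = alg_mod[OF S] and bb = bilin_box[OF S] and m = bSA[OF S] and mm = bSAA[OF S]
 show ?thesis
 proof (rule tensor_bilin_ext[OF mS A mS A bilin_comp[OF bb bilin_left[OF m x'(1)] bilin_left[OF m x'(2)]]
    bilin_post[OF bb bilin_left[OF mm bilin_closed[OF bb x']]] _ x])
  fix s a t b assume q: "s <: S" "a <: A" "t <: S" "b <: A"
  note p = tens_closed[OF mS A q(1,2)] tens_closed[OF mS A q(3,4)]
  show "box S (tens R S A s a \<otimes>\<^bsub>tensor R S A\<^esub> x') (tens R S A t b \<otimes>\<^bsub>tensor R S A\<^esub> y')
   = box S (tens R S A s a) (tens R S A t b) \<otimes>\<^bsub>tensor R S (tensor R A A)\<^esub> box S x' y'"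
   by (rule tensor_bilin_ext[OF mS A mS A bilin_comp[OF bb bilin_right[OF m p(1)] bilin_right[OF m p(2)]]
      bilin_post[OF bb bilin_right[OF mm bilin_closed[OF bb p]]] _ x'])
    (simp add: q box_pure[OF S] SA_pure[OF S] SAA_pure[OF S] bilin_closed[OF bA] tens_closed[OF A A] tensor_mult_pure[OF A A bA bA] S.m_ac)
 qed
qed

lemma push_mult:
 assumes S: "algebra R S" and T: "algebra R T" and h: "alg_map R S T h" and x: "x <: tensor R S A" "y <: tensor R S A"
 shows "push_pt S T h (x \<otimes>\<^bsub>tensor R S A\<^esub> y) = push_pt S T h x \<otimes>\<^bsub>tensor R T A\<^esub> push_pt S T h y"
proof -
 note mS = alg_mod[OF S] and mT = alg_mod[OF T] and hl = alg_map_lin[OF h]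
 note l = lin_tensor_map[OF mS A mT A hl lin_id]
 show ?thesis
  by (rule tensor_bilin_ext[OF mS A mS A bilin_post[OF bSA[OF S] l] bilin_comp[OF bSA[OF T] l l] _ x])
   (simp add: SA_pure[OF S] SA_pure[OF T] tmap_pure[OF mS A mT A hl lin_id] lin_closed[OF hl] alg_map_mult[OF h]
    bilin_closed[OF bilin_mult[OF S]] bilin_closed[OF bA])
qed

text \<open>Left multiplication by scalars does not disturb a right factor. It is used to extend
  associativity linearly in the first argument only.\<close>

lemma act_mult:
 assumes S: "algebra R S" and T: "algebra R T" and h: "alg_map R S T h" and t: "t <: T"
  and x: "x <: tensor R S A" "y <: tensor R S A"
 shows "act R T A h t (x \<otimes>\<^bsub>tensor R S A\<^esub> y) = act R T A h t x \<otimes>\<^bsub>tensor R T A\<^esub> push_pt S T h y"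
proof -
 interpret T: algebra R T by (rule T)
 note mS = alg_mod[OF S] and mT = alg_mod[OF T] and hl = alg_map_lin[OF h]
 note l = lin_tensor_map[OF mS A mT A hl lin_id] and al = bilin_right[OF bilin_act[OF mS T A hl] t]
 show ?thesis
  by (rule tensor_bilin_ext[OF mS A mS A bilin_post[OF bSA[OF S] al] bilin_comp[OF bSA[OF T] al l] _ x])
   (simp add: t SA_pure[OF S] SA_pure[OF T] tmap_pure[OF mS A mT A hl lin_id] act_pure[OF mS T A hl] lin_closed[OF hl] alg_map_mult[OF h]
    bilin_closed[OF bilin_mult[OF S]] bilin_closed[OF bA] T.m_assoc)
qed

lemma comult_mult:
 assumes S: "algebra R S" and x: "x <: tensor R S A" "y <: tensor R S A"
 shows "rmap R S (tensor R A A) (tensor R A A) (tlift (tensor R A A) (\<lambda>a b. comult A a \<otimes>\<^bsub>tensor R A A\<^esub> comult A b)) (box S x y)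
  = rmap R S A (tensor R A A) (comult A) x \<otimes>\<^bsub>tensor R S (tensor R A A)\<^esub> rmap R S A (tensor R A A) (comult A) y"
proof -
 note mS = alg_mod[OF S] and AA = module_tensor[OF A A] and fb = bilin_comp[OF bAA comult comult]
 note l = lin_tlift[OF A A AA fb] and tp = tlift_pure[OF A A AA fb] and c = lin_tensor_map[OF mS A mS AA lin_id comult]
 show ?thesis
  by (rule tensor_bilin_ext[OF mS A mS A bilin_post[OF bilin_box[OF S] lin_tensor_map[OF mS AA mS AA lin_id l]]
     bilin_comp[OF bSAA[OF S] c c] _ x])
   (simp add: box_pure[OF S] SAA_pure[OF S] tmap_pure[OF mS AA mS AA lin_id l] tmap_pure[OF mS A mS AA lin_id comult]
    bilin_closed[OF bilin_mult[OF S]] lin_closed[OF comult] tens_closed[OF A A] tp)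
qed

lemma counit_mult:
 assumes S: "algebra R S" and x: "x <: tensor R S A" "y <: tensor R S A"
 shows "rmap R S (tensor R A A) Rm (tlift Rm (\<lambda>a b. counit A a \<otimes>\<^sub>Rm counit A b)) (box S x y)
  = rmap R S A Rm (counit A) x \<otimes>\<^bsub>tensor R S Rm\<^esub> rmap R S A Rm (counit A) y"
proof -
 note mS = alg_mod[OF S] and AA = module_tensor[OF A A] and mR = alg_mod[OF RR]
 note fb = bilin_comp[OF bilin_mult[OF RR] counit counit]
 note l = lin_tlift[OF A A mR fb] and tp = tlift_pure[OF A A mR fb] and c = lin_tensor_map[OF mS A mS mR lin_id counit]
 show ?thesis
  by (rule tensor_bilin_ext[OF mS A mS A bilin_post[OF bilin_box[OF S] lin_tensor_map[OF mS AA mS mR lin_id l]]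
     bilin_comp[OF bilin_mult[OF algebra_tensor[OF S RR]] c c] _ x])
   (simp add: box_pure[OF S] tensor_mult_pure[OF mS mR bilin_mult[OF S] bilin_mult[OF RR]] tmap_pure[OF mS AA mS mR lin_id l] tmap_pure[OF mS A mS mR lin_id counit]
    bilin_closed[OF bilin_mult[OF S]] lin_closed[OF counit] tens_closed[OF A A] tp)
qed

end

theorem monoid_grm:
 assumes b: "bialgebra R A" and S: "algebra R S"
 shows "monoid (grm S)"
proof -
 interpret S: algebra R S by (rule S)
 have aa: "assoc_algebra R A" and \<Delta>: "comult A \<in> ring_hom A (tensor R A A)" and \<epsilon>: "counit A \<in> ring_hom A R"
  using b by (simp_all add: bialgebra_def)
 interpret A: ring A using aa by (simp add: assoc_algebra_def)
 note mS = alg_mod[OF S] and AA = module_tensor[OF A A] and mR = alg_mod[OF RR]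
 note bA = assoc_algebra_bilin[OF aa]
 note m = bSA[OF bA S] and mp = SA_pure[OF bA S]
 note cl = tens_closed[OF mS A] and ci = tmap_pure[OF mS A mS AA lin_id comult]
 have sm: "s \<otimes>\<^sub>S t <: S" if "s <: S" "t <: S" for s t using that by simp
 have \<epsilon>m: "contract S (counit A) (x \<otimes>\<^bsub>tensor R S A\<^esub> y) = contract S (counit A) x \<otimes>\<^sub>S contract S (counit A) y"
  if x: "x <: tensor R S A" "y <: tensor R S A" for x y
 proof (rule tensor_bilin_ext[OF mS A mS A bilin_post[OF m lin_contract[OF mS A counit]]
    bilin_comp[OF bilin_mult[OF S] lin_contract[OF mS A counit] lin_contract[OF mS A counit]] _ x])
  fix s a t b assume q: "s <: S" "a <: A" "t <: S" "b <: A"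
  have r: "counit A a <: R" "counit A b <: R" using q \<epsilon> by (auto simp: ring_hom_def)
  show "contract S (counit A) (tens R S A s a \<otimes>\<^bsub>tensor R S A\<^esub> tens R S A t b)
   = contract S (counit A) (tens R S A s a) \<otimes>\<^sub>S contract S (counit A) (tens R S A t b)"
   using q r by (simp add: mp contract_pure[OF mS A counit] ring_hom_mult[OF \<epsilon>] S.smult_assoc1 S.smult_assoc2 flip: S.smult_assoc1)
    (simp add: lin_smult[OF bilin_right[OF bilin_mult[OF S]]] S.smult_assoc1 S.smult_assoc2)
 qed
 show ?thesis
 proof (rule monoidI; simp only: grm_simps)
  fix x y assume x: "x \<in> gr S" "y \<in> gr S"
  note xc = gr_closed[OF x(1)] gr_closed[OF x(2)]
  have "rmap R S A (tensor R A A) (comult A) (x \<otimes>\<^bsub>tensor R S A\<^esub> y)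
   = rmap R S A (tensor R A A) (comult A) x \<otimes>\<^bsub>tensor R S (tensor R A A)\<^esub> rmap R S A (tensor R A A) (comult A) y"
   by (rule tensor_bilin_ext[OF mS A mS A bilin_post[OF m lin_tensor_map[OF mS A mS AA lin_id comult]]
      bilin_comp[OF bSAA[OF bA S] lin_tensor_map[OF mS A mS AA lin_id comult] lin_tensor_map[OF mS A mS AA lin_id comult]] _ xc])
    (simp add: mp ci SAA_pure[OF bA S] lin_closed[OF comult] ring_hom_mult[OF \<Delta>] bilin_closed[OF bA] sm)
  also have "\<dots> = box S x x \<otimes>\<^bsub>tensor R S (tensor R A A)\<^esub> box S y y"
   using x by (simp add: gr_iff[OF S])
  also have "\<dots> = box S (x \<otimes>\<^bsub>tensor R S A\<^esub> y) (x \<otimes>\<^bsub>tensor R S A\<^esub> y)" by (rule box_mult[OF bA S xc(1) xc(1) xc(2) xc(2), symmetric])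
  finally show "x \<otimes>\<^bsub>tensor R S A\<^esub> y \<in> gr S"
   using x \<epsilon>m[OF xc] bilin_closed[OF m xc] by (simp add: gr_iff[OF S])
 next
  have "counit A \<one>\<^sub>A = \<one>\<^sub>R" "comult A \<one>\<^sub>A = tens R A A \<one>\<^sub>A \<one>\<^sub>A" using ring_hom_one[OF \<epsilon>] ring_hom_one[OF \<Delta>] by (simp_all add: tensor_one)
  then show "\<one>\<^bsub>tensor R S A\<^esub> \<in> gr S"
   by (simp add: gr_iff[OF S] tensor_one cl ci contract_pure[OF mS A counit] box_pure[OF S])
 next
  fix x y z assume xyz: "x \<in> gr S" "y \<in> gr S" "z \<in> gr S"
  note x = gr_closed[OF xyz(1)] gr_closed[OF xyz(2)] and z = gr_closed[OF xyz(3)]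
  show "x \<otimes>\<^bsub>tensor R S A\<^esub> y \<otimes>\<^bsub>tensor R S A\<^esub> z = x \<otimes>\<^bsub>tensor R S A\<^esub> (y \<otimes>\<^bsub>tensor R S A\<^esub> z)"
  proof (rule tensor_bilin_ext[OF mS A mS A bilin_post[OF m bilin_left[OF m z]] bilin_comp[OF m lin_id bilin_left[OF m z]] _ x])
   fix s a t b assume q: "s <: S" "a <: A" "t <: S" "b <: A"
   note p = cl[OF q(1,2)] cl[OF q(3,4)]
   show "tens R S A s a \<otimes>\<^bsub>tensor R S A\<^esub> tens R S A t b \<otimes>\<^bsub>tensor R S A\<^esub> z
    = tens R S A s a \<otimes>\<^bsub>tensor R S A\<^esub> (tens R S A t b \<otimes>\<^bsub>tensor R S A\<^esub> z)"
    by (rule tmap_ext[OF mS A bilin_right[OF m bilin_closed[OF m p]] lin_comp[OF bilin_right[OF m p(2)] bilin_right[OF m p(1)]] _ z])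
     (simp add: q mp S.m_assoc A.m_assoc)
  qed
 next
  fix x assume x: "x \<in> gr S"
  have o: "\<one>\<^bsub>tensor R S A\<^esub> <: tensor R S A" by (simp add: tensor_one cl)
  show "\<one>\<^bsub>tensor R S A\<^esub> \<otimes>\<^bsub>tensor R S A\<^esub> x = x"
   by (rule tmap_ext[OF mS A bilin_right[OF m o] lin_id _ gr_closed[OF x]]) (simp add: tensor_one mp)
  show "x \<otimes>\<^bsub>tensor R S A\<^esub> \<one>\<^bsub>tensor R S A\<^esub> = x"
   by (rule tmap_ext[OF mS A bilin_left[OF m o] lin_id _ gr_closed[OF x]]) (simp add: tensor_one mp)
 qed
qed

text \<open>Each bialgebra axiom asserts the equality of two linear or bilinear maps, so it is
  enough to know it at points, where it expresses a monoid law or the closure of group-like elements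
  under products.\<close>

theorem bialgebra_of_monoid_grm:
 assumes bA: "bilin R A A A (mult A)" and o: "\<one>\<^sub>A <: A"
  and M: "\<And>S :: ('u, 'u) module. algebra R S ==> monoid (grm S)"
 shows "bialgebra R A"
proof -
 note AA = module_tensor[OF A A] and mR = alg_mod[OF RR]
 interpret Am: module R A by (rule A)
 have gm: "x \<otimes>\<^bsub>tensor R S A\<^esub> y \<in> gr S" if "algebra R S" "x \<in> gr S" "y \<in> gr S" for S :: "'u md" and x y
  using monoid.m_closed[OF M[OF that(1)], of x y] that by (simp add: grm_simps)
 have ga: "x \<otimes>\<^bsub>tensor R S A\<^esub> y \<otimes>\<^bsub>tensor R S A\<^esub> z = x \<otimes>\<^bsub>tensor R S A\<^esub> (y \<otimes>\<^bsub>tensor R S A\<^esub> z)"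
  if "algebra R S" "x \<in> gr S" "y \<in> gr S" "z \<in> gr S" for S :: "'u md" and x y z
  using monoid.m_assoc[OF M[OF that(1)], of x y z] that by (simp add: grm_simps)
 have go: "\<one>\<^bsub>tensor R S A\<^esub> \<in> gr S" if "algebra R S" for S :: "'u md"
  using monoid.one_closed[OF M[OF that]] by (simp add: grm_simps)
 have gu: "\<one>\<^bsub>tensor R S A\<^esub> \<otimes>\<^bsub>tensor R S A\<^esub> x = x" "x \<otimes>\<^bsub>tensor R S A\<^esub> \<one>\<^bsub>tensor R S A\<^esub> = x"
  if "algebra R S" "x \<in> gr S" for S :: "'u md" and x
  using monoid.l_one[OF M[OF that(1)], of x] monoid.r_one[OF M[OF that(1)], of x] that by (simp_all add: grm_simps)
 have ml: "(\<one>\<^sub>S <: S)" if "algebra R S" for S :: "'u md"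
 proof - interpret S: algebra R S by (rule that) show ?thesis by simp qed
 \<comment> \<open>Associativity involves three variables. Here the first point is replaced by an
   arbitrary a, while the other two remain points; the next claim frees these by
   \<open>points_unique2\<close>.\<close>
 have step: "(tens R S A \<one>\<^sub>S a \<otimes>\<^bsub>tensor R S A\<^esub> y) \<otimes>\<^bsub>tensor R S A\<^esub> z = tens R S A \<one>\<^sub>S a \<otimes>\<^bsub>tensor R S A\<^esub> (y \<otimes>\<^bsub>tensor R S A\<^esub> z)"
  if S: "algebra R S" and y: "y \<in> gr S" and z: "z \<in> gr S" and a: "a <: A" for S :: "'u md" and a y z
 proof -
  note mS = alg_mod[OF S] and y' = gr_closed[OF y] and z' = gr_closed[OF z]
  note m = bSA[OF bA S] and pl = bilin_right[OF bilin_pure_tensor[OF mS A] ml[OF S]]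
  note l1 = lin_comp[OF lin_comp[OF pl bilin_left[OF m y']] bilin_left[OF m z']]
   and l2 = lin_comp[OF pl bilin_left[OF m bilin_closed[OF m y' z']]]
  show ?thesis
  proof (rule points_unique[OF S A l1 l2 _ a])
   fix T :: "'u md" and h x assume T: "algebra R T" and h: "alg_map R S T h" and x: "x \<in> gr T"
   interpret T: algebra R T by (rule T)
   note mT = alg_mod[OF T] and hl = alg_map_lin[OF h] and x' = gr_closed[OF x]
   note n = bSA[OF bA T] and hy = gr_push[OF S T h y] and hz = gr_push[OF S T h z]
   note am = act_mult[OF bA S T h] and pc = tens_closed[OF mS A ml[OF S]]
   have ao: "act R T A h t (tens R S A \<one>\<^sub>S a) = tens R T A t a" if "t <: T" "a <: A" for t a
    using that ml[OF S] by (simp add: act_pure[OF mS T A hl] alg_map_one[OF h])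
   have "ext_map R T A h (\<lambda>a. (tens R S A \<one>\<^sub>S a \<otimes>\<^bsub>tensor R S A\<^esub> y) \<otimes>\<^bsub>tensor R S A\<^esub> z) x
    = (x \<otimes>\<^bsub>tensor R T A\<^esub> push_pt S T h y) \<otimes>\<^bsub>tensor R T A\<^esub> push_pt S T h z"
    by (rule tmap_ext[OF mT A lin_ext_map[OF A mS T A hl l1] lin_comp[OF bilin_left[OF n gr_closed[OF hy]] bilin_left[OF n gr_closed[OF hz]]] _ x'])
     (simp add: ext_map_pure[OF A mS T A hl l1] am y' z' pc bilin_closed[OF m] ao)
   also have "\<dots> = x \<otimes>\<^bsub>tensor R T A\<^esub> push_pt S T h (y \<otimes>\<^bsub>tensor R S A\<^esub> z)"
    using ga[OF T x hy hz] push_mult[OF bA S T h y' z'] by simp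
   also have "\<dots> = ext_map R T A h (\<lambda>a. tens R S A \<one>\<^sub>S a \<otimes>\<^bsub>tensor R S A\<^esub> (y \<otimes>\<^bsub>tensor R S A\<^esub> z)) x"
    by (rule tmap_ext[OF mT A bilin_left[OF n gr_closed[OF gr_push[OF S T h gm[OF S y z]]]] lin_ext_map[OF A mS T A hl l2] _ x'])
     (simp add: ext_map_pure[OF A mS T A hl l2] am y' z' pc bilin_closed[OF m] ao)
   finally show "ext_map R T A h (\<lambda>a. (tens R S A \<one>\<^sub>S a \<otimes>\<^bsub>tensor R S A\<^esub> y) \<otimes>\<^bsub>tensor R S A\<^esub> z) x
    = ext_map R T A h (\<lambda>a. tens R S A \<one>\<^sub>S a \<otimes>\<^bsub>tensor R S A\<^esub> (y \<otimes>\<^bsub>tensor R S A\<^esub> z)) x" .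
  qed
 qed
 have assoc: "a \<otimes>\<^sub>A b \<otimes>\<^sub>A c = a \<otimes>\<^sub>A (b \<otimes>\<^sub>A c)" if a: "a <: A" and b: "b <: A" and c: "c <: A" for a b c
 proof -
  note b1 = bilin_comp[OF bA bilin_right[OF bA a] lin_id] and b2 = bilin_post[OF bA bilin_right[OF bA a]]
  show ?thesis
  proof (rule points_unique2[OF A b1 b2 _ b c])
   fix S :: "'u md" and y z assume S: "algebra R S" and y: "y \<in> gr S" and z: "z \<in> gr S"
   interpret S: algebra R S by (rule S)
   note mS = alg_mod[OF S] and y' = gr_closed[OF y] and z' = gr_closed[OF z]
   note m = bSA[OF bA S] and oa = tens_closed[OF mS A ml[OF S] a]
   note l1 = lin_tlift[OF A A A b1] and l2 = lin_tlift[OF A A A b2]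
   have "rmap R S (tensor R A A) A (tlift A (\<lambda>b c. a \<otimes>\<^sub>A b \<otimes>\<^sub>A c)) (box S y z)
    = (tens R S A \<one>\<^sub>S a \<otimes>\<^bsub>tensor R S A\<^esub> y) \<otimes>\<^bsub>tensor R S A\<^esub> z"
    by (rule tensor_bilin_ext[OF mS A mS A bilin_post[OF bilin_box[OF S] lin_tensor_map[OF mS AA mS A lin_id l1]]
       bilin_comp[OF m bilin_right[OF m oa] lin_id] _ y' z'])
     (simp add: box_pure[OF S] SA_pure[OF bA S] tmap_pure[OF mS AA mS A lin_id l1] tens_closed[OF A A] tlift_pure[OF A A A b1] a bilin_closed[OF bA])
   moreover have "rmap R S (tensor R A A) A (tlift A (\<lambda>b c. a \<otimes>\<^sub>A (b \<otimes>\<^sub>A c))) (box S y z)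
    = tens R S A \<one>\<^sub>S a \<otimes>\<^bsub>tensor R S A\<^esub> (y \<otimes>\<^bsub>tensor R S A\<^esub> z)"
    by (rule tensor_bilin_ext[OF mS A mS A bilin_post[OF bilin_box[OF S] lin_tensor_map[OF mS AA mS A lin_id l2]]
       bilin_post[OF m bilin_right[OF m oa]] _ y' z'])
     (simp add: box_pure[OF S] SA_pure[OF bA S] tmap_pure[OF mS AA mS A lin_id l2] tens_closed[OF A A] tlift_pure[OF A A A b2] a bilin_closed[OF bA])
   ultimately show "rmap R S (tensor R A A) A (tlift A (\<lambda>b c. a \<otimes>\<^sub>A b \<otimes>\<^sub>A c)) (box S y z)
    = rmap R S (tensor R A A) A (tlift A (\<lambda>b c. a \<otimes>\<^sub>A (b \<otimes>\<^sub>A c))) (box S y z)"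
    using step[OF S y z a] by simp
  qed
 qed
 have unit: "\<one>\<^sub>A \<otimes>\<^sub>A b = b" "b \<otimes>\<^sub>A \<one>\<^sub>A = b" if b: "b <: A" for b
 proof -
  have e: "rmap R S A A (mult A \<one>\<^sub>A) y = rmap R S A A (\<lambda>a. a) y"
   "rmap R S A A (\<lambda>a. a \<otimes>\<^sub>A \<one>\<^sub>A) y = rmap R S A A (\<lambda>a. a) y"
   if S: "algebra R S" and y: "y \<in> gr S" for S :: "'u md" and y
  proof -
   interpret S: algebra R S by (rule S)
   note mS = alg_mod[OF S] and y' = gr_closed[OF y] and oo = gr_closed[OF go[OF S]]
   note tl = lin_tensor_map[OF mS A mS A lin_id] and tp = tmap_pure[OF mS A mS A lin_id]
   have "rmap R S A A (mult A \<one>\<^sub>A) y = \<one>\<^bsub>tensor R S A\<^esub> \<otimes>\<^bsub>tensor R S A\<^esub> y"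
    by (rule tmap_ext[OF mS A tl[OF bilin_right[OF bA o]] bilin_right[OF bSA[OF bA S] oo] _ y'])
     (simp add: tensor_one SA_pure[OF bA S] o tp[OF bilin_right[OF bA o]])
   then show "rmap R S A A (mult A \<one>\<^sub>A) y = rmap R S A A (\<lambda>a. a) y"
    by (simp add: gu[OF S y] tmap_ident[OF mS A y'])
   have "rmap R S A A (\<lambda>a. a \<otimes>\<^sub>A \<one>\<^sub>A) y = y \<otimes>\<^bsub>tensor R S A\<^esub> \<one>\<^bsub>tensor R S A\<^esub>"
    by (rule tmap_ext[OF mS A tl[OF bilin_left[OF bA o]] bilin_left[OF bSA[OF bA S] oo] _ y'])
     (simp add: tensor_one SA_pure[OF bA S] o tp[OF bilin_left[OF bA o]])
   then show "rmap R S A A (\<lambda>a. a \<otimes>\<^sub>A \<one>\<^sub>A) y = rmap R S A A (\<lambda>a. a) y"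
    by (simp add: gu[OF S y] tmap_ident[OF mS A y'])
  qed
  show "\<one>\<^sub>A \<otimes>\<^sub>A b = b" by (rule points_unique0[OF A bilin_right[OF bA o] lin_id e(1) b])
  show "b \<otimes>\<^sub>A \<one>\<^sub>A = b" by (rule points_unique0[OF A bilin_left[OF bA o] lin_id e(2) b])
 qed
 \<comment> \<open>At points x and y both sides equal the square of the product x y, as the product
   is again group-like.\<close>
 have \<Delta>m: "comult A (a \<otimes>\<^sub>A b) = comult A a \<otimes>\<^bsub>tensor R A A\<^esub> comult A b" if a: "a <: A" and b: "b <: A" for a b
 proof (rule points_unique2[OF AA bilin_post[OF bA comult] bilin_comp[OF bAA[OF bA] comult comult] _ a b])
  fix S :: "'u md" and x y assume S: "algebra R S" and x: "x \<in> gr S" and y: "y \<in> gr S"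
  note x' = gr_closed[OF x] and y' = gr_closed[OF y]
  show "rmap R S (tensor R A A) (tensor R A A) (tlift (tensor R A A) (\<lambda>a b. comult A (a \<otimes>\<^sub>A b))) (box S x y)
   = rmap R S (tensor R A A) (tensor R A A) (tlift (tensor R A A) (\<lambda>a b. comult A a \<otimes>\<^bsub>tensor R A A\<^esub> comult A b)) (box S x y)"
   unfolding mult_box[OF bA S x' y' AA comult] comult_mult[OF bA S x' y']
   using x y gm[OF S x y] box_mult[OF bA S x' x' y' y'] by (simp add: gr_iff[OF S])
 qed
 have \<epsilon>m: "counit A (a \<otimes>\<^sub>A b) = counit A a \<otimes>\<^sub>Rm counit A b" if a: "a <: A" and b: "b <: A" for a b
 proof (rule points_unique2[OF mR bilin_post[OF bA counit] bilin_comp[OF bilin_mult[OF RR] counit counit] _ a b])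
  fix S :: "'u md" and x y assume S: "algebra R S" and x: "x \<in> gr S" and y: "y \<in> gr S"
  interpret SR: algebra R "tensor R S Rm" by (rule algebra_tensor[OF S RR])
  note x' = gr_closed[OF x] and y' = gr_closed[OF y] and xy = gm[OF S x y] and mS = alg_mod[OF S]
  have "rmap R S A Rm (counit A) x = \<one>\<^bsub>tensor R S Rm\<^esub>" if x: "x \<in> gr S" for x
   unfolding tmap_contract[OF mS counit gr_closed[OF x]] using x by (simp add: gr_iff[OF S] tensor_one) (simp add: ring_as_module_def)
  then show "rmap R S (tensor R A A) Rm (tlift Rm (\<lambda>a b. counit A (a \<otimes>\<^sub>A b))) (box S x y)
   = rmap R S (tensor R A A) Rm (tlift Rm (\<lambda>a b. counit A a \<otimes>\<^sub>Rm counit A b)) (box S x y)"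
   unfolding mult_box[OF bA S x' y' mR counit] counit_mult[OF bA S x' y'] using x y xy by simp
 qed
 have oR: "\<one>\<^sub>R <: Rm" using ml[OF RR] by (simp add: ring_as_module_def)
 have o1: "\<one>\<^bsub>tensor R Rm A\<^esub> = tens R Rm A \<one>\<^sub>R \<one>\<^sub>A" by (simp add: tensor_one) (simp add: ring_as_module_def)
 note g1 = go[OF RR, unfolded gr_iff[OF RR] o1]
 \<comment> \<open>The unit over \<open>R\<close> is group-like, and R \<otimes> (A \<otimes> A) is
   identified with A \<otimes> A.\<close>
 have \<Delta>o: "comult A \<one>\<^sub>A = \<one>\<^bsub>tensor R A A\<^esub>"
 proof -
  have "tens R Rm (tensor R A A) \<one>\<^sub>R (comult A \<one>\<^sub>A) = tens R Rm (tensor R A A) (\<one>\<^sub>R \<otimes>\<^sub>Rm \<one>\<^sub>R) (tens R A A \<one>\<^sub>A \<one>\<^sub>A)"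
   using g1 by (simp add: tmap_pure[OF mR A mR AA lin_id comult oR o] box_pure[OF RR oR o oR o])
  also have "\<one>\<^sub>R \<otimes>\<^sub>Rm \<one>\<^sub>R = \<one>\<^sub>R" using cring.cring_simprules(12)[OF R_cring] cring.cring_simprules(6)[OF R_cring] by (simp add: ring_as_module_def)
  finally have e: "tens R Rm (tensor R A A) \<one>\<^sub>R (comult A \<one>\<^sub>A) = tens R Rm (tensor R A A) \<one>\<^sub>R (tens R A A \<one>\<^sub>A \<one>\<^sub>A)" .
  from arg_cong[where f = "lact (tensor R A A)", OF e] show ?thesis
   unfolding lact_one[OF AA lin_closed[OF comult o]] lact_one[OF AA tens_closed[OF A A o o]] tensor_one .
 qed
 have \<epsilon>c: "counit A a <: R" if "a <: A" for a using lin_closed[OF counit that] by (simp add: ring_as_module_def)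
 have \<epsilon>o: "counit A \<one>\<^sub>A = \<one>\<^sub>R"
  using g1 \<epsilon>c[OF o] monoid.r_one[OF ring.is_monoid[OF cring.axioms(1)[OF R_cring]]] by (simp add: contract_pure[OF mR A counit oR o]) (simp add: ring_as_module_def)
 have "ring A"
 proof (rule ringI)
  show "abelian_group A" by unfold_locales
  show "monoid A" by (rule monoidI) (use bilin_closed[OF bA] o assoc unit in auto)
 qed (use lin_add[OF bilin_left[OF bA]] lin_add[OF bilin_right[OF bA]] in auto)
 then have "assoc_algebra R A"
  unfolding assoc_algebra_def using A lin_smult[OF bilin_left[OF bA]] lin_smult[OF bilin_right[OF bA]] by auto
 moreover have "comult A \<in> ring_hom A (tensor R A A)"
  by (rule ring_hom_memI) (use lin_closed[OF comult] lin_add[OF comult] \<Delta>m \<Delta>o in auto)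
 moreover have "counit A \<in> ring_hom A R"
  by (rule ring_hom_memI) (use \<epsilon>c lin_add[OF counit] \<epsilon>m \<epsilon>o in \<open>auto simp: ring_as_module_def\<close>)
 ultimately show ?thesis using coalgebra by (simp add: bialgebra_def)
qed

end

section \<open>The functor from bialgebras to formal monoids\<close>

lemma is_category_functor_cat:
 assumes D: "is_category D"
 shows "is_category (functor_cat C D)"
proof -
 have idm: "Ident D X \<in> Mor D X X" if "X \<in> Ob D" for X
  using D that by (simp add: is_category_def)
 have cm: "Cmp D X Y Z g f \<in> Mor D X Z" if "X \<in> Ob D" "Y \<in> Ob D" "Z \<in> Ob D" "f \<in> Mor D X Y" "g \<in> Mor D Y Z" for X Y Z f g
  using D that by (simp add: is_category_def)
 have un: "Cmp D X X Y f (Ident D X) = f" "Cmp D X Y Y (Ident D Y) f = f" if "X \<in> Ob D" "Y \<in> Ob D" "f \<in> Mor D X Y" for X Y f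
  using D that by (simp_all add: is_category_def)
 have as: "Cmp D W Y Z h (Cmp D W X Y g f) = Cmp D W X Z (Cmp D X Y Z h g) f"
  if "W \<in> Ob D" "X \<in> Ob D" "Y \<in> Ob D" "Z \<in> Ob D" "f \<in> Mor D W X" "g \<in> Mor D X Y" "h \<in> Mor D Y Z" for W X Y Z f g h
  using D that unfolding is_category_def by blast
 have fo: "on_ob F X \<in> Ob D" if "is_functor C D F" "X \<in> Ob C" for F X
  using that by (simp add: is_functor_def)
 have fm: "on_mor F X Y f \<in> Mor D (on_ob F X) (on_ob F Y)" if "is_functor C D F" "X \<in> Ob C" "Y \<in> Ob C" "f \<in> Mor C X Y" for F X Y f
  using that by (simp add: is_functor_def)
 have nx: "\<tau> \<in> extensional (Ob C)" if "\<tau> \<in> nat_trans C D F G" for \<tau> F G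
  using that by (simp add: nat_trans_def)
 have nm: "\<tau> X \<in> Mor D (on_ob F X) (on_ob G X)" if "\<tau> \<in> nat_trans C D F G" "X \<in> Ob C" for \<tau> F G X
  using that by (simp add: nat_trans_def)
 have nn: "Cmp D (on_ob F X) (on_ob F Y) (on_ob G Y) (\<tau> Y) (on_mor F X Y f) = Cmp D (on_ob F X) (on_ob G X) (on_ob G Y) (on_mor G X Y f) (\<tau> X)"
  if "\<tau> \<in> nat_trans C D F G" "X \<in> Ob C" "Y \<in> Ob C" "f \<in> Mor C X Y" for \<tau> F G X Y f
  using that by (simp add: nat_trans_def)
 show ?thesis
  unfolding is_category_def
 proof (intro conjI ballI)
  fix F assume "F \<in> Ob (functor_cat C D)"
  then have F: "is_functor C D F" by (simp add: functor_cat_def)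
  show "Ident (functor_cat C D) F \<in> Mor (functor_cat C D) F F"
   by (simp add: functor_cat_def nat_trans_def idm fo[OF F] un fm[OF F])
  fix G assume "G \<in> Ob (functor_cat C D)"
  then have G: "is_functor C D G" by (simp add: functor_cat_def)
  fix \<tau> assume "\<tau> \<in> Mor (functor_cat C D) F G"
  then have \<tau>: "\<tau> \<in> nat_trans C D F G" by (simp add: functor_cat_def)
  show "Cmp (functor_cat C D) F F G \<tau> (Ident (functor_cat C D) F) = \<tau>" "Cmp (functor_cat C D) F G G (Ident (functor_cat C D) G) \<tau> = \<tau>"
   by (rule extensionalityI[OF _ nx[OF \<tau>]]; simp add: functor_cat_def un fo[OF F] fo[OF G] nm[OF \<tau>])+
  fix H assume "H \<in> Ob (functor_cat C D)"
  then have H: "is_functor C D H" by (simp add: functor_cat_def)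
  fix \<sigma> assume "\<sigma> \<in> Mor (functor_cat C D) G H"
  then have \<sigma>: "\<sigma> \<in> nat_trans C D G H" by (simp add: functor_cat_def)
  have n: "Cmp D (on_ob F X) (on_ob F Y) (on_ob H Y) (Cmp D (on_ob F Y) (on_ob G Y) (on_ob H Y) (\<sigma> Y) (\<tau> Y)) (on_mor F X Y f)
   = Cmp D (on_ob F X) (on_ob H X) (on_ob H Y) (on_mor H X Y f) (Cmp D (on_ob F X) (on_ob G X) (on_ob H X) (\<sigma> X) (\<tau> X))"
   if X: "X \<in> Ob C" and Y: "Y \<in> Ob C" and f: "f \<in> Mor C X Y" for X Y f
  proof -
   note o = fo[OF F X] fo[OF F Y] fo[OF G X] fo[OF G Y] fo[OF H X] fo[OF H Y]
   show ?thesis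
    unfolding as[OF o(1,2,4,6) fm[OF F X Y f] nm[OF \<tau> Y] nm[OF \<sigma> Y], symmetric] nn[OF \<tau> X Y f]
     as[OF o(1,3,4,6) nm[OF \<tau> X] fm[OF G X Y f] nm[OF \<sigma> Y]] nn[OF \<sigma> X Y f]
     as[OF o(1,3,5,6) nm[OF \<tau> X] nm[OF \<sigma> X] fm[OF H X Y f]] ..
  qed
  then show "Cmp (functor_cat C D) F G H \<sigma> \<tau> \<in> Mor (functor_cat C D) F H"
   by (simp add: functor_cat_def nat_trans_def cm fo[OF F] fo[OF G] fo[OF H] nm[OF \<tau>] nm[OF \<sigma>])
  fix K assume "K \<in> Ob (functor_cat C D)"
  then have K: "is_functor C D K" by (simp add: functor_cat_def)
  fix \<rho> assume "\<rho> \<in> Mor (functor_cat C D) H K"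
  then have \<rho>: "\<rho> \<in> nat_trans C D H K" by (simp add: functor_cat_def)
  show "Cmp (functor_cat C D) F H K \<rho> (Cmp (functor_cat C D) F G H \<sigma> \<tau>) = Cmp (functor_cat C D) F G K (Cmp (functor_cat C D) G H K \<rho> \<sigma>) \<tau>"
   by (simp add: functor_cat_def fun_eq_iff restrict_def as[OF fo[OF F] fo[OF G] fo[OF H] fo[OF K] nm[OF \<tau>] nm[OF \<sigma>] nm[OF \<rho>]])
 qed
qed

lemma is_category_full_subcat: "is_category C ==> is_category (full_subcat C P)"
 unfolding is_category_def full_subcat_def by simp

lemma is_category_monoid_cat: "is_category monoid_cat"
 unfolding is_category_def monoid_cat_def
proof (simp, intro conjI allI impI ballI)
 fix X :: "'a monoid" assume "monoid X"
 then interpret monoid X .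
 show "(\<lambda>x\<in>carrier X. x) \<in> hom X X" by (simp add: hom_def Pi_def)
next
 fix X Y Z :: "'a monoid" and f g assume m: "monoid X" "monoid Y" "monoid Z"
  and f: "f \<in> hom X Y \<and> f \<in> extensional (carrier X) \<and> f \<one>\<^sub>X = \<one>\<^sub>Y"
  and g: "g \<in> hom Y Z \<and> g \<in> extensional (carrier Y) \<and> g \<one>\<^sub>Y = \<one>\<^sub>Z"
 interpret X: monoid X by (rule m)
 show "compose (carrier X) g f \<in> hom X Z" "compose (carrier X) g f \<one>\<^sub>X = \<one>\<^sub>Z"
  using f g X.m_closed by (auto simp: hom_def Pi_def compose_def)
next
 fix X Y :: "'a monoid" and f assume m: "monoid X" "monoid Y"
  and f: "f \<in> hom X Y \<and> f \<in> extensional (carrier X) \<and> f \<one>\<^sub>X = \<one>\<^sub>Y"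
 show "compose (carrier X) f (\<lambda>x\<in>carrier X. x) = f" "compose (carrier X) (\<lambda>x\<in>carrier Y. x) f = f"
  using f compose_Id[of f "carrier X" "carrier Y"] Id_compose[of f "carrier X" "carrier Y"] by (auto simp: hom_def)
next
 fix W X Y Z :: "'a monoid" and f g h
 assume "f \<in> hom W X \<and> f \<in> extensional (carrier W) \<and> f \<one>\<^sub>W = \<one>\<^sub>X"
 then have "f \<in> carrier W \<rightarrow> carrier X" by (simp add: hom_def)
 then show "compose (carrier W) h (compose (carrier W) g f) = compose (carrier W) (compose (carrier X) h g) f"
  by (rule compose_assoc)
qed

lemma bialg_homD:
 assumes "f \<in> bialg_hom R A B"
 shows "lmap R A B f" "f \<in> extensional (carrier A)" "f \<in> ring_hom A B"
  "\<And>x. x <: A ==> comult B (f x) = tmap R A A B B f f (comult A x)"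
  "\<And>x. x <: A ==> counit B (f x) = counit A x"
 using assms by (auto simp: bialg_hom_def lin_hom_iff)

lemma bialg_homI:
 assumes A: "assoc_algebra R A" and B: "module R B" and f: "lmap R A B f" "f \<in> ring_hom A B" and \<Delta>: "comult A \<in> carrier A \<rightarrow> carrier (tensor R A A)"
  and "\<And>x. x <: A ==> comult B (f x) = tmap R A A B B f f (comult A x)"
  and "\<And>x. x <: A ==> counit B (f x) = counit A x"
 shows "restrict f (carrier A) \<in> bialg_hom R A B"
proof -
 interpret A: ring A using A by (simp add: assoc_algebra_def)
 have mA: "module R A" using A by (simp add: assoc_algebra_def)
 have "restrict f (carrier A) \<in> ring_hom A B"
  by (rule ring_hom_memI) (use f(2) in \<open>auto simp: ring_hom_def\<close>)
 moreover have "tmap R A A B B (restrict f (carrier A)) (restrict f (carrier A)) (comult A x) = tmap R A A B B f f (comult A x)" if "x <: A" for x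
  using tmap_cong[OF mA mA B B lin_restrict[OF mA f(1)] lin_restrict[OF mA f(1)] _ _ funcset_mem[OF \<Delta> that], of f f] by fastforce
 ultimately show ?thesis using assms(6,7) restrict_lin_hom[OF mA f(1)] by (simp add: bialg_hom_def)
qed

lemma coalgebra_comult_closed:
 assumes "coalgebra R A" "x <: A"
 shows "comult A x <: tensor R A A"
proof -
 have "lmap R A (tensor R A A) (comult A)" using assms(1) by (simp add: coalgebra_def lin_hom_iff)
 then show ?thesis by (rule lin_closed[OF _ assms(2)])
qed

lemma is_category_bialgebras: "is_category (projective_cocomm_bialgebras R)"
 unfolding is_category_def projective_cocomm_bialgebras_def
proof (intro conjI ballI; simp only: cat.simps mem_Collect_eq; (elim conjE)?)
 fix A :: "('a, 'a) bialg" assume A: "bialgebra R A"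
 then have aa: "assoc_algebra R A" and co: "coalgebra R A" by (simp_all add: bialgebra_def)
 note c = coalgebra_comult_closed[OF co]
 have mA: "module R A" using co by (simp add: coalgebra_def)
 show "(\<lambda>x\<in>carrier A. x) \<in> bialg_hom R A A"
  by (rule bialg_homI[OF aa mA lin_id]) (use c in \<open>auto simp: ring_hom_def tmap_ident[OF mA mA]\<close>)
next
 fix A B C :: "('a, 'a) bialg" and f g assume "bialgebra R A" "bialgebra R B" "bialgebra R C"
  and f: "f \<in> bialg_hom R A B" and g: "g \<in> bialg_hom R B C"
 then have aa: "assoc_algebra R A" and m: "module R A" "module R B" "module R C" and co: "coalgebra R A"
  by (simp_all add: bialgebra_def coalgebra_def)
 note c = coalgebra_comult_closed[OF co]
 note f = bialg_homD[OF f] and g = bialg_homD[OF g]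
 have "(\<lambda>x\<in>carrier A. g (f x)) \<in> bialg_hom R A C"
  by (rule bialg_homI[OF aa m(3) lin_comp[OF f(1) g(1)]])
   (use f g c lin_closed[OF f(1)] in \<open>auto simp: ring_hom_def Pi_def tmap_comp[OF m(1) m(1) m(2) m(2) m(3) m(3) f(1) f(1) g(1) g(1)]\<close>)
 then show "compose (carrier A) g f \<in> bialg_hom R A C" by (simp add: compose_def)
next
 fix A B :: "('a, 'a) bialg" and f assume "f \<in> bialg_hom R A B"
 then have "f \<in> carrier A \<rightarrow> carrier B" "f \<in> extensional (carrier A)" using bialg_homD[of f R A B] lin_closed[of R A B f] by auto
 then show "compose (carrier A) f (\<lambda>x\<in>carrier A. x) = f" "compose (carrier A) (\<lambda>x\<in>carrier B. x) f = f"
  by (simp_all add: compose_Id Id_compose)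
next
 fix A B C D :: "('a, 'a) bialg" and f g h assume "f \<in> bialg_hom R A B"
 then have "f \<in> carrier A \<rightarrow> carrier B" using bialg_homD[of f R A B] lin_closed[of R A B f] by auto
 then show "compose (carrier A) h (compose (carrier A) g f) = compose (carrier A) (compose (carrier B) h g) f"
  by (rule compose_assoc)
qed

context lp_coalg
begin

definition unpt :: "'u md => 'u spec_point => ('u, 'u) tensor_elt" where
 "unpt S = inv_into (gr S) (pt S)"

text \<open>The monoid of group-like elements transported along \<open>pt\<close>, so that the
  underlying functor of sets is literally the spectrum. Outside the carrier the product is whatever
  \<open>unpt\<close> makes of it.\<close>

definition fmon :: "(('u, 'u) module, 'u => 'u, 'u spec_point monoid, 'u spec_point => 'u spec_point) ftor" where
 "fmon = \<lparr>on_ob = (\<lambda>S. \<lparr>carrier = on_ob (Spec R DF) S, mult = (\<lambda>\<phi> \<psi>. pt S (unpt S \<phi> \<otimes>\<^bsub>tensor R S A\<^esub> unpt S \<psi>)),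
   one = pt S \<one>\<^bsub>tensor R S A\<^esub>\<rparr>), on_mor = on_mor (Spec R DF)\<rparr>"

lemma
 assumes S: "algebra R S"
 shows unpt_pt: "x \<in> gr S ==> unpt S (pt S x) = x"
  and unpt_gr: "\<phi> <: on_ob fmon S ==> unpt S \<phi> \<in> gr S"
  and pt_unpt: "\<phi> <: on_ob fmon S ==> pt S (unpt S \<phi>) = \<phi>"
  and pt_fmon: "x \<in> gr S ==> pt S x <: on_ob fmon S"
  and fmon_mult: "x \<in> gr S ==> y \<in> gr S ==> pt S x \<otimes>\<^bsub>on_ob fmon S\<^esub> pt S y = pt S (x \<otimes>\<^bsub>tensor R S A\<^esub> y)"
  and fmon_one: "\<one>\<^bsub>on_ob fmon S\<^esub> = pt S \<one>\<^bsub>tensor R S A\<^esub>"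
proof -
 note b = bij_pt[OF S]
 show u: "x \<in> gr S ==> unpt S (pt S x) = x" for x unfolding unpt_def by (rule bij_betw_inv_into_left[OF b])
 show "\<phi> <: on_ob fmon S ==> unpt S \<phi> \<in> gr S" "\<phi> <: on_ob fmon S ==> pt S (unpt S \<phi>) = \<phi>"
  unfolding unpt_def using bij_betwE[OF bij_betw_inv_into[OF b]] bij_betw_inv_into_right[OF b] by (auto simp: fmon_def)
 show "x \<in> gr S ==> pt S x <: on_ob fmon S" using bij_betwE[OF b] by (simp add: fmon_def)
 show "x \<in> gr S ==> y \<in> gr S ==> pt S x \<otimes>\<^bsub>on_ob fmon S\<^esub> pt S y = pt S (x \<otimes>\<^bsub>tensor R S A\<^esub> y)" by (simp add: fmon_def u)
 show "\<one>\<^bsub>on_ob fmon S\<^esub> = pt S \<one>\<^bsub>tensor R S A\<^esub>" by (simp add: fmon_def)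
qed

lemma fmon_mor:
 "algebra R S ==> algebra R T ==> lmap R S T h ==> x \<in> gr S ==> on_mor fmon S T h (pt S x) = pt T (push_pt S T h x)"
 by (simp add: fmon_def pt_nat)

lemma fmon_mor_ext: "on_mor fmon S T h \<in> extensional (carrier (on_ob fmon S))"
 by (simp add: fmon_def Spec_def)

lemma fmon_ext:
 assumes S: "algebra R S" and "f \<in> extensional (carrier (on_ob fmon S))" "g \<in> extensional (carrier (on_ob fmon S))"
  and "\<And>x. x \<in> gr S ==> f (pt S x) = g (pt S x)"
 shows "f = g"
 by (rule extensionalityI[OF assms(2,3)]) (use assms(4)[OF unpt_gr[OF S]] pt_unpt[OF S] in simp)

lemma is_functor_fmon:
 assumes b: "bialgebra R A"
 shows "is_functor (comm_algs R) monoid_cat fmon"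
 unfolding is_functor_def comm_algs_simps monoid_cat_def cat.simps
proof (intro conjI ballI; simp only: mem_Collect_eq)
 fix S :: "'u md" assume S: "algebra R S"
 interpret G: monoid "grm S" by (rule monoid_grm[OF b S])
 note gs = grm_simps
 have cl: "x \<otimes>\<^bsub>tensor R S A\<^esub> y \<in> gr S" if "x \<in> gr S" "y \<in> gr S" for x y using G.m_closed that by (simp add: gs)
 have as: "x \<otimes>\<^bsub>tensor R S A\<^esub> y \<otimes>\<^bsub>tensor R S A\<^esub> z = x \<otimes>\<^bsub>tensor R S A\<^esub> (y \<otimes>\<^bsub>tensor R S A\<^esub> z)" if "x \<in> gr S" "y \<in> gr S" "z \<in> gr S" for x y z
  using G.m_assoc that by (simp add: gs)
 have o: "\<one>\<^bsub>tensor R S A\<^esub> \<in> gr S" using G.one_closed by (simp add: gs)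
 have un: "\<one>\<^bsub>tensor R S A\<^esub> \<otimes>\<^bsub>tensor R S A\<^esub> x = x" "x \<otimes>\<^bsub>tensor R S A\<^esub> \<one>\<^bsub>tensor R S A\<^esub> = x" if "x \<in> gr S" for x
  using G.l_one[of x] G.r_one[of x] that by (simp_all add: gs)
 note fm = fmon_mult[OF S] and fo = fmon_one[OF S]
 have E: "\<exists>x. x \<in> gr S \<and> \<phi> = pt S x" if "\<phi> <: on_ob fmon S" for \<phi>
  using unpt_gr[OF S that] pt_unpt[OF S that] by metis
 show "monoid (on_ob fmon S)"
 proof (rule monoidI)
  show "\<one>\<^bsub>on_ob fmon S\<^esub> <: on_ob fmon S" by (simp add: fo pt_fmon[OF S] o)
  fix \<phi> assume "\<phi> <: on_ob fmon S"
  then obtain x where x: "x \<in> gr S" "\<phi> = pt S x" using E by blast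
  show "\<one>\<^bsub>on_ob fmon S\<^esub> \<otimes>\<^bsub>on_ob fmon S\<^esub> \<phi> = \<phi>" "\<phi> \<otimes>\<^bsub>on_ob fmon S\<^esub> \<one>\<^bsub>on_ob fmon S\<^esub> = \<phi>"
   by (simp_all add: x fo fm o un)
  fix \<psi> assume "\<psi> <: on_ob fmon S"
  then obtain y where y: "y \<in> gr S" "\<psi> = pt S y" using E by blast
  show "\<phi> \<otimes>\<^bsub>on_ob fmon S\<^esub> \<psi> <: on_ob fmon S" by (simp add: x y fm cl pt_fmon[OF S])
  fix \<chi> assume "\<chi> <: on_ob fmon S"
  then obtain z where z: "z \<in> gr S" "\<chi> = pt S z" using E by blast
  show "\<phi> \<otimes>\<^bsub>on_ob fmon S\<^esub> \<psi> \<otimes>\<^bsub>on_ob fmon S\<^esub> \<chi> = \<phi> \<otimes>\<^bsub>on_ob fmon S\<^esub> (\<psi> \<otimes>\<^bsub>on_ob fmon S\<^esub> \<chi>)" by (simp add: x y z fm cl as)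
 qed
 show "on_mor fmon S S (\<lambda>x\<in>carrier S. x) = (\<lambda>x\<in>carrier (on_ob fmon S). x)"
 proof (rule fmon_ext[OF S fmon_mor_ext])
  fix x assume x: "x \<in> gr S"
  note mS = alg_mod[OF S]
  have l: "lmap R S S (\<lambda>x\<in>carrier S. x)" by (rule lin_restrict[OF mS lin_id])
  have "push_pt S S (\<lambda>x\<in>carrier S. x) x = push_pt S S (\<lambda>x. x) x"
   by (rule tmap_cong[OF mS A mS A l lin_id _ _ gr_closed[OF x]]) simp_all
  then show "on_mor fmon S S (\<lambda>x\<in>carrier S. x) (pt S x) = (\<lambda>x\<in>carrier (on_ob fmon S). x) (pt S x)"
   using fmon_mor[OF S S l x] pt_fmon[OF S x] tmap_ident[OF mS A gr_closed[OF x]] by simp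
 qed simp
 fix T :: "'u md" and h assume T: "algebra R T" and "h \<in> alg_hom R S T"
 then have h: "alg_map R S T h" by (simp add: alg_hom_iff)
 note hl = alg_map_lin[OF h] and mS = alg_mod[OF S] and mT = alg_mod[OF T]
 have bA: "bilin R A A A (mult A)" using b by (simp add: bialgebra_def assoc_algebra_bilin)
 have aA: "\<one>\<^sub>A <: A" using b ring.ring_simprules(6)[of A] by (simp add: bialgebra_def assoc_algebra_def)
 interpret S: algebra R S by (rule S)
 have po: "push_pt S T h \<one>\<^bsub>tensor R S A\<^esub> = \<one>\<^bsub>tensor R T A\<^esub>"
  by (simp add: tensor_one tmap_pure[OF mS A mT A hl lin_id] aA alg_map_one[OF h])
 have "on_mor fmon S T h \<in> hom (on_ob fmon S) (on_ob fmon T)"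
 proof (rule homI)
  fix \<phi> assume "\<phi> <: on_ob fmon S"
  then obtain x where x: "x \<in> gr S" "\<phi> = pt S x" using E by blast
  show "on_mor fmon S T h \<phi> <: on_ob fmon T"
   by (simp add: x fmon_mor[OF S T hl] pt_fmon[OF T] gr_push[OF S T h])
  fix \<psi> assume "\<psi> <: on_ob fmon S"
  then obtain y where y: "y \<in> gr S" "\<psi> = pt S y" using E by blast
  show "on_mor fmon S T h (\<phi> \<otimes>\<^bsub>on_ob fmon S\<^esub> \<psi>) = on_mor fmon S T h \<phi> \<otimes>\<^bsub>on_ob fmon T\<^esub> on_mor fmon S T h \<psi>"
   using push_mult[OF bA S T h gr_closed[OF x(1)] gr_closed[OF y(1)]]
   by (simp add: x y fm cl fmon_mor[OF S T hl] fmon_mult[OF T] gr_push[OF S T h])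
 qed
 then show "on_mor fmon S T h \<in> hom (on_ob fmon S) (on_ob fmon T) \<inter> extensional (carrier (on_ob fmon S)) \<and> on_mor fmon S T h \<one>\<^bsub>on_ob fmon S\<^esub> = \<one>\<^bsub>on_ob fmon T\<^esub>"
  by (simp add: fmon_mor_ext fo fmon_mor[OF S T hl] o po fmon_one[OF T])
 fix U :: "'u md" and k assume U: "algebra R U" and "k \<in> alg_hom R T U"
 then have k: "alg_map R T U k" by (simp add: alg_hom_iff)
 note kl = alg_map_lin[OF k] and mU = alg_mod[OF U]
 have c: "lmap R S U (compose (carrier S) k h)" unfolding compose_def by (rule lin_restrict[OF mS lin_comp[OF hl kl]])
 show "on_mor fmon S U (compose (carrier S) k h) = compose (carrier (on_ob fmon S)) (on_mor fmon T U k) (on_mor fmon S T h)"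
 proof (rule fmon_ext[OF S fmon_mor_ext])
  fix x assume x: "x \<in> gr S"
  have "push_pt S U (compose (carrier S) k h) x = push_pt S U (\<lambda>s. k (h s)) x"
   by (rule tmap_cong[OF mS A mU A c lin_id _ _ gr_closed[OF x]]) (simp_all add: compose_def)
  also have "\<dots> = push_pt T U k (push_pt S T h x)"
   by (rule tmap_comp[OF mS A mT A mU A hl lin_id kl lin_id gr_closed[OF x], symmetric])
  finally show "on_mor fmon S U (compose (carrier S) k h) (pt S x) = compose (carrier (on_ob fmon S)) (on_mor fmon T U k) (on_mor fmon S T h) (pt S x)"
   unfolding fmon_mor[OF S U c x] using pt_fmon[OF S x] by (simp add: compose_def fmon_mor[OF S T hl x] fmon_mor[OF T U kl gr_push[OF S T h x]])
 qed simp
qed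

lemma projective_formal_scheme_fmon:
 assumes "projective_module R A"
 shows "projective_formal_scheme R (carrier_functor fmon)"
 unfolding projective_formal_scheme_def
 using same_mod_projective[OF same_mod_mod_of assms] comm_algebra_functor_dual
 by (intro exI[of _ "mod_of A"] exI[of _ "conv A"] exI[of _ "conv_one A"]) (simp add: functors_agree_def carrier_functor_def fmon_def)

end

section \<open>Full faithfulness\<close>

locale two_bialg = A: lp_coalg R A + B: lp_coalg R B
 for R :: "('u, 'y) ring_scheme" and A :: "('u, 'u, 'p) bialg_scheme" and B :: "('u, 'u, 'q) bialg_scheme" +
 assumes biA: "bialgebra R A" and biB: "bialgebra R B"
begin

abbreviation fm :: "('u, 'c, 's) module_scheme => ('u => 'u) => ('c, 'u) tensor_elt => ('c, 'u) tensor_elt" where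
 "fm S f \<equiv> rmap R S A B f"

lemma
 shows bA: "bilin R A A A (mult A)" and bB: "bilin R B B B (mult B)"
  and oA: "\<one>\<^sub>A <: A" and oB: "\<one>\<^sub>B <: B"
  and aaA: "assoc_algebra R A" and aaB: "assoc_algebra R B"
proof -
 show a: "assoc_algebra R A" "assoc_algebra R B" using biA biB by (simp_all add: bialgebra_def)
 from a show "bilin R A A A (mult A)" "bilin R B B B (mult B)" by (simp_all add: assoc_algebra_bilin)
 show "\<one>\<^sub>A <: A" "\<one>\<^sub>B <: B" using a by (auto simp: assoc_algebra_def intro: ring.ring_simprules(6))
qed

lemma fm_box:
 assumes S: "algebra R S" and f: "lmap R A B f" and x: "x <: tensor R S A" "y <: tensor R S A"
 shows "rmap R S (tensor R A A) (tensor R B B) (tmap R A A B B f f) (A.box S x y) = B.box S (fm S f x) (fm S f y)"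
proof -
 note mS = alg_mod[OF S] and AA = module_tensor[OF A.A A.A] and BB = module_tensor[OF B.A B.A]
 note ff = lin_tensor_map[OF A.A A.A B.A B.A f f] and fp = tmap_pure[OF A.A A.A B.A B.A f f]
 note l = lin_tensor_map[OF mS A.A mS B.A lin_id f]
 show ?thesis
  by (rule tensor_bilin_ext[OF mS A.A mS A.A bilin_post[OF A.bilin_box[OF S] lin_tensor_map[OF mS AA mS BB lin_id ff]]
     bilin_comp[OF B.bilin_box[OF S] l l] _ x])
   (simp add: A.box_pure[OF S] B.box_pure[OF S] tmap_pure[OF mS AA mS BB lin_id ff] fp tmap_pure[OF mS A.A mS B.A lin_id f]
    tens_closed[OF A.A A.A] bilin_closed[OF bilin_mult[OF S]] lin_closed[OF f])
qed

lemma fm_mult: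
 assumes S: "algebra R S" and f: "lmap R A B f" and x: "x <: tensor R S A" "y <: tensor R S A"
 shows "rmap R S (tensor R A A) B (tlift B (\<lambda>a b. f a \<otimes>\<^sub>B f b)) (A.box S x y) = fm S f x \<otimes>\<^bsub>tensor R S B\<^esub> fm S f y"
proof -
 note mS = alg_mod[OF S] and AA = module_tensor[OF A.A A.A] and fb = bilin_comp[OF bB f f]
 note l = lin_tlift[OF A.A A.A B.A fb] and tp = tlift_pure[OF A.A A.A B.A fb]
 note lf = lin_tensor_map[OF mS A.A mS B.A lin_id f]
 show ?thesis
  by (rule tensor_bilin_ext[OF mS A.A mS A.A bilin_post[OF A.bilin_box[OF S] lin_tensor_map[OF mS AA mS B.A lin_id l]]
     bilin_comp[OF B.bSA[OF bB S] lf lf] _ x])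
   (simp add: A.box_pure[OF S] B.SA_pure[OF bB S] tmap_pure[OF mS AA mS B.A lin_id l] tmap_pure[OF mS A.A mS B.A lin_id f]
    tens_closed[OF A.A A.A] bilin_closed[OF bilin_mult[OF S]] lin_closed[OF f] tp)
qed

text \<open>A coalgebra map preserves group-like elements, and multiplicativity of f makes the
  induced maps on points monoid homomorphisms.\<close>

lemma
 assumes S: "algebra R S" and f: "f \<in> bialg_hom R A B" and x: "x \<in> A.gr S"
 shows gr_fm: "fm S f x \<in> B.gr S"
  and fm_hom: "y \<in> A.gr S ==> fm S f (x \<otimes>\<^bsub>tensor R S A\<^esub> y) = fm S f x \<otimes>\<^bsub>tensor R S B\<^esub> fm S f y"
  and fm_one: "fm S f \<one>\<^bsub>tensor R S A\<^esub> = \<one>\<^bsub>tensor R S B\<^esub>"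
proof -
 interpret S: algebra R S by (rule S)
 note mS = alg_mod[OF S] and AA = module_tensor[OF A.A A.A] and BB = module_tensor[OF B.A B.A] and x' = A.gr_closed[OF x]
 note f = bialg_homD[OF f]
 note ff = lin_tensor_map[OF A.A A.A B.A B.A f(1) f(1)]
 have "rmap R S B (tensor R B B) (comult B) (fm S f x) = rmap R S A (tensor R B B) (\<lambda>a. comult B (f a)) x"
  by (rule tmap_comp[OF mS A.A mS B.A mS BB lin_id f(1) lin_id B.comult x'])
 also have "\<dots> = rmap R S A (tensor R B B) (\<lambda>a. tmap R A A B B f f (comult A a)) x"
  by (rule tmap_cong[OF mS A.A mS BB lin_id lin_comp[OF f(1) B.comult] refl f(4) x'])
 also have "\<dots> = rmap R S (tensor R A A) (tensor R B B) (tmap R A A B B f f) (rmap R S A (tensor R A A) (comult A) x)"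
  by (rule tmap_comp[OF mS A.A mS AA mS BB lin_id A.comult lin_id ff x', symmetric])
 also have "\<dots> = B.box S (fm S f x) (fm S f x)"
  using x fm_box[OF S f(1) x' x'] by (simp add: A.gr_iff[OF S])
 moreover have "contract S (counit B) (fm S f x) = contract S (counit A) x"
  by (rule tmap_ext[OF mS A.A lin_comp[OF lin_tensor_map[OF mS A.A mS B.A lin_id f(1)] lin_contract[OF mS B.A B.counit]]
     lin_contract[OF mS A.A A.counit] _ x'])
   (simp add: tmap_pure[OF mS A.A mS B.A lin_id f(1)] contract_pure[OF mS B.A B.counit] contract_pure[OF mS A.A A.counit] lin_closed[OF f(1)] f(5))
 ultimately show "fm S f x \<in> B.gr S"
  using x lin_closed[OF lin_tensor_map[OF mS A.A mS B.A lin_id f(1)] x'] by (simp add: B.gr_iff[OF S] A.gr_iff[OF S])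
 show "fm S f \<one>\<^bsub>tensor R S A\<^esub> = \<one>\<^bsub>tensor R S B\<^esub>"
  by (simp add: tensor_one tmap_pure[OF mS A.A mS B.A lin_id f(1)] oA ring_hom_one[OF f(3)])
 assume y: "y \<in> A.gr S"
 have lf: "lmap R (tensor R S A) (tensor R S B) (fm S f)" by (rule lin_tensor_map[OF mS A.A mS B.A lin_id f(1)])
 show "fm S f (x \<otimes>\<^bsub>tensor R S A\<^esub> y) = fm S f x \<otimes>\<^bsub>tensor R S B\<^esub> fm S f y"
  by (rule tensor_bilin_ext[OF mS A.A mS A.A bilin_post[OF A.bSA[OF bA S] lf] bilin_comp[OF B.bSA[OF bB S] lf lf] _ x' A.gr_closed[OF y]])
   (simp add: A.SA_pure[OF bA S] B.SA_pure[OF bB S] tmap_pure[OF mS A.A mS B.A lin_id f(1)] lin_closed[OF f(1)] ring_hom_mult[OF f(3)] bilin_closed[OF bA])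
qed

lemma fm_push:
 assumes S: "algebra R S" and T: "algebra R T" and h: "lmap R S T h" and f: "lmap R A B f" and x: "x <: tensor R S A"
 shows "fm T f (A.push_pt S T h x) = B.push_pt S T h (fm S f x)"
 unfolding tmap_comp[OF alg_mod[OF S] A.A alg_mod[OF T] A.A alg_mod[OF T] B.A h lin_id lin_id f x]
  tmap_comp[OF alg_mod[OF S] A.A alg_mod[OF S] B.A alg_mod[OF T] B.A lin_id f h lin_id x] ..

lemma fm_cong:
 assumes S: "algebra R S" and f: "lmap R A B f" and eq: "\<And>a. a <: A ==> f a = g a" and x: "x \<in> A.gr S"
 shows "fm S f x = fm S g x"
 by (rule tmap_cong[OF alg_mod[OF S] A.A alg_mod[OF S] B.A lin_id f refl eq A.gr_closed[OF x]])

text \<open>\<open>points_linear0\<close> provides the linear map. That it respects coproduct,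
  counit, product and unit is then tested on points, where it says that \<open>\<phi>\<close> takes
  group-like elements to such elements and is a monoid homomorphism.\<close>

lemma bialg_hom_of_points:
 fixes \<phi> :: "'u md => ('u, 'u) tensor_elt => ('u, 'u) tensor_elt"
 assumes cl: "\<And>T x. algebra R T ==> x \<in> A.gr T ==> \<phi> T x \<in> B.gr T"
  and nat: "\<And>T T' k x. algebra R T ==> algebra R T' ==> alg_map R T T' k ==> x \<in> A.gr T
   ==> \<phi> T' (A.push_pt T T' k x) = B.push_pt T T' k (\<phi> T x)"
  and mul: "\<And>T x y. algebra R T ==> x \<in> A.gr T ==> y \<in> A.gr T ==> \<phi> T (x \<otimes>\<^bsub>tensor R T A\<^esub> y) = \<phi> T x \<otimes>\<^bsub>tensor R T B\<^esub> \<phi> T y"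
  and one: "\<And>T. algebra R T ==> \<phi> T \<one>\<^bsub>tensor R T A\<^esub> = \<one>\<^bsub>tensor R T B\<^esub>"
 shows "\<exists>f\<in>bialg_hom R A B. \<forall>T x. algebra R T --> x \<in> A.gr T --> \<phi> T x = fm T f x"
proof -
 obtain f where f: "lmap R A B f" and fe: "\<And>T x. algebra R T ==> x \<in> A.gr T ==> \<phi> T x = fm T f x"
  by (rule A.points_linear0[OF B.A, of \<phi>, OF B.gr_closed[OF cl] nat], assumption+, rule that)
 note AA = module_tensor[OF A.A A.A] and BB = module_tensor[OF B.A B.A] and mR = alg_mod[OF A.RR]
 note ff = lin_tensor_map[OF A.A A.A B.A B.A f f]
 have gm: "fm T f x \<in> B.gr T" if "algebra R T" "x \<in> A.gr T" for T :: "'u md" and x using cl[OF that] fe[OF that] by simp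
 have \<Delta>: "comult B (f a) = tmap R A A B B f f (comult A a)" if a: "a <: A" for a
 proof (rule A.points_unique0[OF BB lin_comp[OF f B.comult] lin_comp[OF A.comult ff] _ a])
  fix S :: "'u md" and x assume S: "algebra R S" and x: "x \<in> A.gr S"
  note mS = alg_mod[OF S] and x' = A.gr_closed[OF x]
  show "rmap R S A (tensor R B B) (\<lambda>a. comult B (f a)) x = rmap R S A (tensor R B B) (\<lambda>a. tmap R A A B B f f (comult A a)) x"
   using tmap_comp[OF mS A.A mS B.A mS BB lin_id f lin_id B.comult x'] tmap_comp[OF mS A.A mS AA mS BB lin_id A.comult lin_id ff x']
    gm[OF S x] x fm_box[OF S f x' x'] by (simp add: A.gr_iff[OF S] B.gr_iff[OF S])
 qed
 have \<epsilon>: "counit B (f a) = counit A a" if a: "a <: A" for a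
 proof (rule A.points_unique0[OF mR lin_comp[OF f B.counit] A.counit _ a])
  fix S :: "'u md" and x assume S: "algebra R S" and x: "x \<in> A.gr S"
  note mS = alg_mod[OF S] and x' = A.gr_closed[OF x]
  show "rmap R S A B.Rm (\<lambda>a. counit B (f a)) x = rmap R S A B.Rm (counit A) x"
   using tmap_comp[OF mS A.A mS B.A mS mR lin_id f lin_id B.counit x'] gm[OF S x] x
    A.tmap_contract[OF mS A.counit x'] B.tmap_contract[OF mS B.counit B.gr_closed[OF gm[OF S x]]]
   by (simp add: A.gr_iff[OF S] B.gr_iff[OF S])
 qed
 have m: "f (a \<otimes>\<^sub>A b) = f a \<otimes>\<^sub>B f b" if a: "a <: A" and b: "b <: A" for a b
 proof (rule A.points_unique2[OF B.A bilin_post[OF bA f] bilin_comp[OF bB f f] _ a b])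
  fix S :: "'u md" and x y assume S: "algebra R S" and x: "x \<in> A.gr S" and y: "y \<in> A.gr S"
  have xy: "x \<otimes>\<^bsub>tensor R S A\<^esub> y \<in> A.gr S" using monoid.m_closed[OF A.monoid_grm[OF biA S], of x y] x y by (simp add: A.grm_simps)
  show "rmap R S (tensor R A A) B (tlift B (\<lambda>a b. f (a \<otimes>\<^sub>A b))) (A.box S x y)
   = rmap R S (tensor R A A) B (tlift B (\<lambda>a b. f a \<otimes>\<^sub>B f b)) (A.box S x y)"
   unfolding A.mult_box[OF bA S A.gr_closed[OF x] A.gr_closed[OF y] B.A f] fm_mult[OF S f A.gr_closed[OF x] A.gr_closed[OF y]]
   using mul[OF S x y] fe[OF S x] fe[OF S y] fe[OF S xy] by simp
 qed
 \<comment> \<open>The unit over the base \<open>R\<close> is compared and then read in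
   \<open>B\<close> through R \<otimes> B = B.\<close>
 have o: "f \<one>\<^sub>A = \<one>\<^sub>B"
 proof -
  have oR: "\<one>\<^bsub>A.Rm\<^esub> <: A.Rm" "\<one>\<^bsub>A.Rm\<^esub> = \<one>\<^sub>R" using cring.cring_simprules(6)[OF A.R_cring] by (simp_all add: ring_as_module_def)
  have "\<one>\<^bsub>tensor R A.Rm A\<^esub> \<in> A.gr A.Rm" using monoid.one_closed[OF A.monoid_grm[OF biA A.RR]] by (simp add: A.grm_simps)
  from fe[OF A.RR this] one[OF A.RR] have e: "tens R A.Rm B \<one>\<^sub>R (f \<one>\<^sub>A) = tens R A.Rm B \<one>\<^sub>R \<one>\<^sub>B"
   using oR by (simp add: tensor_one tmap_pure[OF mR A.A mR B.A lin_id f] oA)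
  from arg_cong[where f = "B.lact B", OF e] show ?thesis
   unfolding B.lact_one[OF B.A lin_closed[OF f oA]] B.lact_one[OF B.A oB] .
 qed
 have "f \<in> ring_hom A B" by (rule ring_hom_memI) (use lin_closed[OF f] lin_add[OF f] m o in auto)
 then have "restrict f (carrier A) \<in> bialg_hom R A B"
  by (rule bialg_homI[OF aaA B.A f _ _ \<Delta> \<epsilon>]) (use lin_closed[OF A.comult] in auto)
 moreover have "\<phi> T x = fm T (restrict f (carrier A)) x" if "algebra R T" "x \<in> A.gr T" for T :: "'u md" and x
  using fe[OF that] fm_cong[OF that(1) f _ that(2), of "restrict f (carrier A)"] by simp
 ultimately show ?thesis by blast
qed

definition fmor :: "('u => 'u) => 'u md => 'u spec_point => 'u spec_point" where
 "fmor f = (\<lambda>S\<in>{S. algebra R S}. \<lambda>\<phi>\<in>carrier (on_ob A.fmon S). B.pt S (fm S f (A.unpt S \<phi>)))"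

lemma fmor_pt: "algebra R S ==> x \<in> A.gr S ==> fmor f S (A.pt S x) = B.pt S (fm S f x)"
 by (simp add: fmor_def A.pt_fmon A.unpt_pt)

text \<open>Expresses morphisms of formal monoids by group-like elements, so that full faithfulness
  no longer refers to the points of the spectrum as natural transformations.\<close>

lemma nat_trans_fmon_iff:
 "\<eta> \<in> nat_trans (comm_algs R) monoid_cat A.fmon B.fmon \<longleftrightarrow> \<eta> \<in> extensional {S. algebra R S} \<and>
   (\<forall>S. algebra R S --> \<eta> S \<in> extensional (carrier (on_ob A.fmon S)) \<and> \<eta> S (A.pt S \<one>\<^bsub>tensor R S A\<^esub>) = B.pt S \<one>\<^bsub>tensor R S B\<^esub> \<and>
    (\<forall>x\<in>A.gr S. \<eta> S (A.pt S x) <: on_ob B.fmon S \<and> (\<forall>y\<in>A.gr S. \<eta> S (A.pt S (x \<otimes>\<^bsub>tensor R S A\<^esub> y)) = \<eta> S (A.pt S x) \<otimes>\<^bsub>on_ob B.fmon S\<^esub> \<eta> S (A.pt S y)) \<and>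
     (\<forall>T h. algebra R T --> h \<in> alg_hom R S T --> \<eta> T (A.pt T (A.push_pt S T h x)) = on_mor B.fmon S T h (\<eta> S (A.pt S x)))))"
 (is "?L \<longleftrightarrow> ?R")
proof
 assume L: ?L
 have ext: "\<eta> \<in> extensional {S. algebra R S}"
  and mor: "\<And>S. algebra R S ==> \<eta> S \<in> hom (on_ob A.fmon S) (on_ob B.fmon S) \<and> \<eta> S \<in> extensional (carrier (on_ob A.fmon S))
   \<and> \<eta> S \<one>\<^bsub>on_ob A.fmon S\<^esub> = \<one>\<^bsub>on_ob B.fmon S\<^esub>"
  and nat: "\<And>S T h. algebra R S ==> algebra R T ==> h \<in> alg_hom R S T ==>
   compose (carrier (on_ob A.fmon S)) (\<eta> T) (on_mor A.fmon S T h) = compose (carrier (on_ob A.fmon S)) (on_mor B.fmon S T h) (\<eta> S)"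
  using L by (simp_all add: nat_trans_def comm_algs_simps monoid_cat_def)
 show ?R
 proof (intro conjI allI impI ballI ext)
  fix S :: "'u md" assume S: "algebra R S"
  show "\<eta> S \<in> extensional (carrier (on_ob A.fmon S))" using mor[OF S] by simp
  show "\<eta> S (A.pt S \<one>\<^bsub>tensor R S A\<^esub>) = B.pt S \<one>\<^bsub>tensor R S B\<^esub>" using mor[OF S] by (simp add: A.fmon_one[OF S] B.fmon_one[OF S])
  fix x assume x: "x \<in> A.gr S"
  note px = A.pt_fmon[OF S x]
  show "\<eta> S (A.pt S x) <: on_ob B.fmon S" using mor[OF S] px by (auto simp: hom_def)
  show "\<eta> S (A.pt S (x \<otimes>\<^bsub>tensor R S A\<^esub> y)) = \<eta> S (A.pt S x) \<otimes>\<^bsub>on_ob B.fmon S\<^esub> \<eta> S (A.pt S y)" if y: "y \<in> A.gr S" for y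
   using hom_mult[OF conjunct1[OF mor[OF S]] px A.pt_fmon[OF S y]] by (simp only: A.fmon_mult[OF S x y])
  fix T :: "'u md" and h assume T: "algebra R T" and h: "h \<in> alg_hom R S T"
  have hl: "lmap R S T h" using h alg_map_lin by (auto simp: alg_hom_iff)
  show "\<eta> T (A.pt T (A.push_pt S T h x)) = on_mor B.fmon S T h (\<eta> S (A.pt S x))"
   using fun_cong[OF nat[OF S T h], of "A.pt S x"] px by (simp add: compose_def A.fmon_mor[OF S T hl x])
 qed
next
 assume r: ?R
 have "\<eta> S \<in> hom (on_ob A.fmon S) (on_ob B.fmon S)" if S: "algebra R S" for S :: "'u md"
 proof (rule homI)
  fix \<phi> assume p: "\<phi> <: on_ob A.fmon S"
  show "\<eta> S \<phi> <: on_ob B.fmon S" using r S A.unpt_gr[OF S p] A.pt_unpt[OF S p] by metis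
  fix \<psi> assume q: "\<psi> <: on_ob A.fmon S"
  show "\<eta> S (\<phi> \<otimes>\<^bsub>on_ob A.fmon S\<^esub> \<psi>) = \<eta> S \<phi> \<otimes>\<^bsub>on_ob B.fmon S\<^esub> \<eta> S \<psi>"
   using r S A.fmon_mult[OF S A.unpt_gr[OF S p] A.unpt_gr[OF S q]] A.unpt_gr[OF S p] A.unpt_gr[OF S q]
   unfolding A.pt_unpt[OF S p] A.pt_unpt[OF S q] by (metis A.pt_unpt[OF S p] A.pt_unpt[OF S q])
 qed
 moreover have "compose (carrier (on_ob A.fmon S)) (\<eta> T) (on_mor A.fmon S T h) = compose (carrier (on_ob A.fmon S)) (on_mor B.fmon S T h) (\<eta> S)"
  if S: "algebra R S" and T: "algebra R T" and h: "h \<in> alg_hom R S T" for S T :: "'u md" and h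
 proof (rule A.fmon_ext[OF S])
  have hl: "lmap R S T h" using h alg_map_lin by (auto simp: alg_hom_iff)
  fix x assume x: "x \<in> A.gr S"
  show "compose (carrier (on_ob A.fmon S)) (\<eta> T) (on_mor A.fmon S T h) (A.pt S x) = compose (carrier (on_ob A.fmon S)) (on_mor B.fmon S T h) (\<eta> S) (A.pt S x)"
   using r S T h x A.pt_fmon[OF S x] by (simp add: compose_def A.fmon_mor[OF S T hl x])
 qed simp_all
 ultimately show ?L
  using r by (simp add: nat_trans_def comm_algs_simps monoid_cat_def A.fmon_one B.fmon_one)
qed

lemma fmor_nat_trans:
 assumes f: "f \<in> bialg_hom R A B"
 shows "fmor f \<in> nat_trans (comm_algs R) monoid_cat A.fmon B.fmon"
proof -
 have mon: "x \<otimes>\<^bsub>tensor R S A\<^esub> y \<in> A.gr S" if "algebra R S" "x \<in> A.gr S" "y \<in> A.gr S" for S :: "'u md" and x y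
  using monoid.m_closed[OF A.monoid_grm[OF biA that(1)], of x y] that by (simp add: A.grm_simps)
 have o: "\<one>\<^bsub>tensor R S A\<^esub> \<in> A.gr S" if "algebra R S" for S :: "'u md"
  using monoid.one_closed[OF A.monoid_grm[OF biA that]] by (simp add: A.grm_simps)
 have "fmor f T (A.pt T (A.push_pt S T h x)) = on_mor B.fmon S T h (fmor f S (A.pt S x))"
  if S: "algebra R S" and T: "algebra R T" and h: "h \<in> alg_hom R S T" and x: "x \<in> A.gr S" for S T :: "'u md" and h x
 proof -
  have h: "alg_map R S T h" using h by (simp add: alg_hom_iff)
  show ?thesis
   by (simp add: fmor_pt[OF S x] fmor_pt[OF T A.gr_push[OF S T h x]] B.fmon_mor[OF S T alg_map_lin[OF h] gr_fm[OF S f x]]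
     fm_push[OF S T alg_map_lin[OF h] bialg_homD(1)[OF f] A.gr_closed[OF x]])
 qed
 then show ?thesis
  unfolding nat_trans_fmon_iff
  by (simp add: fmor_pt o mon fm_one[OF _ f o] B.pt_fmon gr_fm[OF _ f] fm_hom[OF _ f] B.fmon_mult) (simp add: fmor_def)
qed

lemma bij_fmor: "bij_betw fmor (bialg_hom R A B) (nat_trans (comm_algs R) monoid_cat A.fmon B.fmon)"
proof (rule bij_betw_imageI)
 show "inj_on fmor (bialg_hom R A B)"
 proof (rule inj_onI)
  fix f g assume f: "f \<in> bialg_hom R A B" and g: "g \<in> bialg_hom R A B" and eq: "fmor f = fmor g"
  have "f a = g a" if a: "a <: A" for a
  proof (rule A.points_unique0[OF B.A bialg_homD(1)[OF f] bialg_homD(1)[OF g] _ a])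
   fix S :: "'u md" and x assume S: "algebra R S" and x: "x \<in> A.gr S"
   have "B.pt S (fm S f x) = B.pt S (fm S g x)" using fmor_pt[OF S x, of f] fmor_pt[OF S x, of g] eq by simp
   then show "fm S f x = fm S g x" by (rule B.pt_inj[OF S gr_fm[OF S f x] gr_fm[OF S g x]])
  qed
  then show "f = g" by (rule extensionalityI[OF bialg_homD(2)[OF f] bialg_homD(2)[OF g]])
 qed
 show "fmor ` bialg_hom R A B = nat_trans (comm_algs R) monoid_cat A.fmon B.fmon"
 proof (rule subset_antisym; rule subsetI)
  show "\<eta> \<in> nat_trans (comm_algs R) monoid_cat A.fmon B.fmon" if "\<eta> \<in> fmor ` bialg_hom R A B" for \<eta>
   using that fmor_nat_trans by blast
  fix \<eta> assume \<eta>: "\<eta> \<in> nat_trans (comm_algs R) monoid_cat A.fmon B.fmon"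
  note r = \<eta>[unfolded nat_trans_fmon_iff]
  define \<phi> where "\<phi> T x = B.unpt T (\<eta> T (A.pt T x))" for T x
  have cl: "\<phi> T x \<in> B.gr T" and \<phi>p: "B.pt T (\<phi> T x) = \<eta> T (A.pt T x)" if "algebra R T" "x \<in> A.gr T" for T :: "'u md" and x
   using r that B.unpt_gr[OF that(1)] B.pt_unpt[OF that(1)] by (simp_all add: \<phi>_def)
  have "\<exists>f\<in>bialg_hom R A B. \<forall>T x. algebra R T --> x \<in> A.gr T --> \<phi> T x = fm T f x"
  proof (rule bialg_hom_of_points[OF cl])
   fix T :: "'u md" assume T: "algebra R T"
   show "\<phi> T \<one>\<^bsub>tensor R T A\<^esub> = \<one>\<^bsub>tensor R T B\<^esub>"
    using r T B.unpt_pt[OF T] monoid.one_closed[OF B.monoid_grm[OF biB T]] by (simp add: \<phi>_def B.grm_simps)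
   fix x assume x: "x \<in> A.gr T"
   show "\<phi> T (x \<otimes>\<^bsub>tensor R T A\<^esub> y) = \<phi> T x \<otimes>\<^bsub>tensor R T B\<^esub> \<phi> T y" if y: "y \<in> A.gr T" for y
   proof -
    have c: "\<phi> T x \<otimes>\<^bsub>tensor R T B\<^esub> \<phi> T y \<in> B.gr T"
     using monoid.m_closed[OF B.monoid_grm[OF biB T], of "\<phi> T x" "\<phi> T y"] cl[OF T x] cl[OF T y] by (simp add: B.grm_simps)
    have "\<eta> T (A.pt T (x \<otimes>\<^bsub>tensor R T A\<^esub> y)) = B.pt T (\<phi> T x \<otimes>\<^bsub>tensor R T B\<^esub> \<phi> T y)"
     using r T x y \<phi>p[OF T x] \<phi>p[OF T y] B.fmon_mult[OF T cl[OF T x] cl[OF T y]] by simp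
    then show ?thesis using B.unpt_pt[OF T c] by (simp add: \<phi>_def)
   qed
   fix T' :: "'u md" and k assume T': "algebra R T'" and k: "alg_map R T T' k"
   \<comment> \<open>Morphisms of algebras are extensional, while the criterion is stated for plain
     \<open>alg_map\<close>; the restriction induces the same base change.\<close>
   let ?k = "restrict k (carrier T)"
   have kh: "?k \<in> alg_hom R T T'" by (rule restrict_alg_hom[OF T k])
   have kl: "lmap R T T' ?k" using kh alg_map_lin by (auto simp: alg_hom_iff)
   note mT = alg_mod[OF T] and mT' = alg_mod[OF T']
   have "A.push_pt T T' ?k x = A.push_pt T T' k x" "B.push_pt T T' ?k (\<phi> T x) = B.push_pt T T' k (\<phi> T x)"
    using tmap_cong[OF mT A.A mT' A.A kl lin_id _ refl A.gr_closed[OF x], of k] tmap_cong[OF mT B.A mT' B.A kl lin_id _ refl B.gr_closed[OF cl[OF T x]], of k]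
    by simp_all
   moreover have "\<eta> T' (A.pt T' (A.push_pt T T' ?k x)) = B.pt T' (B.push_pt T T' ?k (\<phi> T x))"
    using r T T' kh x \<phi>p[OF T x] B.fmon_mor[OF T T' kl cl[OF T x]] by metis
   ultimately show "\<phi> T' (A.push_pt T T' k x) = B.push_pt T T' k (\<phi> T x)"
    using B.unpt_pt[OF T' B.gr_push[OF T T' k cl[OF T x]]] by (simp add: \<phi>_def)
  qed
  then obtain f where f: "f \<in> bialg_hom R A B" and fe: "\<And>T x. algebra R T ==> x \<in> A.gr T ==> \<phi> T x = fm T f x" by blast
  have "\<eta> = fmor f"
  proof (rule extensionalityI)
   show "\<eta> \<in> extensional {S. algebra R S}" using r by simp
   show "fmor f \<in> extensional {S. algebra R S}" by (simp add: fmor_def)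
   fix S :: "'u md" assume "S \<in> {S. algebra R S}"
   then have S: "algebra R S" by simp
   show "\<eta> S = fmor f S"
    by (rule A.fmon_ext[OF S]) (use r S fe[OF S] \<phi>p[OF S] fmor_pt[OF S] in \<open>simp_all add: fmor_def\<close>)
  qed
  then show "\<eta> \<in> fmor ` bialg_hom R A B" using f by blast
 qed
qed

end

section \<open>Essential surjectivity\<close>

lemma alg_hom_source_cong:
 assumes "carrier M = carrier M'" "add M = add M'" "smult M = smult M'" "one M = one M'"
  and "\<And>x y. x <: M ==> y <: M ==> x \<otimes>\<^sub>M y = x \<otimes>\<^sub>M' y"
 shows "alg_hom K M N = alg_hom K M' N"
 using assms(5) by (auto simp: alg_hom_def lin_hom_def ring_hom_def assms(1-4))

text \<open>The structure on the dual functor is compared only on linear maps and on commutative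
  algebras, since off these domains the given operations are arbitrary. The spectra are nevertheless
  equal.\<close>

lemma Spec_dual_cong:
 fixes A :: "'u md" and A' :: "'u md"
 assumes e: "same_mod A A'"
  and m: "\<And>T v w. algebra R T ==> v \<in> lin_hom R A T ==> w \<in> lin_hom R A T ==> m T v w = m' T v w"
  and o: "\<And>T. algebra R T ==> e T = e' T"
 shows "on_ob (Spec R (dual_functor R A m e)) S = on_ob (Spec R (dual_functor R A' m' e')) S"
  and "on_mor (Spec R (dual_functor R A m e)) S T h = on_mor (Spec R (dual_functor R A' m' e')) S T h"
proof -
 let ?F = "dual_functor R A m e" and ?F' = "dual_functor R A' m' e'"
 note s = dual_functor_simps
 have l: "lin_hom R A T = lin_hom R A' T" for T :: "'u md" by (rule same_mod_lin_hom[OF e same_mod_refl])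
 have c: "carrier A = carrier A'" using e by (simp add: same_mod_def)
 have om: "on_mor ?F T T' k = on_mor ?F' T T' k" for T T' k by (simp add: s l c)
 have ah: "alg_hom T (on_ob ?F T) N = alg_hom T (on_ob ?F' T) N" if "algebra R T" for T and N :: "('u, 'z, 'q) module_scheme"
  by (rule alg_hom_source_cong) (simp_all add: s l c m o that flip: l)
 have h: "alg_functor_homs R ?F G = alg_functor_homs R ?F' G" for G
  unfolding alg_functor_homs_def om by (simp add: ah comm_algs_simps s l cong: conj_cong ball_cong)
 show "on_ob (Spec R ?F) S = on_ob (Spec R ?F') S" by (simp add: Spec_def h)
 show "on_mor (Spec R ?F) S T h = on_mor (Spec R ?F') S T h" by (simp add: Spec_def h s l)
qed

text \<open>The two functors need not be equal: their monoid records may differ outside the carrier.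
  The identity maps on carriers form the isomorphism.\<close>

lemma iso_of_agree:
 assumes F: "is_functor C monoid_cat F" and G: "is_functor C monoid_cat G"
  and c: "\<And>X. X \<in> Ob C ==> carrier (on_ob F X) = carrier (on_ob G X)"
  and m: "\<And>X x y. X \<in> Ob C ==> x <: on_ob F X ==> y <: on_ob F X ==> x \<otimes>\<^bsub>on_ob F X\<^esub> y = x \<otimes>\<^bsub>on_ob G X\<^esub> y"
  and o: "\<And>X. X \<in> Ob C ==> \<one>\<^bsub>on_ob F X\<^esub> = \<one>\<^bsub>on_ob G X\<^esub>"
  and h: "\<And>X Y f. X \<in> Ob C ==> Y \<in> Ob C ==> f \<in> Mor C X Y ==> on_mor F X Y f = on_mor G X Y f"
 shows "\<exists>\<eta>. is_iso (functor_cat C monoid_cat) F G \<eta>"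
proof -
 have mon: "monoid (on_ob F X)" if "X \<in> Ob C" for X using F that by (simp add: is_functor_def monoid_cat_def)
 have mm: "on_mor F X Y f \<in> carrier (on_ob F X) \<rightarrow> carrier (on_ob F Y)" if "X \<in> Ob C" "Y \<in> Ob C" "f \<in> Mor C X Y" for X Y f
  using F that by (auto simp: is_functor_def monoid_cat_def hom_def)
 let ?i = "\<lambda>X\<in>Ob C. \<lambda>x\<in>carrier (on_ob F X). x"
 have nat: "?i \<in> nat_trans C monoid_cat F' G'"
  if c': "\<And>X. X \<in> Ob C ==> carrier (on_ob F' X) = carrier (on_ob F X) \<and> carrier (on_ob G' X) = carrier (on_ob F X)"
   and m': "\<And>X x y. X \<in> Ob C ==> x <: on_ob F X ==> y <: on_ob F X ==> x \<otimes>\<^bsub>on_ob F' X\<^esub> y = x \<otimes>\<^bsub>on_ob F X\<^esub> y \<and> x \<otimes>\<^bsub>on_ob G' X\<^esub> y = x \<otimes>\<^bsub>on_ob F X\<^esub> y"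
   and o': "\<And>X. X \<in> Ob C ==> \<one>\<^bsub>on_ob F' X\<^esub> = \<one>\<^bsub>on_ob F X\<^esub> \<and> \<one>\<^bsub>on_ob G' X\<^esub> = \<one>\<^bsub>on_ob F X\<^esub>"
   and h': "\<And>X Y f. X \<in> Ob C ==> Y \<in> Ob C ==> f \<in> Mor C X Y ==> on_mor F' X Y f = on_mor F X Y f \<and> on_mor G' X Y f = on_mor F X Y f"
  for F' G'
  unfolding nat_trans_def
 proof (intro CollectI conjI ballI)
  fix X assume X: "X \<in> Ob C"
  interpret M: monoid "on_ob F X" by (rule mon[OF X])
  show "?i X \<in> Mor monoid_cat (on_ob F' X) (on_ob G' X)"
   using X c'[OF X] o'[OF X] m'[OF X] by (auto simp: monoid_cat_def hom_def)
  fix Y f assume Y: "Y \<in> Ob C" and f: "f \<in> Mor C X Y"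
  show "Cmp monoid_cat (on_ob F' X) (on_ob F' Y) (on_ob G' Y) (?i Y) (on_mor F' X Y f) = Cmp monoid_cat (on_ob F' X) (on_ob G' X) (on_ob G' Y) (on_mor G' X Y f) (?i X)"
   using X Y c'[OF X] h'[OF X Y f] funcset_mem[OF mm[OF X Y f]] by (auto simp: monoid_cat_def compose_def fun_eq_iff)
 qed simp
 show ?thesis
 proof (rule exI[of _ ?i], unfold is_iso_def, intro conjI bexI[of _ ?i])
  show "?i \<in> Mor (functor_cat C monoid_cat) F G" "?i \<in> Mor (functor_cat C monoid_cat) G F"
   unfolding functor_cat_def cat.simps by (rule nat; simp add: c m o h)+
  show "Cmp (functor_cat C monoid_cat) F G F ?i ?i = Ident (functor_cat C monoid_cat) F" "Cmp (functor_cat C monoid_cat) G F G ?i ?i = Ident (functor_cat C monoid_cat) G"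
   by (auto simp: functor_cat_def monoid_cat_def compose_def fun_eq_iff c)
 qed
qed

context lp_coalg
begin

text \<open>The monoid law is a natural operation on pairs of points, hence bilinear by
  \<open>points_bilinear\<close>; the unit is a point over \<open>R\<close>, that is, an element of
  R \<otimes> A = A.\<close>

lemma mult_of_monoid_functor:
 fixes Y :: "(('u, 'u) module, 'u => 'u, 'u spec_point monoid, 'u spec_point => 'u spec_point) ftor"
 assumes Y: "is_functor (comm_algs R) monoid_cat Y"
  and ob: "\<And>S. algebra R S ==> carrier (on_ob Y S) = carrier (on_ob fmon S)"
  and mor: "\<And>S T h. algebra R S ==> algebra R T ==> h \<in> alg_hom R S T ==> on_mor Y S T h = on_mor fmon S T h"
 shows "\<exists>\<beta> i. bilin R A A A \<beta> \<and> i <: A \<and> (\<forall>S. algebra R S -->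
   tens R S A \<one>\<^sub>S i \<in> gr S \<and> \<one>\<^bsub>on_ob Y S\<^esub> = pt S (tens R S A \<one>\<^sub>S i) \<and>
   (\<forall>x\<in>gr S. \<forall>y\<in>gr S. rmap R S (tensor R A A) A (tlift A \<beta>) (box S x y) \<in> gr S \<and>
    pt S x \<otimes>\<^bsub>on_ob Y S\<^esub> pt S y = pt S (rmap R S (tensor R A A) A (tlift A \<beta>) (box S x y))))"
proof -
 have mon: "monoid (on_ob Y S)" if "algebra R S" for S using Y that by (simp add: is_functor_def monoid_cat_def comm_algs_simps)
 have hm: "on_mor Y S T h \<in> hom (on_ob Y S) (on_ob Y T)" "on_mor Y S T h \<one>\<^bsub>on_ob Y S\<^esub> = \<one>\<^bsub>on_ob Y T\<^esub>"
  if "algebra R S" "algebra R T" "h \<in> alg_hom R S T" for S T h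
  using Y that by (auto simp: is_functor_def monoid_cat_def comm_algs_simps)
 have mo: "on_mor Y S T (restrict k (carrier S)) (pt S x) = pt T (push_pt S T k x)"
  if S: "algebra R S" and T: "algebra R T" and k: "alg_map R S T k" and x: "x \<in> gr S" for S T :: "'u md" and k x
 proof -
  note kh = restrict_alg_hom[OF S k]
  have kl: "lmap R S T (restrict k (carrier S))" using kh alg_map_lin by (auto simp: alg_hom_iff)
  show ?thesis
   unfolding mor[OF S T kh] fmon_mor[OF S T kl x]
   using tmap_cong[OF alg_mod[OF S] A alg_mod[OF T] A kl lin_id _ refl gr_closed[OF x], of k] by simp
 qed
 \<comment> \<open>The multiplication of \<open>Y\<close>, read on group-like elements.\<close>
 define \<mu> where "\<mu> T x y = unpt T (pt T x \<otimes>\<^bsub>on_ob Y T\<^esub> pt T y)" for T x y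
 have pc: "pt T x <: on_ob Y T" if "algebra R T" "x \<in> gr T" for T :: "'u md" and x using pt_fmon[OF that] ob[OF that(1)] by simp
 have \<mu>c: "\<mu> T x y \<in> gr T" and \<mu>p: "pt T (\<mu> T x y) = pt T x \<otimes>\<^bsub>on_ob Y T\<^esub> pt T y"
  if T: "algebra R T" and x: "x \<in> gr T" and y: "y \<in> gr T" for T :: "'u md" and x y
  using unpt_gr[OF T] pt_unpt[OF T] monoid.m_closed[OF mon[OF T] pc[OF T x] pc[OF T y]] unfolding \<mu>_def ob[OF T] by simp_all
 obtain \<beta> where b: "bilin R A A A \<beta>" and be: "\<And>T x y. algebra R T ==> x \<in> gr T ==> y \<in> gr T
   ==> \<mu> T x y = rmap R T (tensor R A A) A (tlift A \<beta>) (box T x y)"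
 proof (rule points_bilinear[OF A, of \<mu>])
  show "\<mu> T x y <: tensor R T A" if "algebra R T" "x \<in> gr T" "y \<in> gr T" for T x y
   by (rule gr_closed[OF \<mu>c[OF that]])
  fix T T' :: "'u md" and k x y assume T: "algebra R T" and T': "algebra R T'" and k: "alg_map R T T' k" and x: "x \<in> gr T" and y: "y \<in> gr T"
  have "pt T' (\<mu> T' (push_pt T T' k x) (push_pt T T' k y)) = pt T' (push_pt T T' k (\<mu> T x y))"
   unfolding \<mu>p[OF T' gr_push[OF T T' k x] gr_push[OF T T' k y]] mo[OF T T' k x, symmetric] mo[OF T T' k y, symmetric] mo[OF T T' k \<mu>c[OF T x y], symmetric] \<mu>p[OF T x y]
   by (rule hom_mult[OF hm(1)[OF T T' restrict_alg_hom[OF T k]] pc[OF T x] pc[OF T y], symmetric])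
  then show "\<mu> T' (push_pt T T' k x) (push_pt T T' k y) = push_pt T T' k (\<mu> T x y)"
   by (rule pt_inj[OF T' \<mu>c[OF T' gr_push[OF T T' k x] gr_push[OF T T' k y]] gr_push[OF T T' k \<mu>c[OF T x y]]])
 qed (rule that)
 let ?e = "unpt Rm \<one>\<^bsub>on_ob Y Rm\<^esub>"
 have oY: "\<one>\<^bsub>on_ob Y Rm\<^esub> <: on_ob fmon Rm" using monoid.one_closed[OF mon[OF RR]] ob[OF RR] by simp
 have eg: "?e \<in> gr Rm" and ep: "pt Rm ?e = \<one>\<^bsub>on_ob Y Rm\<^esub>" using unpt_gr[OF RR oY] pt_unpt[OF RR oY] .
 let ?i = "lact A ?e"
 have i: "?i <: A" by (rule lin_closed[OF lin_lact[OF A] gr_closed[OF eg]])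
 \<comment> \<open>Since the transition maps of \<open>Y\<close> preserve units, the unit over
   \<open>S\<close> is the base change of the one over \<open>R\<close>.\<close>
 have un: "tens R S A \<one>\<^sub>S ?i \<in> gr S \<and> \<one>\<^bsub>on_ob Y S\<^esub> = pt S (tens R S A \<one>\<^sub>S ?i)" if S: "algebra R S" for S :: "'u md"
 proof -
  note k = alg_map_unit[OF S]
  have oR: "\<one>\<^sub>R <: Rm" using cring.cring_simprules(6)[OF R_cring] by (simp add: ring_as_module_def)
  have "push_pt Rm S (\<lambda>r. r \<odot>\<^sub>S \<one>\<^sub>S) ?e = push_pt Rm S (\<lambda>r. r \<odot>\<^sub>S \<one>\<^sub>S) (tens R Rm A \<one>\<^sub>R ?i)"
   using one_lact[OF A gr_closed[OF eg]] by simp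
  also have "\<dots> = tens R S A \<one>\<^sub>S ?i"
   using alg_map_one[OF k] by (simp add: tmap_pure[OF alg_mod[OF RR] A alg_mod[OF S] A alg_map_lin[OF k] lin_id oR i]) (simp add: ring_as_module_def)
  finally have p: "push_pt Rm S (\<lambda>r. r \<odot>\<^sub>S \<one>\<^sub>S) ?e = tens R S A \<one>\<^sub>S ?i" .
  show ?thesis
   using gr_push[OF RR S k eg] mo[OF RR S k eg] hm(2)[OF RR S restrict_alg_hom[OF RR k]] unfolding p ep by simp
 qed
 have fin: "\<forall>S. algebra R S -->
   tens R S A \<one>\<^sub>S ?i \<in> gr S \<and> \<one>\<^bsub>on_ob Y S\<^esub> = pt S (tens R S A \<one>\<^sub>S ?i) \<and>
   (\<forall>x\<in>gr S. \<forall>y\<in>gr S. rmap R S (tensor R A A) A (tlift A \<beta>) (box S x y) \<in> gr S \<and>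
    pt S x \<otimes>\<^bsub>on_ob Y S\<^esub> pt S y = pt S (rmap R S (tensor R A A) A (tlift A \<beta>) (box S x y)))"
 proof (intro allI impI conjI ballI)
  fix S :: "'u md" assume S: "algebra R S"
  show "tens R S A \<one>\<^sub>S ?i \<in> gr S" "\<one>\<^bsub>on_ob Y S\<^esub> = pt S (tens R S A \<one>\<^sub>S ?i)" using un[OF S] by simp_all
  fix x y assume xy: "x \<in> gr S" "y \<in> gr S"
  show "rmap R S (tensor R A A) A (tlift A \<beta>) (box S x y) \<in> gr S"
   "pt S x \<otimes>\<^bsub>on_ob Y S\<^esub> pt S y = pt S (rmap R S (tensor R A A) A (tlift A \<beta>) (box S x y))"
   using \<mu>c[OF S xy] \<mu>p[OF S xy] unfolding be[OF S xy] by simp_all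
 qed
 show ?thesis by (rule exI[of _ \<beta>], rule exI[of _ ?i]) (intro conjI b i fin)
qed

lemma bialgebra_of_monoid_functor:
 fixes Y :: "(('u, 'u) module, 'u => 'u, 'u spec_point monoid, 'u spec_point => 'u spec_point) ftor"
 assumes Y: "is_functor (comm_algs R) monoid_cat Y"
  and ob: "\<And>S. algebra R S ==> carrier (on_ob Y S) = carrier (on_ob fmon S)"
  and mor: "\<And>S T h. algebra R S ==> algebra R T ==> h \<in> alg_hom R S T ==> on_mor Y S T h = on_mor fmon S T h"
  and bA: "bilin R A A A (mult A)" and oA: "\<one>\<^sub>A <: A"
  and one: "\<And>S. algebra R S ==> \<one>\<^bsub>tensor R S A\<^esub> \<in> gr S \<and> \<one>\<^bsub>on_ob Y S\<^esub> = pt S \<one>\<^bsub>tensor R S A\<^esub>"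
  and mul: "\<And>S x y. algebra R S ==> x \<in> gr S ==> y \<in> gr S
   ==> x \<otimes>\<^bsub>tensor R S A\<^esub> y \<in> gr S \<and> pt S x \<otimes>\<^bsub>on_ob Y S\<^esub> pt S y = pt S (x \<otimes>\<^bsub>tensor R S A\<^esub> y)"
 shows "bialgebra R A" and "\<exists>\<eta>. is_iso (functor_cat (comm_algs R) monoid_cat) fmon Y \<eta>"
proof -
 have mon: "monoid (on_ob Y S)" if "algebra R S" for S using Y that by (simp add: is_functor_def monoid_cat_def comm_algs_simps)
 have pc: "pt T x <: on_ob Y T" if "algebra R T" "x \<in> gr T" for T :: "'u md" and x using pt_fmon[OF that] ob[OF that(1)] by simp
 show b: "bialgebra R A"
 proof (rule bialgebra_of_monoid_grm[OF bA oA])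
  fix S :: "'u md" assume S: "algebra R S"
  interpret M: monoid "on_ob Y S" by (rule mon[OF S])
  note o = one[OF S] and m = mul[OF S]
  show "monoid (grm S)"
  proof (rule monoidI; simp only: grm_simps)
   show "\<one>\<^bsub>tensor R S A\<^esub> \<in> gr S" using o by simp
   fix x assume x: "x \<in> gr S"
   show "\<one>\<^bsub>tensor R S A\<^esub> \<otimes>\<^bsub>tensor R S A\<^esub> x = x"
    by (rule pt_inj[OF S _ x]) (use m[of "\<one>\<^bsub>tensor R S A\<^esub>" x] o x M.l_one[OF pc[OF S x]] in auto)
   show "x \<otimes>\<^bsub>tensor R S A\<^esub> \<one>\<^bsub>tensor R S A\<^esub> = x"
    by (rule pt_inj[OF S _ x]) (use m[of x "\<one>\<^bsub>tensor R S A\<^esub>"] o x M.r_one[OF pc[OF S x]] in auto)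
   fix y assume y: "y \<in> gr S"
   note xy = m[OF x y]
   then show "x \<otimes>\<^bsub>tensor R S A\<^esub> y \<in> gr S" by simp
   fix z assume z: "z \<in> gr S"
   note yz = m[OF y z]
   note xyz = m[OF conjunct1[OF xy] z] and xyz' = m[OF x conjunct1[OF yz]]
   show "x \<otimes>\<^bsub>tensor R S A\<^esub> y \<otimes>\<^bsub>tensor R S A\<^esub> z = x \<otimes>\<^bsub>tensor R S A\<^esub> (y \<otimes>\<^bsub>tensor R S A\<^esub> z)"
    by (rule pt_inj[OF S conjunct1[OF xyz] conjunct1[OF xyz']])
     (unfold conjunct2[OF xyz, symmetric] conjunct2[OF xyz', symmetric] conjunct2[OF xy, symmetric] conjunct2[OF yz, symmetric],
      rule M.m_assoc[OF pc[OF S x] pc[OF S y] pc[OF S z]])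
  qed
 qed
 show "\<exists>\<eta>. is_iso (functor_cat (comm_algs R) monoid_cat) fmon Y \<eta>"
 proof (rule iso_of_agree[OF is_functor_fmon[OF b] Y]; unfold comm_algs_simps mem_Collect_eq)
  fix S :: "'u md" assume S: "algebra R S"
  show "carrier (on_ob fmon S) = carrier (on_ob Y S)" by (rule ob[OF S, symmetric])
  show "\<one>\<^bsub>on_ob fmon S\<^esub> = \<one>\<^bsub>on_ob Y S\<^esub>" using one[OF S] fmon_one[OF S] by simp
  show "on_mor fmon S T h = on_mor Y S T h" if "algebra R T" "h \<in> alg_hom R S T" for T h by (rule mor[OF S that, symmetric])
  fix \<phi> \<psi> assume p: "\<phi> <: on_ob fmon S" and q: "\<psi> <: on_ob fmon S"
  show "\<phi> \<otimes>\<^bsub>on_ob fmon S\<^esub> \<psi> = \<phi> \<otimes>\<^bsub>on_ob Y S\<^esub> \<psi>"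
   using mul[OF S unpt_gr[OF S p] unpt_gr[OF S q]] fmon_mult[OF S unpt_gr[OF S p] unpt_gr[OF S q]] unfolding pt_unpt[OF S p] pt_unpt[OF S q] by simp
 qed
qed

end

lemma coalg_dataI: "coalgebra R A ==> coalg_data R A"
 by (rule coalg_data.intro) (simp_all add: coalgebra_def lin_hom_iff)

lemma lp_coalgI:
 fixes R :: "('u, 'y) ring_scheme" and A :: "('u, 'u, 'p) bialg_scheme"
 assumes "infinite (UNIV :: 'u set)" "coalgebra R A" "cocommutative R A" "loc_proj R A"
 shows "lp_coalg R A"
 by (intro lp_coalg.intro universe_coalg.intro cocomm_coalg.intro coalg_dataI cocomm_coalg_axioms.intro lp_coalg_axioms.intro assms)

text \<open>The algebra structure on the dual gives the coalgebra, the monoid structure then gives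
  the product. The multiplication can be exchanged in the record without affecting points, as these
  depend only on the coalgebra data.\<close>

lemma ex_bialgebra_of_formal_monoid:
 fixes R :: "'u ring" and Y :: "(('u, 'u) module, 'u => 'u, 'u spec_point monoid, 'u spec_point => 'u spec_point) ftor"
 assumes inf: "infinite (UNIV :: 'u set)" and R: "cring R"
  and Y: "is_functor (comm_algs R) monoid_cat Y" and sch: "projective_formal_scheme R (carrier_functor Y)"
 shows "\<exists>A :: ('u, 'u) bialg. bialgebra R A \<and> cocommutative R A \<and> projective_module R A
  \<and> (\<exists>\<eta>. is_iso (functor_cat (comm_algs R) monoid_cat) (lp_coalg.fmon R A) Y \<eta>)"
proof -
 obtain A0 :: "'u md" and m e where pr: "projective_module R A0" and F: "comm_algebra_functor R (dual_functor R A0 m e)"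
  and ag: "functors_agree (comm_algs R) (carrier_functor Y) (Spec R (dual_functor R A0 m e))"
  using sch unfolding projective_formal_scheme_def by blast
 obtain B :: "('u, 'u) bialg" where e: "same_mod A0 B" and co: "cocomm_coalg R B"
  and mB: "\<forall>T v w. algebra R T --> v \<in> lin_hom R A0 T --> w \<in> lin_hom R A0 T --> m T v w = conv B T v w"
  and eB: "\<forall>T. algebra R T --> e T = conv_one B T"
  using coalgebra_of_dual[OF inf R projective_imp_loc_proj[OF inf pr] F] by blast
 interpret B: cocomm_coalg R B by (rule co)
 have prB: "projective_module R B" by (rule same_mod_projective[OF e pr])
 \<comment> \<open>Stated for every record with the module and coalgebra data of \<open>B\<close>,
   because it is applied both to \<open>B\<close> and to the record with the final
   multiplication.\<close>
 have eq: "carrier (on_ob Y S) = carrier (on_ob (lp_coalg.fmon R C) S)"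
  "algebra R T ==> h \<in> alg_hom R S T ==> on_mor Y S T h = on_mor (lp_coalg.fmon R C) S T h"
  if C: "lp_coalg R C" and s: "same_mod B C" "comult C = comult B" "counit C = counit B" and S: "algebra R S"
  for C :: "('u, 'u) bialg" and S T h
 proof -
  have sm: "same_mod A0 (mod_of C)" using e s(1) same_mod_mod_of[of C] by (simp add: same_mod_def)
  have c: "conv C = conv B" "conv_one C = conv_one B" using s by (simp_all add: conv_def[abs_def] conv_one_def[abs_def] same_mod_def)
  note k = Spec_dual_cong[OF sm, of R m "conv C" e "conv_one C", unfolded c, OF mB[rule_format] eB[rule_format]]
  show "carrier (on_ob Y S) = carrier (on_ob (lp_coalg.fmon R C) S)"
   using ag S k(1)[of S] by (simp add: functors_agree_def carrier_functor_def comm_algs_simps lp_coalg.fmon_def[OF C] c)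
  show "on_mor Y S T h = on_mor (lp_coalg.fmon R C) S T h" if "algebra R T" "h \<in> alg_hom R S T"
   using ag S that k(2)[of S T h] by (simp add: functors_agree_def carrier_functor_def comm_algs_simps lp_coalg.fmon_def[OF C] c)
 qed
 have lB: "lp_coalg R B" by (rule lp_coalgI[OF inf B.coalgebra B.cocomm projective_imp_loc_proj[OF inf prB]])
 interpret B: lp_coalg R B by (rule lB)
 obtain \<beta> i where b: "bilin R B B B \<beta>" and i: "i <: B"
  and bi: "\<forall>S. algebra R S -->
   tens R S B \<one>\<^sub>S i \<in> B.gr S \<and> \<one>\<^bsub>on_ob Y S\<^esub> = B.pt S (tens R S B \<one>\<^sub>S i) \<and>
   (\<forall>x\<in>B.gr S. \<forall>y\<in>B.gr S. rmap R S (tensor R B B) B (tlift B \<beta>) (B.box S x y) \<in> B.gr S \<and>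
    B.pt S x \<otimes>\<^bsub>on_ob Y S\<^esub> B.pt S y = B.pt S (rmap R S (tensor R B B) B (tlift B \<beta>) (B.box S x y)))"
  using B.mult_of_monoid_functor[OF Y eq(1)[OF lB same_mod_refl refl refl] eq(2)[OF lB same_mod_refl refl refl]] by blast
 \<comment> \<open>\<open>B\<close> still carries the meaningless product and unit of the original
   module record; they are replaced by those found from \<open>Y\<close>.\<close>
 define A where "A = B\<lparr>mult := \<beta>, one := i\<rparr>"
 have s: "same_mod B A" and cm: "comult A = comult B" "counit A = counit B" and A_simps: "carrier A = carrier B" "mult A = \<beta>" "one A = i"
  by (simp_all add: A_def same_mod_def)
 have prA: "projective_module R A" by (rule same_mod_projective[OF s prB])
 have coA: "cocommutative R A" by (rule same_mod_cocommutative[OF s cm(1)[symmetric] B.cocomm])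
 have lA: "lp_coalg R A"
  by (rule lp_coalgI[OF inf same_mod_coalgebra[OF s cm[symmetric] B.coalgebra] coA projective_imp_loc_proj[OF inf prA]])
 interpret A: lp_coalg R A by (rule lA)
 note sr = same_mod_refl and s' = same_mod_sym[OF s]
 have cA: "conv A = conv B" using cm by (simp add: conv_def[abs_def] A_simps)
 have gr: "A.gr S = B.gr S" for S :: "'u md"
  unfolding A.gr_def B.gr_def cA cm same_mod_linmap[OF s' sr] same_mod_carrier_tensor[OF sr s'] ..
 have pt: "A.pt S = B.pt S" for S
  unfolding A.pt_def[abs_def] B.pt_def[abs_def] same_mod_lin_hom[OF s' sr] same_mod_tensor_map[OF sr s' sr sr] ..
 have sAA: "same_mod (tensor R A A) (tensor R B B)" by (rule same_mod_tensor[OF s' s'])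
 have box: "A.box S = B.box S" for S :: "'u md"
  unfolding A.box_def[abs_def] B.box_def[abs_def] same_mod_tlift[OF same_mod_tensor[OF sr sAA]] same_mod_pure_tensor[OF sr sAA] same_mod_pure_tensor[OF s' s'] ..
 have bA: "bilin R A A A (mult A)" using b unfolding A_simps bilin_def same_mod_linmap[OF s' s'] by simp
 \<comment> \<open>The operation represented by \<open>\<beta>\<close> is the multiplication of S
   \<otimes> A for the new record, by \<open>mult_box\<close> with the identity map.\<close>
 have mul: "rmap R S (tensor R B B) B (tlift B \<beta>) (B.box S x y) = x \<otimes>\<^bsub>tensor R S A\<^esub> y"
  if S: "algebra R S" and xy: "x \<in> B.gr S" "y \<in> B.gr S" for S :: "'u md" and x y
 proof -
  note g = A.gr_closed[OF xy(1)[folded gr]] A.gr_closed[OF xy(2)[folded gr]]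
  show ?thesis
   using A.mult_box[OF bA S g A.A lin_id]
   unfolding tmap_ident[OF alg_mod[OF S] A.A bilin_closed[OF A.bSA[OF bA S] g]] box same_mod_tlift[OF s'] same_mod_tensor_map[OF sr sAA sr s']
   unfolding A_simps .
 qed
 have one: "\<one>\<^bsub>tensor R S A\<^esub> = tens R S B \<one>\<^sub>S i" for S :: "'u md"
  by (simp add: tensor_one A_simps same_mod_pure_tensor[OF sr s'])
 note fin = A.bialgebra_of_monoid_functor[OF Y eq(1)[OF lA s cm] eq(2)[OF lA s cm] bA]
 have "bialgebra R A \<and> (\<exists>\<eta>. is_iso (functor_cat (comm_algs R) monoid_cat) A.fmon Y \<eta>)"
  by (intro conjI; rule fin) (use i bi mul in \<open>auto simp: A_simps gr pt one\<close>)
 then show ?thesis using coA prA by blast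
qed

lemma two_bialgI:
 assumes "lp_coalg R A" "lp_coalg R B" "bialgebra R A" "bialgebra R B"
 shows "two_bialg R A B"
 by (intro two_bialg.intro two_bialg_axioms.intro assms)

theorem theorem6p8:
  fixes R :: "'u ring"
  assumes "infinite (UNIV :: 'u set)"
    and "cring R"
  shows "equivalent_categories (projective_cocomm_bialgebras R) (projective_formal_monoids R)"
proof -
 let ?C = "projective_cocomm_bialgebras R" and ?D = "projective_formal_monoids R"
 let ?F = "\<lparr>on_ob = lp_coalg.fmon R, on_mor = two_bialg.fmor R\<rparr>"
 have Cs: "Mor ?C = bialg_hom R" "Ident ?C = (\<lambda>A. \<lambda>x\<in>carrier A. x)" "Cmp ?C = (\<lambda>A B C g f. compose (carrier A) g f)"
  by (simp_all add: projective_cocomm_bialgebras_def)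
 have ob: "lp_coalg R A" "bialgebra R A" "cocommutative R A" "projective_module R A" if "A \<in> Ob ?C" for A
 proof -
  show a: "bialgebra R A" "cocommutative R A" "projective_module R A" using that by (simp_all add: projective_cocomm_bialgebras_def)
  from a(1) have "coalgebra R A" by (simp add: bialgebra_def)
  then show "lp_coalg R A" by (rule lp_coalgI[OF assms(1) _ a(2) projective_imp_loc_proj[OF assms(1) a(3)]])
 qed
 have two: "two_bialg R A B" if "A \<in> Ob ?C" "B \<in> Ob ?C" for A B
  by (rule two_bialgI[OF ob(1)[OF that(1)] ob(1)[OF that(2)] ob(2)[OF that(1)] ob(2)[OF that(2)]])
 have Ds: "Mor ?D = nat_trans (comm_algs R) monoid_cat"
  "Ident ?D = (\<lambda>G. \<lambda>S\<in>Ob (comm_algs R). \<lambda>x\<in>carrier (on_ob G S). x)"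
  "Cmp ?D = (\<lambda>F G H \<sigma> \<tau>. \<lambda>S\<in>Ob (comm_algs R). compose (carrier (on_ob F S)) (\<sigma> S) (\<tau> S))"
  by (simp_all add: projective_formal_monoids_def full_subcat_def functor_cat_def monoid_cat_def)
 show ?thesis
 proof (rule equivalent_categoriesI[where F = ?F])
  show "is_category ?C" by (rule is_category_bialgebras)
  show "is_category ?D"
   unfolding projective_formal_monoids_def by (rule is_category_full_subcat[OF is_category_functor_cat[OF is_category_monoid_cat]])
  show bij: "bij_betw (on_mor ?F A B) (Mor ?C A B) (Mor ?D (on_ob ?F A) (on_ob ?F B))" if "A \<in> Ob ?C" "B \<in> Ob ?C" for A B
   using two_bialg.bij_fmor[OF two[OF that]] by (simp add: Cs Ds)
  show "is_functor ?C ?D ?F"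
   unfolding is_functor_def
  proof (intro conjI ballI)
   fix A assume A: "A \<in> Ob ?C"
   interpret A: lp_coalg R A by (rule ob(1)[OF A])
   show "on_ob ?F A \<in> Ob ?D"
    using A.is_functor_fmon[OF ob(2)[OF A]] A.projective_formal_scheme_fmon[OF ob(4)[OF A]]
    by (simp add: projective_formal_monoids_def full_subcat_def functor_cat_def)
   interpret AA: two_bialg R A A by (rule two[OF A A])
   show "on_mor ?F A A (Ident ?C A) = Ident ?D (on_ob ?F A)"
    unfolding Cs Ds ftor.simps
   proof (rule extensionalityI)
    fix S assume "S \<in> Ob (comm_algs R)"
    then have S: "algebra R S" by (simp add: comm_algs_simps)
    show "AA.fmor (\<lambda>x\<in>carrier A. x) S = (\<lambda>S\<in>Ob (comm_algs R). \<lambda>x\<in>carrier (on_ob A.fmon S). x) S"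
    proof (rule A.fmon_ext[OF S])
     fix x assume x: "x \<in> A.gr S"
     show "AA.fmor (\<lambda>x\<in>carrier A. x) S (A.pt S x) = (\<lambda>S\<in>Ob (comm_algs R). \<lambda>x\<in>carrier (on_ob A.fmon S). x) S (A.pt S x)"
      using AA.fmor_pt[OF S x, of "\<lambda>x\<in>carrier A. x"] AA.fm_cong[OF S lin_id _ x, of "\<lambda>x\<in>carrier A. x"] S A.pt_fmon[OF S x]
       tmap_ident[OF alg_mod[OF S] A.A A.gr_closed[OF x]] by (simp add: comm_algs_simps)
    qed (use S in \<open>simp_all add: AA.fmor_def comm_algs_simps\<close>)
   qed (simp_all add: AA.fmor_def comm_algs_simps)
   fix B f assume B: "B \<in> Ob ?C" and f: "f \<in> Mor ?C A B"
   show "on_mor ?F A B f \<in> Mor ?D (on_ob ?F A) (on_ob ?F B)" using bij_betwE[OF bij[OF A B]] f by blast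
   fix C g assume C: "C \<in> Ob ?C" and g: "g \<in> Mor ?C B C"
   interpret AB: two_bialg R A B by (rule two[OF A B])
   interpret BC: two_bialg R B C by (rule two[OF B C])
   interpret AC: two_bialg R A C by (rule two[OF A C])
   have f': "f \<in> bialg_hom R A B" and g': "g \<in> bialg_hom R B C" using f g by (simp_all add: Cs)
   note fl = bialg_homD(1)[OF f'] and gl = bialg_homD(1)[OF g']
   show "on_mor ?F A C (Cmp ?C A B C g f) = Cmp ?D (on_ob ?F A) (on_ob ?F B) (on_ob ?F C) (on_mor ?F B C g) (on_mor ?F A B f)"
    unfolding Cs Ds ftor.simps
   proof (rule extensionalityI)
    fix S assume "S \<in> Ob (comm_algs R)"
    then have S: "algebra R S" by (simp add: comm_algs_simps)
    note mS = alg_mod[OF S]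
    show "AC.fmor (compose (carrier A) g f) S = (\<lambda>S\<in>Ob (comm_algs R). compose (carrier (on_ob A.fmon S)) (BC.fmor g S) (AB.fmor f S)) S"
    proof (rule A.fmon_ext[OF S])
     fix x assume x: "x \<in> A.gr S"
     have "AC.fm S (compose (carrier A) g f) x = AC.fm S (\<lambda>a. g (f a)) x"
      by (rule AC.fm_cong[OF S lin_comp[OF fl gl] _ x, symmetric]) (simp add: compose_def)
     also have "\<dots> = BC.fm S g (AB.fm S f x)"
      by (rule tmap_comp[OF mS A.A mS AB.B.A mS BC.B.A lin_id fl lin_id gl A.gr_closed[OF x], symmetric])
     finally show "AC.fmor (compose (carrier A) g f) S (A.pt S x) = (\<lambda>S\<in>Ob (comm_algs R). compose (carrier (on_ob A.fmon S)) (BC.fmor g S) (AB.fmor f S)) S (A.pt S x)"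
      using S A.pt_fmon[OF S x] AC.fmor_pt[OF S x, of "compose (carrier A) g f"] AB.fmor_pt[OF S x, of f] BC.fmor_pt[OF S AB.gr_fm[OF S f' x], of g]
      by (simp add: comm_algs_simps compose_def)
    qed (use S in \<open>simp_all add: AC.fmor_def comm_algs_simps\<close>)
   qed (simp_all add: AC.fmor_def comm_algs_simps)
  qed
  fix Y assume "Y \<in> Ob ?D"
  then have "is_functor (comm_algs R) monoid_cat Y" "projective_formal_scheme R (carrier_functor Y)"
   by (simp_all add: projective_formal_monoids_def full_subcat_def functor_cat_def)
  from ex_bialgebra_of_formal_monoid[OF assms this] obtain A :: "('u, 'u) bialg" and \<eta>
   where "bialgebra R A" "cocommutative R A" "projective_module R A"
    and \<eta>: "is_iso (functor_cat (comm_algs R) monoid_cat) (lp_coalg.fmon R A) Y \<eta>" by blast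
  then have "A \<in> Ob ?C" by (simp add: projective_cocomm_bialgebras_def)
  \<comment> \<open>The formal monoids form a full subcategory, so an isomorphism of functors with
    values in monoids is one there.\<close>
  moreover have "is_iso ?D (on_ob ?F A) Y \<eta>"
   using \<eta> by (simp add: is_iso_def projective_formal_monoids_def full_subcat_def)
  ultimately show "\<exists>A\<in>Ob ?C. \<exists>\<eta>. is_iso ?D (on_ob ?F A) Y \<eta>" by blast
 qed
qed

end
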